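(* Let $\alpha\in(\frac12,1)$, $B_0\in C_b^{0,3}([0,T]\times\mathbb{R}^N;\mathbb{R}^N)$, $f\in C([0,T];\mathbb{R}^N)$, and define $B(t,x)=B_0(t,x)-f(t)$. Put $\gamma=1/(2\alpha)$. Then, for every $\phi\in\mathcal{B}_b(\mathbb{R}^N)$ and every $0<t\le T$, the function $(s,x)\mapsto P_{s,t}\phi(x)$, $0\le s\le t$, $x\in\mathbb{R}^N$, is the unique solution $u_s(t,x)=u^\phi_s(t,x)$ of the mild Kolmogorov backward equation $$u_s(t,x)=R_{s,t}\phi(x)+\int_s^t R_{s,r}\big(\langle B(r,\cdot),\nabla^\top u_r(t,\cdot)\rangle\big)(x)\,dr,\qquad s\in[0,t],\ x\in\mathbb{R}^N,$$ such that the function $(s,x)\mapsto u_{t-s}(t,x)$ belongs to $\Lambda_1^\gamma(0,t]$.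
   Context: Fix $N\in\mathbb{N}$, $T>0$ and a complete probability space $(\Omega,\mathcal{F},\mathbb{P})$. $W=(\beta^1,\dots,\beta^N)^\top$ is a standard $N$-dimensional Brownian motion and $L=(L_t)_{t\ge0}$ is a strictly $\alpha$-stable subordinator (increasing Lévy process), $\alpha\in(0,1)$, independent of $W$, with $\mathbb{E}[e^{iuL_1}]=\exp\{-\bar\gamma^\alpha|u|^\alpha(1-i\tan\frac{\pi\alpha}{2}\,\mathrm{sign}\,u)\}$, $u\in\mathbb{R}$, for some $\bar\gamma>0$. $W_L=(W_{L_t})_{t\ge0}$ is the subordinated Brownian motion. $A=-\mathrm{diag}[\lambda_1,\dots,\lambda_N]$ with $0<\lambda_1\le\dots\le\lambda_N$, $Q=\mathrm{diag}[\sigma_1^2,\dots,\sigma_N^2]$ with $\sigma_n^2>0$. For $0\le s\le T$ and $x\in\mathbb{R}^N$, $Z^{s,x}=(Z^{s,x}_t)_{t\in[s,T]}$ is the unique solution of the linear SDE $dZ_t^{s,x}=(AZ_t^{s,x}+f(t))dt+\sqrt{Q}\,dW_{L_t}$, $Z_s^{s,x}=x$, and $X^{s,x}=(X^{s,x}_t)_{t\in[s,T]}$ is the unique solution of $dX_t^{s,x}=(AX_t^{s,x}+B_0(t,X_t^{s,x}))dt+\sqrt{Q}\,dW_{L_t}$, $X_s^{s,x}=x$. For $0\le s\le t\le T$ and $\phi\in\mathcal{B}_b(\mathbb{R}^N)$ (real-valued bounded Borel functions), $R_{s,t}\phi(x)=\mathbb{E}[\phi(Z_t^{s,x})]$ and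 $P_{s,t}\phi(x)=\mathbb{E}[\phi(X_t^{s,x})]$. $\nabla u$ is the gradient (a row vector) in $x$ and $\nabla^\top u$ its transpose; $\langle\cdot,\cdot\rangle$ is the Euclidean scalar product. $C_b^{k}(\mathbb{R}^N)$ is the space of bounded functions that are continuously differentiable up to order $k$ with bounded derivatives. $C_b^{0,n}([0,T]\times\mathbb{R}^N;\mathbb{R}^N)$ is the space of bounded continuous maps whose partial derivatives in the space variable up to order $n$ exist, are continuous and bounded on $[0,T]\times\mathbb{R}^N$. $\Lambda_1^\gamma(0,t]$ is the set of measurable $V\colon(0,t]\times\mathbb{R}^N\to\mathbb{R}$ such that $V(\cdot,x)$ is continuous on $(0,t]$ for every $x$, $V(s,\cdot)\in C_b^1(\mathbb{R}^N)$ for every $s\in(0,t]$, and $\sup_{s\in(0,t]}s^\gamma\big(\|V(s,\cdot)\|_\infty+\sup_{i}\|\partial_{x_i}V(s,\cdot)\|_\infty\big)<\infty$. *)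

theory Defs
  imports "HOL-Probability.Probability"
begin

subsection \<open>Function spaces\<close>

definition partial_deriv ::
  "'n::finite \<Rightarrow> (real ^ 'n \<Rightarrow> 'b::real_normed_vector) \<Rightarrow> real ^ 'n \<Rightarrow> 'b" where
  "partial_deriv i g x = vector_derivative (\<lambda>h. g (x + h *\<^sub>R axis i 1)) (at 0)"

definition partial_differentiable ::
  "'n::finite \<Rightarrow> (real ^ 'n \<Rightarrow> 'b::real_normed_vector) \<Rightarrow> real ^ 'n \<Rightarrow> bool" where
  "partial_differentiable i g x \<longleftrightarrow> (\<lambda>h. g (x + h *\<^sub>R axis i 1)) differentiable at 0"

definition gradient :: "(real ^ 'n::finite \<Rightarrow> real) \<Rightarrow> real ^ 'n \<Rightarrow> real ^ 'n" where
  "gradient u x = (\<chi> i. partial_deriv i u x)"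

fun C_b :: "nat \<Rightarrow> (real ^ 'n::finite \<Rightarrow> 'b::real_normed_vector) set" where
  "C_b 0 = {g. continuous_on UNIV g \<and> bounded (range g)}"
| "C_b (Suc k) = {g. g \<in> C_b 0 \<and>
     (\<forall>i. (\<forall>x. partial_differentiable i g x) \<and> partial_deriv i g \<in> C_b k)}"

text \<open>Functions on \<open>[0,T] \<times> \<real>\<^sup>N\<close> whose space derivatives up to order \<open>k\<close> are bounded and
  jointly continuous. Values at times outside \<open>[0,T]\<close> are irrelevant.\<close>

fun C_b_space ::
  "real \<Rightarrow> nat \<Rightarrow> (real \<Rightarrow> real ^ 'n::finite \<Rightarrow> 'b::real_normed_vector) set" where
  "C_b_space T 0 = {g. continuous_on ({0..T} \<times> UNIV) (\<lambda>(t, x). g t x) \<and>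
     bounded ((\<lambda>(t, x). g t x) ` ({0..T} \<times> UNIV))}"
| "C_b_space T (Suc k) = {g. g \<in> C_b_space T 0 \<and>
     (\<forall>i. (\<forall>t\<in>{0..T}. \<forall>x. partial_differentiable i (g t) x) \<and>
          (\<lambda>t. partial_deriv i (g t)) \<in> C_b_space T k)}"

definition bounded_borel :: "(real ^ 'n::finite \<Rightarrow> real) set" where
  "bounded_borel = {\<phi>. \<phi> \<in> borel_measurable borel \<and> bounded (range \<phi>)}"

definition sup_norm :: "(real ^ 'n::finite \<Rightarrow> real) \<Rightarrow> real" where
  "sup_norm g = (SUP x. \<bar>g x\<bar>)"

text \<open>The real-valued suprema below are genuine, since \<open>V s \<in> C_b 1\<close> for all \<open>s \<in> (0,t]\<close>.\<close>

definition Lambda1 :: "real \<Rightarrow> real \<Rightarrow> (real \<Rightarrow> real ^ 'n::finite \<Rightarrow> real) set" where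
  "Lambda1 \<gamma> t = {V.
     (\<lambda>(s, x). V s x) \<in> borel_measurable (restrict_space borel ({0<..t} \<times> UNIV)) \<and>
     (\<forall>x. continuous_on {0<..t} (\<lambda>s. V s x)) \<and>
     (\<forall>s\<in>{0<..t}. V s \<in> C_b 1) \<and>
     bdd_above ((\<lambda>s. s powr \<gamma> * (sup_norm (V s) + (MAX i. sup_norm (partial_deriv i (V s)))))
                ` {0<..t})}"

subsection \<open>Processes\<close>

definition cadlag_on :: "real set \<Rightarrow> (real \<Rightarrow> 'b::topological_space) \<Rightarrow> bool" where
  "cadlag_on I g \<longleftrightarrow> (\<forall>t\<in>I. (g \<longlongrightarrow> g t) (at t within I \<inter> {t<..}) \<and>
                            (\<exists>l. (g \<longlongrightarrow> l) (at t within I \<inter> {..<t})))"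

definition independent_increments :: "'w measure \<Rightarrow> (real \<Rightarrow> 'w \<Rightarrow> real) \<Rightarrow> bool" where
  "independent_increments M Y \<longleftrightarrow>
     (\<forall>(\<tau>::nat \<Rightarrow> real) n. 0 \<le> \<tau> 0 \<and> mono \<tau> \<longrightarrow>
        prob_space.indep_vars M (\<lambda>_. borel) (\<lambda>i \<omega>. Y (\<tau> (Suc i)) \<omega> - Y (\<tau> i) \<omega>) {..<n})"

text \<open>A process viewed as a random element of \<open>E\<^bsup>[0,\<infinity>)\<^esup>\<close> with the product
  sigma-algebra; independence and equality in law of processes refer to this.\<close>

definition path_map :: "(real \<Rightarrow> 'w \<Rightarrow> 'b) \<Rightarrow> 'w \<Rightarrow> real \<Rightarrow> 'b" where
  "path_map Y \<omega> = (\<lambda>t\<in>{0..}. Y t \<omega>)"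

abbreviation path_space :: "(real \<Rightarrow> 'b::topological_space) measure" where
  "path_space \<equiv> Pi\<^sub>M {0..} (\<lambda>_. borel)"

text \<open>The library's \<open>indep_var\<close> requires both variables to have the same range type.\<close>

definition independent_processes ::
  "'w measure \<Rightarrow> (real \<Rightarrow> 'w \<Rightarrow> 'b::topological_space) \<Rightarrow> (real \<Rightarrow> 'w \<Rightarrow> 'c::topological_space) \<Rightarrow> bool"
  where
  "independent_processes M Y Z \<longleftrightarrow>
     prob_space.indep_set M
       {path_map Y -` S \<inter> space M | S. S \<in> sets path_space}
       {path_map Z -` S \<inter> space M | S. S \<in> sets path_space}"

definition brownian_motion_1d :: "'w measure \<Rightarrow> (real \<Rightarrow> 'w \<Rightarrow> real) \<Rightarrow> bool" where
  "brownian_motion_1d M \<beta> \<longleftrightarrow>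
     (\<forall>t\<ge>0. \<beta> t \<in> borel_measurable M) \<and>
     (AE \<omega> in M. \<beta> 0 \<omega> = 0) \<and>
     independent_increments M \<beta> \<and>
     (\<forall>s t. 0 \<le> s \<and> s < t \<longrightarrow>
        distributed M lborel (\<lambda>\<omega>. \<beta> t \<omega> - \<beta> s \<omega>) (normal_density 0 (sqrt (t - s)))) \<and>
     (AE \<omega> in M. continuous_on {0..} (\<lambda>t. \<beta> t \<omega>))"

definition brownian_motion :: "'w measure \<Rightarrow> (real \<Rightarrow> 'w \<Rightarrow> real ^ 'n::finite) \<Rightarrow> bool" where
  "brownian_motion M W \<longleftrightarrow>
     (\<forall>n. brownian_motion_1d M (\<lambda>t \<omega>. W t \<omega> $ n)) \<and>
     prob_space.indep_vars M (\<lambda>_. path_space) (\<lambda>n. path_map (\<lambda>t \<omega>. W t \<omega> $ n)) UNIV"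

text \<open>Stochastic continuity is implied by stationarity of the increments and right-continuity.\<close>

definition levy_process :: "'w measure \<Rightarrow> (real \<Rightarrow> 'w \<Rightarrow> real) \<Rightarrow> bool" where
  "levy_process M L \<longleftrightarrow>
     (\<forall>t\<ge>0. L t \<in> borel_measurable M) \<and>
     (AE \<omega> in M. L 0 \<omega> = 0) \<and>
     independent_increments M L \<and>
     (\<forall>s t. 0 \<le> s \<and> s \<le> t \<longrightarrow>
        distr M borel (\<lambda>\<omega>. L t \<omega> - L s \<omega>) = distr M borel (L (t - s))) \<and>
     (AE \<omega> in M. cadlag_on {0..} (\<lambda>t. L t \<omega>))"

definition subordinator :: "'w measure \<Rightarrow> (real \<Rightarrow> 'w \<Rightarrow> real) \<Rightarrow> bool" where
  "subordinator M L \<longleftrightarrow> levy_process M L \<and> (AE \<omega> in M. mono_on {0..} (\<lambda>t. L t \<omega>))"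

definition strictly_stable :: "'w measure \<Rightarrow> real \<Rightarrow> (real \<Rightarrow> 'w \<Rightarrow> real) \<Rightarrow> bool" where
  "strictly_stable M \<alpha> L \<longleftrightarrow>
     (\<forall>a>0. distr M path_space (path_map (\<lambda>t. L (a * t))) =
            distr M path_space (path_map (\<lambda>t \<omega>. a powr (1 / \<alpha>) * L t \<omega>)))"

subsection \<open>The SDEs and the Kolmogorov equation\<close>

definition diag_matrix :: "('n::finite \<Rightarrow> real) \<Rightarrow> real ^ 'n ^ 'n" where
  "diag_matrix d = (\<chi> i j. if i = j then d i else 0)"

text \<open>\<open>X\<close> solves \<open>dX\<^sub>t = b(t, X\<^sub>t) dt + dY\<^sub>t\<close> on \<open>[s,T]\<close>, \<open>X\<^sub>s = x\<close>. As the noise is additive,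
  the integral equation is understood path by path.\<close>

definition sde_solution ::
  "'w measure \<Rightarrow> (real \<Rightarrow> 'w \<Rightarrow> real ^ 'n::finite) \<Rightarrow> (real \<Rightarrow> real ^ 'n \<Rightarrow> real ^ 'n) \<Rightarrow>
     real \<Rightarrow> real \<Rightarrow> real ^ 'n \<Rightarrow> (real \<Rightarrow> 'w \<Rightarrow> real ^ 'n) \<Rightarrow> bool" where
  "sde_solution M Y b T s x X \<longleftrightarrow>
     (\<forall>t\<in>{s..T}. X t \<in> borel_measurable M) \<and>
     (AE \<omega> in M. cadlag_on {s..T} (\<lambda>t. X t \<omega>) \<and>
        (\<forall>t\<in>{s..T}. X t \<omega> = x + (LBINT r:{s..t}. b r (X r \<omega>)) + (Y t \<omega> - Y s \<omega>)))"

definition transition_op ::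
  "'w measure \<Rightarrow> (real \<Rightarrow> real ^ 'n::finite \<Rightarrow> real \<Rightarrow> 'w \<Rightarrow> real ^ 'n) \<Rightarrow>
     real \<Rightarrow> real \<Rightarrow> (real ^ 'n \<Rightarrow> real) \<Rightarrow> real ^ 'n \<Rightarrow> real" where
  "transition_op M X s t \<phi> x = (LINT \<omega>|M. \<phi> (X s x t \<omega>))"

text \<open>In \<open>mild_solution R B \<phi> t u\<close>, \<open>u s x\<close> stands for \<open>u\<^sub>s(t,x)\<close>. Integrability is required
  explicitly because the Bochner integral is totalised by the value 0.\<close>

definition mild_solution ::
  "(real \<Rightarrow> real \<Rightarrow> (real ^ 'n::finite \<Rightarrow> real) \<Rightarrow> real ^ 'n \<Rightarrow> real) \<Rightarrow>
     (real \<Rightarrow> real ^ 'n \<Rightarrow> real ^ 'n) \<Rightarrow> (real ^ 'n \<Rightarrow> real) \<Rightarrow> real \<Rightarrow>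
     (real \<Rightarrow> real ^ 'n \<Rightarrow> real) \<Rightarrow> bool" where
  "mild_solution R B \<phi> t u \<longleftrightarrow>
     (\<forall>s\<in>{0..t}. \<forall>x.
        set_integrable lborel {s..t} (\<lambda>r. R s r (\<lambda>y. B r y \<bullet> gradient (u r) y) x) \<and>
        u s x = R s t \<phi> x + (LBINT r:{s..t}. R s r (\<lambda>y. B r y \<bullet> gradient (u r) y) x))"

end

theory Submission
  imports Defs
begin

text \<open>
 Conditionally on \<open>L\<close>, the Ornstein--Uhlenbeck variable \<open>Z\<^sub>q\<close> started from \<open>x\<close> at time \<open>s\<close> is Gaussian with
 standard deviations of order \<open>(L\<^sub>q - L\<^sub>s)\<^sup>1\<^sup>/\<^sup>2\<close>. Differentiating the Gaussian density instead of the test function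
 and using that \<open>E (L\<^sub>q - L\<^sub>s)\<^sup>-\<^sup>1\<^sup>/\<^sup>2\<close> is a multiple of \<open>(q - s) powr (- \<gamma>)\<close>, one bounds the gradient of \<open>R\<^sub>s\<^sub>,\<^sub>q \<psi>\<close> by
 a multiple of \<open>(q - s) powr (- \<gamma>)\<close> times the supremum of \<open>\<bar>\<psi>\<bar>\<close>, for \<open>\<psi>\<close> merely bounded and Borel. Since \<open>\<gamma> < 1\<close>, the
 function \<open>w = \<langle>B, \<nabla>u\<rangle>\<close> of a mild solution \<open>u\<close> solves a Volterra equation with integrable singularity, and Picard
 iteration in an exponentially weighted norm produces a mild solution.

 The path \<open>r \<mapsto> e\<^sup>(\<^sup>t\<^sup>-\<^sup>r\<^sup>)\<^sup>A X\<^sub>r + \<xi>\<^sub>r\<^sub>,\<^sub>t\<close>, with \<open>\<xi>\<^sub>r\<^sub>,\<^sub>t\<close> the stochastic convolution on \<open>[r,t]\<close>, is Lipschitz because the noise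
 cancels. The chain rule along it and the independence of \<open>X\<^sub>r\<close> and \<open>\<xi>\<^sub>r\<^sub>,\<^sub>t\<close> give
 \<open>P\<^sub>s\<^sub>,\<^sub>t \<psi> = R\<^sub>s\<^sub>,\<^sub>t \<psi> + \<integral> P\<^sub>s\<^sub>,\<^sub>r \<langle>B\<^sub>r, \<nabla>R\<^sub>r\<^sub>,\<^sub>t \<psi>\<rangle> dr\<close>, first for smooth \<open>\<psi>\<close> and then, by a monotone class argument, for
 bounded Borel \<open>\<psi>\<close>. Applying this to \<open>\<phi>\<close> and to \<open>w\<^sub>q\<close> for all \<open>q\<close> and interchanging the time integrals, one sees that
 every mild solution equals \<open>P\<^sub>s\<^sub>,\<^sub>t \<phi>\<close>; in particular the one produced above does.
\<close>

text \<open>The exponent \<open>\<gamma>\<close> = 1/(2\<alpha>) is the scaling exponent of (L_q -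
  L_s)^(-1/2), and \<alpha> > 1/2 is what makes it smaller than 1. As the noise is additive,
  everything is done path by path: convolutions are limits of weighted sums of noise increments
  (Abel summation) and solutions are limits of Euler schemes. Independence of X_r and \<xi>_{r,t}
  thus reduces to that of increments over disjoint time blocks, without a filtration. The solutions
  X^{s,x} are given separately for each (s,x), so a Markov property or joint measurability in (s,x)
  would first have to be proved; the forward identity keeps s and x fixed and avoids both. With
  k_{r,q} \<psi> = <B_r, grad R_{r,q} \<psi>> the Volterra equation is w_r = k_{r,t} \<phi> +
  int_r^t k_{r,q} w_q dq. Integrating the forward identity for w_q over q in (s,t) and exchanging
  integrals, int P_{s,q} w_q dq appears on both sides and cancels; what remains is int P_{s,r}
  k_{r,t} \<phi> dr = int R_{s,q} w_q dq. Put into the forward identity for \<phi>, this says that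
  P_{s,t} \<phi> is the mild solution.\<close>

abbreviation (input) "borel_fun \<equiv> borel_measurable borel"
abbreviation (input) "borel_fun2 \<equiv> borel_measurable (borel \<Otimes>\<^sub>M borel)"
abbreviation (input) seq_lim (infixr "\<leadsto>" 60) where "f \<leadsto> a \<equiv> f \<longlonglongrightarrow> a"
abbreviation (input) "nudge x h i \<equiv> x + h *\<^sub>R axis i 1"

section \<open>Bounded Borel functions and differentiation under the integral sign\<close>

definition bump :: "nat => real ^ 'n::finite => real ^ 'n => real" where
 "bump n a x = exp (- (real n * (\<Sum>i\<in>UNIV. (max 0 (x $ i - a $ i))\<^sup>2)))"

lemma bump_bounds: "0 <= bump n a x" "bump n a x <= 1" "\<bar>bump n a x\<bar> <= 1"
 by (auto simp: bump_def sum_nonneg)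

lemma continuous_bump: "continuous_on UNIV (bump n a)"
 unfolding bump_def by (intro continuous_intros)

lemma bounded_borelI:
 assumes "\<phi> \<in> borel_fun" "\<And>x. \<bar>\<phi> x\<bar> <= K"
 shows "\<phi> \<in> bounded_borel"
 using assms unfolding bounded_borel_def bounded_iff by auto

lemma bounded_borelD:
 assumes "\<phi> \<in> bounded_borel"
 obtains K where "0 <= K" "\<And>x. \<bar>\<phi> x\<bar> <= K"
proof -
 obtain K where K: "\<forall>x. \<bar>\<phi> x\<bar> <= K"
  using assms unfolding bounded_borel_def bounded_iff by auto
 then have "0 <= K" by (meson abs_ge_zero order_trans)
 with K that show ?thesis by blast
qed

lemma bounded_borel_measurable[measurable_dest]: "\<phi> \<in> bounded_borel ==> \<phi> \<in> borel_fun"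
 unfolding bounded_borel_def by auto

lemma bump_bounded_borel: "bump n a \<in> bounded_borel"
 by (intro bounded_borelI[where K=1] borel_measurable_continuous_onI continuous_bump bump_bounds)

lemma bump_tendsto: "(\<lambda>n. bump n a x) \<leadsto> indicator {..a} x"
proof (cases "x <= a")
 case True
 then have "(\<Sum>i\<in>UNIV. (max 0 (x $ i - a $ i))\<^sup>2) = 0"
  by (intro sum.neutral) (auto simp: less_eq_vec_def max_absorb1)
 with True show ?thesis by (simp add: bump_def)
next
 case False
 then obtain i where i: "x $ i > a $ i" by (auto simp: less_eq_vec_def not_le)
 define S where "S = (\<Sum>i\<in>UNIV. (max 0 (x $ i - a $ i))\<^sup>2)"
 have "0 < (max 0 (x $ i - a $ i))\<^sup>2" using i by simp
 also have "\<dots> <= S" unfolding S_def by (rule member_le_sum) auto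
 finally have "0 < S" .
 then have "(\<lambda>n. exp (- (real n * S))) \<leadsto> 0" by real_asymp
 with False show ?thesis by (simp add: bump_def S_def)
qed

lemma bounded_borel_lincomb:
 assumes "f \<in> bounded_borel" "g \<in> bounded_borel"
 shows "(\<lambda>x. c * f x + d * g x) \<in> bounded_borel"
proof -
 obtain K L where "\<And>x. \<bar>f x\<bar> <= K" "\<And>x. \<bar>g x\<bar> <= L"
  using bounded_borelD[OF assms(1)] bounded_borelD[OF assms(2)] by metis
 moreover have [measurable]: "f \<in> borel_fun" "g \<in> borel_fun"
  using assms by (auto simp: bounded_borel_def)
 ultimately show ?thesis
  by (intro bounded_borelI[where K="\<bar>c\<bar> * K + \<bar>d\<bar> * L"])
   (measurable, auto intro!: order_trans[OF abs_triangle_ineq] add_mono mult_left_mono simp: abs_mult)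
qed

lemma indicator_bounded_borel: "A \<in> sets borel ==> indicator A \<in> bounded_borel"
 by (rule bounded_borelI[where K=1]) (auto split: split_indicator)

text \<open>A functional monotone class theorem; the test functions \<open>bump n a\<close> are continuously
 differentiable and decrease to the indicator of the orthant \<open>{..a}\<close>.\<close>

lemma bounded_borel_induct [consumes 1, case_names bump lin lim]:
 fixes P :: "(real ^ 'n::finite => real) => bool"
 assumes \<phi>: "\<phi> \<in> bounded_borel"
  and base: "\<And>n a. P (bump n a)"
  and lin: "\<And>f g c d. f \<in> bounded_borel ==> g \<in> bounded_borel ==> P f ==> P g ==>
   P (\<lambda>x. c * f x + d * g x)"
  and lim: "\<And>F f K. (\<And>n::nat. F n \<in> bounded_borel) ==> (\<And>n. P (F n)) ==> f \<in> bounded_borel ==>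
   (\<And>n x. \<bar>F n x\<bar> <= K) ==> (\<And>x. \<bar>f x\<bar> <= K) ==> (\<And>x. (\<lambda>n. F n x) \<leadsto> f x) ==> P f"
 shows "P \<phi>"
proof -
 have lim': "P f" if "\<And>n::nat. F n \<in> bounded_borel" "\<And>n. P (F n)" "\<And>n x. \<bar>F n x\<bar> <= K"
  "\<And>x. (\<lambda>n. F n x) \<leadsto> f x" for F f K
 proof (rule lim[where F=F and K=K])
  show "f \<in> bounded_borel"
  proof (rule bounded_borelI)
   show "f \<in> borel_fun"
    by (rule borel_measurable_LIMSEQ_real[OF that(4)]) (use bounded_borel_measurable[OF that(1)] in simp)
   show "\<bar>f x\<bar> <= K" for x
    by (rule LIMSEQ_le_const2[OF tendsto_rabs[OF that(4)]]) (use that(3) in blast)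
  qed
  show "\<bar>f x\<bar> <= K" for x
   by (rule LIMSEQ_le_const2[OF tendsto_rabs[OF that(4)]]) (use that(3) in blast)
 qed (fact that)+
 have at: "P (indicator {..a})" for a
  by (rule lim'[OF bump_bounded_borel base bump_bounds(3) bump_tendsto])
 \<comment> \<open>The whole space is the limit of the orthants with corner (n,...,n); it supplies
   constants and complements.\<close>
 have un: "P (indicator UNIV)"
 proof (rule lim'[of "\<lambda>n. indicator {..(\<chi> i. real n)}" 1])
  fix x :: "real ^ 'n"
  obtain n0 where n0: "norm x <= real n0" using real_arch_simple by blast
  have "\<forall>n\<ge>n0. x \<in> {..(\<chi> i. real n)}"
  proof (intro allI impI)
   fix n assume "n \<ge> n0"
   then have "x $ i <= real n" for i
    using n0 component_le_norm_cart[of x i] by linarith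
   then show "x \<in> {..(\<chi> i. real n)}" by (simp add: less_eq_vec_def)
  qed
  then have "\<forall>\<^sub>F n in sequentially. (indicator {..(\<chi> i. real n)} x :: real) = indicator UNIV x"
   unfolding eventually_sequentially by (auto intro!: exI[of _ n0])
  then show "(\<lambda>n. indicator {..(\<chi> i. real n)} x) \<leadsto> (indicator UNIV x :: real)"
   by (rule tendsto_eventually)
 qed (auto intro: at indicator_bounded_borel split: split_indicator)
 \<comment> \<open>Dynkin's pi-lambda theorem: two orthants meet in the orthant of
   \<open>inf a b\<close>, and a countable disjoint union is the bounded limit of its finite partial
   unions, which \<open>lin\<close> handles.\<close>
 have ind: "P (indicator A)" if "A \<in> sets borel" for A
 proof -
  have gen: "sets (borel :: (real^'n) measure) = sigma_sets UNIV (range (\<lambda>a. {..a}))"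
   unfolding borel_eq_atMost by simp
  have "Int_stable (range (\<lambda>a. {..a::real^'n}))"
  proof (rule Int_stableI)
   fix A B assume "A \<in> range (\<lambda>a. {..a::real^'n})" "B \<in> range (\<lambda>a. {..a::real^'n})"
   then obtain a b where "A = {..a}" "B = {..b}" by auto
   then have "A \<inter> B = {..inf a b}" by auto
   then show "A \<inter> B \<in> range (\<lambda>a. {..a})" by auto
  qed
  moreover have "range (\<lambda>a. {..a::real^'n}) \<subseteq> Pow UNIV" by simp
  moreover have "A \<in> sigma_sets UNIV (range (\<lambda>a. {..a}))" using that gen by simp
  ultimately show ?thesis
  proof (induction rule: sigma_sets_induct_disjoint)
   case (basic A) then show ?case by (elim rangeE) (simp only: at)
  next
   case empty
   have "P (\<lambda>x. 0 * indicator UNIV x + 0 * indicator UNIV x)"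
    by (rule lin[OF indicator_bounded_borel indicator_bounded_borel un un]) simp_all
   then show ?case by (simp add: indicator_def[abs_def])
  next
   case (compl A)
   have A: "A \<in> sets borel" using compl gen by simp
   have "P (\<lambda>x. 1 * indicator UNIV x + (-1) * indicator A x)"
    by (rule lin[OF indicator_bounded_borel indicator_bounded_borel[OF A] un compl(2)]) simp
   moreover have "(\<lambda>x. 1 * indicator UNIV x + (-1) * indicator A x) = (indicator (UNIV - A) :: _ => real)"
    by (auto split: split_indicator)
   ultimately show ?case by simp
  next
   case (union A)
   have m: "A i \<in> sets borel" for i using union gen by auto
   have fin: "P (indicator (\<Union>i<n. A i))" for n
   proof (induction n)
    case 0
    have "P (\<lambda>x. 0 * indicator UNIV x + 0 * indicator UNIV x)"
     by (rule lin[OF indicator_bounded_borel indicator_bounded_borel un un]) simp_all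
    then show ?case by (simp add: indicator_def[abs_def])
   next
    case (Suc n)
    have "P (\<lambda>x. 1 * indicator (\<Union>i<n. A i) x + 1 * indicator (A n) x)"
     by (rule lin[OF indicator_bounded_borel indicator_bounded_borel Suc union(3)]) (use m in auto)
    moreover have "(\<Union>i<n. A i) \<inter> A n = {}"
    proof -
     have "A i \<inter> A n = {}" if "i < n" for i
      using union(1) that unfolding disjoint_family_on_def by auto
     then show ?thesis by auto
    qed
    then have "indicator ((\<Union>i<n. A i) \<union> A n) x = indicator (\<Union>i<n. A i) x + (indicator (A n) x :: real)" for x
     by (rule indicator_disj_union)
    moreover have "(\<Union>i<Suc n. A i) = (\<Union>i<n. A i) \<union> A n" by (auto simp: less_Suc_eq)
    ultimately show ?case by (simp only: mult_1)
   qed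
   show ?case
   proof (rule lim'[of "\<lambda>n. indicator (\<Union>i<n. A i)" 1])
    show "(\<lambda>n. indicator (\<Union>i<n. A i) x) \<leadsto> (indicator (\<Union>i. A i) x :: real)" for x
     by (rule LIMSEQ_indicator_UN)
   qed (use m fin in "auto intro!: indicator_bounded_borel split: split_indicator")
  qed
 qed
 have simple: "P g" if g: "simple_function borel g" for g
 proof -
  have fin: "finite (range g)" using g by (simp add: simple_function_def)
  have m: "g -` {y} \<in> sets borel" for y
   using simple_functionD(2)[OF g, of "{y}"] by simp
  have "P (\<lambda>x. \<Sum>y\<in>Y. y * indicator (g -` {y}) x) \<and> (\<lambda>x. \<Sum>y\<in>Y. y * indicator (g -` {y}) x) \<in> bounded_borel"
   if "finite Y" for Y
   using that
  proof induction
   case empty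
   have "P (\<lambda>x. 0 * indicator UNIV x + 0 * indicator UNIV x)"
    by (rule lin[OF indicator_bounded_borel indicator_bounded_borel un un]) simp_all
   then show ?case by (auto intro: bounded_borelI[where K=0])
  next
   case (insert y Y)
   then have "P (\<lambda>x. y * indicator (g -` {y}) x + 1 * (\<Sum>y\<in>Y. y * indicator (g -` {y}) x))"
    using m by (intro lin ind indicator_bounded_borel) auto
   moreover have "(\<lambda>x. y * indicator (g -` {y}) x + 1 * (\<Sum>y\<in>Y. y * indicator (g -` {y}) x)) \<in> bounded_borel"
    using insert m by (intro bounded_borel_lincomb indicator_bounded_borel) auto
   ultimately show ?case
    by (simp only: sum.insert[OF insert(1,2)] mult_1 simp_thms)
  qed
  from this[OF fin] have "P (\<lambda>x. \<Sum>y\<in>range g. y * indicator (g -` {y}) x)" by (rule conjunct1)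
  moreover have "(\<lambda>x. \<Sum>y\<in>range g. y * indicator (g -` {y}) x) = g"
  proof
   fix x
   have "(\<Sum>y\<in>range g. y * indicator (g -` {y}) x) = (\<Sum>y\<in>range g. if y = g x then y else 0)"
    by (intro sum.cong) (auto simp: indicator_def)
   then show "(\<Sum>y\<in>range g. y * indicator (g -` {y}) x) = g x" using fin by simp
  qed
  ultimately show ?thesis by (simp only:)
 qed
 obtain K where K: "\<And>x. \<bar>\<phi> x\<bar> <= K" using bounded_borelD[OF \<phi>] by blast
 \<comment> \<open>The simple approximations are bounded by twice the absolute value of the
   function, hence the common bound 2 * K.\<close>
 obtain F where F: "\<And>i::nat. simple_function borel (F i)" "\<And>x. (\<lambda>i. F i x) \<leadsto> \<phi> x"
  "\<And>i x. dist (F i x) 0 <= 2 * dist (\<phi> x) 0"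
  using borel_measurable_implies_sequence_metric[of \<phi> borel 0] \<phi> by (auto simp: bounded_borel_def)
 have b: "\<bar>F i x\<bar> <= 2 * K" for i x
  using F(3)[of i x] K[of x] by (simp add: dist_real_def)
 show ?thesis
 proof (rule lim'[of F "2 * K"])
  show "F n \<in> bounded_borel" for n
   by (rule bounded_borelI[OF borel_measurable_simple_function[OF F(1)] b])
 qed (use F(2) b simple[OF F(1)] in simp_all)
qed

text \<open>The mean value inequality bounds the difference quotients by \<open>g\<close>, so
  dominated convergence applies along every null sequence. Control for |h| <= 1 suffices after
  dropping finitely many terms.\<close>

lemma has_real_derivative_integral:
 fixes F F' :: "real => 'a => real"
 assumes int: "\<And>h. \<bar>h\<bar> <= 1 ==> integrable M (F h)"
  and deriv: "AE a in M. \<forall>h. \<bar>h\<bar> <= 1 \<longrightarrow> ((\<lambda>h. F h a) has_real_derivative F' h a) (at h)"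
  and bound: "AE a in M. \<forall>h. \<bar>h\<bar> <= 1 \<longrightarrow> \<bar>F' h a\<bar> <= g a"
  and g: "integrable M g"
  and meas: "F' 0 \<in> borel_measurable M"
 shows "((\<lambda>h. \<integral>a. F h a \<partial>M) has_real_derivative (LINT a|M. F' 0 a)) (at 0)"
proof -
 have "((\<lambda>h. ((LINT a|M. F (0 + h) a) - (LINT a|M. F 0 a)) / h) \<longlongrightarrow> (LINT a|M. F' 0 a)) (at 0)"
  unfolding tendsto_at_iff_sequentially comp_def
 proof (intro allI impI)
  fix X :: "nat => real" assume X: "\<forall>i. X i \<in> UNIV - {0}" "X \<leadsto> 0"
  from X(2) have "\<forall>\<^sub>F i in sequentially. \<bar>X i\<bar> < 1"
   using tendstoD[OF X(2), of 1] by (simp add: dist_real_def)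
  then obtain n where n: "\<And>i. i \<ge> n ==> \<bar>X i\<bar> < 1" by (auto simp: eventually_sequentially)
  define Y where "Y i = X (i + n)" for i
  have Y: "\<bar>Y i\<bar> <= 1" "Y i \<noteq> 0" for i using n[of "i+n"] X(1) by (auto simp: Y_def)
  have Y0: "Y \<leadsto> 0" using X(2) unfolding Y_def by (rule LIMSEQ_ignore_initial_segment)
  have "(\<lambda>i. \<integral>a. (F (Y i) a - F 0 a) / Y i \<partial>M) \<leadsto> (LINT a|M. F' 0 a)"
  proof (rule integral_dominated_convergence[where w=g])
   show "(\<lambda>a. (F (Y i) a - F 0 a) / Y i) \<in> borel_measurable M" for i
    using int[of "Y i"] int[of 0] Y[of i] by auto
   show "AE a in M. (\<lambda>i. (F (Y i) a - F 0 a) / Y i) \<leadsto> F' 0 a"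
    using deriv
   proof eventually_elim
    case (elim a)
    then have "((\<lambda>h. F h a) has_real_derivative F' 0 a) (at 0)" by simp
    then have "((\<lambda>h. (F (0 + h) a - F 0 a) / h) \<longlongrightarrow> F' 0 a) (at 0)"
     by (simp add: DERIV_def)
    then show ?case
     using Y Y0 unfolding tendsto_at_iff_sequentially comp_def by auto
   qed
   show "AE a in M. norm ((F (Y i) a - F 0 a) / Y i) <= g a" for i
    using deriv bound
   proof eventually_elim
    case (elim a)
    have "norm (F (Y i) a - F 0 a) <= g a * norm (Y i - 0)"
    proof (rule field_differentiable_bound[where S="{-1..1}" and f'="\<lambda>h. F' h a"])
     show "((\<lambda>h. F h a) has_field_derivative F' h a) (at h within {-1..1})" if "h \<in> {-1..1}" for h
      using elim(1) that by (auto intro: has_field_derivative_at_within)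
    qed (use elim(2) Y[of i] in auto)
    then show ?case using Y[of i] by (simp add: divide_le_eq)
   qed
  qed (use g meas in auto)
  moreover have "(LINT a|M. (F (Y i) a - F 0 a) / Y i) = ((LINT a|M. F (0 + Y i) a) - (LINT a|M. F 0 a)) / Y i" for i
   using int[of "Y i"] int[of 0] Y[of i] by (simp add: Bochner_Integration.integral_diff)
  ultimately have "(\<lambda>i. ((LINT a|M. F (0 + Y i) a) - (LINT a|M. F 0 a)) / Y i) \<leadsto> (LINT a|M. F' 0 a)"
   by (simp only: )
  then have "(\<lambda>i. ((LINT a|M. F (0 + X (i + n)) a) - (LINT a|M. F 0 a)) / X (i + n)) \<leadsto> (LINT a|M. F' 0 a)"
   by (simp add: Y_def)
  then show "(\<lambda>i. ((LINT a|M. F (0 + X i) a) - (LINT a|M. F 0 a)) / X i) \<leadsto> (LINT a|M. F' 0 a)"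
   by (rule LIMSEQ_offset)
 qed
 then show ?thesis by (simp add: DERIV_def)
qed

section \<open>Right-continuous paths and Euler schemes\<close>

definition gp :: "real => real => nat => nat => real" where
 "gp a b k j = a + (b - a) * real j / real k"

text \<open>The index j of the left-open cell from \<open>gp a b k j\<close> to
  \<open>gp a b k (Suc j)\<close> that contains v. With left-open cells the right endpoint
  \<open>up\<close> is never to the left of v, so a right-continuous function sampled there
  converges to its value at v.\<close>

definition idx :: "real => real => nat => real => nat" where
 "idx a b k v = nat \<lceil>(v - a) * real k / (b - a)\<rceil> - 1"

definition up :: "real => real => nat => real => real" where
 "up a b k v = gp a b k (Suc (idx a b k v))"

definition dn :: "real => real => nat => real => real" where
 "dn a b k v = gp a b k (idx a b k v)"

lemma gp_0 [simp]: "gp a b k 0 = a"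
 by (simp add: gp_def)

lemma gp_last [simp]: "0 < k ==> gp a b k k = b"
 by (simp add: gp_def)

lemma gp_less_iff: "a < b ==> 0 < k ==> gp a b k i < gp a b k j \<longleftrightarrow> i < j"
 by (simp add: gp_def divide_less_cancel)

lemma gp_le_iff: "a < b ==> 0 < k ==> gp a b k i <= gp a b k j \<longleftrightarrow> i <= j"
 using gp_less_iff[of a b k j i] by (simp add: not_less[symmetric])

lemma gp_Suc_diff: "gp a b k (Suc j) - gp a b k j = (b - a) / real k"
 by (simp add: gp_def add_divide_distrib distrib_left)

lemma gp_in: "a < b ==> 0 < k ==> j <= k ==> gp a b k j \<in> {a..b}"
 using gp_le_iff[of a b k 0 j] gp_le_iff[of a b k j k] by simp

lemma idx_bounds:
 assumes "a < b" "0 < k" "v \<in> {a<..b}"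
 shows "idx a b k v < k" "dn a b k v < v" "v <= up a b k v" "a <= dn a b k v" "up a b k v <= b"
proof -
 define y where "y = (v - a) * real k / (b - a)"
 have y: "0 < y" "y <= real k" using assms by (auto simp: y_def divide_le_eq mult.commute)
 define m where "m = nat \<lceil>y\<rceil>"
 have m: "real m - 1 < y" "y <= real m" "0 < m" "m <= k"
  using y unfolding m_def by (auto simp: ceiling_le_iff) linarith+
 have i: "idx a b k v = m - 1" by (simp add: idx_def m_def y_def)
 have v: "v = a + (b - a) * y / real k" using assms by (simp add: y_def)
 show 1: "idx a b k v < k" using i m by simp
 have mono: "p < q ==> a + (b - a) * p / real k < a + (b - a) * q / real k" for p q
  using assms by (simp add: divide_less_cancel)
 have mono2: "p <= q ==> a + (b - a) * p / real k <= a + (b - a) * q / real k" for p q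
  using assms by (simp add: divide_right_mono)
 have "dn a b k v = a + (b - a) * (real m - 1) / real k"
  using m by (simp add: dn_def gp_def i of_nat_diff)
 then show "dn a b k v < v" using mono[OF m(1)] v by simp
 have "up a b k v = a + (b - a) * real m / real k"
  using m by (simp add: up_def gp_def i)
 then show "v <= up a b k v" using mono2[OF m(2)] v by simp
 show "a <= dn a b k v" unfolding dn_def using gp_in[of a b k "idx a b k v"] assms 1 by auto
 show "up a b k v <= b" unfolding up_def using gp_in[of a b k "Suc (idx a b k v)"] assms 1 by auto
qed

lemma idx_eq:
 assumes "a < b" "0 < k" "j < k" "v \<in> {gp a b k j<..gp a b k (Suc j)}"
 shows "idx a b k v = j"
proof -
 have "gp a b k j \<in> {a..b}" "gp a b k (Suc j) \<in> {a..b}"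
  using gp_in[OF assms(1,2), of j] gp_in[OF assms(1,2), of "Suc j"] assms(3) by auto
 then have v: "v \<in> {a<..b}" using assms(4) by auto
 note B = idx_bounds[OF assms(1,2) v]
 have "gp a b k (idx a b k v) < gp a b k (Suc j)" "gp a b k j < gp a b k (Suc (idx a b k v))"
  using B assms(4) by (auto simp: up_def dn_def)
 then show ?thesis using gp_less_iff[OF assms(1,2)] by auto
qed

lemma up_dn_tendsto:
 assumes "a < b" "v \<in> {a<..b}"
 shows "(\<lambda>k. up a b (Suc k) v) \<leadsto> v" "(\<lambda>k. dn a b (Suc k) v) \<leadsto> v"
proof -
 have l: "(\<lambda>k. (b - a) / real (Suc k)) \<leadsto> 0"
  by real_asymp
 have d: "up a b (Suc k) v - dn a b (Suc k) v = (b - a) / real (Suc k)" for k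
  unfolding up_def dn_def by (rule gp_Suc_diff)
 note B = idx_bounds[OF assms(1) zero_less_Suc assms(2)]
 have 1: "\<bar>up a b (Suc k) v - v\<bar> <= (b - a) / real (Suc k)"
   "\<bar>dn a b (Suc k) v - v\<bar> <= (b - a) / real (Suc k)" for k
  using B(2,3)[of k] d[of k] by linarith+
 show "(\<lambda>k. up a b (Suc k) v) \<leadsto> v"
  using Lim_null_comparison[OF always_eventually l, of "\<lambda>k. up a b (Suc k) v - v"] 1 LIM_zero_cancel by fastforce
 show "(\<lambda>k. dn a b (Suc k) v) \<leadsto> v"
  using Lim_null_comparison[OF always_eventually l, of "\<lambda>k. dn a b (Suc k) v - v"] 1 LIM_zero_cancel by fastforce
qed

lemma right_cont_up_tendsto:
 assumes "a < b" "v \<in> {a<..b}" "continuous (at v within {v..b}) g"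
 shows "(\<lambda>k. g (up a b (Suc k) v)) \<leadsto> g v"
proof -
 have "\<forall>k. up a b (Suc k) v \<in> {v..b}"
  using idx_bounds[OF assms(1) zero_less_Suc assms(2)] by auto
 moreover have "\<forall>x. (\<forall>n. x n \<in> {v..b}) \<and> x \<leadsto> v \<longrightarrow> (\<lambda>n. g (x n)) \<leadsto> g v"
  using assms(3) unfolding continuous_within_sequentially comp_def .
 ultimately show ?thesis
  using up_dn_tendsto(1)[OF assms(1,2)] by (auto dest: spec[of _ "\<lambda>k. up a b (Suc k) v"])
qed

text \<open>Time is rounded up to the next multiple of 1/(k+1). The rounded process takes countably
  many times and is jointly measurable, and right-continuity makes it converge.\<close>

lemma right_cont_measurable_pair:
 fixes G :: "real => 'w => 'b::{metric_space, second_countable_topology}"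
 assumes G: "\<And>v. G v \<in> borel_measurable M"
  and rc: "\<And>v om. om \<in> space M ==> continuous (at v within {v..}) (\<lambda>v. G v om)"
 shows "(\<lambda>(v, om). G v om) \<in> borel_measurable (borel \<Otimes>\<^sub>M M)"
proof (rule borel_measurable_LIMSEQ_metric)
 define p where "p k v = (real_of_int \<lceil>v * real (Suc k)\<rceil>) / real (Suc k)" for k v
 have [measurable]: "(\<lambda>x. G (real_of_int i / c) (snd x)) \<in> borel_measurable (borel \<Otimes>\<^sub>M M)" for i c
  using G by measurable
 show "(\<lambda>x. G (p k (fst x)) (snd x)) \<in> borel_measurable (borel \<Otimes>\<^sub>M M)" for k
  unfolding p_def
  by (rule measurable_compose_countable[where f="\<lambda>i x. G (real_of_int i / real (Suc k)) (snd x)"]) measurable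
 fix x :: "real \<times> 'w" assume x: "x \<in> space (borel \<Otimes>\<^sub>M M)"
 have ge: "v <= p k v" "p k v - v <= 1 / real (Suc k)" for k v
 proof -
  have "v * real (Suc k) <= real_of_int \<lceil>v * real (Suc k)\<rceil>"
   "real_of_int \<lceil>v * real (Suc k)\<rceil> <= v * real (Suc k) + 1" by linarith+
  then have "v * real (Suc k) / real (Suc k) <= real_of_int \<lceil>v * real (Suc k)\<rceil> / real (Suc k)"
   "p k v <= (v * real (Suc k) + 1) / real (Suc k)"
   unfolding p_def by (intro divide_right_mono; simp)+
  moreover have "v * real (Suc k) / real (Suc k) = v" by (simp del: of_nat_Suc)
  ultimately have "v <= p k v" "p k v <= (v * real (Suc k) + 1) / real (Suc k)"
   unfolding p_def by simp_all
  then show "v <= p k v" "p k v - v <= 1 / real (Suc k)"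
   by (simp_all add: add_divide_distrib del: of_nat_Suc)
 qed
 have l: "(\<lambda>k. 1 / real (Suc k)) \<leadsto> 0" by real_asymp
 have pv: "(\<lambda>k. p k v) \<leadsto> v" for v
 proof -
  have "(\<lambda>k. p k v - v) \<leadsto> 0"
  proof (rule Lim_null_comparison[OF always_eventually l], intro allI)
   show "norm (p k v - v) <= 1 / real (Suc k)" for k using ge(2)[of k v] ge(1)[of v k] by simp
  qed
  then show ?thesis by (rule LIM_zero_cancel)
 qed
 have "continuous (at (fst x) within {fst x..}) (\<lambda>v. G v (snd x))"
  using x by (intro rc) (auto simp: space_pair_measure)
 moreover have "\<forall>k. p k (fst x) \<in> {fst x..}" using ge by auto
 ultimately have "(\<lambda>k. G (p k (fst x)) (snd x)) \<leadsto> G (fst x) (snd x)"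
  using pv[of "fst x"] unfolding continuous_within_sequentially comp_def
  by (auto dest: spec[of _ "\<lambda>k. p k (fst x)"])
 then show "(\<lambda>k. G (p k (fst x)) (snd x)) \<leadsto> (case x of (v, om) => G v om)"
  by (simp add: case_prod_beta)
qed

lemma right_cont_measurable:
 fixes g :: "real => 'b::{metric_space, second_countable_topology}"
 assumes "\<And>v. continuous (at v within {v..}) g"
 shows "g \<in> borel_fun"
proof -
 have "(\<lambda>(v, om). g v) \<in> borel_measurable (borel \<Otimes>\<^sub>M count_space {()})"
  using assms by (intro right_cont_measurable_pair) auto
 then have "(\<lambda>v. (\<lambda>(v, om). g v) (v, ())) \<in> borel_fun"
  by (rule measurable_compose[rotated]) auto
 then show ?thesis by simp
qed

text \<open>Freezing time outside [a,b] makes functions that are controlled only on [a,b] total; it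
  preserves continuity and right-continuity.\<close>

definition clip :: "real => real => real => real" where
 "clip a b v = max a (min b v)"

lemma clip_in: "a <= b ==> clip a b v \<in> {a..b}" "v \<in> {a..b} ==> clip a b v = v"
 by (auto simp: clip_def)

lemma clip_right_cont:
 assumes "a <= b" "\<And>v. v \<in> {a..b} ==> continuous (at v within {v..b}) g"
 shows "continuous (at v within {v..}) (\<lambda>v. g (clip a b v))"
proof -
 have 1: "continuous (at v within {v..}) (clip a b)"
  unfolding clip_def by (intro continuous_intros)
 have "clip a b ` {v..} \<subseteq> {clip a b v..b}"
  using assms(1) by (auto simp: clip_def)
 then have "continuous (at (clip a b v) within clip a b ` {v..}) g"
  using assms(2)[OF clip_in(1)[OF assms(1)]] continuous_within_subset by blast
 from continuous_within_compose[OF 1 this] show ?thesis by (simp add: comp_def)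
qed

lemma right_cont_set_measurable:
 fixes g :: "real => 'b::{real_normed_vector, second_countable_topology}"
 assumes "a <= b" "\<And>v. v \<in> {a..b} ==> continuous (at v within {v..b}) g"
 shows "set_borel_measurable lborel {a<..b} g"
proof -
 have [measurable]: "(\<lambda>v. g (clip a b v)) \<in> borel_fun"
  by (intro right_cont_measurable clip_right_cont assms)
 have "(\<lambda>v. indicator {a<..b} v *\<^sub>R g (clip a b v)) \<in> borel_fun"
  by measurable
 moreover have "(\<lambda>v. indicator {a<..b} v *\<^sub>R g (clip a b v)) = (\<lambda>v. indicator {a<..b} v *\<^sub>R g v)"
  by (auto simp: clip_in split: split_indicator)
 ultimately show ?thesis unfolding set_borel_measurable_def by simp
qed

lemma set_integrable_bounded_Ioc:
 fixes g :: "real => 'b::{banach, second_countable_topology}"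
 assumes "set_borel_measurable lborel {a<..b} g" "\<And>v. v \<in> {a<..b} ==> norm (g v) <= K"
 shows "set_integrable lborel {a<..b} g"
 unfolding set_integrable_def
proof (rule Bochner_Integration.integrable_bound[where f="\<lambda>v. indicator {a<..b} v *\<^sub>R K"])
 show "integrable lborel (\<lambda>v. indicator {a<..b} v *\<^sub>R K)"
  using emeasure_bounded_finite[OF bounded_subset[OF bounded_closed_interval[of a b]], of "{a<..b}"]
  by (intro integrable_real_indicator[THEN integrable_scaleR_left]) (auto simp: subset_eq)
qed (use assms in "auto simp: set_borel_measurable_def split: split_indicator intro!: AE_I2 order_trans[OF _ abs_ge_self]")

lemma set_integrable_Icc_iff_Ioc:
 fixes g :: "real => 'b::{banach, second_countable_topology}"
 assumes "a <= b"
 shows "set_integrable lborel {a..b} g \<longleftrightarrow> set_integrable lborel {a<..b} g"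
 unfolding set_integrable_def
 by (rule integrable_discrete_difference[where X="{a}"])
  (use assms in "auto simp: indicator_def")

lemma set_integral_Icc_eq_Ioc:
 fixes g :: "real => 'b::{banach, second_countable_topology}"
 assumes "a <= b"
 shows "(LBINT v:{a..b}. g v) = (LBINT v:{a<..b}. g v)"
 unfolding set_lebesgue_integral_def
 by (rule integral_discrete_difference[where X="{a}"])
  (use assms in "auto simp: indicator_def")

text \<open>The integrand may change from cell to cell. This one gluing step serves Abel summation,
  the error of the Euler scheme and the chain rule.\<close>

lemma grid_sum:
 fixes c :: "nat => real => 'b::{banach, second_countable_topology}"
 assumes ab: "a < b" and k: "0 < k"
  and c: "\<And>j. j < k ==> set_integrable lborel {gp a b k j<..gp a b k (Suc j)} (c j)"
 shows "set_integrable lborel {a<..b} (\<lambda>v. c (idx a b k v) v)" (is "?A")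
  and "(LBINT v:{a<..b}. c (idx a b k v) v) = (\<Sum>j<k. LBINT v:{gp a b k j<..gp a b k (Suc j)}. c j v)" (is "?B")
proof -
 have "set_integrable lborel {a<..gp a b k m} (\<lambda>v. c (idx a b k v) v) \<and>
  (LBINT v:{a<..gp a b k m}. c (idx a b k v) v) = (\<Sum>j<m. LBINT v:{gp a b k j<..gp a b k (Suc j)}. c j v)"
  if "m <= k" for m
  using that
 proof (induction m)
  case 0 show ?case by (simp add: set_integrable_def set_lebesgue_integral_def)
 next
  case (Suc m)
  let ?I = "{gp a b k m<..gp a b k (Suc m)}"
  have eq: "c (idx a b k v) v = c m v" if "v \<in> ?I" for v
   using idx_eq[OF ab k _ that] Suc by simp
  have i: "set_integrable lborel ?I (\<lambda>v. c (idx a b k v) v)"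
   using c[of m] Suc.prems set_integrable_cong[of lborel lborel ?I ?I "\<lambda>v. c (idx a b k v) v" "c m"] eq by auto
  have e: "(LBINT v:?I. c (idx a b k v) v) = (LBINT v:?I. c m v)"
   by (rule set_lebesgue_integral_cong) (auto simp: eq)
  have u: "{a<..gp a b k (Suc m)} = {a<..gp a b k m} \<union> ?I"
   using gp_le_iff[OF ab k, of 0 m] gp_le_iff[OF ab k, of m "Suc m"] by auto
  have d: "{a<..gp a b k m} \<inter> ?I = {}" by auto
  show ?case
   unfolding u using Suc i e d by (auto intro!: set_integrable_Un simp: set_integral_Un)
 qed
 from this[of k] show ?A ?B using k by auto
qed

lemma cadlag_on_right_cont:
 assumes "cadlag_on {s..T} g" "v \<in> {s..T}"
 shows "continuous (at v within {v..T}) g"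
proof -
 have "(g \<longlongrightarrow> g v) (at v within {s..T} \<inter> {v<..})" using assms by (auto simp: cadlag_on_def)
 moreover have "at v within {s..T} \<inter> {v<..} = at v within {v..T}"
  unfolding at_within_def using assms(2) by (intro arg_cong2[where f=inf] refl arg_cong[where f=principal]) auto
 ultimately show ?thesis by (simp add: continuous_within)
qed

text \<open>The two one-sided limits bound the function near each point; compactness of the interval
  then leaves finitely many local bounds, whose absolute values are summed.\<close>

lemma cadlag_on_bounded:
 fixes g :: "real => 'b::real_normed_vector"
 assumes "cadlag_on {s..T} g"
 shows "\<exists>K. \<forall>v\<in>{s..T}. norm (g v) <= K"
proof -
 have "\<exists>U K. open U \<and> t \<in> U \<and> (\<forall>v\<in>U \<inter> {s..T}. norm (g v) <= K)" if t: "t \<in> {s..T}" for t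
 proof -
  obtain l where l: "(g \<longlongrightarrow> l) (at t within {s..T} \<inter> {..<t})"
   using assms t unfolding cadlag_on_def by blast
  have r: "(g \<longlongrightarrow> g t) (at t within {s..T} \<inter> {t<..})"
   using assms t by (auto simp: cadlag_on_def)
  from tendstoD[OF l, of 1] obtain U1 where U1: "open U1" "t \<in> U1"
   "\<forall>y\<in>U1. y \<noteq> t \<longrightarrow> y \<in> {s..T} \<inter> {..<t} \<longrightarrow> dist (g y) l < 1"
   unfolding eventually_at_topological by auto
  from tendstoD[OF r, of 1] obtain U2 where U2: "open U2" "t \<in> U2"
   "\<forall>y\<in>U2. y \<noteq> t \<longrightarrow> y \<in> {s..T} \<inter> {t<..} \<longrightarrow> dist (g y) (g t) < 1"
   unfolding eventually_at_topological by auto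
  have "norm (g v) <= norm l + norm (g t) + 1" if v: "v \<in> (U1 \<inter> U2) \<inter> {s..T}" for v
  proof -
   consider "v < t" | "v = t" | "t < v" by linarith
   then show ?thesis
   proof cases
    case 1 then have "dist (g v) l < 1" using U1 v by auto
    then show ?thesis using norm_triangle_sub[of "g v" l] norm_ge_zero[of "g t"] unfolding dist_norm by linarith
   next
    case 2 then show ?thesis by simp
   next
    case 3 then have "dist (g v) (g t) < 1" using U2 v by auto
    then show ?thesis using norm_triangle_sub[of "g v" "g t"] norm_ge_zero[of l] unfolding dist_norm by linarith
   qed
  qed
  then show ?thesis using U1 U2 by (intro exI[of _ "U1 \<inter> U2"] exI[of _ "norm l + norm (g t) + 1"] conjI ballI open_Int) auto
 qed
 then obtain U K where UK: "\<And>t. t \<in> {s..T} ==> open (U t) \<and> t \<in> U t \<and> (\<forall>v\<in>U t \<inter> {s..T}. norm (g v) <= K t)"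
  by metis
 have "compact {s..T}" by (rule compact_Icc)
 then obtain C where C: "C \<subseteq> {s..T}" "finite C" "{s..T} \<subseteq> (\<Union>c\<in>C. U c)"
  by (rule compactE_image[of "{s..T}" "{s..T}" U]) (use UK in auto)
 have "norm (g v) <= (\<Sum>c\<in>C. \<bar>K c\<bar>)" if v: "v \<in> {s..T}" for v
 proof -
  from C v obtain c where c: "c \<in> C" "v \<in> U c" by auto
  then have "norm (g v) <= K c" using UK C v by blast
  also have "\<dots> <= \<bar>K c\<bar>" by simp
  also have "\<dots> <= (\<Sum>c\<in>C. \<bar>K c\<bar>)" using c C by (intro member_le_sum) auto
  finally show ?thesis .
 qed
 then show ?thesis by blast
qed

lemma set_integral_tendsto_bounded:
 fixes h :: "nat => real => 'b::{banach, second_countable_topology}"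
 assumes h: "\<And>k. set_borel_measurable lborel {a<..b} (h k)" and f: "set_borel_measurable lborel {a<..b} f"
  and bd: "\<And>k v. v \<in> {a<..b} ==> norm (h k v) <= K"
  and lim: "\<And>v. v \<in> {a<..b} ==> (\<lambda>k. h k v) \<leadsto> f v"
 shows "(\<lambda>k. LBINT v:{a<..b}. h k v) \<leadsto> (LBINT v:{a<..b}. f v)"
 unfolding set_lebesgue_integral_def
proof (rule integral_dominated_convergence[where w="\<lambda>v. indicator {a<..b} v *\<^sub>R K"])
 have "set_integrable lborel {a<..b} (\<lambda>v. \<bar>K\<bar>)"
  by (rule set_integrable_bounded_Ioc[where K="\<bar>K\<bar>"]) (auto simp: set_borel_measurable_def)
 then have "set_integrable lborel {a<..b} (\<lambda>v. K)"
  by (rule set_integrable_bound) (auto simp: set_borel_measurable_def)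
 then show "integrable lborel (\<lambda>v. indicator {a<..b} v *\<^sub>R K)" unfolding set_integrable_def .
 show "AE v in lborel. (\<lambda>k. indicator {a<..b} v *\<^sub>R h k v) \<leadsto> indicator {a<..b} v *\<^sub>R f v"
  by (intro AE_I2) (auto intro!: tendsto_scaleR tendsto_const lim split: split_indicator)
 show "AE v in lborel. norm (indicator {a<..b} v *\<^sub>R h k v) <= indicator {a<..b} v *\<^sub>R K" for k
  by (intro AE_I2) (auto intro: bd split: split_indicator)
qed (use h f in "auto simp: set_borel_measurable_def")

lemma set_measurable_step:
 fixes c :: "nat => real => 'b::{banach, second_countable_topology}"
 assumes [measurable]: "\<And>j. c j \<in> borel_fun"
 shows "(\<lambda>v. c (idx a b k v) v) \<in> borel_fun"
 unfolding idx_def by (rule measurable_compose_countable) measurable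

lemma summation_by_parts:
 fixes e g :: "nat => real"
 shows "(\<Sum>j<k. e j * (g (Suc j) - g j)) = e k * g k - e 0 * g 0 - (\<Sum>j<k. (e (Suc j) - e j) * g (Suc j))"
 by (induction k) (auto simp: algebra_simps)

lemma has_integral_imp_set_integral_Ioc:
 fixes F f :: "real => real"
 assumes "a <= b" "\<And>v. (F has_real_derivative f v) (at v)" "continuous_on UNIV f"
 shows "set_integrable lborel {a<..b} f" "(LBINT v:{a<..b}. f v) = F b - F a"
proof -
 have 1: "set_integrable lborel {a..b} f"
  by (rule borel_integrable_atLeastAtMost') (rule continuous_on_subset[OF assms(3)], simp)
 then show "set_integrable lborel {a<..b} f" using set_integrable_Icc_iff_Ioc[OF assms(1)] by blast
 have "(LINT x|lborel. f x * indicator {a..b} x) = F b - F a"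
  by (rule integral_FTC_Icc_real[OF assms(1)])
   (use assms in "auto simp: continuous_on_eq_continuous_at")
 then have "(LBINT v:{a..b}. f v) = F b - F a"
  by (simp add: set_lebesgue_integral_def mult.commute)
 then show "(LBINT v:{a<..b}. f v) = F b - F a"
  using set_integral_Icc_eq_Ioc[OF assms(1), of f] by simp
qed

text \<open>The sums are of Riemann-Stieltjes type against \<open>g\<close>, which may have infinite
  variation. Summation by parts moves the differences to the exponential; the resulting sum is
  exactly the integral of \<mu> e(v) g(up v), and right-continuity with dominated convergence gives
  the limit. It is used both for the noise and for the subordinator.\<close>

lemma abel_sum_tendsto:
 fixes g :: "real => real"
 assumes ab: "a < b"
  and rc: "\<And>v. v \<in> {a..b} ==> continuous (at v within {v..b}) g"
  and bd: "\<And>v. v \<in> {a..b} ==> \<bar>g v\<bar> <= K"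
 shows "(\<lambda>k. \<Sum>j<Suc k. exp (- (\<mu> * (b - gp a b (Suc k) j))) * (g (gp a b (Suc k) (Suc j)) - g (gp a b (Suc k) j)))
  \<leadsto> g b - exp (- (\<mu> * (b - a))) * g a - (LBINT v:{a<..b}. \<mu> * exp (- (\<mu> * (b - v))) * g v)"
proof -
 define e where "e v = exp (- (\<mu> * (b - v)))" for v
 have e': "(e has_real_derivative \<mu> * e v) (at v)" for v
  unfolding e_def by (auto intro!: derivative_eq_intros)
 have ce: "continuous_on UNIV (\<lambda>v. \<mu> * e v)" unfolding e_def by (intro continuous_intros)
 note Ie = has_integral_imp_set_integral_Ioc[OF _ e' ce]
 have [measurable]: "e \<in> borel_fun" unfolding e_def by measurable
 have "(\<Sum>j<k. e (gp a b k j) * (g (gp a b k (Suc j)) - g (gp a b k j))) =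
   g b - e a * g a - (LBINT v:{a<..b}. \<mu> * e v * g (up a b k v))" if k: "0 < k" for k
 proof -
  have i: "set_integrable lborel {gp a b k j<..gp a b k (Suc j)} (\<lambda>v. \<mu> * e v * g (gp a b k (Suc j)))" for j
   by (intro set_integrable_mult_left impI Ie(1)) (use gp_le_iff[OF ab k] in simp)
  have eq: "(LBINT v:{gp a b k j<..gp a b k (Suc j)}. \<mu> * e v * g (gp a b k (Suc j))) =
    (e (gp a b k (Suc j)) - e (gp a b k j)) * g (gp a b k (Suc j))" for j
  proof -
   have "gp a b k j <= gp a b k (Suc j)" using gp_le_iff[OF ab k] by simp
   then show ?thesis using Ie(2) by (subst set_integral_mult_left) simp
  qed
  have "(LBINT v:{a<..b}. \<mu> * e v * g (up a b k v)) =
    (\<Sum>j<k. LBINT v:{gp a b k j<..gp a b k (Suc j)}. \<mu> * e v * g (gp a b k (Suc j)))"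
   unfolding up_def by (rule grid_sum(2)[OF ab k i])
  then have "(LBINT v:{a<..b}. \<mu> * e v * g (up a b k v)) =
    (\<Sum>j<k. (e (gp a b k (Suc j)) - e (gp a b k j)) * g (gp a b k (Suc j)))"
   by (simp only: eq)
  then show ?thesis
   using summation_by_parts[of "\<lambda>j. e (gp a b k j)" "\<lambda>j. g (gp a b k j)" k] k
   by (simp add: e_def)
 qed
 moreover have "(\<lambda>k. LBINT v:{a<..b}. \<mu> * e v * g (up a b (Suc k) v)) \<leadsto> (LBINT v:{a<..b}. \<mu> * e v * g v)"
 proof (rule set_integral_tendsto_bounded[where K="\<bar>\<mu>\<bar> * exp (\<bar>\<mu>\<bar> * (b - a)) * K"])
  show "set_borel_measurable lborel {a<..b} (\<lambda>v. \<mu> * e v * g (up a b (Suc k) v))" for k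
  proof -
   have [measurable]: "(\<lambda>v. g (up a b (Suc k) v)) \<in> borel_fun"
    unfolding up_def by (rule set_measurable_step[where c="\<lambda>j v. g (gp a b (Suc k) (Suc j))"]) simp
   show ?thesis unfolding set_borel_measurable_def by measurable
  qed
  show "set_borel_measurable lborel {a<..b} (\<lambda>v. \<mu> * e v * g v)"
  proof -
   have [measurable]: "(\<lambda>v. indicator {a<..b} v *\<^sub>R g v) \<in> borel_fun"
    using right_cont_set_measurable[of a b g] ab rc by (simp add: set_borel_measurable_def)
   have "(\<lambda>v. \<mu> * e v * (indicator {a<..b} v *\<^sub>R g v)) \<in> borel_fun" by measurable
   then show ?thesis unfolding set_borel_measurable_def by (simp add: mult_ac)
  qed
  fix k v assume v: "v \<in> {a<..b}"
  have "\<bar>e v\<bar> <= exp (\<bar>\<mu>\<bar> * (b - a))"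
  proof -
   have "- (\<mu> * (b - v)) <= \<bar>\<mu>\<bar> * (b - v)" using v by (simp add: abs_if mult_le_0_iff zero_le_mult_iff)
   also have "\<dots> <= \<bar>\<mu>\<bar> * (b - a)" using v by (intro mult_left_mono) auto
   finally show ?thesis by (simp add: e_def)
  qed
  moreover have "\<bar>g (up a b (Suc k) v)\<bar> <= K"
   using idx_bounds[OF ab zero_less_Suc v] v by (intro bd) (fastforce intro: order_trans[OF less_imp_le])
  ultimately show "norm (\<mu> * e v * g (up a b (Suc k) v)) <= \<bar>\<mu>\<bar> * exp (\<bar>\<mu>\<bar> * (b - a)) * K"
   by (auto simp: abs_mult intro!: mult_mono)
 next
  fix v assume v: "v \<in> {a<..b}"
  then show "(\<lambda>k. \<mu> * e v * g (up a b (Suc k) v)) \<leadsto> \<mu> * e v * g v"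
   by (intro tendsto_intros right_cont_up_tendsto[OF ab v] rc) auto
 qed
 ultimately have "(\<lambda>k. \<Sum>j<Suc k. e (gp a b (Suc k) j) * (g (gp a b (Suc k) (Suc j)) - g (gp a b (Suc k) j)))
   \<leadsto> g b - e a * g a - (LBINT v:{a<..b}. \<mu> * e v * g v)"
  by (simp only: zero_less_Suc) (intro tendsto_intros)
 then show ?thesis by (simp add: e_def)
qed

text \<open>Integration by parts for absolutely continuous functions, via Fubini: no derivative of
 \<open>\<lambda>v. LBINT u:{a<..v}. h u\<close> is needed.\<close>

lemma exp_integral_by_parts:
 fixes h :: "real => real"
 assumes ab: "a <= b" and h: "set_integrable lborel {a<..b} h"
 shows "(LBINT v:{a<..b}. exp (\<mu> * v) * h v) =
  exp (\<mu> * b) * (LBINT u:{a<..b}. h u) - (LBINT v:{a<..b}. \<mu> * exp (\<mu> * v) * (LBINT u:{a<..v}. h u))"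
  and "set_integrable lborel {a<..b} (\<lambda>v. exp (\<mu> * v) * h v)"
  and "set_integrable lborel {a<..b} (\<lambda>v. \<mu> * exp (\<mu> * v) * (LBINT u:{a<..v}. h u))"
proof -
 have e': "((\<lambda>v. exp (\<mu> * v)) has_real_derivative \<mu> * exp (\<mu> * v)) (at v)" for v
  by (auto intro!: derivative_eq_intros)
 have ce: "continuous_on UNIV (\<lambda>v. \<mu> * exp (\<mu> * v))" by (intro continuous_intros)
 note Ie = has_integral_imp_set_integral_Ioc[OF _ e' ce]
 define H where "H u = indicator {a<..b} u *\<^sub>R h u" for u
 define E where "E v = indicator {a<..b} v *\<^sub>R (\<mu> * exp (\<mu> * v))" for v
 have H: "integrable lborel H" using h by (simp add: H_def[abs_def] set_integrable_def)
 have E: "integrable lborel E" using Ie(1)[OF ab] by (simp add: E_def[abs_def] set_integrable_def)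
 have [measurable]: "H \<in> borel_fun" "E \<in> borel_fun" using H E by auto
 interpret lborel_pair: pair_sigma_finite lborel lborel ..
 have P: "integrable (lborel \<Otimes>\<^sub>M lborel) (\<lambda>(v, u). E v * H u)"
  using H E by (intro lborel_pair.Fubini_integrable) (auto simp: abs_mult)
 \<comment> \<open>The product is restricted to the triangle u <= v; its two iterated integrals,
   \<open>inner\<close> and \<open>outer\<close>, are the two sides of the formula.\<close>
 have Pi: "integrable (lborel \<Otimes>\<^sub>M lborel) (\<lambda>(v, u). E v * H u * indicator {..v} u)"
 proof (rule Bochner_Integration.integrable_bound[OF P])
  show "(\<lambda>(v, u). E v * H u * indicator {..v} u) \<in> borel_measurable (lborel \<Otimes>\<^sub>M lborel)"
   by (simp add: indicator_def atMost_def if_distrib cong: if_cong) measurable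
 qed (auto split: split_indicator)
 have inner: "(LINT u|lborel. E v * H u * indicator {..v} u) = indicator {a<..b} v *\<^sub>R (\<mu> * exp (\<mu> * v) * (LBINT u:{a<..v}. h u))" for v
 proof -
  have "E v * H u * indicator {..v} u = E v * (indicator {a<..v} u *\<^sub>R h u)" for u
   by (auto simp: E_def H_def split: split_indicator)
  then have "(LINT u|lborel. E v * H u * indicator {..v} u) = (LINT u|lborel. E v * (indicator {a<..v} u *\<^sub>R h u))"
   by (simp only:)
  then show ?thesis by (simp add: E_def set_lebesgue_integral_def)
 qed
 have outer: "(LINT v|lborel. E v * H u * indicator {..v} u) = indicator {a<..b} u *\<^sub>R ((exp (\<mu> * b) - exp (\<mu> * u)) * h u)" for u
 proof (cases "u \<in> {a<..b}")
  case True
  have "E v * H u * indicator {..v} u = h u * (indicator {u..b} v *\<^sub>R (\<mu> * exp (\<mu> * v)))" for v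
   using True by (auto simp: E_def H_def split: split_indicator)
  then have "(LINT v|lborel. E v * H u * indicator {..v} u) = h u * (LBINT v:{u..b}. \<mu> * exp (\<mu> * v))"
   unfolding set_lebesgue_integral_def by (simp only: integral_mult_right_zero)
  moreover have "(LBINT v:{u..b}. \<mu> * exp (\<mu> * v)) = exp (\<mu> * b) - exp (\<mu> * u)"
   using True Ie(2)[of u b] set_integral_Icc_eq_Ioc[of u b "\<lambda>v. \<mu> * exp (\<mu> * v)"] by simp
  ultimately show ?thesis using True by simp
 next
  case False then show ?thesis by (simp add: H_def)
 qed
 have 3: "integrable lborel (\<lambda>v. indicator {a<..b} v *\<^sub>R (\<mu> * exp (\<mu> * v) * (LBINT u:{a<..v}. h u)))"
  using lborel_pair.integrable_fst'[OF Pi] inner by simp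
 then show "set_integrable lborel {a<..b} (\<lambda>v. \<mu> * exp (\<mu> * v) * (LBINT u:{a<..v}. h u))"
  by (simp add: set_integrable_def)
 have 4: "integrable lborel (\<lambda>u. indicator {a<..b} u *\<^sub>R ((exp (\<mu> * b) - exp (\<mu> * u)) * h u))"
  using lborel_pair.integrable_snd[of "\<lambda>v u. E v * H u * indicator {..v} u"] Pi outer by simp
 have 5: "integrable lborel (\<lambda>u. exp (\<mu> * b) * H u - indicator {a<..b} u *\<^sub>R ((exp (\<mu> * b) - exp (\<mu> * u)) * h u))"
  using H 4 by auto
 have eq: "exp (\<mu> * b) * H u - indicator {a<..b} u *\<^sub>R ((exp (\<mu> * b) - exp (\<mu> * u)) * h u) =
   indicator {a<..b} u *\<^sub>R (exp (\<mu> * u) * h u)" for u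
  by (simp add: H_def algebra_simps)
 show "set_integrable lborel {a<..b} (\<lambda>v. exp (\<mu> * v) * h v)"
  using 5 unfolding eq set_integrable_def .
 have "(\<integral>v. \<integral>u. E v * H u * indicator {..v} u \<partial>lborel \<partial>lborel) = (\<integral>u. \<integral>v. E v * H u * indicator {..v} u \<partial>lborel \<partial>lborel)"
  using lborel_pair.Fubini_integral[of "\<lambda>v u. E v * H u * indicator {..v} u"] Pi by simp
 then have "(LBINT v:{a<..b}. \<mu> * exp (\<mu> * v) * (LBINT u:{a<..v}. h u)) =
   (LINT u|lborel. indicator {a<..b} u *\<^sub>R ((exp (\<mu> * b) - exp (\<mu> * u)) * h u))"
  unfolding inner outer set_lebesgue_integral_def .
 moreover have "(LINT u|lborel. exp (\<mu> * b) * H u - indicator {a<..b} u *\<^sub>R ((exp (\<mu> * b) - exp (\<mu> * u)) * h u)) =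
   exp (\<mu> * b) * (LINT u|lborel. H u) - (LINT u|lborel. indicator {a<..b} u *\<^sub>R ((exp (\<mu> * b) - exp (\<mu> * u)) * h u))"
  using H 4 by (subst Bochner_Integration.integral_diff) auto
 ultimately show "(LBINT v:{a<..b}. exp (\<mu> * v) * h v) =
  exp (\<mu> * b) * (LBINT u:{a<..b}. h u) - (LBINT v:{a<..b}. \<mu> * exp (\<mu> * v) * (LBINT u:{a<..v}. h u))"
  unfolding eq by (simp add: set_lebesgue_integral_def H_def)
qed

text \<open>E solves E' = g - \<mu> E in integrated form, with g merely integrable. Integrating
  exp(\<mu> v) h(v) by parts for h = g - \<mu> E, the terms containing the integral of exp(\<mu> v)
  E(v) cancel.\<close>

lemma variation_of_constants:
 fixes E g :: "real => real"
 assumes ab: "a <= b"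
  and E: "\<And>v. v \<in> {a..b} ==> E v = E a + (LBINT u:{a<..v}. g u - \<mu> * E u)"
  and g: "set_integrable lborel {a<..b} g" and Ei: "set_integrable lborel {a<..b} E"
 shows "E b = exp (- (\<mu> * (b - a))) * E a + (LBINT v:{a<..b}. exp (- (\<mu> * (b - v))) * g v)"
  and "set_integrable lborel {a<..b} (\<lambda>v. exp (- (\<mu> * (b - v))) * g v)"
proof -
 define h where "h u = g u - \<mu> * E u" for u
 have h: "set_integrable lborel {a<..b} h"
  unfolding h_def using g Ei by (intro set_integral_diff set_integrable_mult_right) auto
 note P = exp_integral_by_parts[OF ab h, of \<mu>]
 have G: "(LBINT u:{a<..v}. h u) = E v - E a" if "v \<in> {a..b}" for v
  using E[OF that] by (simp add: h_def)
 have e': "((\<lambda>v. exp (\<mu> * v)) has_real_derivative \<mu> * exp (\<mu> * v)) (at v)" for v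
  by (auto intro!: derivative_eq_intros)
 have ce: "continuous_on UNIV (\<lambda>v. \<mu> * exp (\<mu> * v))" by (intro continuous_intros)
 note Ie = has_integral_imp_set_integral_Ioc[OF ab e' ce]
 have gi: "set_integrable lborel {a<..b} (\<lambda>v. exp (\<mu> * v) * g v)"
  by (rule exp_integral_by_parts(2)[OF ab g])
 have Eii: "set_integrable lborel {a<..b} (\<lambda>v. exp (\<mu> * v) * E v)"
  by (rule exp_integral_by_parts(2)[OF ab Ei])
 have 1: "(LBINT v:{a<..b}. exp (\<mu> * v) * h v) = (LBINT v:{a<..b}. exp (\<mu> * v) * g v) - \<mu> * (LBINT v:{a<..b}. exp (\<mu> * v) * E v)"
 proof -
  have "(LBINT v:{a<..b}. exp (\<mu> * v) * h v) = (LBINT v:{a<..b}. exp (\<mu> * v) * g v - \<mu> * (exp (\<mu> * v) * E v))"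
   by (simp add: h_def algebra_simps)
  also have "\<dots> = (LBINT v:{a<..b}. exp (\<mu> * v) * g v) - (LBINT v:{a<..b}. \<mu> * (exp (\<mu> * v) * E v))"
   by (rule set_integral_diff(2)[OF gi]) (rule set_integrable_mult_right, rule Eii)
  finally show ?thesis by (simp add: set_integral_mult_right)
 qed
 have 2: "(LBINT v:{a<..b}. \<mu> * exp (\<mu> * v) * (LBINT u:{a<..v}. h u)) =
   \<mu> * (LBINT v:{a<..b}. exp (\<mu> * v) * E v) - E a * (exp (\<mu> * b) - exp (\<mu> * a))"
 proof -
  have "(LBINT v:{a<..b}. \<mu> * exp (\<mu> * v) * (LBINT u:{a<..v}. h u)) =
    (LBINT v:{a<..b}. \<mu> * (exp (\<mu> * v) * E v) - E a * (\<mu> * exp (\<mu> * v)))"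
   by (rule set_lebesgue_integral_cong) (auto simp: G algebra_simps)
  also have "\<dots> = (LBINT v:{a<..b}. \<mu> * (exp (\<mu> * v) * E v)) - (LBINT v:{a<..b}. E a * (\<mu> * exp (\<mu> * v)))"
   by (rule set_integral_diff(2)) (intro set_integrable_mult_right Eii Ie(1) impI)+
  finally show ?thesis using Ie(2) by (simp add: set_integral_mult_right)
 qed
 have "(LBINT v:{a<..b}. exp (\<mu> * v) * g v) = exp (\<mu> * b) * E b - exp (\<mu> * a) * E a"
  using P(1) G[of b] ab unfolding 1 2 by (simp add: algebra_simps)
 note R = this
 have s: "exp (- (\<mu> * (b - v))) = exp (- (\<mu> * b)) * exp (\<mu> * v)" for v
  by (simp add: exp_add[symmetric] algebra_simps)
 have one: "exp (- (\<mu> * b)) * exp (\<mu> * b) = 1" by (simp add: exp_add[symmetric])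
 have "(LBINT v:{a<..b}. exp (- (\<mu> * (b - v))) * g v) = exp (- (\<mu> * b)) * (LBINT v:{a<..b}. exp (\<mu> * v) * g v)"
  unfolding s mult.assoc by (rule set_integral_mult_right)
 also have "\<dots> = (exp (- (\<mu> * b)) * exp (\<mu> * b)) * E b - exp (- (\<mu> * b)) * exp (\<mu> * a) * E a"
  unfolding R by (simp only: right_diff_distrib mult.assoc)
 finally show "E b = exp (- (\<mu> * (b - a))) * E a + (LBINT v:{a<..b}. exp (- (\<mu> * (b - v))) * g v)"
  unfolding one s[of a] by simp
 show "set_integrable lborel {a<..b} (\<lambda>v. exp (- (\<mu> * (b - v))) * g v)"
  unfolding s mult.assoc using gi by (intro set_integrable_mult_right)
qed

text \<open>The scheme approximates the solution minus the noise, which is continuous. The state is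
  taken at the left grid point, so that the scheme is explicit; time and noise are taken at the
  right one, because the noise is only right-continuous.\<close>

fun euler :: "(real => 'b => 'b) => real => real => nat => 'b => (nat => 'b) => nat => 'b::real_normed_vector" where
 "euler b a c k x n 0 = x"
| "euler b a c k x n (Suc j) = euler b a c k x n j +
   ((c - a) / real k) *\<^sub>R b (gp a c k (Suc j)) (euler b a c k x n j + n (Suc j))"

lemma set_integral_const_Ioc:
 fixes z :: "'b::{banach, second_countable_topology}"
 assumes "p <= q"
 shows "set_integrable lborel {p<..q} (\<lambda>v. z)" "(LBINT v:{p<..q}. z) = (q - p) *\<^sub>R z"
proof -
 show "set_integrable lborel {p<..q} (\<lambda>v. z)"
  by (rule set_integrable_bounded_Ioc[where K="norm z"]) (auto simp: set_borel_measurable_def)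
 show "(LBINT v:{p<..q}. z) = (q - p) *\<^sub>R z"
  using assms unfolding set_lebesgue_integral_def by (subst integral_scaleR_left) (auto simp: measure_def)
qed

lemma set_integral_Ioc_split:
 fixes f :: "real => 'b::{banach, second_countable_topology}"
 assumes "p <= q" "q <= r" "set_integrable lborel {p<..r} f"
 shows "(LBINT v:{p<..r}. f v) = (LBINT v:{p<..q}. f v) + (LBINT v:{q<..r}. f v)"
  and "set_integrable lborel {p<..q} f" "set_integrable lborel {q<..r} f"
proof -
 show 1: "set_integrable lborel {p<..q} f" "set_integrable lborel {q<..r} f"
  using assms by (auto intro: set_integrable_subset)
 have "{p<..r} = {p<..q} \<union> {q<..r}" using assms by auto
 then show "(LBINT v:{p<..r}. f v) = (LBINT v:{p<..q}. f v) + (LBINT v:{q<..r}. f v)"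
  using set_integral_Un[OF _ 1] by auto
qed

lemma discrete_gronwall:
 fixes e d :: "nat => real"
 assumes "e 0 = 0" "0 <= q" "\<And>j. 0 <= d j" "\<And>j. j < k ==> e (Suc j) <= (1 + q) * e j + d j"
 shows "j <= k ==> e j <= (1 + q) ^ j * (\<Sum>i<j. d i)"
proof (induction j)
 case (Suc j)
 have "e (Suc j) <= (1 + q) * e j + d j" using assms Suc by simp
 also have "\<dots> <= (1 + q) * ((1 + q) ^ j * (\<Sum>i<j. d i)) + (1 + q) ^ Suc j * d j"
 proof (intro add_mono mult_left_mono)
  have "1 <= (1 + q) ^ Suc j" using assms by (intro one_le_power) simp
  then show "d j <= (1 + q) ^ Suc j * d j" using assms(3)[of j] by (simp add: mult_le_cancel_right1)
 qed (use Suc assms in auto)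
 finally show ?case by (simp add: algebra_simps)
qed (use assms in simp)

text \<open>The local error \<open>D\<close> compares the drift at v with the drift at the sampled
  arguments. It is bounded and tends to 0 pointwise, by continuity of E and right-continuity of n,
  so its integral \<open>\<epsilon>\<close> vanishes; the jumps of n exclude a rate. Discrete
  Gronwall multiplies it by at most exp(K (c - a)).\<close>

lemma euler_tendsto:
 fixes b :: "real => 'b::euclidean_space => 'b"
 assumes ac: "a < c"
  and bc: "continuous_on UNIV (\<lambda>(t, x). b t x)"
  and lip: "\<And>t x y. norm (b t x - b t y) <= K * norm (x - y)" and K: "0 <= K"
  and Ec: "continuous_on UNIV E"
  and E: "\<And>v. v \<in> {a..c} ==> E v = x + (LBINT u:{a<..v}. b u (E u + n u))"
  and rc: "\<And>v. continuous (at v within {v..}) n"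
  and nb: "\<And>v. norm (n v) <= Kn"
 shows "(\<lambda>k. euler b a c (Suc k) x (\<lambda>j. n (gp a c (Suc k) j)) (Suc k)) \<leadsto> E c"
proof -
 have [measurable]: "n \<in> borel_fun" by (rule right_cont_measurable[OF rc])
 have [measurable]: "E \<in> borel_fun" by (rule borel_measurable_continuous_onI[OF Ec])
 have bm: "(\<lambda>(t, x). b t x) \<in> borel_fun2"
  using borel_measurable_continuous_onI[OF bc] by (simp add: borel_prod)
 have [measurable]: "(\<lambda>v. b (f v) (g v)) \<in> borel_fun"
  if [measurable]: "f \<in> borel_fun" "g \<in> borel_fun" for f and g :: "real => 'b"
  using measurable_compose[OF _ bm, of "\<lambda>v. (f v, g v)" borel] by simp
 have Eb: "\<exists>KE. \<forall>v\<in>{a..c}. norm (E v) <= KE"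
  using compact_imp_bounded[OF compact_continuous_image[OF continuous_on_subset[OF Ec], of "{a..c}"]]
  by (auto simp: bounded_iff)
 then obtain KE where "\<forall>v\<in>{a..c}. norm (E v) <= KE" by blast
 then have KE: "norm (E v) <= KE" if "v \<in> {a..c}" for v using that by blast
 have "compact ((\<lambda>(t, x). b t x) ` ({a..c} \<times> cball 0 (KE + Kn)))"
  by (intro compact_continuous_image continuous_on_subset[OF bc] compact_Times) auto
 then have "\<exists>Kb. \<forall>z\<in>{a..c} \<times> cball 0 (KE + Kn). norm (case z of (t, x) => b t x) <= Kb"
  using compact_imp_bounded bounded_iff by (metis (no_types, lifting) imageI)
 then obtain Kb where Kb: "\<And>t x. t \<in> {a..c} ==> norm x <= KE + Kn ==> norm (b t x) <= Kb"
  by fastforce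
 have EnKb: "norm (b t (E u + n w)) <= Kb" if "t \<in> {a..c}" "u \<in> {a..c}" for t u w
  using that KE[of u] nb[of w] norm_triangle_ineq[of "E u" "n w"] by (intro Kb) auto
 define D where "D k v = norm (b v (E v + n v) - b (up a c k v) (E (dn a c k v) + n (up a c k v)))" for k v
 define \<epsilon> where "\<epsilon> k = (LBINT v:{a<..c}. D (Suc k) v)" for k
 have upm [measurable]: "up a c k \<in> borel_fun" "dn a c k \<in> borel_fun" for k
  unfolding up_def[abs_def] dn_def[abs_def] gp_def idx_def by measurable
 have Dm [measurable]: "D k \<in> borel_fun" for k
  unfolding D_def by measurable
 have "\<epsilon> \<leadsto> (LBINT v:{a<..c}. 0)"
  unfolding \<epsilon>_def
 proof (rule set_integral_tendsto_bounded[where K="Kb + Kb"])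
  show "norm (D (Suc k) v) <= Kb + Kb" if "v \<in> {a<..c}" for k v
  proof -
   note B = idx_bounds[OF ac zero_less_Suc that, of k]
   have "up a c (Suc k) v \<in> {a..c}" "dn a c (Suc k) v \<in> {a..c}" using B that by auto
   moreover have "v \<in> {a..c}" using that by simp
   ultimately have "norm (b v (E v + n v)) + norm (b (up a c (Suc k) v) (E (dn a c (Suc k) v) + n (up a c (Suc k) v))) <= Kb + Kb"
    by (intro add_mono EnKb)
   then show ?thesis unfolding D_def by (simp only: real_norm_def abs_norm_cancel) (rule order_trans[OF norm_triangle_ineq4])
  qed
  show "(\<lambda>k. D (Suc k) v) \<leadsto> 0" if v: "v \<in> {a<..c}" for v
  proof -
   note T = up_dn_tendsto[OF ac v]
   have "(\<lambda>k. n (up a c (Suc k) v)) \<leadsto> n v"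
    by (rule right_cont_up_tendsto[OF ac v]) (rule continuous_within_subset[OF rc], auto)
   moreover have "(\<lambda>k. E (dn a c (Suc k) v)) \<leadsto> E v"
    using Ec T(2) by (intro isCont_tendsto_compose[where g=E]) (auto simp: continuous_on_eq_continuous_at)
   ultimately have 1: "(\<lambda>k. (up a c (Suc k) v, E (dn a c (Suc k) v) + n (up a c (Suc k) v))) \<leadsto> (v, E v + n v)"
    by (intro tendsto_Pair tendsto_add T)
   have "(\<lambda>k. b (up a c (Suc k) v) (E (dn a c (Suc k) v) + n (up a c (Suc k) v))) \<leadsto> b v (E v + n v)"
    using isCont_tendsto_compose[where g="\<lambda>(t,x). b t x", OF _ 1] bc
    by (simp add: continuous_on_eq_continuous_at)
   then show ?thesis
    unfolding D_def by (auto intro!: tendsto_eq_intros)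
  qed
 qed (auto simp: set_borel_measurable_def)
 then have \<epsilon>0: "\<epsilon> \<leadsto> 0" by (simp add: set_lebesgue_integral_def)
 have main: "norm (E c - euler b a c (Suc k) x (\<lambda>j. n (gp a c (Suc k) j)) (Suc k)) <= exp (K * (c - a)) * \<epsilon> k" for k
 proof -
  let ?k = "Suc k"
  define t where "t j = gp a c ?k j" for j
  define h where "h = (c - a) / real ?k"
  have h0: "0 <= h" using ac by (simp add: h_def)
  have tS: "t (Suc j) - t j = h" for j unfolding t_def h_def by (rule gp_Suc_diff)
  have tin: "t j \<in> {a..c}" if "j <= ?k" for j unfolding t_def using that by (intro gp_in ac) auto
  have tle: "t j <= t (Suc j)" for j using tS[of j] h0 by simp
  define y where "y j = euler b a c ?k x (\<lambda>j. n (gp a c ?k j)) j" for j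
  define F where "F u = b u (E u + n u)" for u
  define G where "G j = b (t (Suc j)) (E (t j) + n (t (Suc j)))" for j
  have Fi: "set_integrable lborel {a<..c} F"
   unfolding F_def by (rule set_integrable_bounded_Ioc[where K=Kb]) (auto simp: set_borel_measurable_def intro!: EnKb)
  define d where "d j = (LBINT v:{t j<..t (Suc j)}. norm (F v - G j))" for j
  have Fi': "set_integrable lborel {t j<..t (Suc j)} F" if "j < ?k" for j
   using tin[of j] tin[of "Suc j"] that by (intro set_integrable_subset[OF Fi]) auto
  have ni: "set_integrable lborel {t j<..t (Suc j)} (\<lambda>v. norm (F v - G j))" if "j < ?k" for j
   using Fi'[OF that] by (intro set_integrable_norm set_integral_diff(1) set_integral_const_Ioc(1) tle)
  have step: "norm (E (t (Suc j)) - y (Suc j)) <= (1 + K * h) * norm (E (t j) - y j) + d j" if j: "j < ?k" for j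
  proof -
   have tj: "t j \<in> {a..c}" "t (Suc j) \<in> {a..c}" using tin j by auto
   have "E (t (Suc j)) - E (t j) = (LBINT v:{t j<..t (Suc j)}. F v)"
   proof -
    have "set_integrable lborel {a<..t (Suc j)} F" using tj by (intro set_integrable_subset[OF Fi]) auto
    from set_integral_Ioc_split(1)[OF _ tle this] E[OF tj(1)] E[OF tj(2)] tj show ?thesis by (simp add: F_def)
   qed
   also have "\<dots> = (LBINT v:{t j<..t (Suc j)}. F v - G j) + h *\<^sub>R G j"
    using set_integral_diff(2)[OF Fi'[OF j] set_integral_const_Ioc(1)[OF tle], of "G j"]
     set_integral_const_Ioc(2)[OF tle, of j "G j"] tS[of j] by simp
   finally have "E (t (Suc j)) - y (Suc j) = (E (t j) - y j) + (LBINT v:{t j<..t (Suc j)}. F v - G j)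
     + h *\<^sub>R (G j - b (t (Suc j)) (y j + n (t (Suc j))))"
    unfolding y_def by (simp add: h_def t_def algebra_simps)
   also have "norm \<dots> <= norm (E (t j) - y j) + norm (LBINT v:{t j<..t (Suc j)}. F v - G j)
     + norm (h *\<^sub>R (G j - b (t (Suc j)) (y j + n (t (Suc j)))))"
    by (intro norm_triangle_le add_mono order_refl norm_triangle_ineq)
   also have "norm (LBINT v:{t j<..t (Suc j)}. F v - G j) <= d j"
    unfolding d_def by (rule set_integral_norm_bound) (rule set_integral_diff(1)[OF Fi'[OF j] set_integral_const_Ioc(1)[OF tle]])
   also have "norm (h *\<^sub>R (G j - b (t (Suc j)) (y j + n (t (Suc j))))) <= h * (K * norm (E (t j) - y j))"
    using lip[of "t (Suc j)" "E (t j) + n (t (Suc j))" "y j + n (t (Suc j))"] h0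
    by (auto simp: G_def intro!: mult_left_mono)
   finally show ?thesis by (simp add: algebra_simps)
  qed
  have d0: "0 <= d j" for j unfolding d_def set_lebesgue_integral_def by (rule integral_nonneg_AE) auto
  have "norm (E (t ?k) - y ?k) <= (1 + K * h) ^ ?k * (\<Sum>i<?k. d i)"
   using step d0 K h0 E[of a] ac
   by (intro discrete_gronwall[where k="?k" and e="\<lambda>j. norm (E (t j) - y j)"])
    (auto simp: t_def y_def set_lebesgue_integral_def)
  moreover have "(\<Sum>i<?k. d i) = \<epsilon> k"
  proof -
   have "(LBINT v:{a<..c}. (\<lambda>j v. norm (F v - G j)) (idx a c ?k v) v) = (\<Sum>j<?k. d j)"
    unfolding d_def t_def by (rule grid_sum(2)[OF ac]) (use ni t_def in auto)
   then show ?thesis by (simp add: \<epsilon>_def D_def F_def G_def t_def up_def dn_def)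
  qed
  moreover have "(1 + K * h) ^ ?k <= exp (K * (c - a))"
  proof -
   have "(1 + K * h) ^ ?k <= exp (K * h) ^ ?k"
    using K h0 by (intro power_mono) (auto simp: add.commute intro: exp_ge_add_one_self)
   also have "\<dots> = exp (real ?k * (K * h))" by (rule exp_of_nat_mult[symmetric])
   also have "real ?k * (K * h) = K * (c - a)" unfolding h_def by (simp del: of_nat_Suc)
   finally show ?thesis .
  qed
  moreover have "0 <= \<epsilon> k" unfolding \<epsilon>_def set_lebesgue_integral_def by (rule integral_nonneg_AE) (auto simp: D_def)
  moreover have "t ?k = c" unfolding t_def by simp
  ultimately show ?thesis by (auto simp: y_def intro: order_trans[OF _ mult_right_mono])
 qed
 have "(\<lambda>k. E c - euler b a c (Suc k) x (\<lambda>j. n (gp a c (Suc k) j)) (Suc k)) \<leadsto> 0"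
  by (rule Lim_null_comparison[where g="\<lambda>k. exp (K * (c - a)) * \<epsilon> k"])
   (use main \<epsilon>0 in "auto intro!: tendsto_eq_intros")
 from tendsto_diff[OF tendsto_const[of "E c"] this] show ?thesis by (simp del: euler.simps)
qed

text \<open>Y is Lipschitz but its density g is only measurable. On each grid cell the mean value
  theorem writes the increment of \<phi> as the gradient at an intermediate point times the
  increment of Y, which is an integral of g. The cells telescope, and refining the grid moves the
  intermediate points to Y v.\<close>

lemma chain_rule_integral:
 fixes Y :: "real => real ^ 'n::finite" and \<phi> :: "real ^ 'n => real"
 assumes ac: "a < c"
  and Y: "\<And>v i. v \<in> {a..c} ==> Y v $ i = Y a $ i + (LBINT u:{a<..v}. g i u)"
  and gm: "\<And>i. set_borel_measurable lborel {a<..c} (g i)" and gb: "\<And>i v. v \<in> {a<..c} ==> \<bar>g i v\<bar> <= Kg"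
  and \<phi>: "\<And>x. (\<phi> has_derivative (\<lambda>h. \<Sum>i\<in>UNIV. D i x * h $ i)) (at x)"
  and Dc: "\<And>i. continuous_on UNIV (D i)" and Db: "\<And>i x. \<bar>D i x\<bar> <= KD"
 shows "\<phi> (Y c) - \<phi> (Y a) = (LBINT v:{a<..c}. \<Sum>i\<in>UNIV. D i (Y v) * g i v)"
proof -
 have Kg: "0 <= Kg" using gb[of c undefined] ac by (auto intro: order_trans[OF abs_ge_zero])
 have KD: "0 <= KD" using Db[of undefined undefined] by (auto intro: order_trans[OF abs_ge_zero])
 have gi: "set_integrable lborel {a<..c} (g i)" for i
  using gm gb by (intro set_integrable_bounded_Ioc[where K=Kg]) auto
 define N where "N = real (CARD('n))"
 have inc: "Y q $ i - Y p $ i = (LBINT u:{p<..q}. g i u)" if pq: "a <= p" "p <= q" "q <= c" for p q i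
 proof -
  have "set_integrable lborel {a<..q} (g i)" using pq by (intro set_integrable_subset[OF gi]) auto
  from set_integral_Ioc_split(1)[OF pq(1,2) this] Y[of p i] Y[of q i] pq show ?thesis by simp
 qed
 have lipY: "norm (Y q - Y p) <= N * (Kg * (q - p))" if "a <= p" "p <= q" "q <= c" for p q
 proof -
  have "\<bar>(Y q - Y p) $ i\<bar> <= Kg * (q - p)" for i
  proof -
   have s: "set_integrable lborel {p<..q} (g i)" using that by (intro set_integrable_subset[OF gi]) auto
   have "\<bar>LBINT u:{p<..q}. g i u\<bar> <= (LBINT u:{p<..q}. \<bar>g i u\<bar>)"
    using set_integral_norm_bound[OF s] by simp
   also have "\<dots> <= (LBINT u:{p<..q}. Kg)"
    using s that by (intro set_integral_mono set_integrable_abs set_integral_const_Ioc(1) gb) auto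
   finally show ?thesis using that inc[OF that, of i] by (simp add: set_integral_const_Ioc(2) mult.commute)
  qed
  then have "(\<Sum>i\<in>UNIV. \<bar>(Y q - Y p) $ i\<bar>) <= (\<Sum>i\<in>(UNIV::'n set). Kg * (q - p))" by (intro sum_mono)
  with norm_le_l1_cart[of "Y q - Y p"] show ?thesis by (simp add: N_def)
 qed
 have mvt: "\<exists>\<zeta>. norm (\<zeta> - p) <= norm (q - p) \<and> \<phi> q - \<phi> p = (\<Sum>i\<in>UNIV. D i \<zeta> * (q - p) $ i)" for p q
 proof -
  have d: "((\<lambda>s. \<phi> (p + s *\<^sub>R (q - p))) has_real_derivative (\<Sum>i\<in>UNIV. D i (p + s *\<^sub>R (q - p)) * (q - p) $ i)) (at s)" for s
  proof -
   have "((\<lambda>s. \<phi> (p + s *\<^sub>R (q - p))) has_derivative (\<lambda>h. \<Sum>i\<in>UNIV. D i (p + s *\<^sub>R (q - p)) * (h *\<^sub>R (q - p)) $ i)) (at s)"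
    by (rule has_derivative_compose[OF _ \<phi>, of "\<lambda>s. p + s *\<^sub>R (q - p)"]) (auto intro!: derivative_eq_intros)
   then show ?thesis
    unfolding has_field_derivative_def
    by (rule has_derivative_eq_rhs) (auto simp: fun_eq_iff sum_distrib_left sum_distrib_right algebra_simps)
  qed
  obtain z where z: "0 < z" "z < 1" "\<phi> (p + 1 *\<^sub>R (q - p)) - \<phi> (p + 0 *\<^sub>R (q - p)) = (1 - 0) * (\<Sum>i\<in>UNIV. D i (p + z *\<^sub>R (q - p)) * (q - p) $ i)"
   using MVT2[of 0 1 "\<lambda>s. \<phi> (p + s *\<^sub>R (q - p))", OF _ d] by auto
  then show ?thesis
   by (intro exI[of _ "p + z *\<^sub>R (q - p)"]) (auto simp: mult_left_le_one_le)
 qed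
 \<comment> \<open>An intermediate point of the segment between the values of Y at the two ends of
   cell j; its distance to Y at the left end is at most the increment of Y over the cell.\<close>
 define \<zeta> where "\<zeta> k j = (SOME \<zeta>. norm (\<zeta> - Y (gp a c k j)) <= norm (Y (gp a c k (Suc j)) - Y (gp a c k j)) \<and>
   \<phi> (Y (gp a c k (Suc j))) - \<phi> (Y (gp a c k j)) = (\<Sum>i\<in>UNIV. D i \<zeta> * (Y (gp a c k (Suc j)) - Y (gp a c k j)) $ i))" for k j
 have \<zeta>: "norm (\<zeta> k j - Y (gp a c k j)) <= norm (Y (gp a c k (Suc j)) - Y (gp a c k j)) \<and>
   \<phi> (Y (gp a c k (Suc j))) - \<phi> (Y (gp a c k j)) = (\<Sum>i\<in>UNIV. D i (\<zeta> k j) * (Y (gp a c k (Suc j)) - Y (gp a c k j)) $ i)" for k j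
  unfolding \<zeta>_def by (rule someI_ex[OF mvt])
 have gmi: "(\<lambda>v. indicator {a<..c} v * g i v) \<in> borel_fun" for i
  using gm[of i] by (simp add: set_borel_measurable_def)
 have Dm [measurable]: "D i \<in> borel_fun" for i
  by (rule borel_measurable_continuous_onI[OF Dc])
 have bnd: "\<bar>\<Sum>i\<in>UNIV. D i (z i) * g i v\<bar> <= N * (KD * Kg)" if "v \<in> {a<..c}" for z v
 proof -
  have "\<bar>\<Sum>i\<in>UNIV. D i (z i) * g i v\<bar> <= (\<Sum>i\<in>UNIV. \<bar>D i (z i) * g i v\<bar>)" by (rule sum_abs)
  also have "\<dots> <= (\<Sum>i\<in>(UNIV::'n set). KD * Kg)"
   using Db gb[OF that] KD by (intro sum_mono) (auto simp: abs_mult intro!: mult_mono)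
  finally show ?thesis by (simp add: N_def)
 qed
 have tele: "\<phi> (Y c) - \<phi> (Y a) = (LBINT v:{a<..c}. \<Sum>i\<in>UNIV. D i (\<zeta> (Suc k) (idx a c (Suc k) v)) * g i v)" for k
 proof -
  let ?t = "gp a c (Suc k)"
  have tin: "a <= ?t j" "?t j <= ?t (Suc j)" "?t (Suc j) <= c" if "j < Suc k" for j
   using gp_in[OF ac, of "Suc k" j] gp_in[OF ac, of "Suc k" "Suc j"] that gp_le_iff[OF ac] by auto
  have s: "set_integrable lborel {?t j<..?t (Suc j)} (g i)" if "j < Suc k" for i j
   using tin[OF that] by (intro set_integrable_subset[OF gi]) auto
  have piece: "\<phi> (Y (?t (Suc j))) - \<phi> (Y (?t j)) = (LBINT v:{?t j<..?t (Suc j)}. \<Sum>i\<in>UNIV. D i (\<zeta> (Suc k) j) * g i v)"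
   if j: "j < Suc k" for j
  proof -
   have "(LBINT v:{?t j<..?t (Suc j)}. \<Sum>i\<in>UNIV. D i (\<zeta> (Suc k) j) * g i v) =
    (\<Sum>i\<in>UNIV. D i (\<zeta> (Suc k) j) * (LBINT v:{?t j<..?t (Suc j)}. g i v))"
    using s[OF j] unfolding set_lebesgue_integral_def set_integrable_def
    by (simp add: sum_distrib_left mult.left_commute)
   then show ?thesis using \<zeta>[of "Suc k" j] inc[OF tin[OF j]] by simp
  qed
  have "(LBINT v:{a<..c}. \<Sum>i\<in>UNIV. D i (\<zeta> (Suc k) (idx a c (Suc k) v)) * g i v) =
    (\<Sum>j<Suc k. LBINT v:{?t j<..?t (Suc j)}. \<Sum>i\<in>UNIV. D i (\<zeta> (Suc k) j) * g i v)"
  proof (rule grid_sum(2)[OF ac zero_less_Suc, where c="\<lambda>j v. \<Sum>i\<in>UNIV. D i (\<zeta> (Suc k) j) * g i v"])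
   fix j assume "j < Suc k"
   then show "set_integrable lborel {?t j<..?t (Suc j)} (\<lambda>v. \<Sum>i\<in>UNIV. D i (\<zeta> (Suc k) j) * g i v)"
    using s[of j] unfolding set_integrable_def by (simp add: sum_distrib_left mult.left_commute)
  qed
  also have "\<dots> = (\<Sum>j<Suc k. \<phi> (Y (?t (Suc j))) - \<phi> (Y (?t j)))"
   by (intro sum.cong refl piece[symmetric]) auto
  also have "\<dots> = \<phi> (Y (?t (Suc k))) - \<phi> (Y (?t 0))" by (rule sum_lessThan_telescope)
  finally show ?thesis by simp
 qed
 have "(\<lambda>k. LBINT v:{a<..c}. \<Sum>i\<in>UNIV. D i (\<zeta> (Suc k) (idx a c (Suc k) v)) * g i v) \<leadsto>
   (LBINT v:{a<..c}. \<Sum>i\<in>UNIV. D i (Y v) * g i v)"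
 proof (rule set_integral_tendsto_bounded[where K="N * (KD * Kg)"])
  show "set_borel_measurable lborel {a<..c} (\<lambda>v. \<Sum>i\<in>UNIV. D i (\<zeta> (Suc k) (idx a c (Suc k) v)) * g i v)" for k
  proof -
   have [measurable]: "(\<lambda>v. D i (\<zeta> (Suc k) (idx a c (Suc k) v))) \<in> borel_fun" for i
    by (rule set_measurable_step[where c="\<lambda>j v. D i (\<zeta> (Suc k) j)"]) simp
   note gmi[measurable]
   have "(\<lambda>v. \<Sum>i\<in>UNIV. D i (\<zeta> (Suc k) (idx a c (Suc k) v)) * (indicator {a<..c} v * g i v)) \<in> borel_fun"
    by measurable
   then show ?thesis by (simp add: set_borel_measurable_def sum_distrib_left mult.left_commute)
  qed
  have "continuous_on {a..c} Y"
  proof (rule continuous_onI)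
   fix x e assume x: "x \<in> {a..c}" and e: "(0::real) < e"
   have l: "norm (Y x' - Y x) <= N * (Kg * \<bar>x' - x\<bar>)" if "x' \<in> {a..c}" for x'
    using lipY[of x x'] lipY[of x' x] x that by (cases "x <= x'") (auto simp: norm_minus_commute)
   show "\<exists>d>0. \<forall>x'\<in>{a..c}. dist x' x < d \<longrightarrow> dist (Y x') (Y x) <= e"
   proof (intro exI[of _ "e / (N * Kg + 1)"] conjI ballI impI)
    have p: "0 < N * Kg + 1" using Kg by (simp add: N_def add_nonneg_pos)
    then show "0 < e / (N * Kg + 1)" using e by simp
    fix x' assume x': "x' \<in> {a..c}" "dist x' x < e / (N * Kg + 1)"
    have "norm (Y x' - Y x) <= (N * Kg + 1) * \<bar>x' - x\<bar>"
     using l[OF x'(1)] by (simp add: algebra_simps)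
    also have "\<dots> <= e" using x'(2) p by (simp add: dist_real_def less_divide_eq mult.commute)
    finally show "dist (Y x') (Y x) <= e" by (simp add: dist_norm)
   qed
  qed
  then have "(\<lambda>v. indicator {a..c} v *\<^sub>R Y v) \<in> borel_fun"
   by (intro borel_measurable_continuous_on_indicator) auto
  then have Ym: "(\<lambda>v. indicator {a..c} v *\<^sub>R Y v) \<in> borel_fun" .
  show "set_borel_measurable lborel {a<..c} (\<lambda>v. \<Sum>i\<in>UNIV. D i (Y v) * g i v)"
  proof -
   note gmi[measurable] Ym[measurable]
   have "(\<lambda>v. \<Sum>i\<in>UNIV. D i (indicator {a..c} v *\<^sub>R Y v) * (indicator {a<..c} v * g i v)) \<in> borel_fun"
    by measurable
   moreover have "(\<lambda>v. \<Sum>i\<in>UNIV. D i (indicator {a..c} v *\<^sub>R Y v) * (indicator {a<..c} v * g i v)) =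
     (\<lambda>v. indicator {a<..c} v *\<^sub>R (\<Sum>i\<in>UNIV. D i (Y v) * g i v))"
    by (auto simp: fun_eq_iff sum_distrib_left split: split_indicator)
   ultimately show ?thesis by (simp add: set_borel_measurable_def)
  qed
  fix v assume v: "v \<in> {a<..c}"
  show "norm (\<Sum>i\<in>UNIV. D i (\<zeta> (Suc k) (idx a c (Suc k) v)) * g i v) <= N * (KD * Kg)" for k
   using bnd[OF v, of "\<lambda>_. \<zeta> (Suc k) (idx a c (Suc k) v)"] by simp
  have \<zeta>v: "norm (\<zeta> (Suc k) (idx a c (Suc k) v) - Y v) <= N * (Kg * (2 * ((c - a) / real (Suc k))))" for k
  proof -
   note B = idx_bounds[OF ac zero_less_Suc v, of k]
   have d: "up a c (Suc k) v - dn a c (Suc k) v = (c - a) / real (Suc k)"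
    unfolding up_def dn_def by (rule gp_Suc_diff)
   have "norm (\<zeta> (Suc k) (idx a c (Suc k) v) - Y (dn a c (Suc k) v)) <= norm (Y (up a c (Suc k) v) - Y (dn a c (Suc k) v))"
    using \<zeta>[of "Suc k" "idx a c (Suc k) v"] unfolding up_def dn_def by blast
   also have "\<dots> <= N * (Kg * ((c - a) / real (Suc k)))"
    using lipY[of "dn a c (Suc k) v" "up a c (Suc k) v"] B d by auto
   finally have 1: "norm (\<zeta> (Suc k) (idx a c (Suc k) v) - Y (dn a c (Suc k) v)) <= N * (Kg * ((c - a) / real (Suc k)))" .
   have "norm (Y v - Y (dn a c (Suc k) v)) <= N * (Kg * (v - dn a c (Suc k) v))"
    using B v by (intro lipY) auto
   also have "\<dots> <= N * (Kg * ((c - a) / real (Suc k)))"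
    using B d Kg by (intro mult_left_mono) (auto simp: N_def)
   finally have 2: "norm (Y v - Y (dn a c (Suc k) v)) <= N * (Kg * ((c - a) / real (Suc k)))" .
   have "norm (\<zeta> (Suc k) (idx a c (Suc k) v) - Y v) <= norm (\<zeta> (Suc k) (idx a c (Suc k) v) - Y (dn a c (Suc k) v)) + norm (Y v - Y (dn a c (Suc k) v))"
    by (metis dist_norm dist_triangle2)
   moreover have "N * (Kg * (2 * ((c - a) / real (Suc k)))) = N * (Kg * ((c - a) / real (Suc k))) + N * (Kg * ((c - a) / real (Suc k)))"
    by (simp only: mult_2 distrib_left)
   ultimately show ?thesis by (simp only:) (rule order_trans[OF _ add_mono[OF 1 2]])
  qed
  have "(\<lambda>k. \<zeta> (Suc k) (idx a c (Suc k) v) - Y v) \<leadsto> 0"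
   by (rule Lim_null_comparison[OF always_eventually[OF allI[OF \<zeta>v]]]) real_asymp
  then have \<zeta>lim: "(\<lambda>k. \<zeta> (Suc k) (idx a c (Suc k) v)) \<leadsto> Y v" by (rule LIM_zero_cancel)
  show "(\<lambda>k. \<Sum>i\<in>UNIV. D i (\<zeta> (Suc k) (idx a c (Suc k) v)) * g i v) \<leadsto> (\<Sum>i\<in>UNIV. D i (Y v) * g i v)"
   using Dc by (intro tendsto_intros isCont_tendsto_compose[OF _ \<zeta>lim]) (auto simp: continuous_on_eq_continuous_at)
 qed
 then show ?thesis unfolding tele[symmetric] using LIMSEQ_unique[OF tendsto_const] by auto
qed

section \<open>Gaussian smoothing\<close>

lemma prod_Basis_cart:
 "(\<Prod>b\<in>(Basis :: (real ^ 'n::finite) set). F b) = (\<Prod>i\<in>UNIV. F (axis i (1::real)))"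
proof -
 have B: "(Basis :: (real ^ 'n) set) = range (\<lambda>i. axis i 1)"
  by (auto simp: Basis_vec_def)
 have "inj (\<lambda>i::'n. axis i (1::real))"
  by (auto simp: inj_on_def axis_eq_axis)
 then show ?thesis unfolding B by (subst prod.reindex) auto
qed

lemma nn_integral_lborel_cart:
 fixes f :: "'n::finite => real => ennreal"
 assumes "\<And>i. f i \<in> borel_fun"
 shows "(\<integral>\<^sup>+x. (\<Prod>i\<in>UNIV. f i (x $ i)) \<partial>(lborel :: (real ^ 'n) measure)) = (\<Prod>i\<in>UNIV. \<integral>\<^sup>+y. f i y \<partial>lborel)"
proof -
 define h where "h b = f (THE i. b = axis i (1::real))" for b
 have h: "h (axis i 1) = f i" for i
 proof -
  have "(THE j. axis i (1::real) = axis j 1) = i" by (rule the_equality) (auto simp: axis_eq_axis)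
  then show ?thesis by (simp add: h_def)
 qed
 have "(\<integral>\<^sup>+x. (\<Prod>b\<in>Basis. h b (x \<bullet> b)) \<partial>(lborel :: (real ^ 'n) measure)) = (\<Prod>b\<in>Basis. \<integral>\<^sup>+y. h b y \<partial>lborel)"
  by (rule nn_integral_lborel_prod) (use assms in "auto simp: h_def")
 then show ?thesis by (simp add: prod_Basis_cart h inner_axis)
qed

definition gauss :: "(real ^ 'n::finite) measure" where
 "gauss = density lborel (\<lambda>g. ennreal (\<Prod>i\<in>UNIV. std_normal_density (g $ i)))"

text \<open>Dominates \<open>\<bar>g $ i\<bar>\<close> and all exponentials \<open>exp (k \<bullet> g)\<close> with \<open>\<bar>k $ i\<bar> <= 1\<close>, hence difference quotients of
 shifted Gaussian densities.\<close>

definition gwt :: "real ^ 'n::finite => real" where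
 "gwt g = exp (2 * (\<Sum>i\<in>UNIV. \<bar>g $ i\<bar>))"

lemma sets_gauss [measurable_cong, simp]: "sets gauss = sets borel"
 by (simp add: gauss_def)

lemma space_gauss [simp]: "space gauss = UNIV"
 by (simp add: gauss_def)

lemma measurable_vec_nth_borel [measurable]: "(\<lambda>x::real ^ 'n::finite. x $ i) \<in> borel_fun"
 by (intro borel_measurable_continuous_onI continuous_intros)

lemma measurable_vec_lambda_borel [measurable (raw)]:
 fixes f :: "'a => 'n::finite => real"
 assumes "\<And>i. (\<lambda>x. f x i) \<in> borel_measurable M"
 shows "(\<lambda>x. \<chi> i. f x i) \<in> borel_measurable M"
proof (rule borel_measurable_euclidean_space[THEN iffD2], intro ballI)
 fix b :: "real ^ 'n" assume "b \<in> Basis"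
 then obtain i where "b = axis i 1" by (auto simp: Basis_vec_def)
 then show "(\<lambda>x. (\<chi> i. f x i) \<bullet> b) \<in> borel_measurable M" using assms[of i] by (simp add: inner_axis)
qed

lemma nn_integral_gauss:
 fixes f :: "'n::finite => real => ennreal"
 assumes [measurable]: "\<And>i. f i \<in> borel_fun"
 shows "(\<integral>\<^sup>+g. (\<Prod>i\<in>UNIV. f i (g $ i)) \<partial>gauss) = (\<Prod>i\<in>UNIV. \<integral>\<^sup>+y. ennreal (std_normal_density y) * f i y \<partial>lborel)"
proof -
 have "(\<integral>\<^sup>+g. (\<Prod>i\<in>UNIV. f i (g $ i)) \<partial>gauss) =
   (\<integral>\<^sup>+g. (\<Prod>i\<in>UNIV. ennreal (std_normal_density (g $ i)) * f i (g $ i)) \<partial>lborel)"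
  unfolding gauss_def by (subst nn_integral_density) (auto simp: prod.distrib prod_ennreal)
 then show ?thesis
  using nn_integral_lborel_cart[of "\<lambda>i y. ennreal (std_normal_density y) * f i y"] by simp
qed

lemma nn_integral_std_normal: "(\<integral>\<^sup>+y. ennreal (std_normal_density y) \<partial>lborel) = 1"
 using prob_space.emeasure_space_1[OF prob_space_normal_density[of 1 0]]
 by (simp add: emeasure_density)

lemma prob_space_gauss: "prob_space gauss"
proof
 show "emeasure gauss (space gauss) = 1"
  using nn_integral_gauss[of "\<lambda>i y. 1"] by (simp add: nn_integral_std_normal)
qed

text \<open>The two laws are compared on the function space, where a product measure is determined
  by boxes, and carried back to vectors by \<open>vec_lambda\<close>.\<close>

lemma (in prob_space) indep_std_normal_distr:
 fixes X :: "'n::finite => 'a => real"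
 assumes ind: "indep_vars (\<lambda>_. borel) X UNIV"
  and X: "\<And>i. distributed M lborel (X i) std_normal_density"
 shows "distr M borel (\<lambda>om. \<chi> i. X i om) = gauss"
proof -
 let ?d = "density lborel (\<lambda>y. ennreal (std_normal_density y))"
 have rv [measurable]: "X i \<in> borel_measurable M" for i
  using X[of i] by (simp add: distributed_def)
 have dX: "distr M borel (X i) = ?d" for i
 proof -
  have "distr M borel (X i) = distr M lborel (X i)" by (rule distr_cong) auto
  then show ?thesis using distributed_distr_eq_density[OF X[of i]] by simp
 qed
 interpret d: prob_space ?d using prob_space_normal_density[of 1 0] by simp
 interpret pd: product_sigma_finite "\<lambda>i::'n. ?d" ..
 have P: "distr gauss (Pi\<^sub>M UNIV (\<lambda>_. borel)) vec_nth = Pi\<^sub>M UNIV (\<lambda>i::'n. ?d)"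
 proof (rule pd.PiM_eqI)
  fix A :: "'n => real set" assume "\<And>i. i \<in> UNIV ==> A i \<in> sets ?d"
  then have [measurable]: "A i \<in> sets borel" for i by auto
  have PA: "Pi\<^sub>E UNIV A \<in> sets (Pi\<^sub>M UNIV (\<lambda>_. borel))"
   by (intro sets_PiM_I_finite) auto
  have "emeasure (distr gauss (Pi\<^sub>M UNIV (\<lambda>_. borel)) vec_nth) (Pi\<^sub>E UNIV A) =
    emeasure gauss (vec_nth -` Pi\<^sub>E UNIV A \<inter> space gauss)"
   by (rule emeasure_distr[OF _ PA]) (auto intro!: measurable_PiM_single')
  also have "\<dots> = (\<integral>\<^sup>+g. indicator (vec_nth -` Pi\<^sub>E UNIV A \<inter> space gauss) g \<partial>gauss)"
  proof (rule nn_integral_indicator[symmetric])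
   have "vec_nth \<in> measurable gauss (Pi\<^sub>M UNIV (\<lambda>_. borel))" by (auto intro!: measurable_PiM_single')
   from measurable_sets[OF this PA] show "vec_nth -` Pi\<^sub>E UNIV A \<inter> space gauss \<in> sets gauss" .
  qed
  also have "\<dots> = (\<integral>\<^sup>+g. (\<Prod>i\<in>UNIV. indicator (A i) (g $ i)) \<partial>gauss)"
  proof (rule nn_integral_cong)
   fix g :: "real ^ 'n"
   show "(indicator (vec_nth -` Pi\<^sub>E UNIV A \<inter> space gauss) g :: ennreal) = (\<Prod>i\<in>UNIV. indicator (A i) (g $ i))"
   proof (cases "\<forall>i. g $ i \<in> A i")
    case True then show ?thesis by (simp add: indicator_def PiE_def)
   next
    case False
    then obtain i where "g $ i \<notin> A i" by auto
    then have "(\<Prod>i\<in>UNIV. indicator (A i) (g $ i) :: ennreal) = 0" by (intro prod_zero bexI[of _ i]) auto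
    with False show ?thesis by (auto simp: indicator_def PiE_def)
   qed
  qed
  also have "\<dots> = (\<Prod>i\<in>UNIV. emeasure ?d (A i))"
   by (subst nn_integral_gauss) (auto simp: emeasure_density)
  finally show "emeasure (distr gauss (Pi\<^sub>M UNIV (\<lambda>_. borel)) vec_nth) (Pi\<^sub>E UNIV A) = (\<Prod>i\<in>UNIV. emeasure ?d (A i))" .
 qed (auto cong: sets_PiM_cong)
 have "distr M (Pi\<^sub>M UNIV (\<lambda>_. borel)) (\<lambda>x. \<lambda>i\<in>UNIV. X i x) = Pi\<^sub>M UNIV (\<lambda>i. distr M borel (X i))"
  using indep_vars_iff_distr_eq_PiM'[where I=UNIV and M'="\<lambda>_. borel" and X=X] ind rv by auto
 then have 1: "distr M (Pi\<^sub>M UNIV (\<lambda>_. borel)) (\<lambda>x i. X i x) = distr gauss (Pi\<^sub>M UNIV (\<lambda>_. borel)) vec_nth"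
  unfolding P by (simp add: dX restrict_def)
 have vl [measurable]: "vec_lambda \<in> borel_measurable (Pi\<^sub>M (UNIV :: 'n set) (\<lambda>_. borel :: real measure))"
 proof -
  have "(\<lambda>f. \<chi> i. f i) \<in> borel_measurable (Pi\<^sub>M (UNIV :: 'n set) (\<lambda>_. borel :: real measure))"
   by (rule measurable_vec_lambda_borel) measurable
  then show ?thesis by (simp add: eta_contract_eq)
 qed
 have "distr M borel (\<lambda>om. \<chi> i. X i om) = distr (distr M (Pi\<^sub>M UNIV (\<lambda>_. borel)) (\<lambda>x i. X i x)) borel vec_lambda"
  by (subst distr_distr) (auto simp: comp_def intro!: measurable_PiM_single')
 also have "\<dots> = distr gauss borel (\<lambda>g. g)"
  unfolding 1 by (subst distr_distr) (auto simp: comp_def intro!: measurable_PiM_single')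
 also have "\<dots> = gauss" by (rule distr_id2) simp
 finally show ?thesis .
qed

lemma gwt_measurable [measurable]: "gwt \<in> borel_fun"
 unfolding gwt_def by measurable

lemma gwt_ge: "exp (2 * \<bar>g $ i\<bar>) <= gwt g" "1 <= gwt g" "0 <= gwt g"
 unfolding gwt_def by (auto intro: member_le_sum sum_nonneg)

lemma integrable_gwt: "integrable (gauss :: (real ^ 'n::finite) measure) gwt"
proof -
 have fin: "(\<integral>\<^sup>+y. ennreal (std_normal_density y) * ennreal (exp (2 * \<bar>y\<bar>)) \<partial>lborel) < \<infinity>"
 proof -
  \<comment> \<open>Completing the square: the standard normal density times exp(2 y) is exp 2 times
    the normal density with mean 2, and symmetrically for -2.\<close>
  have le: "std_normal_density y * exp (2 * \<bar>y\<bar>) <= exp 2 * (normal_density 2 1 y + normal_density (-2) 1 y)" for y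
  proof -
   have "std_normal_density y * exp (2 * y) = exp 2 * normal_density 2 1 y"
    "std_normal_density y * exp (- 2 * y) = exp 2 * normal_density (-2) 1 y"
    by (simp_all add: normal_density_def exp_add[symmetric] power2_eq_square algebra_simps add_divide_distrib diff_divide_distrib)
   moreover have "exp (2 * \<bar>y\<bar>) <= exp (2 * y) + exp (- 2 * y)"
    by (cases "0 <= y") (auto simp: add_increasing add_increasing2)
   ultimately show ?thesis
    using mult_left_mono[of "exp (2 * \<bar>y\<bar>)" "exp (2 * y) + exp (- 2 * y)" "std_normal_density y"]
    by (simp add: distrib_left)
  qed
  have "integrable lborel (\<lambda>y. std_normal_density y * exp (2 * \<bar>y\<bar>))"
   by (rule Bochner_Integration.integrable_bound[where f="\<lambda>y. exp 2 * (normal_density 2 1 y + normal_density (-2) 1 y)"])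
    (use le in "auto intro!: integrable_normal_density simp: abs_mult")
  then have "(\<integral>\<^sup>+y. ennreal (std_normal_density y * exp (2 * \<bar>y\<bar>)) \<partial>lborel) < \<infinity>"
   by (subst (asm) integrable_iff_bounded) (auto simp: abs_mult)
  then show ?thesis by (simp add: ennreal_mult')
 qed
 have "gwt g = (\<Prod>i\<in>UNIV. exp (2 * \<bar>g $ i\<bar>))" for g :: "real ^ 'n"
  by (simp add: gwt_def exp_sum sum_distrib_left)
 then have "(\<integral>\<^sup>+g. ennreal (gwt (g :: real ^ 'n)) \<partial>gauss) = (\<integral>\<^sup>+g. (\<Prod>i\<in>UNIV. ennreal (exp (2 * \<bar>g $ i\<bar>))) \<partial>(gauss :: (real ^ 'n) measure))"
  by (simp add: prod_ennreal)
 also have "\<dots> = (\<Prod>i\<in>(UNIV::'n set). \<integral>\<^sup>+y. ennreal (std_normal_density y) * ennreal (exp (2 * \<bar>y\<bar>)) \<partial>lborel)"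
  by (rule nn_integral_gauss) measurable
 also have "\<dots> < \<infinity>" using fin by (auto simp: ennreal_prod_eq_top less_top intro!: power_less_top_ennreal[THEN iffD2])
 finally show ?thesis
  by (intro integrableI_bounded) (auto simp: gwt_ge)
qed

text \<open>The finite-dimensional Cameron-Martin formula. It transfers a translation from the
  function to the density, which is the only source of smoothness in \<open>gsm\<close> for
  discontinuous functions.\<close>

lemma gauss_shift:
 fixes F :: "real ^ 'n::finite => real"
 assumes [measurable]: "F \<in> borel_fun"
 shows "(LINT g|gauss. F (g + k)) = (LINT g|gauss. F g * exp (k \<bullet> g - (k \<bullet> k) / 2))"
proof -
 let ?\<rho> = "\<lambda>g::real ^ 'n. \<Prod>i\<in>UNIV. std_normal_density (g $ i)"
 have \<rho>: "?\<rho> (g - k) = ?\<rho> g * exp (k \<bullet> g - (k \<bullet> k) / 2)" for g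
 proof -
  have "std_normal_density ((g - k) $ i) = std_normal_density (g $ i) * exp (k $ i * g $ i - (k $ i * k $ i) / 2)" for i
   by (simp add: std_normal_density_def exp_add[symmetric] power2_eq_square algebra_simps diff_divide_distrib add_divide_distrib)
  then have "?\<rho> (g - k) = ?\<rho> g * (\<Prod>i\<in>UNIV. exp (k $ i * g $ i - (k $ i * k $ i) / 2))"
   by (simp add: prod.distrib)
  also have "(\<Prod>i\<in>UNIV. exp (k $ i * g $ i - (k $ i * k $ i) / 2)) = exp (k \<bullet> g - (k \<bullet> k) / 2)"
   by (simp add: exp_sum[symmetric] inner_vec_def sum_subtractf sum_divide_distrib)
  finally show ?thesis .
 qed
 have nn: "0 <= ?\<rho> g" for g by (intro prod_nonneg) simp
 have "(LINT g|gauss. F (g + k)) = (LINT g|lborel. ?\<rho> g *\<^sub>R F (g + k))"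
  unfolding gauss_def by (subst integral_density) (use nn in auto)
 also have "\<dots> = (LINT g|lborel. ?\<rho> (k + g - k) *\<^sub>R F (k + g))"
  by (simp add: add.commute)
 also have "\<dots> = (LINT g|(distr lborel borel ((+) k)). ?\<rho> (g - k) *\<^sub>R F g)"
  by (subst integral_distr) auto
 also have "\<dots> = (LINT g|lborel. ?\<rho> g *\<^sub>R (F g * exp (k \<bullet> g - (k \<bullet> k) / 2)))"
  unfolding lborel_distr_plus by (simp only: \<rho>) (simp add: mult_ac)
 also have "\<dots> = (LINT g|gauss. F g * exp (k \<bullet> g - (k \<bullet> k) / 2))"
  unfolding gauss_def by (subst integral_density) (use nn in auto)
 finally show ?thesis .
qed

definition gmap :: "real ^ 'n::finite => ('n => real) => real ^ 'n => real ^ 'n" where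
 "gmap z v g = (\<chi> i. z $ i + v i * g $ i)"

definition gsm :: "(real ^ 'n::finite => real) => real ^ 'n => ('n => real) => real" where
 "gsm \<psi> z v = (LINT g|gauss. \<psi> (gmap z v g))"

text \<open>The derivative of \<open>gsm \<psi>\<close> in direction \<open>i\<close>: it falls on the Gaussian density, so that \<open>\<psi>\<close> need not be smooth.\<close>

definition gsd :: "'n::finite => (real ^ 'n => real) => real ^ 'n => ('n => real) => real" where
 "gsd i \<psi> z v = (LINT g|gauss. \<psi> (gmap z v g) * g $ i) / v i"

text \<open>Serves as an upper bound for the first absolute moment of every coordinate under
  \<open>gauss\<close>.\<close>

definition gC :: "'n::finite itself => real" where
 "gC _ = (LINT g|(gauss :: (real ^ 'n) measure). gwt g)"

lemma gmap_measurable [measurable (raw)]: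
 assumes [measurable]: "f \<in> borel_measurable M" "h \<in> borel_measurable M" "\<And>i. (\<lambda>x. v x i) \<in> borel_measurable M"
 shows "(\<lambda>x. gmap (f x) (v x) (h x)) \<in> borel_measurable M"
 unfolding gmap_def by measurable

lemma gauss_weighted_bound:
 fixes F :: "real ^ 'n::finite => real"
 assumes "\<And>g. \<bar>F g\<bar> <= K * gwt g" "F \<in> borel_fun"
 shows "integrable gauss F" "\<bar>LINT g|gauss. F g\<bar> <= K * (LINT g|(gauss :: (real ^ 'n) measure). gwt g)"
proof -
 have i: "integrable gauss (\<lambda>g. K * gwt g)" using integrable_gwt by auto
 show F: "integrable gauss F"
  by (rule Bochner_Integration.integrable_bound[OF i]) (use assms in "auto intro: order_trans[OF _ abs_ge_self]")
 have "\<bar>LINT g|gauss. F g\<bar> <= (LINT g|gauss. \<bar>F g\<bar>)" by (rule integral_abs_bound)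
 also have "\<dots> <= (LINT g|(gauss :: (real ^ 'n) measure). K * gwt g)"
  by (rule integral_mono_AE) (use F i assms(1) in auto)
 finally show "\<bar>LINT g|gauss. F g\<bar> <= K * (LINT g|(gauss :: (real ^ 'n) measure). gwt g)" by simp
qed

lemma coord_le_gwt: "\<bar>g $ i\<bar> <= gwt g"
proof -
 have "\<bar>g $ i\<bar> <= exp (2 * \<bar>g $ i\<bar>)" using exp_ge_add_one_self[of "2 * \<bar>g $ i\<bar>"] by linarith
 then show ?thesis using gwt_ge(1)[of g i] by linarith
qed

lemma gsm_bound:
 assumes "\<psi> \<in> bounded_borel" "\<And>x. \<bar>\<psi> x\<bar> <= K"
 shows "\<bar>gsm \<psi> z v\<bar> <= K"
proof -
 interpret prob_space "gauss :: (real ^ 'a) measure" by (rule prob_space_gauss)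
 have [measurable]: "\<psi> \<in> borel_fun" using assms by (simp add: bounded_borel_def)
 have "0 <= K" using assms(2)[of 0] by (auto intro: order_trans[OF abs_ge_zero])
 have "\<bar>gsm \<psi> z v\<bar> <= (LINT g|gauss. \<bar>\<psi> (gmap z v g)\<bar>)" unfolding gsm_def by (rule integral_abs_bound)
 also have "\<dots> <= (LINT g|(gauss :: (real ^ 'a) measure). K)"
  by (intro Bochner_Integration.integral_mono integrable_const_bound[where B=K]) (use assms \<open>0 <= K\<close> in auto)
 finally show ?thesis using prob_space by simp
qed

lemma gsd_bound:
 fixes \<psi> :: "real ^ 'n::finite => real"
 assumes "\<psi> \<in> bounded_borel" "\<And>x. \<bar>\<psi> x\<bar> <= K" "0 < v i"
 shows "\<bar>gsd i \<psi> z v\<bar> <= K * gC TYPE('n) / v i"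
proof -
 have [measurable]: "\<psi> \<in> borel_fun" using assms by (simp add: bounded_borel_def)
 have K: "0 <= K" using assms(2)[of 0] by (auto intro: order_trans[OF abs_ge_zero])
 have "\<bar>LINT g|gauss. \<psi> (gmap z v g) * g $ i\<bar> <= K * (LINT g|(gauss::(real^'n) measure). gwt g)"
  by (rule gauss_weighted_bound(2)) (use assms K coord_le_gwt in "auto simp: abs_mult intro!: mult_mono")
 then show ?thesis using assms(3) by (simp add: gsd_def gC_def abs_divide divide_right_mono)
qed

lemma gmap_shift: "v i \<noteq> 0 ==> gmap (z + (k * v i) *\<^sub>R axis i 1) v g = gmap z v (nudge g k i)"
 by (auto simp: gmap_def vec_eq_iff axis_def algebra_simps)

text \<open>Moving z by k * v i along axis i moves g by k, and \<open>gauss_shift\<close> turns this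
  into the factor exp(k g_i - k^2/2), whose k-derivative at 0 is g_i. Passing from k to h = k * v i
  yields the division by v i in \<open>gsd\<close>.\<close>

lemma gsm_deriv:
 fixes \<psi> :: "real ^ 'n::finite => real"
 assumes \<psi>: "\<psi> \<in> bounded_borel" and v: "0 < v i"
 shows "((\<lambda>h. gsm \<psi> (nudge z h i) v) has_real_derivative gsd i \<psi> (nudge z h0 i) v) (at h0)"
proof -
 have main: "((\<lambda>h. gsm \<psi> (nudge z h i) v) has_real_derivative gsd i \<psi> z v) (at 0)" for z
 proof -
  obtain K where K: "0 <= K" "\<And>x. \<bar>\<psi> x\<bar> <= K" using bounded_borelD[OF \<psi>] by blast
  have [measurable]: "\<psi> \<in> borel_fun" using \<psi> by (simp add: bounded_borel_def)
  define F where "F k g = \<psi> (gmap z v g) * exp (k * g $ i - k * k / 2)" for k g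
  define F' where "F' k g = \<psi> (gmap z v g) * ((g $ i - k) * exp (k * g $ i - k * k / 2))" for k g
  have eb: "exp (k * g $ i - k * k / 2) <= exp \<bar>g $ i\<bar>" if "\<bar>k\<bar> <= 1" for k and g :: "real ^ 'n"
  proof -
   have "k * g $ i <= \<bar>k\<bar> * \<bar>g $ i\<bar>" by (simp add: abs_mult[symmetric])
   also have "\<dots> <= \<bar>g $ i\<bar>" using that by (simp add: mult_left_le_one_le)
   finally have "k * g $ i - k * k / 2 <= \<bar>g $ i\<bar>" by (smt (verit) zero_le_square divide_nonneg_pos)
   then show ?thesis by simp
  qed
  have e1: "exp \<bar>g $ i\<bar> <= gwt g" for g :: "real ^ 'n"
   by (rule order_trans[OF _ gwt_ge(1)[of g i]]) simp
  have e2: "(\<bar>g $ i\<bar> + 1) * exp \<bar>g $ i\<bar> <= gwt g" for g :: "real ^ 'n"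
  proof -
   have "(\<bar>g $ i\<bar> + 1) * exp \<bar>g $ i\<bar> <= exp \<bar>g $ i\<bar> * exp \<bar>g $ i\<bar>"
    using exp_ge_add_one_self[of "\<bar>g $ i\<bar>"] by (intro mult_right_mono) (auto simp: add.commute)
   also have "\<dots> = exp (2 * \<bar>g $ i\<bar>)" by (simp add: exp_add[symmetric])
   finally show ?thesis using gwt_ge(1)[of g i] by linarith
  qed
  have "((\<lambda>k. \<integral>g. F k g \<partial>gauss) has_real_derivative (LINT g|gauss. F' 0 g)) (at 0)"
  proof (rule has_real_derivative_integral[where g="\<lambda>g. K * gwt g"])
   show "integrable gauss (F k)" if "\<bar>k\<bar> <= 1" for k
    using order_trans[OF eb[OF that] e1] K unfolding F_def
    by (intro gauss_weighted_bound(1)[where K=K]) (auto simp: abs_mult simp del: exp_le_cancel_iff intro!: mult_mono)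
   show "AE g in gauss. \<forall>k. \<bar>k\<bar> <= 1 \<longrightarrow> ((\<lambda>k. F k g) has_real_derivative F' k g) (at k)"
    unfolding F_def F'_def by (auto intro!: AE_I2 derivative_eq_intros)
   show "AE g in gauss. \<forall>k. \<bar>k\<bar> <= 1 \<longrightarrow> \<bar>F' k g\<bar> <= K * gwt g"
   proof (intro AE_I2 allI impI)
    fix g :: "real ^ 'n" and k :: real assume k: "\<bar>k\<bar> <= 1"
    have "\<bar>g $ i - k\<bar> * exp (k * g $ i - k * k / 2) <= (\<bar>g $ i\<bar> + 1) * exp \<bar>g $ i\<bar>"
     using k eb[OF k, of g] by (intro mult_mono) auto
    then show "\<bar>F' k g\<bar> <= K * gwt g"
     unfolding F'_def abs_mult using K e2[of g] by (intro mult_mono) auto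
   qed
   show "integrable gauss (\<lambda>g. K * gwt g)" using integrable_gwt by auto
   show "F' 0 \<in> borel_measurable gauss" unfolding F'_def by measurable
  qed
  moreover have "(LINT g|gauss. F k g) = gsm \<psi> (z + (k * v i) *\<^sub>R axis i 1) v" for k
   using gauss_shift[of "\<lambda>g. \<psi> (gmap z v g)" "k *\<^sub>R axis i 1"] v
   by (simp add: gsm_def F_def gmap_shift inner_axis' inner_axis mult.assoc axis_nth)
  ultimately have "((\<lambda>k. gsm \<psi> (z + (k * v i) *\<^sub>R axis i 1) v) has_real_derivative (v i * gsd i \<psi> z v)) (at (0 / v i))"
   using v by (simp add: gsd_def F'_def)
  moreover have "((\<lambda>h. h / v i) has_real_derivative 1 / v i) (at 0)"
   by (rule DERIV_cdivide) (rule DERIV_ident)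
  ultimately have "((\<lambda>h. gsm \<psi> (z + (h / v i * v i) *\<^sub>R axis i 1) v) has_real_derivative (v i * gsd i \<psi> z v) * (1 / v i)) (at 0)"
   by (rule DERIV_chain2)
  then show ?thesis using v by simp
 qed
 have "((\<lambda>h. gsm \<psi> (z + (h0 + h) *\<^sub>R axis i 1) v) has_real_derivative gsd i \<psi> (nudge z h0 i) v) (at 0)"
  using main[of "nudge z h0 i"] by (simp add: algebra_simps)
 then show ?thesis
  using DERIV_shift[of "\<lambda>h. gsm \<psi> (nudge z h i) v" _ 0 h0] by (simp add: add.commute)
qed

text \<open>The factor c g_i + d treats \<open>gsm\<close> (c = 0, d = 1) and \<open>gsd\<close> (c
  = 1, d = 0) at once. Convergence of the base points is rewritten as a shift of g by vectors k n
  tending to 0; moved into the density, it is harmless for discontinuous \<psi>.\<close>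

lemma gauss_continuous_aux:
 fixes \<psi> :: "real ^ 'n::finite => real"
 assumes \<psi>: "\<psi> \<in> bounded_borel" and v: "\<And>i. 0 < v i" and c: "0 <= c" "c <= 1" "0 <= d" "d <= 1"
 shows "continuous_on UNIV (\<lambda>z. \<integral>g. \<psi> (gmap z v g) * (c * g $ i + d) \<partial>gauss)"
 unfolding continuous_on_sequentially comp_def
proof (intro ballI allI impI, elim conjE)
 fix X :: "nat => real ^ 'n" and z assume X: "X \<leadsto> z"
 obtain K where K: "0 <= K" "\<And>x. \<bar>\<psi> x\<bar> <= K" using bounded_borelD[OF \<psi>] by blast
 have [measurable]: "\<psi> \<in> borel_fun" using \<psi> by (simp add: bounded_borel_def)
 define k where "k n = (\<chi> j. (X n $ j - z $ j) / v j)" for n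
 have k0: "(\<lambda>n. k n $ j) \<leadsto> 0" for j
 proof -
  have "(\<lambda>n. (X n $ j - z $ j) / v j) \<leadsto> (z $ j - z $ j) / v j"
   using v[of j] by (intro tendsto_intros tendsto_vec_nth X) simp
  then show ?thesis by (simp add: k_def)
 qed
 have k0': "k \<leadsto> 0" using k0 by (intro vec_tendstoI) simp
 have "\<forall>\<^sub>F n in sequentially. \<forall>j. \<bar>k n $ j\<bar> <= 1"
 proof (rule eventually_all_finite)
  show "\<forall>\<^sub>F n in sequentially. \<bar>k n $ j\<bar> <= 1" for j
   using tendstoD[OF k0[of j], of 1] by (auto elim: eventually_mono)
 qed
 \<comment> \<open>From n0 on all coordinates of the shift are at most 1 in modulus, the range in
   which \<open>gwt\<close> dominates.\<close>
 then obtain n0 where n0: "\<And>n j. n \<ge> n0 ==> \<bar>k n $ j\<bar> <= 1" by (auto simp: eventually_sequentially)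
 define F where "F k g = \<psi> (gmap z v g) * (c * (g - k) $ i + d) * exp (k \<bullet> g - (k \<bullet> k) / 2)" for k g
 have eq: "(LINT g|gauss. \<psi> (gmap (X n) v g) * (c * g $ i + d)) = (LINT g|gauss. F (k n) g)" for n
 proof -
  have "gmap z v (g + k n) = gmap (X n) v g" for g
   using v by (auto simp: gmap_def vec_eq_iff k_def distrib_left less_imp_neq[symmetric])
  then show ?thesis
   using gauss_shift[of "\<lambda>g. \<psi> (gmap z v g) * (c * (g - k n) $ i + d)" "k n"] by (simp add: F_def)
 qed
 have Fm [measurable]: "F k \<in> borel_fun" for k
  unfolding F_def by measurable
 have Fb: "\<bar>F k g\<bar> <= (2 * K) * gwt g" if k: "\<And>j. \<bar>k $ j\<bar> <= 1" for k g
 proof -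
  let ?S = "\<Sum>j\<in>UNIV. \<bar>g $ j\<bar>"
  have "k \<bullet> g <= ?S"
   unfolding inner_vec_def
  proof (rule sum_mono)
   fix j have "k $ j * g $ j <= \<bar>k $ j\<bar> * \<bar>g $ j\<bar>" by (simp add: abs_mult[symmetric])
   also have "\<dots> <= \<bar>g $ j\<bar>" using k by (simp add: mult_left_le_one_le)
   finally show "k $ j \<bullet> g $ j <= \<bar>g $ j\<bar>" by simp
  qed
  then have e: "exp (k \<bullet> g - (k \<bullet> k) / 2) <= exp ?S"
   using inner_ge_zero[of k] by (smt (verit) exp_le_cancel_iff divide_nonneg_pos)
  have "\<bar>c * (g - k) $ i + d\<bar> <= c * \<bar>(g - k) $ i\<bar> + d"
   using c by (auto intro!: order_trans[OF abs_triangle_ineq] simp: abs_mult)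
  also have "\<dots> <= 1 * \<bar>(g - k) $ i\<bar> + 1" using c by (intro add_mono mult_right_mono) auto
  also have "\<dots> <= \<bar>g $ i\<bar> + 2" using k[of i] abs_triangle_ineq4[of "g $ i" "k $ i"] by simp
  also have "\<dots> <= 2 * exp ?S"
  proof -
   have "\<bar>g $ i\<bar> <= ?S" by (rule member_le_sum) auto
   moreover have "0 <= ?S" by (rule sum_nonneg) simp
   ultimately show ?thesis using exp_ge_add_one_self[of ?S] by linarith
  qed
  finally have "\<bar>c * (g - k) $ i + d\<bar> <= 2 * exp ?S" .
  then have "\<bar>F k g\<bar> <= K * (2 * exp ?S) * exp ?S"
   unfolding F_def abs_mult using K e by (intro mult_mono) auto
  also have "\<dots> = 2 * K * gwt g" unfolding gwt_def by (simp add: exp_double power2_eq_square)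
  finally show ?thesis .
 qed
 have "(\<lambda>n. \<integral>g. F (k (n + n0)) g \<partial>gauss) \<leadsto> (LINT g|gauss. F 0 g)"
 proof (rule integral_dominated_convergence[where w="\<lambda>g. (2 * K) * gwt g"])
  show "AE g in gauss. (\<lambda>n. F (k (n + n0)) g) \<leadsto> F 0 g"
  proof (rule AE_I2)
   fix g :: "real ^ 'n"
   have "(\<lambda>n. k (n + n0)) \<leadsto> 0" using k0' by (rule LIMSEQ_ignore_initial_segment)
   then show "(\<lambda>n. F (k (n + n0)) g) \<leadsto> F 0 g"
    unfolding F_def by (intro tendsto_intros) auto
  qed
  show "integrable gauss (\<lambda>g. (2 * K) * gwt g)" using integrable_gwt by auto
 qed (use Fb n0 in auto)
 then have "(\<lambda>n. \<integral>g. F (k n) g \<partial>gauss) \<leadsto> (LINT g|gauss. F 0 g)" by (rule LIMSEQ_offset)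
 note lim = this
 have F0: "(LINT g|gauss. F 0 g) = (LINT g|gauss. \<psi> (gmap z v g) * (c * g $ i + d))"
  by (simp add: F_def)
 show "(\<lambda>n. \<integral>g. \<psi> (gmap (X n) v g) * (c * g $ i + d) \<partial>gauss) \<leadsto> (LINT g|gauss. \<psi> (gmap z v g) * (c * g $ i + d))"
  unfolding eq using lim by (simp only: F0)
qed

lemma gsm_continuous:
 assumes "\<psi> \<in> bounded_borel" "\<And>i. 0 < v i"
 shows "continuous_on UNIV (\<lambda>z. gsm \<psi> z v)"
 using gauss_continuous_aux[OF assms, where c=0 and d=1] by (simp add: gsm_def)

lemma gsd_continuous:
 assumes "\<psi> \<in> bounded_borel" "\<And>i. 0 < v i"
 shows "continuous_on UNIV (\<lambda>z. gsd i \<psi> z v)"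
 using gauss_continuous_aux[OF assms, where c=1 and d=0 and i=i] assms(2)[of i] unfolding gsd_def
 by (auto intro!: continuous_intros)

lemma gs_tendsto:
 fixes \<psi> :: "real ^ 'n::finite => real"
 assumes "\<And>n. \<Psi> n \<in> bounded_borel" "\<psi> \<in> bounded_borel" "\<And>n x. \<bar>\<Psi> n x\<bar> <= K" "\<And>x. (\<lambda>n. \<Psi> n x) \<leadsto> \<psi> x"
 shows "(\<lambda>n. gsm (\<Psi> n) z v) \<leadsto> gsm \<psi> z v" "v i \<noteq> 0 ==> (\<lambda>n. gsd i (\<Psi> n) z v) \<leadsto> gsd i \<psi> z v"
proof -
 have [measurable]: "\<psi> \<in> borel_fun" "\<Psi> n \<in> borel_fun" for n
  using assms by (auto simp: bounded_borel_def)
 have K: "0 <= K" using assms(3)[of 0 0] by (auto intro: order_trans[OF abs_ge_zero])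
 have ib: "integrable (gauss :: (real ^ 'n) measure) (\<lambda>g. K * gwt g)" using integrable_gwt by auto
 show "(\<lambda>n. gsm (\<Psi> n) z v) \<leadsto> gsm \<psi> z v"
  unfolding gsm_def
 proof (rule integral_dominated_convergence[OF _ _ ib])
  show "AE g in gauss. norm (\<Psi> n (gmap z v g)) <= K * gwt g" for n
  proof (rule AE_I2)
   fix g :: "real ^ 'n"
   have "K * 1 <= K * gwt g" using K gwt_ge(2)[of g] by (intro mult_left_mono)
   then show "norm (\<Psi> n (gmap z v g)) <= K * gwt g" using assms(3)[of n "gmap z v g"] by simp
  qed
 qed (use assms in auto)
 have "(\<lambda>n. \<integral>g. \<Psi> n (gmap z v g) * g $ i \<partial>gauss) \<leadsto> (LINT g|gauss. \<psi> (gmap z v g) * g $ i)"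
 proof (rule integral_dominated_convergence[OF _ _ ib])
  show "AE g in gauss. (\<lambda>n. \<Psi> n (gmap z v g) * g $ i) \<leadsto> \<psi> (gmap z v g) * g $ i"
   using assms(4) by (intro AE_I2 tendsto_intros)
  show "AE g in gauss. norm (\<Psi> n (gmap z v g) * g $ i) <= K * gwt g" for n
   using assms(3) coord_le_gwt K by (intro AE_I2) (auto simp: abs_mult intro!: mult_mono)
 qed auto
 then show "v i \<noteq> 0 ==> (\<lambda>n. gsd i (\<Psi> n) z v) \<leadsto> gsd i \<psi> z v"
  unfolding gsd_def by (intro tendsto_intros)
qed

lemma gs_measurable:
 fixes v :: "'w => 'n::finite => real"
 assumes [measurable]: "\<psi> \<in> borel_fun" "\<And>i. (\<lambda>om. v om i) \<in> borel_measurable M"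
 shows "(\<lambda>om. gsm \<psi> z (v om)) \<in> borel_measurable M" "(\<lambda>om. gsd i \<psi> z (v om)) \<in> borel_measurable M"
proof -
 interpret prob_space "gauss :: (real ^ 'n) measure" by (rule prob_space_gauss)
 show "(\<lambda>om. gsm \<psi> z (v om)) \<in> borel_measurable M" "(\<lambda>om. gsd i \<psi> z (v om)) \<in> borel_measurable M"
  unfolding gsm_def gsd_def by measurable
qed

section \<open>The stable subordinator\<close>

lemma path_map_measurable [measurable]:
 assumes "\<And>t. 0 <= t ==> Y t \<in> borel_measurable M"
 shows "path_map Y \<in> measurable M path_space"
 unfolding path_map_def using assms by (intro measurable_restrict) auto

lemma distr_path_component:
 fixes Y Y' :: "real => 'w => 'b::topological_space"
 assumes Y: "\<And>t. 0 <= t ==> Y t \<in> borel_measurable M" and Y': "\<And>t. 0 <= t ==> Y' t \<in> borel_measurable M"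
  and eq: "distr M path_space (path_map Y) = distr M path_space (path_map Y')" and t: "0 <= t"
 shows "distr M borel (Y t) = distr M borel (Y' t)"
proof -
 have c: "(\<lambda>p. p t) \<in> measurable path_space (borel :: 'b measure)"
  using t by (intro measurable_component_singleton) auto
 have "distr (distr M path_space (path_map Y)) borel (\<lambda>p. p t) = distr (distr M path_space (path_map Y')) borel (\<lambda>p. p t)"
  by (simp only: eq)
 then show ?thesis
  using t by (simp add: distr_distr[OF c path_map_measurable[OF Y]] distr_distr[OF c path_map_measurable[OF Y']] comp_def path_map_def)
qed

locale stable_subordinator = prob_space M for M :: "'w measure" +
 fixes L :: "real => 'w => real" and \<alpha> gbar :: real
 assumes alpha: "1 / 2 < \<alpha>" "\<alpha> < 1" and gbar: "0 < gbar"
  and subord: "subordinator M L" and stable: "strictly_stable M \<alpha> L"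
  and char_L: "char (distr M borel (L 1)) u =
    exp (- complex_of_real (gbar powr \<alpha> * \<bar>u\<bar> powr \<alpha>) *
        (1 - \<i> * complex_of_real (tan (pi * \<alpha> / 2) * sgn u)))"
begin

lemma L_measurable: "0 <= t ==> L t \<in> borel_measurable M"
 using subord by (auto simp: subordinator_def levy_process_def)

lemma L1_measurable [measurable]: "L 1 \<in> borel_measurable M"
 by (rule L_measurable) simp

lemma L_mono_AE: "AE om in M. mono_on {0..} (\<lambda>t. L t om)"
 and L_zero_AE: "AE om in M. L 0 om = 0"
 and L_cadlag_AE: "AE om in M. cadlag_on {0..} (\<lambda>t. L t om)"
 using subord by (auto simp: subordinator_def levy_process_def)

lemma L_nonneg_AE: "AE om in M. \<forall>t\<ge>0. 0 <= L t om"
 using L_mono_AE L_zero_AE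
proof eventually_elim
 case (elim om)
 show ?case
 proof (intro allI impI)
  fix t :: real assume "0 <= t"
  then show "0 <= L t om" using mono_onD[OF elim(1), of 0 t] elim(2) by simp
 qed
qed

lemma L1_nonneg_AE: "AE om in M. 0 <= L 1 om"
 using L_nonneg_AE by eventually_elim simp

text \<open>Stationarity reduces the increment to L (t - s), and self-similarity with a = t - s,
  read at time 1, gives the scaled copy of L 1.\<close>

lemma L_increment_distr:
 assumes "0 <= s" "s < t"
 shows "distr M borel (\<lambda>om. L t om - L s om) = distr M borel (\<lambda>om. (t - s) powr (1 / \<alpha>) * L 1 om)"
proof -
 have "distr M borel (\<lambda>om. L t om - L s om) = distr M borel (L (t - s))"
  using subord assms by (auto simp: subordinator_def levy_process_def)
 also have "\<dots> = distr M borel (\<lambda>om. (t - s) powr (1 / \<alpha>) * L 1 om)"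
 proof -
  have "distr M path_space (path_map (\<lambda>u. L ((t - s) * u))) =
    distr M path_space (path_map (\<lambda>u om. (t - s) powr (1 / \<alpha>) * L u om))"
   using stable assms by (auto simp: strictly_stable_def)
  note eq = this
  have m1: "L ((t - s) * u) \<in> borel_measurable M" if "0 <= u" for u
   using that assms by (intro L_measurable) simp
  have m2: "(\<lambda>om. (t - s) powr (1 / \<alpha>) * L u om) \<in> borel_measurable M" if "0 <= u" for u
   using L_measurable[OF that] by measurable
  have "distr M borel (L ((t - s) * 1)) = distr M borel (\<lambda>om. (t - s) powr (1 / \<alpha>) * L 1 om)"
   by (rule distr_path_component[OF m1 m2 eq]) auto
  then show ?thesis by (simp only: mult_1_right)
 qed
 finally show ?thesis .
qed

lemma expectation_increment:
 fixes h :: "real => real"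
 assumes st: "0 <= s" "s < t" and [measurable]: "h \<in> borel_fun"
 shows "(LINT om|M. h (L t om - L s om)) = (LINT om|M. h ((t - s) powr (1 / \<alpha>) * L 1 om))"
  and "integrable M (\<lambda>om. h (L t om - L s om)) \<longleftrightarrow> integrable M (\<lambda>om. h ((t - s) powr (1 / \<alpha>) * L 1 om))"
  and "(AE om in M. h (L t om - L s om) \<noteq> 0) \<longleftrightarrow> (AE om in M. h ((t - s) powr (1 / \<alpha>) * L 1 om) \<noteq> 0)"
proof -
 have [measurable]: "L t \<in> borel_measurable M" "L s \<in> borel_measurable M" using st by (auto intro: L_measurable)
 note D = L_increment_distr[OF st]
 have "(LINT om|M. h (L t om - L s om)) = integral\<^sup>L (distr M borel (\<lambda>om. L t om - L s om)) h"
  by (rule integral_distr[symmetric]) measurable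
 also have "\<dots> = (LINT om|M. h ((t - s) powr (1 / \<alpha>) * L 1 om))"
  unfolding D by (rule integral_distr) measurable
 finally show "(LINT om|M. h (L t om - L s om)) = (LINT om|M. h ((t - s) powr (1 / \<alpha>) * L 1 om))" .
 have "integrable M (\<lambda>om. h (L t om - L s om)) \<longleftrightarrow> integrable (distr M borel (\<lambda>om. L t om - L s om)) h"
  by (rule integrable_distr_eq[symmetric]) measurable
 also have "\<dots> \<longleftrightarrow> integrable M (\<lambda>om. h ((t - s) powr (1 / \<alpha>) * L 1 om))"
  unfolding D by (rule integrable_distr_eq) measurable
 finally show "integrable M (\<lambda>om. h (L t om - L s om)) \<longleftrightarrow> integrable M (\<lambda>om. h ((t - s) powr (1 / \<alpha>) * L 1 om))" .
 have "(AE om in M. h (L t om - L s om) \<noteq> 0) \<longleftrightarrow> (AE x in distr M borel (\<lambda>om. L t om - L s om). h x \<noteq> 0)"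
  by (rule AE_distr_iff[symmetric]) measurable
 also have "\<dots> \<longleftrightarrow> (AE om in M. h ((t - s) powr (1 / \<alpha>) * L 1 om) \<noteq> 0)"
  unfolding D by (rule AE_distr_iff) measurable
 finally show "(AE om in M. h (L t om - L s om) \<noteq> 0) \<longleftrightarrow> (AE om in M. h ((t - s) powr (1 / \<alpha>) * L 1 om) \<noteq> 0)" .
qed

definition lap :: real where "lap = (LINT om|M. exp (- L 1 om))"

lemma integrable_exp_L1:
 assumes "0 <= c" shows "integrable M (\<lambda>om. exp (- (c * L 1 om)))"
 by (rule integrable_const_bound[where B=1])
  (use L1_nonneg_AE assms in "auto elim!: eventually_mono")

text \<open>If \<open>lap\<close> were 1, then L 1 = 0 almost surely and its characteristic function
  would be 1 at u = 1; but there it has modulus exp(- gbar^\<alpha>) < 1.\<close>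

lemma lap_bounds: "0 <= lap" "lap < 1"
proof -
 show "0 <= lap" unfolding lap_def by (rule integral_nonneg_AE) auto
 have i: "integrable M (\<lambda>om. exp (- L 1 om))" using integrable_exp_L1[of 1] by simp
 have "lap <= (LINT om|M. 1)"
  unfolding lap_def by (rule integral_mono_AE) (use i L1_nonneg_AE in auto)
 then have le: "lap <= 1" by (simp add: prob_space)
 moreover have "lap \<noteq> 1"
 proof
  assume "lap = 1"
  then have "(LINT om|M. 1 - exp (- L 1 om)) = 0"
   using i by (simp add: lap_def prob_space)
  then have "AE om in M. 1 - exp (- L 1 om) = 0"
   by (subst (asm) integral_nonneg_eq_0_iff_AE) (use i L1_nonneg_AE in "auto elim!: eventually_mono")
  then have z: "AE om in M. L 1 om = 0" by eventually_elim simp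
  have "char (distr M borel (L 1)) 1 = (LINT om|M. iexp (1 * L 1 om))"
   unfolding char_def by (subst integral_distr) auto
  also have "\<dots> = (LINT om|M. 1)"
   by (rule integral_cong_AE) (use z in "auto elim!: eventually_mono")
  finally have "char (distr M borel (L 1)) 1 = 1" by (simp add: prob_space)
  then have "norm (exp (- complex_of_real (gbar powr \<alpha> * \<bar>1\<bar> powr \<alpha>) *
        (1 - \<i> * complex_of_real (tan (pi * \<alpha> / 2) * sgn 1)))) = 1"
   unfolding char_L[of 1] by simp
  then have "exp (- (gbar powr \<alpha>)) = 1" by (simp add: norm_exp_eq_Re)
  then show False using gbar by simp
 qed
 ultimately show "lap < 1" by simp
qed

text \<open>Splitting \<open>L 1\<close> into \<open>n\<close> independent copies of \<open>n powr (- 1 / \<alpha>) * L 1\<close>.\<close>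

lemma laplace_L1:
 assumes n: "0 < n"
 shows "(LINT om|M. exp (- (real n powr (1 / \<alpha>) * L 1 om))) = lap ^ n"
proof -
 define \<tau> where "\<tau> i = real i / real n" for i
 define c where "c = real n powr (1 / \<alpha>)"
 define D where "D i om = L (\<tau> (Suc i)) om - L (\<tau> i) om" for i om
 have \<tau>: "0 <= \<tau> 0" "mono \<tau>" by (auto simp: \<tau>_def mono_def divide_right_mono)
 have ind: "indep_vars (\<lambda>_. borel) D {..<n}"
  using subord \<tau> unfolding subordinator_def levy_process_def independent_increments_def D_def[abs_def] by blast
 then have ind': "indep_vars (\<lambda>_. borel) (\<lambda>i om. exp (- (c * D i om))) {..<n}"
  by (rule indep_vars_compose2) measurable
 have one: "(LINT om|M. exp (- (c * D i om))) = lap \<and> integrable M (\<lambda>om. exp (- (c * D i om)))" for i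
 proof -
  have st: "0 <= \<tau> i" "\<tau> i < \<tau> (Suc i)" "\<tau> (Suc i) - \<tau> i = 1 / real n"
   using n by (auto simp: \<tau>_def divide_strict_right_mono diff_divide_distrib[symmetric])
  have cc: "c * ((1 / real n) powr (1 / \<alpha>) * x) = x" for x
   using n by (simp add: c_def powr_divide)
  have h: "(\<lambda>x. exp (- (c * x))) \<in> borel_fun" by measurable
  show ?thesis
   using expectation_increment(1,2)[OF st(1,2) h] integrable_exp_L1[of 1]
   unfolding D_def st(3) cc lap_def by simp
 qed
 have tele: "(\<Sum>i<n. D i om) = L 1 om - L 0 om" for om
  unfolding D_def using sum_lessThan_telescope[of "\<lambda>i. L (\<tau> i) om" n] n by (simp add: \<tau>_def)
 have "(LINT om|M. exp (- (c * L 1 om))) = (LINT om|M. (\<Prod>i<n. exp (- (c * D i om))))"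
 proof (rule integral_cong_AE)
  have [measurable]: "L 0 \<in> borel_measurable M" "\<And>i. L (\<tau> i) \<in> borel_measurable M"
   by (auto intro!: L_measurable simp: \<tau>_def)
  show "(\<lambda>om. \<Prod>i<n. exp (- (c * D i om))) \<in> borel_measurable M"
   unfolding D_def by measurable
  show "AE om in M. exp (- (c * L 1 om)) = (\<Prod>i<n. exp (- (c * D i om)))"
   using L_zero_AE
  proof eventually_elim
   case (elim om)
   then show ?case using tele[of om] by (simp add: exp_sum[symmetric] sum_negf sum_distrib_left[symmetric])
  qed
 qed measurable
 also have "\<dots> = (\<Prod>i<n. \<integral>om. exp (- (c * D i om)) \<partial>M)"
  by (rule indep_vars_lebesgue_integral) (use ind' one in auto)
 finally show ?thesis using one by (simp add: c_def)
qed

text \<open>The probability of L 1 = 0 is at most E exp(- n^(1/\<alpha>) L 1), which is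
  \<open>lap\<close> to the power n and tends to 0.\<close>

lemma L1_pos_AE: "AE om in M. 0 < L 1 om"
proof -
 have "prob {om \<in> space M. L 1 om = 0} <= lap ^ Suc n" for n
 proof -
  let ?c = "real (Suc n) powr (1 / \<alpha>)"
  have "prob {om \<in> space M. L 1 om = 0} = (LINT om|M. indicator {om \<in> space M. L 1 om = 0} om)" by simp
  also have "\<dots> <= (LINT om|M. exp (- (?c * L 1 om)))"
   by (rule integral_mono, rule integrable_real_indicator)
    (use integrable_exp_L1[of ?c] in "auto simp: less_top[symmetric] split: split_indicator")
  finally show ?thesis using laplace_L1[of "Suc n"] by simp
 qed
 moreover have "(\<lambda>n. lap ^ Suc n) \<leadsto> 0"
  using lap_bounds LIMSEQ_power_zero[of lap] by (intro LIMSEQ_Suc) auto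
 ultimately have "prob {om \<in> space M. L 1 om = 0} <= 0"
  by (intro LIMSEQ_le_const) auto
 then have "prob {om \<in> space M. L 1 om = 0} = 0" by (simp add: measure_le_0_iff)
 then have "AE om in M. L 1 om \<noteq> 0"
  by (subst (asm) prob_eq_0) auto
 then show ?thesis using L1_nonneg_AE by eventually_elim simp
qed

text \<open>For 0 < x < 1 take n to be x^(-\<alpha>) rounded up. Then x^(-1/2) <= n because \<alpha>
  > 1/2, while n^(1/\<alpha>) x stays below 4, so x^(-1/2) is at most the single term
  \<open>T n x\<close>. The expectations of these terms, exp 4 * n * lap^n, are summable.\<close>

lemma integrable_inverse_sqrt_L1: "integrable M (\<lambda>om. 1 / sqrt (L 1 om))"
proof -
 define T where "T n x = exp 4 * (real n * exp (- (real n powr (1 / \<alpha>) * x)))" for n x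
 have pt: "ennreal (1 / sqrt x) <= 1 + (\<Sum>n. ennreal (T n x))" if x: "0 <= x" for x
 proof (cases "x = 0 \<or> 1 <= x")
  case True
  then have "1 / sqrt x <= 1" by auto
  then have "ennreal (1 / sqrt x) <= 1" by (simp add: ennreal_le_1)
  then show ?thesis by (simp add: add_increasing2)
 next
  case False
  then have x: "0 < x" "x < 1" using that by auto
  define n where "n = nat \<lceil>x powr (- \<alpha>)\<rceil>"
  have p1: "1 <= x powr (- \<alpha>)"
   using x alpha powr_mono_both'[of "- \<alpha>" 0 x 1] by (auto simp: powr_minus one_le_inverse_iff powr_le1)
  have n: "x powr (- \<alpha>) <= real n" "real n <= 2 * x powr (- \<alpha>)"
   using p1 unfolding n_def by linarith+
  have "1 / sqrt x = x powr (- (1/2))" using x by (simp add: powr_minus_divide powr_half_sqrt)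
  also have "\<dots> <= x powr (- \<alpha>)" using x alpha by (intro powr_mono') auto
  finally have a: "1 / sqrt x <= real n" using n by simp
  \<comment> \<open>Here n is at most 2 x^(-\<alpha>), and 2^(1/\<alpha>) <= 2^2 because \<alpha> >
    1/2; this is the origin of the constant exp 4 in \<open>T\<close>.\<close>
  have "real n powr (1 / \<alpha>) * x <= (2 * x powr (- \<alpha>)) powr (1 / \<alpha>) * x"
   using n x alpha p1 by (intro mult_right_mono powr_mono2) auto
  also have "\<dots> = 2 powr (1 / \<alpha>) * (x powr (-1) * x)"
   using x alpha by (simp add: powr_mult powr_powr)
  also have "\<dots> = 2 powr (1 / \<alpha>)" using x by (simp add: powr_minus_divide)
  also have "\<dots> <= 2 powr 2" using alpha by (intro powr_mono) (auto simp: divide_le_eq)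
  finally have b: "real n powr (1 / \<alpha>) * x <= 4" by simp
  have "1 / sqrt x <= real n * (exp 4 * exp (- (real n powr (1 / \<alpha>) * x)))"
  proof -
   have "1 <= exp 4 * exp (- (real n powr (1 / \<alpha>) * x))" using b by (simp add: exp_add[symmetric])
   then have "real n * 1 <= real n * (exp 4 * exp (- (real n powr (1 / \<alpha>) * x)))" by (rule mult_left_mono) simp
   then show ?thesis using a by linarith
  qed
  then have "ennreal (1 / sqrt x) <= ennreal (T n x)" by (simp add: T_def mult_ac ennreal_leI)
  also have "\<dots> <= (\<Sum>n. ennreal (T n x))"
   using sum_le_suminf[of "\<lambda>n. ennreal (T n x)" "{n}"] by simp
  finally show ?thesis by (simp add: add_increasing)
 qed
 have ET: "(\<integral>\<^sup>+om. ennreal (T n (L 1 om)) \<partial>M) = ennreal (exp 4 * (real n * lap ^ n))" for n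
 proof (cases "n = 0")
  case False
  then show ?thesis
   using integrable_exp_L1[of "real n powr (1 / \<alpha>)"] laplace_L1[of n]
   by (subst nn_integral_eq_integral) (auto simp: T_def)
 qed (simp add: T_def)
 have sm: "summable (\<lambda>n. exp 4 * (real n * lap ^ n))"
 proof -
  have "summable (\<lambda>n. real (Suc n) * lap ^ n)"
   using geometric_deriv_sums[of lap] lap_bounds by (auto simp: sums_iff)
  then have "summable (\<lambda>n. exp 4 * lap * (real (Suc n) * lap ^ n))" by (rule summable_mult)
  then have "summable (\<lambda>n. exp 4 * (real (Suc n) * lap ^ Suc n))" by (simp add: mult_ac)
  then show ?thesis using summable_Suc_iff[of "\<lambda>n. exp 4 * (real n * lap ^ n)"] by blast
 qed
 have "(\<integral>\<^sup>+om. ennreal (1 / sqrt (L 1 om)) \<partial>M) <= (\<integral>\<^sup>+om. 1 + (\<Sum>n. ennreal (T n (L 1 om))) \<partial>M)"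
  by (rule nn_integral_mono_AE) (use L1_nonneg_AE pt in "auto elim!: eventually_mono")
 also have "\<dots> = 1 + (\<Sum>n. ennreal (exp 4 * (real n * lap ^ n)))"
  unfolding T_def
  by (subst nn_integral_add) (auto simp: nn_integral_suminf ET[unfolded T_def] emeasure_space_1)
 also have "\<dots> < \<infinity>"
  using lap_bounds sm by (subst suminf_ennreal2) auto
 finally show ?thesis
  by (intro integrableI_nonneg) (use L1_nonneg_AE in "auto elim!: eventually_mono")
qed

definition Cneg :: real where "Cneg = (LINT om|M. 1 / sqrt (L 1 om))"

lemma Cneg_nonneg: "0 <= Cneg"
 unfolding Cneg_def by (rule integral_nonneg_AE) (use L1_nonneg_AE in "auto elim!: eventually_mono")

lemma L_increment_pos_AE:
 assumes "0 <= s" "s < t" shows "AE om in M. 0 < L t om - L s om"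
proof -
 have "AE om in M. (t - s) powr (1 / \<alpha>) * L 1 om \<noteq> 0"
  using L1_pos_AE assms by (auto elim!: eventually_mono)
 then have "AE om in M. L t om - L s om \<noteq> 0"
  using expectation_increment(3)[OF assms, of "\<lambda>x. x"] by simp
 then show ?thesis
  using L_mono_AE
 proof eventually_elim
  case (elim om)
  have "L s om <= L t om" using mono_onD[OF elim(2), of s t] assms by simp
  then show ?case using elim(1) by simp
 qed
qed

text \<open>The square root of the scaling factor (t - s)^(1/\<alpha>) produces the exponent -1/(2
  \<alpha>), the singularity of all gradient estimates below.\<close>

lemma inverse_sqrt_increment:
 assumes st: "0 <= s" "s < t"
 shows "integrable M (\<lambda>om. 1 / sqrt (L t om - L s om))"
  and "(LINT om|M. 1 / sqrt (L t om - L s om)) = (t - s) powr (- (1 / (2 * \<alpha>))) * Cneg"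
proof -
 have h: "(\<lambda>x::real. 1 / sqrt x) \<in> borel_fun" by measurable
 have e: "1 / sqrt ((t - s) powr (1 / \<alpha>) * x) = (t - s) powr (- (1 / (2 * \<alpha>))) * (1 / sqrt x)" for x
 proof -
  have "sqrt ((t - s) powr (1 / \<alpha>)) = (t - s) powr (1 / (2 * \<alpha>))"
   using st alpha by (simp add: powr_half_sqrt[symmetric] powr_powr mult.commute)
  then show ?thesis using st by (simp add: real_sqrt_mult powr_minus_divide)
 qed
 show "integrable M (\<lambda>om. 1 / sqrt (L t om - L s om))"
  unfolding expectation_increment(2)[OF st h] e
  by (rule integrable_mult_right) (rule integrable_inverse_sqrt_L1)
 show "(LINT om|M. 1 / sqrt (L t om - L s om)) = (t - s) powr (- (1 / (2 * \<alpha>))) * Cneg"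
  unfolding expectation_increment(1)[OF st h] e Cneg_def by (rule integral_mult_right_zero)
qed

end

section \<open>Subordinated Brownian motion\<close>

text \<open>Evaluates a path at the time \<open>a\<close> through dyadic times. Unlike plain evaluation, this is jointly measurable in
 \<open>(p, a)\<close> for the product sigma-algebra; the two agree on continuous paths.\<close>

definition wl :: "'n::finite => (real => real ^ 'n) => real => real" where
 "wl i p a = lim (\<lambda>k. p (real (nat \<lceil>2 ^ k * a\<rceil>) / 2 ^ k) $ i)"

lemma wl_measurable:
 assumes [measurable]: "P \<in> measurable X path_space" "A \<in> borel_measurable X"
 shows "(\<lambda>x. wl i (P x) (A x)) \<in> borel_measurable X"
proof -
 have [measurable]: "(\<lambda>x. P x (real m / 2 ^ k)) \<in> borel_measurable X" for m k :: nat
  by (rule measurable_compose[OF assms(1) measurable_component_singleton]) simp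
 have "(\<lambda>x. P x (real (nat \<lceil>2 ^ k * A x\<rceil>) / 2 ^ k) $ i) \<in> borel_measurable X" for k :: nat
  by (rule measurable_compose_countable[where f="\<lambda>m x. P x (real m / 2 ^ k) $ i"]) measurable
 then show ?thesis unfolding wl_def by measurable
qed

lemma wl_continuous:
 assumes c: "continuous_on {0..} (\<lambda>t. p t $ i)" and a: "0 <= a"
 shows "wl i p a = p a $ i"
proof -
 define q where "q k = real (nat \<lceil>2 ^ k * a\<rceil>) / 2 ^ k" for k :: nat
 have "\<bar>q k - a\<bar> <= 1 / 2 ^ k" for k
 proof -
  have "0 <= 2 ^ k * a" using a by simp
  then have "2 ^ k * a <= real (nat \<lceil>2 ^ k * a\<rceil>)" "real (nat \<lceil>2 ^ k * a\<rceil>) <= 2 ^ k * a + 1" by linarith+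
  then have "2 ^ k * a / 2 ^ k <= q k" "q k <= (2 ^ k * a + 1) / 2 ^ k"
   unfolding q_def by (intro divide_right_mono; simp)+
  then show ?thesis by (simp add: add_divide_distrib)
 qed
 moreover have "(\<lambda>k. 1 / 2 ^ k :: real) \<leadsto> 0" by real_asymp
 ultimately have "(\<lambda>k. q k - a) \<leadsto> 0"
  by (intro Lim_null_comparison[where g="\<lambda>k. 1 / 2 ^ k" and f="\<lambda>k. q k - a"] always_eventually allI)
   (simp_all only: real_norm_def)
 then have qa: "q \<leadsto> a" by (rule LIM_zero_cancel)
 have "(\<lambda>k. p (q k) $ i) \<leadsto> p a $ i"
 proof (rule continuous_on_tendsto_compose[OF c qa])
  have "0 <= q k" for k unfolding q_def by (intro divide_nonneg_nonneg) auto
  then show "\<forall>\<^sub>F k in sequentially. q k \<in> {0..}" by simp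
 qed (use a in simp)
 then show ?thesis unfolding wl_def q_def by (rule limI)
qed

lemma path_map_continuous:
 assumes "continuous_on {0..} (\<lambda>t. W t om $ i)"
 shows "continuous_on {0..} (\<lambda>t. path_map W om t $ i)"
 by (rule continuous_on_cong[THEN iffD1, OF refl _ assms]) (auto simp: path_map_def)

lemma path_map_apply: "0 <= t ==> path_map Y om t = Y t om"
 by (simp add: path_map_def)

locale stable_noise = stable_subordinator M L \<alpha> gbar for M :: "'w measure" and L \<alpha> gbar +
 fixes W :: "real => 'w => real ^ 'n::finite"
 assumes bm: "brownian_motion M W" and indep_WL: "independent_processes M W L"
begin

lemma W_comp_measurable: "0 <= t ==> (\<lambda>om. W t om $ i) \<in> borel_measurable M"
 using bm by (auto simp: brownian_motion_def brownian_motion_1d_def)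

lemma W_measurable: "0 <= t ==> W t \<in> borel_measurable M"
 using measurable_vec_lambda_borel[of "\<lambda>om i. W t om $ i" M] W_comp_measurable by simp

lemma pathW [measurable]: "path_map W \<in> measurable M path_space"
 by (rule path_map_measurable[OF W_measurable])

lemma pathL [measurable]: "path_map L \<in> measurable M path_space"
 by (rule path_map_measurable[OF L_measurable])

lemma W_continuous_AE: "AE om in M. \<forall>i. continuous_on {0..} (\<lambda>t. W t om $ i)"
proof -
 have "\<And>i. AE om in M. continuous_on {0..} (\<lambda>t. W t om $ i)"
  using bm by (auto simp: brownian_motion_def brownian_motion_1d_def)
 then show ?thesis by (subst AE_all_countable) auto
qed

lemma joint_distr:
 "distr M (path_space \<Otimes>\<^sub>M path_space) (\<lambda>om. (path_map W om, path_map L om)) =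
  distr M path_space (path_map W) \<Otimes>\<^sub>M distr M path_space (path_map L)"
proof (rule pair_measure_eqI[symmetric])
 show "sigma_finite_measure (distr M path_space (path_map W))" "sigma_finite_measure (distr M path_space (path_map L))"
  by (intro prob_space_imp_sigma_finite prob_space_distr pathW pathL)+
 show "sets (distr M path_space (path_map W) \<Otimes>\<^sub>M distr M path_space (path_map L)) =
  sets (distr M (path_space \<Otimes>\<^sub>M path_space) (\<lambda>om. (path_map W om, path_map L om)))"
  by (simp cong: sets_pair_measure_cong)
 fix A B assume "A \<in> sets (distr M path_space (path_map W))" "B \<in> sets (distr M path_space (path_map L))"
 then have [measurable]: "A \<in> sets path_space" "B \<in> sets path_space" by auto
 have "prob ((path_map W -` A \<inter> space M) \<inter> (path_map L -` B \<inter> space M)) = prob (path_map W -` A \<inter> space M) * prob (path_map L -` B \<inter> space M)"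
  using indep_WL unfolding independent_processes_def by (rule indep_setD) auto
 moreover have "(\<lambda>om. (path_map W om, path_map L om)) -` (A \<times> B) \<inter> space M = (path_map W -` A \<inter> space M) \<inter> (path_map L -` B \<inter> space M)"
  by auto
 ultimately show "emeasure (distr M path_space (path_map W)) A * emeasure (distr M path_space (path_map L)) B =
  emeasure (distr M (path_space \<Otimes>\<^sub>M path_space) (\<lambda>om. (path_map W om, path_map L om))) (A \<times> B)"
  by (simp add: emeasure_distr emeasure_eq_measure ennreal_mult'[symmetric])
qed

text \<open>By independence the joint law of the two paths is a product, so Fubini allows the path
  of L to be frozen while averaging over W.\<close>

lemma disintegrate:
 fixes \<Psi> :: "(real => real ^ 'n) \<times> (real => real) => real"
 assumes m [measurable]: "\<Psi> \<in> borel_measurable (path_space \<Otimes>\<^sub>M path_space)" and b: "\<And>x. \<bar>\<Psi> x\<bar> <= K"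
 shows "(LINT om|M. \<Psi> (path_map W om, path_map L om)) = (LINT om'|M. (LINT om|M. \<Psi> (path_map W om, path_map L om')))"
proof -
 let ?PW = "distr M path_space (path_map W)" and ?PL = "distr M path_space (path_map L)"
 interpret PW: prob_space ?PW by (rule prob_space_distr) (rule pathW)
 interpret PL: prob_space ?PL by (rule prob_space_distr) (rule pathL)
 interpret P: pair_prob_space ?PW ?PL ..
 have m': "\<Psi> \<in> borel_measurable (?PW \<Otimes>\<^sub>M ?PL)"
  using m by (simp cong: measurable_cong_sets sets_pair_measure_cong)
 have int: "integrable (?PW \<Otimes>\<^sub>M ?PL) \<Psi>"
  by (rule P.integrable_const_bound[where B=K]) (use b m' in auto)
 have "(LINT om|M. \<Psi> (path_map W om, path_map L om)) = (LINT x|(?PW \<Otimes>\<^sub>M ?PL). \<Psi> x)"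
  unfolding joint_distr[symmetric] by (subst integral_distr) auto
 also have "\<dots> = (LINT l|?PL. (LINT w|?PW. \<Psi> (w, l)))"
  using P.integral_snd[of "\<lambda>w l. \<Psi> (w, l)"] int by simp
 also have "\<dots> = (LINT om'|M. (LINT w|?PW. \<Psi> (w, path_map L om')))"
 proof (rule integral_distr)
  have "(\<lambda>l. \<integral>w. \<Psi> (w, l) \<partial>?PW) \<in> borel_measurable ?PL"
  proof (rule PW.borel_measurable_lebesgue_integral)
   have "(\<lambda>x. (snd x, fst x)) \<in> measurable (?PL \<Otimes>\<^sub>M ?PW) (?PW \<Otimes>\<^sub>M ?PL)" by measurable
   from measurable_compose[OF this m'] show "(\<lambda>(l, w). \<Psi> (w, l)) \<in> borel_measurable (?PL \<Otimes>\<^sub>M ?PW)"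
    by (simp add: split_beta')
  qed
  then show "(\<lambda>l. \<integral>w. \<Psi> (w, l) \<partial>?PW) \<in> borel_measurable path_space" by simp
 qed simp
 also have "\<dots> = (LINT om'|M. (LINT om|M. \<Psi> (path_map W om, path_map L om')))"
 proof (rule Bochner_Integration.integral_cong[OF refl])
  fix om' assume "om' \<in> space M"
  then have "path_map L om' \<in> space path_space" using pathL by (auto simp: measurable_def)
  then have "(\<lambda>w. \<Psi> (w, path_map L om')) \<in> borel_measurable path_space" by measurable
  then show "(LINT w|?PW. \<Psi> (w, path_map L om')) = (LINT om|M. \<Psi> (path_map W om, path_map L om'))"
   by (subst integral_distr) auto
 qed
 finally show ?thesis .
qed

text \<open>The components of W_L as a measurable functional of the two paths. Outside one null set
  they agree with W at L t for all times at once.\<close>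

definition NW :: "'n => real => 'w => real" where
 "NW i t om = wl i (path_map W om) (L t om)"

abbreviation (input) "dW a i j om \<equiv> W (a (Suc j)) om $ i - W (a j) om $ i"
abbreviation (input) "dNW \<tau> i j om \<equiv> NW i (\<tau> (Suc j)) om - NW i (\<tau> j) om"
abbreviation (input) "dL \<tau> j om \<equiv> L (\<tau> (Suc j)) om - L (\<tau> j) om"

lemma NW_measurable [measurable]: "0 <= t ==> NW i t \<in> borel_measurable M"
 unfolding NW_def[abs_def] by (intro wl_measurable pathW L_measurable)

lemma NW_eq_AE: "AE om in M. \<forall>i. \<forall>t\<ge>0. NW i t om = W (L t om) om $ i"
 using W_continuous_AE L_nonneg_AE
proof eventually_elim
 case (elim om)
 show ?case
 proof (intro allI impI)
  fix i and t :: real assume t: "0 <= t"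
  have "continuous_on {0..} (\<lambda>t. path_map W om t $ i)"
   using elim(1) by (intro path_map_continuous) blast
  from wl_continuous[OF this, of "L t om"] elim(2) t show "NW i t om = W (L t om) om $ i"
   by (simp add: NW_def path_map_apply)
 qed
qed

lemma bm_increment:
 assumes "0 <= s" "s < t"
 shows "distributed M lborel (\<lambda>om. W t om $ i - W s om $ i) (normal_density 0 (sqrt (t - s)))"
 using bm assms by (auto simp: brownian_motion_def brownian_motion_1d_def)

lemma bm_indep_times:
 fixes a :: "nat => real"
 assumes "0 <= a 0" "mono a"
 shows "indep_vars (\<lambda>_. borel) (\<lambda>j om. dW a i j om) {..<m}"
 using bm assms unfolding brownian_motion_def brownian_motion_1d_def independent_increments_def by blast

lemma bm_indep_components:
 "indep_vars (\<lambda>_. path_space) (\<lambda>i. path_map (\<lambda>t om. W t om $ i)) UNIV"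
 using bm by (auto simp: brownian_motion_def)

text \<open>In the definition of independent increments the times form an infinite monotone sequence; \<open>a\<close> is therefore
 continued by a constant after \<open>m\<close>.\<close>

definition partial_extend :: "nat => (nat => real) => nat => real" where
 "partial_extend m a j = a (min j m)"

lemma partial_extend_props:
 assumes "0 <= a 0" "\<And>j. j < m ==> a j < a (Suc j)"
 shows "0 <= partial_extend m a 0" "mono (partial_extend m a)" "\<And>j. j <= m ==> 0 <= a j"
  "\<And>j. j < m ==> partial_extend m a j = a j" "\<And>j. j < m ==> partial_extend m a (Suc j) = a (Suc j)"
proof -
 have st: "partial_extend m a j <= partial_extend m a (Suc j)" for j
  using assms(2)[of j] by (cases "j < m") (auto simp: partial_extend_def min_def less_imp_le)
 then show mono: "mono (partial_extend m a)" by (simp add: mono_iff_le_Suc)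
 show z: "0 <= partial_extend m a 0" using assms(1) by (simp add: partial_extend_def)
 show "0 <= a j" if "j <= m" for j
  using z monoD[OF mono, of 0 j] that by (simp add: partial_extend_def)
qed (auto simp: partial_extend_def)

lemma bm_indep_times':
 fixes a :: "nat => real"
 assumes a: "0 <= a 0" "\<And>j. j < m ==> a j < a (Suc j)"
 shows "indep_vars (\<lambda>_. borel) (\<lambda>j om. dW a i j om) {..<m}"
proof -
 note P = partial_extend_props[of a m, OF a]
 have "indep_vars (\<lambda>_. borel) (\<lambda>j om. W (partial_extend m a (Suc j)) om $ i - W (partial_extend m a j) om $ i) {..<m}"
  by (rule bm_indep_times[OF P(1,2)])
 then show ?thesis
  by (rule indep_vars_cong[THEN iffD1, rotated -1]) (auto simp: P)
qed

text \<open>The components of W are independent as random paths, so the expectation factors over i;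
  within a component it factors over the disjoint time increments, which are centred normal.\<close>

lemma bm_product_expectation:
 fixes a :: "nat => real" and F :: "'n => nat => real => real"
 assumes a: "0 <= a 0" "\<And>j. j < m ==> a j < a (Suc j)"
  and F [measurable]: "\<And>i j. F i j \<in> borel_fun" and Fb: "\<And>i j y. \<bar>F i j y\<bar> <= 1"
 shows "(LINT om|M. (\<Prod>i\<in>UNIV. \<Prod>j<m. F i j (dW a i j om))) =
  (\<Prod>i\<in>UNIV. \<Prod>j<m. \<integral>y. normal_density 0 (sqrt (a (Suc j) - a j)) y * F i j y \<partial>lborel)"
proof -
 note P = partial_extend_props[of a m, OF a]
 define G where "G i p = (\<Prod>j<m. F i j (p (a (Suc j)) - p (a j)))" for i and p :: "real => real"
 have am: "0 <= a j" "0 <= a (Suc j)" if "j < m" for j using P(3)[of j] P(3)[of "Suc j"] that by simp_all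
 have Gm: "G i \<in> borel_measurable path_space" for i
  unfolding G_def by (intro borel_measurable_prod measurable_compose[OF _ F] borel_measurable_diff measurable_component_singleton) (use am in auto)
 have Gb: "\<bar>G i p\<bar> <= 1" for i p
  unfolding G_def abs_prod using Fb by (intro prod_le_1) auto
 have Gi: "G i (path_map (\<lambda>t om. W t om $ i) om) = (\<Prod>j<m. F i j (dW a i j om))" for i om
  unfolding G_def by (intro prod.cong refl) (use am in "auto simp: path_map_apply")
 have iv: "indep_vars (\<lambda>_. borel) (\<lambda>i om. G i (path_map (\<lambda>t om. W t om $ i) om)) UNIV"
  by (rule indep_vars_compose2[OF bm_indep_components]) (rule Gm)
 have "(LINT om|M. (\<Prod>i\<in>UNIV. G i (path_map (\<lambda>t om. W t om $ i) om))) =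
   (\<Prod>i\<in>UNIV. \<integral>om. G i (path_map (\<lambda>t om. W t om $ i) om) \<partial>M)"
 proof (rule indep_vars_lebesgue_integral[OF _ iv])
  fix i show "integrable M (\<lambda>om. G i (path_map (\<lambda>t om. W t om $ i) om))"
   using iv Gb by (intro integrable_const_bound[where B=1]) (auto simp: indep_vars_def)
 qed simp
 also have "\<dots> = (\<Prod>i\<in>UNIV. \<Prod>j<m. \<integral>om. F i j (dW a i j om) \<partial>M)"
  unfolding Gi
 proof (rule prod.cong[OF refl])
  fix i
  have iv: "indep_vars (\<lambda>_. borel) (\<lambda>j om. F i j (dW a i j om)) {..<m}"
   by (rule indep_vars_compose2[OF bm_indep_times'[of a, OF a]]) auto
  show "(LINT om|M. (\<Prod>j<m. F i j (dW a i j om))) = (\<Prod>j<m. \<integral>om. F i j (dW a i j om) \<partial>M)"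
  proof (rule indep_vars_lebesgue_integral[OF _ iv])
   fix j assume "j \<in> {..<m}"
   then show "integrable M (\<lambda>om. F i j (dW a i j om))"
    using iv Fb by (intro integrable_const_bound[where B=1]) (auto simp: indep_vars_def)
  qed simp
 qed
 also have "\<dots> = (\<Prod>i\<in>UNIV. \<Prod>j<m. \<integral>y. normal_density 0 (sqrt (a (Suc j) - a j)) y * F i j y \<partial>lborel)"
 proof (intro prod.cong refl)
  fix i j assume "j \<in> {..<m}"
  then show "(LINT om|M. F i j (dW a i j om)) = (LINT y|lborel. normal_density 0 (sqrt (a (Suc j) - a j)) y * F i j y)"
   using am[of j] a(2)[of j] by (intro distributed_integral[OF bm_increment, symmetric]) auto
 qed
 finally show ?thesis unfolding Gi .
qed

text \<open>In each component the weighted increments add up to a centred normal variable with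
  deviation \<open>v i\<close>. Divided by it, the components are independent and standard normal,
  so the vector has law \<open>gauss\<close>.\<close>

lemma bm_sum_expectation:
 fixes a :: "nat => real" and c :: "'n => nat => real"
 assumes m: "0 < m" and a: "0 <= a 0" "\<And>j. j < m ==> a j < a (Suc j)" and c: "\<And>i j. 0 < c i j"
  and [measurable]: "\<psi> \<in> borel_fun"
 shows "(LINT om|M. \<psi> (\<chi> i. z $ i + (\<Sum>j<m. c i j * (dW a i j om)))) =
  gsm \<psi> z (\<lambda>i. sqrt (\<Sum>j<m. (c i j)\<^sup>2 * (a (Suc j) - a j)))"
proof -
 note P = partial_extend_props[of a m, OF a]
 have am: "0 <= a j" "0 <= a (Suc j)" if "j < m" for j using P(3)[of j] P(3)[of "Suc j"] that by simp_all
 define v where "v i = sqrt (\<Sum>j<m. (c i j)\<^sup>2 * (a (Suc j) - a j))" for i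
 define S where "S i p = (\<Sum>j<m. c i j * (p (a (Suc j)) - p (a j)))" for i and p :: "real => real"
 have v0: "0 < v i" for i
 proof -
  have "0 < (c i 0)\<^sup>2 * (a (Suc 0) - a 0)" using c[of i 0] a(2)[OF m] by simp
  also have "\<dots> <= (\<Sum>j<m. (c i j)\<^sup>2 * (a (Suc j) - a j))"
   using m a(2) less_imp_le by (intro member_le_sum) (auto intro!: mult_nonneg_nonneg simp: less_imp_le)
  finally show ?thesis by (simp add: v_def)
 qed
 have Sm: "S i \<in> borel_measurable path_space" for i
  unfolding S_def by (intro borel_measurable_sum borel_measurable_times borel_measurable_const borel_measurable_diff measurable_component_singleton) (use am in auto)
 define X where "X i om = S i (path_map (\<lambda>t om. W t om $ i) om) / v i" for i om
 have SX: "S i (path_map (\<lambda>t om. W t om $ i) om) = (\<Sum>j<m. c i j * (dW a i j om))" for i om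
  unfolding S_def by (intro sum.cong refl) (use am in "auto simp: path_map_apply")
 have iv: "indep_vars (\<lambda>_. borel) X UNIV"
  unfolding X_def[abs_def]
  by (rule indep_vars_compose2[OF bm_indep_components, where Y="\<lambda>i p. S i p / v i"])
   (intro borel_measurable_divide Sm borel_measurable_const)
 have dist: "distributed M lborel (X i) std_normal_density" for i
 proof -
  have "distributed M lborel (\<lambda>om. \<Sum>j\<in>{..<m}. c i j * (dW a i j om))
    (normal_density (\<Sum>j\<in>{..<m}. 0) (sqrt (\<Sum>j\<in>{..<m}. (c i j * sqrt (a (Suc j) - a j))\<^sup>2)))"
  proof (rule sum_indep_normal)
   show "indep_vars (\<lambda>_. borel) (\<lambda>j om. c i j * (dW a i j om)) {..<m}"
    by (rule indep_vars_compose2[OF bm_indep_times'[of a, OF a]]) auto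
   fix j assume j: "j \<in> {..<m}"
   show "0 < c i j * sqrt (a (Suc j) - a j)" using c a(2) j by auto
   have "distributed M lborel (\<lambda>om. 0 + c i j * (dW a i j om))
     (normal_density (0 + c i j * 0) (\<bar>c i j\<bar> * sqrt (a (Suc j) - a j)))"
    using j am[of j] a(2)[of j] c[of i j] by (intro normal_density_affine[OF bm_increment]) auto
   then show "distributed M lborel (\<lambda>om. c i j * (dW a i j om)) (normal_density 0 (c i j * sqrt (a (Suc j) - a j)))"
    using c[of i j] by simp
  qed (use m in auto)
  moreover have "sqrt (\<Sum>j\<in>{..<m}. (c i j * sqrt (a (Suc j) - a j))\<^sup>2) = v i"
   unfolding v_def using a(2) by (intro arg_cong[where f=sqrt] sum.cong refl) (auto simp: power_mult_distrib less_imp_le)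
  ultimately have "distributed M lborel (\<lambda>om. S i (path_map (\<lambda>t om. W t om $ i) om)) (normal_density 0 (v i))"
   by (simp add: SX)
  moreover have "X i = (\<lambda>om. (S i (path_map (\<lambda>t om. W t om $ i) om) - 0) / v i)"
   by (rule ext) (simp add: X_def)
  ultimately show ?thesis
   using normal_standard_normal_convert[OF v0[of i], of "\<lambda>om. S i (path_map (\<lambda>t om. W t om $ i) om)" 0] by (simp add: X_def)
 qed
 have [measurable]: "X i \<in> borel_measurable M" for i using dist[of i] by (simp add: distributed_def)
 have D: "distr M borel (\<lambda>om. \<chi> i. X i om) = gauss"
  by (rule indep_std_normal_distr[OF iv dist])
 have "gsm \<psi> z v = (LINT g|(distr M borel (\<lambda>om. \<chi> i. X i om)). \<psi> (gmap z v g))"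
  unfolding D gsm_def ..
 also have "\<dots> = (LINT om|M. \<psi> (gmap z v (\<chi> i. X i om)))"
  by (rule integral_distr) measurable
 also have "\<dots> = (LINT om|M. \<psi> (\<chi> i. z $ i + (\<Sum>j<m. c i j * (dW a i j om))))"
  using v0 by (simp add: gmap_def X_def SX less_imp_neq[symmetric])
 finally show ?thesis by (simp add: v_def[abs_def])
qed

lemma L_strict_AE:
 assumes "0 <= \<tau> 0" "\<And>j. j < m ==> \<tau> j < \<tau> (Suc j)"
 shows "AE om in M. \<forall>j<m. L (\<tau> j) om < L (\<tau> (Suc j)) om"
proof -
 note P = partial_extend_props[of \<tau> m, OF assms]
 have "AE om in M. j < m \<longrightarrow> L (\<tau> j) om < L (\<tau> (Suc j)) om" for j
 proof (cases "j < m")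
  case True
  then have "AE om in M. 0 < dL \<tau> j om"
   using P(3)[of j] assms(2)[of j] by (intro L_increment_pos_AE) auto
  then show ?thesis by eventually_elim simp
 qed simp
 then show ?thesis by (subst AE_all_countable) auto
qed

text \<open>\<open>L\<close> is frozen by independence, so that functionals of increments of \<open>W\<^sub>L\<close> reduce to functionals of Brownian
 increments between the times \<open>L (\<tau> j)\<close>.\<close>

lemma increment_functional_expectation:
 fixes \<tau> :: "nat => real" and \<Phi> :: "('n => nat => real) => real"
 assumes \<tau>: "0 <= \<tau> 0" "\<And>j. j < m ==> \<tau> j < \<tau> (Suc j)"
  and m1: "(\<lambda>x. \<Phi> (\<lambda>i j. wl i (fst x) (snd x (\<tau> (Suc j))) - wl i (fst x) (snd x (\<tau> j)))) \<in> borel_measurable (path_space \<Otimes>\<^sub>M path_space)"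
  and m2: "\<And>a. (\<And>j. j <= m ==> 0 <= a j) ==> (\<lambda>om. \<Phi> (\<lambda>i j. dW a i j om)) \<in> borel_measurable M"
  and cong: "\<And>d d'. (\<And>i j. j < m ==> d i j = d' i j) ==> \<Phi> d = \<Phi> d'" and K: "\<And>d. \<bar>\<Phi> d\<bar> <= K"
  and \<kappa>: "\<And>a. 0 <= a 0 ==> (\<And>j. j < m ==> a j < a (Suc j)) ==> (LINT om|M. \<Phi> (\<lambda>i j. dW a i j om)) = \<kappa> a"
  and \<kappa>m: "(\<lambda>om. \<kappa> (\<lambda>j. L (\<tau> j) om)) \<in> borel_measurable M"
 shows "(LINT om|M. \<Phi> (\<lambda>i j. dNW \<tau> i j om)) = (LINT om|M. \<kappa> (\<lambda>j. L (\<tau> j) om))"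
proof -
 note P = partial_extend_props[of \<tau> m, OF \<tau>]
 have \<tau>0: "0 <= \<tau> j" "0 <= \<tau> (Suc j)" if "j < m" for j using P(3)[of j] P(3)[of "Suc j"] that by simp_all
 define \<Psi> where "\<Psi> x = \<Phi> (\<lambda>i j. wl i (fst x) (snd x (\<tau> (Suc j))) - wl i (fst x) (snd x (\<tau> j)))" for x
 have \<Psi>m: "\<Psi> \<in> borel_measurable (path_space \<Otimes>\<^sub>M path_space)" unfolding \<Psi>_def by (rule m1)
 have "(LINT om|M. \<Phi> (\<lambda>i j. dNW \<tau> i j om)) = (LINT om|M. \<Psi> (path_map W om, path_map L om))"
  unfolding \<Psi>_def NW_def
  by (intro Bochner_Integration.integral_cong refl cong) (use \<tau>0 in "auto simp: path_map_apply")
 also have "\<dots> = (LINT om'|M. (LINT om|M. \<Psi> (path_map W om, path_map L om')))"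
  by (rule disintegrate[OF \<Psi>m, of K]) (simp add: \<Psi>_def K)
 also have "\<dots> = (LINT om|M. \<kappa> (\<lambda>j. L (\<tau> j) om))"
 proof (rule integral_cong_AE[OF _ \<kappa>m])
  have "(\<lambda>l. \<integral>om. \<Psi> (path_map W om, l) \<partial>M) \<in> borel_measurable path_space"
  proof (rule borel_measurable_lebesgue_integral)
   show "(\<lambda>(l, om). \<Psi> (path_map W om, l)) \<in> borel_measurable (path_space \<Otimes>\<^sub>M M)"
    unfolding split_beta' by (rule measurable_compose[OF _ \<Psi>m]) measurable
  qed
  then show "(\<lambda>om'. \<integral>om. \<Psi> (path_map W om, path_map L om') \<partial>M) \<in> borel_measurable M"
   by (rule measurable_compose[OF pathL])
  have "AE om in M. \<forall>j<m. L (\<tau> j) om < L (\<tau> (Suc j)) om"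
   by (rule L_strict_AE[of \<tau>]) (fact \<tau>)+
  then show "AE om' in M. (LINT om|M. \<Psi> (path_map W om, path_map L om')) = \<kappa> (\<lambda>j. L (\<tau> j) om')"
   using L_nonneg_AE
  proof eventually_elim
   case (elim om')
   define a where "a j = L (\<tau> j) om'" for j
   have a: "0 <= a 0" "\<And>j. j < m ==> a j < a (Suc j)" using elim \<tau>(1) by (auto simp: a_def)
   have a0: "0 <= a j" if "j <= m" for j using partial_extend_props(3)[of a m, OF a that] .
   have "(LINT om|M. \<Psi> (path_map W om, path_map L om')) = (LINT om|M. \<Phi> (\<lambda>i j. dW a i j om))"
   proof (rule integral_cong_AE[OF _ m2[OF a0]])
    have "path_map L om' \<in> space path_space" by (simp add: path_map_def space_PiM)
    then have "(\<lambda>om. (path_map W om, path_map L om')) \<in> measurable M (path_space \<Otimes>\<^sub>M path_space)" by measurable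
    then show "(\<lambda>om. \<Psi> (path_map W om, path_map L om')) \<in> borel_measurable M"
     by (rule measurable_compose[OF _ \<Psi>m])
    show "AE om in M. \<Psi> (path_map W om, path_map L om') = \<Phi> (\<lambda>i j. dW a i j om)"
     using W_continuous_AE
    proof eventually_elim
     case (elim om)
     have "continuous_on {0..} (\<lambda>t. path_map W om t $ i)" for i
      using elim by (intro path_map_continuous) blast
     note wc = wl_continuous[OF this]
     show ?case
      unfolding \<Psi>_def fst_conv snd_conv
      by (intro cong) (use \<tau>0 a0 in "auto simp: path_map_apply wc a_def[symmetric]")
    qed
   qed auto
   also have "\<dots> = \<kappa> a" by (rule \<kappa>[OF a])
   finally show ?case by (simp add: a_def[abs_def])
  qed
 qed
 finally show ?thesis .
qed

lemma wl_path_measurable: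
 assumes "0 <= t"
 shows "(\<lambda>x. wl i (fst x) (snd x t)) \<in> borel_measurable (path_space \<Otimes>\<^sub>M path_space)"
 using assms by (intro wl_measurable measurable_fst measurable_compose[OF measurable_snd measurable_component_singleton]) auto

lemma noise_sum_expectation:
 fixes \<tau> :: "nat => real" and c :: "'n => nat => real"
 assumes m: "0 < m" and \<tau>: "0 <= \<tau> 0" "\<And>j. j < m ==> \<tau> j < \<tau> (Suc j)" and c: "\<And>i j. 0 < c i j"
  and \<psi>: "\<psi> \<in> bounded_borel"
 shows "(LINT om|M. \<psi> (\<chi> i. z $ i + (\<Sum>j<m. c i j * (dNW \<tau> i j om)))) =
  (LINT om|M. gsm \<psi> z (\<lambda>i. sqrt (\<Sum>j<m. (c i j)\<^sup>2 * (dL \<tau> j om))))"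
proof -
 note P = partial_extend_props[of \<tau> m, OF \<tau>]
 have \<tau>0: "0 <= \<tau> j" "0 <= \<tau> (Suc j)" if "j < m" for j using P(3)[of j] P(3)[of "Suc j"] that by simp_all
 obtain K where K: "\<And>x. \<bar>\<psi> x\<bar> <= K" using bounded_borelD[OF \<psi>] by blast
 have \<psi>m: "\<psi> \<in> borel_fun" by (rule bounded_borel_measurable[OF \<psi>])
 note mi = measurable_compose[OF _ \<psi>m] measurable_vec_lambda_borel borel_measurable_add borel_measurable_sum
  borel_measurable_times borel_measurable_const borel_measurable_diff
 show ?thesis
 proof (rule increment_functional_expectation[where \<Phi>="\<lambda>d. \<psi> (\<chi> i. z $ i + (\<Sum>j<m. c i j * d i j))" and m=m and K=K
    and \<kappa>="\<lambda>a. gsm \<psi> z (\<lambda>i. sqrt (\<Sum>j<m. (c i j)\<^sup>2 * (a (Suc j) - a j)))"])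
  show "(\<lambda>x. \<psi> (\<chi> i. z $ i + (\<Sum>j<m. c i j * (wl i (fst x) (snd x (\<tau> (Suc j))) - wl i (fst x) (snd x (\<tau> j))))))
   \<in> borel_measurable (path_space \<Otimes>\<^sub>M path_space)"
   using \<tau>0 by (intro mi wl_path_measurable) auto
  show "(\<lambda>om. \<psi> (\<chi> i. z $ i + (\<Sum>j<m. c i j * (dW a i j om)))) \<in> borel_measurable M"
   if "\<And>j. j <= m ==> 0 <= a j" for a
   using that by (intro mi W_comp_measurable) auto
  show "\<psi> (\<chi> i. z $ i + (\<Sum>j<m. c i j * d i j)) = \<psi> (\<chi> i. z $ i + (\<Sum>j<m. c i j * d' i j))"
   if "\<And>i j. j < m ==> d i j = d' i j" for d d'
   using that by simp
  have "\<And>j. j < m ==> L (\<tau> (Suc j)) \<in> borel_measurable M" "\<And>j. j < m ==> L (\<tau> j) \<in> borel_measurable M"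
   using \<tau>0 by (auto intro: L_measurable)
  then show "(\<lambda>om. gsm \<psi> z (\<lambda>i. sqrt (\<Sum>j<m. (c i j)\<^sup>2 * (dL \<tau> j om)))) \<in> borel_measurable M"
   by (intro gs_measurable(1) measurable_compose[OF _ borel_measurable_sqrt] mi(4-7)) (auto simp: \<psi>m)
  show "(LINT om|M. \<psi> (\<chi> i. z $ i + (\<Sum>j<m. c i j * (dW a i j om)))) =
    gsm \<psi> z (\<lambda>i. sqrt (\<Sum>j<m. (c i j)\<^sup>2 * (a (Suc j) - a j)))"
   if "0 <= a 0" "\<And>j. j < m ==> a j < a (Suc j)" for a
   by (rule bm_sum_expectation[OF m that c \<psi>m])
 qed (use \<tau> K in auto)
qed

text \<open>The conditional expectation of a product over the components of one noise increment,
  given that L grows by \<open>a\<close> over the interval.\<close>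

definition Gk :: "('n => real => real) => real => real" where
 "Gk F a = (\<Prod>i\<in>UNIV. \<integral>y. normal_density 0 (sqrt a) y * F i y \<partial>lborel)"

lemma Gk_measurable [measurable]:
 assumes [measurable]: "\<And>i. F i \<in> borel_fun"
 shows "Gk F \<in> borel_fun"
 unfolding Gk_def normal_density_def by measurable

lemma Gk_bound:
 assumes F: "\<And>i. F i \<in> borel_fun" "\<And>i y. \<bar>F i y\<bar> <= 1" and a: "0 < a"
 shows "\<bar>Gk F a\<bar> <= 1"
proof -
 have "\<bar>LINT y|lborel. normal_density 0 (sqrt a) y * F i y\<bar> <= 1" for i
 proof -
  note F(1)[measurable]
  have nd: "integrable lborel (normal_density 0 (sqrt a))" using a by (intro integrable_normal_density) simp
  have i: "integrable lborel (\<lambda>y. normal_density 0 (sqrt a) y * F i y)"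
   by (rule Bochner_Integration.integrable_bound[OF nd]) (use F(2) in "auto simp: abs_mult intro!: mult_left_le")
  have "\<bar>LINT y|lborel. normal_density 0 (sqrt a) y * F i y\<bar> <= (LINT y|lborel. \<bar>normal_density 0 (sqrt a) y * F i y\<bar>)"
   by (rule integral_abs_bound)
  also have "\<dots> <= (LINT y|lborel. normal_density 0 (sqrt a) y)"
   by (rule integral_mono_AE) (use integrable_abs[OF i] nd F(2) in "auto simp: abs_mult intro!: mult_left_le")
  also have "\<dots> = 1" using a by (intro integral_normal_density) simp
  finally show ?thesis .
 qed
 then show ?thesis unfolding Gk_def abs_prod by (intro prod_le_1) auto
qed

lemma noise_product_expectation:
 fixes \<tau> :: "nat => real" and F :: "'n => nat => real => real"
 assumes \<tau>: "0 <= \<tau> 0" "\<And>j. j < m ==> \<tau> j < \<tau> (Suc j)"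
  and F [measurable]: "\<And>i j. F i j \<in> borel_fun" and Fb: "\<And>i j y. \<bar>F i j y\<bar> <= 1"
 shows "(LINT om|M. (\<Prod>i\<in>UNIV. \<Prod>j<m. F i j (dNW \<tau> i j om))) =
  (LINT om|M. (\<Prod>j<m. Gk (\<lambda>i. F i j) (dL \<tau> j om)))"
proof -
 have \<tau>0: "0 <= \<tau> j" "0 <= \<tau> (Suc j)" if "j < m" for j
  using partial_extend_props(3)[of \<tau> m j] partial_extend_props(3)[of \<tau> m "Suc j"] \<tau> that by simp_all
 note mi = borel_measurable_prod measurable_compose[OF _ F] borel_measurable_diff
 show ?thesis
 proof (rule increment_functional_expectation[where \<Phi>="\<lambda>d. \<Prod>i\<in>UNIV. \<Prod>j<m. F i j (d i j)" and m=m and K=1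
    and \<kappa>="\<lambda>a. \<Prod>j<m. Gk (\<lambda>i. F i j) (a (Suc j) - a j)"])
  show "(\<lambda>x. \<Prod>i\<in>UNIV. \<Prod>j<m. F i j (wl i (fst x) (snd x (\<tau> (Suc j))) - wl i (fst x) (snd x (\<tau> j))))
   \<in> borel_measurable (path_space \<Otimes>\<^sub>M path_space)"
   using \<tau>0 by (intro mi wl_path_measurable) auto
  show "(\<lambda>om. \<Prod>i\<in>UNIV. \<Prod>j<m. F i j (dW a i j om)) \<in> borel_measurable M"
   if "\<And>j. j <= m ==> 0 <= a j" for a
   using that by (intro mi W_comp_measurable) auto
  show "\<bar>\<Prod>i\<in>UNIV. \<Prod>j<m. F i j (d i j)\<bar> <= 1" for d
   unfolding abs_prod using Fb by (intro prod_le_1 conjI prod_nonneg) auto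
  show "(LINT om|M. (\<Prod>i\<in>UNIV. \<Prod>j<m. F i j (dW a i j om))) = (\<Prod>j<m. Gk (\<lambda>i. F i j) (a (Suc j) - a j))"
   if "0 <= a 0" "\<And>j. j < m ==> a j < a (Suc j)" for a
   using bm_product_expectation[of a m F, OF that F Fb] prod.swap unfolding Gk_def by simp
  have "\<And>j. j < m ==> L (\<tau> (Suc j)) \<in> borel_measurable M" "\<And>j. j < m ==> L (\<tau> j) \<in> borel_measurable M"
   using \<tau>0 by (auto intro: L_measurable)
  then show "(\<lambda>om. \<Prod>j<m. Gk (\<lambda>i. F i j) (dL \<tau> j om)) \<in> borel_measurable M"
   by (intro borel_measurable_prod measurable_compose[OF _ Gk_measurable[OF F]] borel_measurable_diff) auto
 qed (use \<tau> in auto)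
qed

text \<open>After averaging over W, the factor of interval j depends on L only through its increment
  there, and increments of L over disjoint intervals are independent. Each factor is then converted
  back into an expectation over the noise.\<close>

lemma noise_product_split:
 fixes \<tau> :: "nat => real" and F :: "'n => nat => real => real"
 assumes \<tau>: "0 <= \<tau> 0" "\<And>j. j < m ==> \<tau> j < \<tau> (Suc j)"
  and F: "\<And>i j. F i j \<in> borel_fun" and Fb: "\<And>i j y. \<bar>F i j y\<bar> <= 1"
 shows "(LINT om|M. (\<Prod>j<m. \<Prod>i\<in>UNIV. F i j (dNW \<tau> i j om))) =
  (\<Prod>j<m. \<integral>om. (\<Prod>i\<in>UNIV. F i j (dNW \<tau> i j om)) \<partial>M)"
proof -
 note P = partial_extend_props[of \<tau> m]
 have \<tau>0: "0 <= \<tau> j" "0 <= \<tau> (Suc j)" if "j < m" for j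
  using partial_extend_props(3)[of \<tau> m j] partial_extend_props(3)[of \<tau> m "Suc j"] \<tau> that by simp_all
 have "indep_vars (\<lambda>_. borel) (\<lambda>j om. L (partial_extend m \<tau> (Suc j)) om - L (partial_extend m \<tau> j) om) {..<m}"
 proof -
  have "0 <= partial_extend m \<tau> 0" "mono (partial_extend m \<tau>)" using P(1,2) \<tau> by auto
  then show ?thesis
   using subord unfolding subordinator_def levy_process_def independent_increments_def by blast
 qed
 then have iv: "indep_vars (\<lambda>_. borel) (\<lambda>j om. dL \<tau> j om) {..<m}"
  by (rule indep_vars_cong[THEN iffD1, rotated -1]) (auto simp: P \<tau>)
 have iv': "indep_vars (\<lambda>_. borel) (\<lambda>j om. Gk (\<lambda>i. F i j) (dL \<tau> j om)) {..<m}"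
  by (rule indep_vars_compose2[OF iv]) (rule Gk_measurable[OF F])
 have "(LINT om|M. (\<Prod>j<m. \<Prod>i\<in>UNIV. F i j (dNW \<tau> i j om))) =
   (LINT om|M. (\<Prod>j<m. Gk (\<lambda>i. F i j) (dL \<tau> j om)))"
  by (subst prod.swap) (rule noise_product_expectation[OF \<tau> F Fb])
 also have "\<dots> = (\<Prod>j<m. \<integral>om. Gk (\<lambda>i. F i j) (dL \<tau> j om) \<partial>M)"
 proof (rule indep_vars_lebesgue_integral[OF _ iv'])
  fix j assume j: "j \<in> {..<m}"
  have "AE om in M. 0 < dL \<tau> j om"
   using \<tau>0[of j] \<tau>(2)[of j] j by (intro L_increment_pos_AE) auto
  then have "AE om in M. norm (Gk (\<lambda>i. F i j) (dL \<tau> j om)) <= 1"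
  proof eventually_elim
   case (elim om)
   show ?case unfolding real_norm_def by (rule Gk_bound[OF F Fb elim])
  qed
  moreover have "(\<lambda>om. Gk (\<lambda>i. F i j) (dL \<tau> j om)) \<in> borel_measurable M"
   using iv' j unfolding indep_vars_def by blast
  ultimately show "integrable M (\<lambda>om. Gk (\<lambda>i. F i j) (dL \<tau> j om))"
   by (rule integrable_const_bound)
 qed simp
 also have "\<dots> = (\<Prod>j<m. \<integral>om. (\<Prod>i\<in>UNIV. F i j (dNW \<tau> i j om)) \<partial>M)"
 proof (rule prod.cong[OF refl])
  fix j assume j: "j \<in> {..<m}"
  \<comment> \<open>The product formula for a single interval, with the grid shifted to start at
    \<open>\<tau> j\<close>.\<close>
  show "(LINT om|M. Gk (\<lambda>i. F i j) (dL \<tau> j om)) = (LINT om|M. (\<Prod>i\<in>UNIV. F i j (dNW \<tau> i j om)))"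
   using noise_product_expectation[of "\<lambda>k. \<tau> (j + k)" 1 "\<lambda>i k. F i j"] \<tau>0[of j] \<tau>(2)[of j] F Fb j by simp
 qed
 finally show ?thesis .
qed

text \<open>The components share the clock L and need not be independent of one another, so the
  increments are treated as vectors. Orthants form a generating pi-system whose indicators are
  products over components, the form that \<open>noise_product_split\<close> can factor over
  time.\<close>

lemma noise_indep:
 fixes \<tau> :: "nat => real"
 assumes m: "0 < m" and \<tau>: "0 <= \<tau> 0" "\<And>j. j < m ==> \<tau> j < \<tau> (Suc j)"
 shows "indep_vars (\<lambda>_. borel) (\<lambda>j om. \<chi> i. dNW \<tau> i j om) {..<m}"
proof -
 define D where "D j om = (\<chi> i. dNW \<tau> i j om)" for j om
 have \<tau>0: "0 <= \<tau> j" "0 <= \<tau> (Suc j)" if "j < m" for j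
  using partial_extend_props(3)[of \<tau> m j] partial_extend_props(3)[of \<tau> m "Suc j"] \<tau> that by simp_all
 have Dm: "D j \<in> borel_measurable M" if "j < m" for j
  unfolding D_def[abs_def] using \<tau>0[OF that] by (intro measurable_vec_lambda_borel borel_measurable_diff NW_measurable)
 \<comment> \<open>\<open>indep_vars_finite\<close> asks for the whole space in the generator, and
   no orthant is the whole space.\<close>
 let ?E = "insert UNIV (range (\<lambda>a. {..a::real ^ 'n}))"
 have gen: "sets (borel :: (real ^ 'n) measure) = sigma_sets UNIV ?E"
 proof
  have "sets (borel :: (real ^ 'n) measure) = sigma_sets UNIV (range (\<lambda>a. {..a::real ^ 'n}))"
   unfolding borel_eq_atMost by simp
  then show "sets (borel :: (real ^ 'n) measure) \<subseteq> sigma_sets UNIV ?E"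
   using sigma_sets_mono'[of "range (\<lambda>a. {..a::real ^ 'n})" ?E UNIV] by auto
  have "?E \<subseteq> sets borel" by auto
  then show "sigma_sets UNIV ?E \<subseteq> sets borel"
   using sets.sigma_sets_subset[of ?E borel] by simp
 qed
 have "indep_vars (\<lambda>_. borel) D {..<m} \<longleftrightarrow>
  (\<forall>A\<in>(\<Pi> i\<in>{..<m}. ?E). prob (\<Inter>j\<in>{..<m}. D j -` A j \<inter> space M) = (\<Prod>j\<in>{..<m}. prob (D j -` A j \<inter> space M)))"
 proof (rule indep_vars_finite)
  show "Int_stable ?E"
  proof (rule Int_stableI)
   fix A B assume "A \<in> ?E" "B \<in> ?E"
   moreover have "{..a} \<inter> {..b} = {..inf a b}" for a b :: "real ^ 'n" by auto
   ultimately show "A \<inter> B \<in> ?E" by auto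
  qed
 qed (use m Dm gen in auto)
 moreover have "prob (\<Inter>j\<in>{..<m}. D j -` A j \<inter> space M) = (\<Prod>j\<in>{..<m}. prob (D j -` A j \<inter> space M))"
  if A: "A \<in> (\<Pi> i\<in>{..<m}. ?E)" for A
 proof -
  have "\<exists>f. (\<forall>i. f i \<in> borel_fun) \<and> (\<forall>i y. \<bar>f i y\<bar> <= (1::real)) \<and> (\<forall>x. indicator (A j) x = (\<Prod>i\<in>UNIV. f i (x $ i)))"
   if j: "j < m" for j
  proof -
   have "A j \<in> ?E" using A j by auto
   then consider "A j = UNIV" | a where "A j = {..a}" by auto
   then show ?thesis
   proof cases
    case 1 then show ?thesis by (intro exI[of _ "\<lambda>i y. 1"]) auto
   next
    case (2 a)
    have "indicator {..a} x = (\<Prod>i\<in>UNIV. indicator {..a $ i} (x $ i) :: real)" for x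
    proof (cases "x <= a")
     case False
     then obtain i where "\<not> x $ i <= a $ i" by (auto simp: less_eq_vec_def)
     then have "(\<Prod>i\<in>UNIV. indicator {..a $ i} (x $ i) :: real) = 0" by (intro prod_zero bexI[of _ i]) auto
     with False show ?thesis by simp
    qed (auto simp: less_eq_vec_def indicator_def)
    then show ?thesis using 2 by (intro exI[of _ "\<lambda>i. indicator {..a $ i}"]) (auto split: split_indicator)
   qed
  qed
  then have "\<forall>j. \<exists>f. j < m \<longrightarrow> (\<forall>i. f i \<in> borel_fun) \<and> (\<forall>i y. \<bar>f i y\<bar> <= (1::real)) \<and> (\<forall>x. indicator (A j) x = (\<Prod>i\<in>UNIV. f i (x $ i)))"
   by blast
  then obtain f where f: "\<And>j. j < m ==> (\<forall>i. f j i \<in> borel_fun) \<and> (\<forall>i y. \<bar>f j i y\<bar> <= (1::real)) \<and> (\<forall>x. indicator (A j) x = (\<Prod>i\<in>UNIV. f j i (x $ i)))"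
   by metis
  define F where "F i j = (if j < m then f j i else (\<lambda>_. 0))" for i j
  have Fm: "F i j \<in> borel_fun" "\<bar>F i j y\<bar> <= 1" for i j y using f[of j] by (auto simp: F_def)
  have Am: "A j \<in> sets borel" if "j < m" for j
  proof -
   have "A j \<in> ?E" using A that by auto
   then show ?thesis by auto
  qed
  have ind: "indicator (D j -` A j \<inter> space M) om = (\<Prod>i\<in>UNIV. F i j (dNW \<tau> i j om))"
   if j: "j < m" and om: "om \<in> space M" for j om
  proof -
   have "indicator (D j -` A j \<inter> space M) om = (indicator (A j) (D j om) :: real)" using om by (auto simp: indicator_def)
   also have "\<dots> = (\<Prod>i\<in>UNIV. f j i (D j om $ i))" using f[OF j] by blast
   finally show ?thesis using j by (simp add: F_def D_def)
  qed
  have "prob (\<Inter>j\<in>{..<m}. D j -` A j \<inter> space M) = (LINT om|M. indicator (\<Inter>j\<in>{..<m}. D j -` A j \<inter> space M) om)"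
  proof -
   have "(\<Inter>j\<in>{..<m}. D j -` A j \<inter> space M) \<inter> space M = (\<Inter>j\<in>{..<m}. D j -` A j \<inter> space M)" using m by auto
   then show ?thesis by simp
  qed
  also have "\<dots> = (LINT om|M. (\<Prod>j<m. \<Prod>i\<in>UNIV. F i j (dNW \<tau> i j om)))"
  proof (rule Bochner_Integration.integral_cong[OF refl])
   fix om assume om: "om \<in> space M"
   have "(\<Prod>j<m. \<Prod>i\<in>UNIV. F i j (dNW \<tau> i j om)) = (\<Prod>j<m. indicator (D j -` A j \<inter> space M) om)"
    by (intro prod.cong refl) (use ind om in simp)
   also have "\<dots> = indicator (\<Inter>j\<in>{..<m}. D j -` A j \<inter> space M) om"
   proof (cases "\<forall>j<m. om \<in> D j -` A j \<inter> space M")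
    case False
    then obtain j where "j < m" "om \<notin> D j -` A j \<inter> space M" by auto
    then have "(\<Prod>j<m. indicator (D j -` A j \<inter> space M) om :: real) = 0" by (intro prod_zero bexI[of _ j]) auto
    with False show ?thesis by (auto simp: indicator_def)
   qed (auto simp: indicator_def)
   finally show "indicator (\<Inter>j\<in>{..<m}. D j -` A j \<inter> space M) om = (\<Prod>j<m. \<Prod>i\<in>UNIV. F i j (dNW \<tau> i j om))" by simp
  qed
  also have "\<dots> = (\<Prod>j<m. \<integral>om. (\<Prod>i\<in>UNIV. F i j (dNW \<tau> i j om)) \<partial>M)"
   by (rule noise_product_split[OF \<tau> Fm])
  also have "\<dots> = (\<Prod>j<m. prob (D j -` A j \<inter> space M))"
  proof (rule prod.cong[OF refl])
   fix j assume "j \<in> {..<m}"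
   then have j: "j < m" by simp
   have "(LINT om|M. (\<Prod>i\<in>UNIV. F i j (dNW \<tau> i j om))) = (LINT om|M. indicator (D j -` A j \<inter> space M) om)"
    by (rule Bochner_Integration.integral_cong[OF refl]) (use ind j in simp)
   then show "(LINT om|M. (\<Prod>i\<in>UNIV. F i j (dNW \<tau> i j om))) = prob (D j -` A j \<inter> space M)"
    by (simp add: Int_absorb2)
  qed
  finally show ?thesis .
 qed
 ultimately show ?thesis unfolding D_def by blast
qed

end

section \<open>Linear equations driven by a path\<close>

definition ldiag :: "('n::finite => real) => real ^ 'n => real ^ 'n" where
 "ldiag lam z = (\<chi> i. lam i * z $ i)"

text \<open>One path of dX = (g(t, X) - diag(lam) X) dt + dN. Both equations of the theorem have
  this form along almost every path, with g = f for Z and g = B0 for X.\<close>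

definition psol :: "('n::finite => real) => real => (real => real ^ 'n => real ^ 'n) => real => real ^ 'n =>
  (real => real ^ 'n) => (real => real ^ 'n) => bool" where
 "psol lam T g s x N X \<longleftrightarrow> cadlag_on {s..T} X \<and>
   (\<forall>t\<in>{s..T}. X t = x + (LBINT r:{s<..t}. g r (X r) - ldiag lam (X r)) + (N t - N s))"

lemma bounded_linear_ldiag: "bounded_linear (ldiag lam)"
 unfolding linear_conv_bounded_linear[symmetric]
 by (rule linearI) (auto simp: ldiag_def vec_eq_iff algebra_simps)

lemma continuous_clip: "continuous_on UNIV (clip a b)"
 unfolding clip_def by (intro continuous_intros)

lemma continuous_clip_first:
 fixes g :: "real => 'a::topological_space => 'b::topological_space"
 assumes "0 <= T" "continuous_on ({0..T} \<times> UNIV) (\<lambda>(t, x). g t x)"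
 shows "continuous_on UNIV (\<lambda>(t, x). g (clip 0 T t) x)"
proof -
 have c: "continuous_on UNIV (\<lambda>z::real \<times> 'a. (clip 0 T (fst z), snd z))"
  by (intro continuous_intros continuous_on_compose2[OF continuous_clip]) auto
 have "continuous_on UNIV (\<lambda>z. (\<lambda>(t, x). g t x) (clip 0 T (fst z), snd z))"
  by (rule continuous_on_compose2[OF assms(2) c]) (use assms(1) in "auto simp: clip_def")
 then show ?thesis by (simp add: split_beta')
qed

lemma indefinite_integral_lipschitz:
 fixes h :: "real => 'b::{banach, second_countable_topology}"
 assumes h: "set_integrable lborel {a<..b} h" and K: "\<And>v. v \<in> {a<..b} ==> norm (h v) <= K"
  and uv: "a <= u" "u <= v" "v <= b"
 shows "norm ((LBINT r:{a<..v}. h r) - (LBINT r:{a<..u}. h r)) <= K * (v - u)"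
proof -
 have hv: "set_integrable lborel {a<..v} h" using uv by (intro set_integrable_subset[OF h]) auto
 note S = set_integral_Ioc_split[OF uv(1,2) hv]
 have "norm (LBINT r:{u<..v}. h r) <= (LBINT r:{u<..v}. norm (h r))" by (rule set_integral_norm_bound[OF S(3)])
 also have "\<dots> <= (LBINT r:{u<..v}. K)"
  using uv by (intro set_integral_mono set_integrable_norm S(3) set_integral_const_Ioc(1) K) auto
 also have "\<dots> = K * (v - u)" using uv by (simp add: set_integral_const_Ioc(2))
 finally show ?thesis using S(1) by simp
qed

lemma indefinite_integral_continuous:
 fixes h :: "real => 'b::{banach, second_countable_topology}"
 assumes h: "set_integrable lborel {a<..b} h" and K: "\<And>v. v \<in> {a<..b} ==> norm (h v) <= K"
 shows "continuous_on {a..b} (\<lambda>v. LBINT r:{a<..v}. h r)"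
proof (rule continuous_onI)
 fix x e :: real assume x: "x \<in> {a..b}" and e: "0 < e"
 let ?H = "\<lambda>v. LBINT r:{a<..v}. h r"
 have l: "dist (?H x') (?H x) <= \<bar>K\<bar> * \<bar>x' - x\<bar>" if "x' \<in> {a..b}" for x'
 proof (cases "x <= x'")
  case True
  have "dist (?H x') (?H x) <= K * (x' - x)"
   unfolding dist_norm using x that True by (intro indefinite_integral_lipschitz[OF h K]) auto
  also have "\<dots> <= \<bar>K\<bar> * \<bar>x' - x\<bar>" using True by (intro mult_mono) auto
  finally show ?thesis .
 next
  case False
  have "dist (?H x') (?H x) <= K * (x - x')"
   unfolding dist_norm norm_minus_commute[of "?H x'"] using x that False by (intro indefinite_integral_lipschitz[OF h K]) auto
  also have "\<dots> <= \<bar>K\<bar> * \<bar>x' - x\<bar>" using False by (intro mult_mono) auto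
  finally show ?thesis .
 qed
 show "\<exists>d>0. \<forall>x'\<in>{a..b}. dist x' x < d \<longrightarrow> dist (?H x') (?H x) <= e"
 proof (intro exI[of _ "e / (\<bar>K\<bar> + 1)"] conjI ballI impI)
  show "0 < e / (\<bar>K\<bar> + 1)" using e by (simp add: add_nonneg_pos)
  fix x' assume x': "x' \<in> {a..b}" "dist x' x < e / (\<bar>K\<bar> + 1)"
  have "\<bar>K\<bar> * \<bar>x' - x\<bar> <= (\<bar>K\<bar> + 1) * \<bar>x' - x\<bar>" by (intro mult_right_mono) auto
  also have "\<dots> <= e"
   using x'(2) by (simp add: dist_real_def less_divide_eq mult.commute add_nonneg_pos less_imp_le)
  finally show "dist (?H x') (?H x) <= e" using l[OF x'(1)] by simp
 qed
qed

lemma set_integral_vec_nth: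
 fixes h :: "real => real ^ 'n::finite"
 assumes "set_integrable lborel S h"
 shows "set_integrable lborel S (\<lambda>v. h v $ i)" "(LBINT v:S. h v) $ i = (LBINT v:S. h v $ i)"
proof -
 have bl: "bounded_linear (\<lambda>x::real ^ 'n. x $ i)" by (rule bounded_linear_vec_nth)
 show "set_integrable lborel S (\<lambda>v. h v $ i)"
  using integrable_bounded_linear[OF bl assms[unfolded set_integrable_def]] by (simp add: set_integrable_def)
 show "(LBINT v:S. h v) $ i = (LBINT v:S. h v $ i)"
  using integral_bounded_linear[OF bl assms[unfolded set_integrable_def]] by (simp add: set_lebesgue_integral_def)
qed

locale path_sol =
 fixes lam :: "'n::finite => real" and T :: real and g :: "real => real ^ 'n => real ^ 'n" and s x N X
 assumes s: "0 <= s" "s <= T"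
  and gc: "continuous_on ({0..T} \<times> UNIV) (\<lambda>(t, x). g t x)"
  and sol: "psol lam T g s x N X"
begin

lemma cadlag: "cadlag_on {s..T} X"
 and eq: "t \<in> {s..T} ==> X t = x + (LBINT r:{s<..t}. g r (X r) - ldiag lam (X r)) + (N t - N s)"
 using sol by (auto simp: psol_def)

lemma X_s: "X s = x"
 using eq[of s] s by (simp add: set_lebesgue_integral_def)

lemma rc: "v \<in> {s..T} ==> continuous (at v within {v..T}) X"
 by (rule cadlag_on_right_cont[OF cadlag])

lemma X_clip_measurable: "(\<lambda>v. X (clip s T v)) \<in> borel_fun"
 by (rule right_cont_measurable, rule clip_right_cont) (use s rc in auto)

lemma gX_measurable: "(\<lambda>v. g (clip 0 T v) (X (clip s T v))) \<in> borel_fun"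
proof -
 have "(\<lambda>(t, x). g (clip 0 T t) x) \<in> borel_fun2"
  using borel_measurable_continuous_onI[OF continuous_clip_first[OF _ gc]] s by (simp add: borel_prod)
 from measurable_compose[OF _ this, of "\<lambda>v. (v, X (clip s T v))" borel] X_clip_measurable
 show ?thesis by simp
qed

lemma clip_eq: "v \<in> {s..T} ==> clip s T v = v" "v \<in> {s..T} ==> clip 0 T v = v"
 using s by (auto simp: clip_def)

lemma bounds: "\<exists>K. \<forall>v\<in>{s..T}. norm (X v) <= K \<and> norm (g v (X v)) <= K"
proof -
 obtain K where K: "\<forall>v\<in>{s..T}. norm (X v) <= K" using cadlag_on_bounded[OF cadlag] by blast
 have "compact ((\<lambda>(t, x). g t x) ` ({0..T} \<times> cball 0 K))"
  by (intro compact_continuous_image continuous_on_subset[OF gc] compact_Times) auto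
 then obtain K' where K': "\<forall>z\<in>(\<lambda>(t, x). g t x) ` ({0..T} \<times> cball 0 K). norm z <= K'"
  using compact_imp_bounded bounded_iff by metis
 show ?thesis
 proof (intro exI[of _ "max K K'"] ballI conjI)
  fix v assume v: "v \<in> {s..T}"
  show "norm (X v) <= max K K'" using K v by (simp add: max.coboundedI1)
  have "(\<lambda>(t, x). g t x) (v, X v) \<in> (\<lambda>(t, x). g t x) ` ({0..T} \<times> cball 0 K)"
   using v K s by (intro imageI) auto
  then have "norm (g v (X v)) <= K'" using K' by auto
  then show "norm (g v (X v)) <= max K K'" by (simp add: max.coboundedI2)
 qed
qed

lemma integrable: "set_integrable lborel {s<..T} X" "set_integrable lborel {s<..T} (\<lambda>v. g v (X v))"
proof -
 obtain K where K: "\<forall>v\<in>{s..T}. norm (X v) <= K \<and> norm (g v (X v)) <= K" using bounds by blast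
 note [measurable] = X_clip_measurable gX_measurable
 have "(\<lambda>v. indicator {s<..T} v *\<^sub>R X (clip s T v)) \<in> borel_fun"
  "(\<lambda>v. indicator {s<..T} v *\<^sub>R g (clip 0 T v) (X (clip s T v))) \<in> borel_fun" by measurable
 moreover have "(\<lambda>v. indicator {s<..T} v *\<^sub>R X (clip s T v)) = (\<lambda>v. indicator {s<..T} v *\<^sub>R X v)"
  "(\<lambda>v. indicator {s<..T} v *\<^sub>R g (clip 0 T v) (X (clip s T v))) = (\<lambda>v. indicator {s<..T} v *\<^sub>R g v (X v))"
  by (auto simp: fun_eq_iff clip_eq split: split_indicator)
 ultimately have m: "set_borel_measurable lborel {s<..T} X" "set_borel_measurable lborel {s<..T} (\<lambda>v. g v (X v))"
  by (simp_all add: set_borel_measurable_def)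
 show "set_integrable lborel {s<..T} X" "set_integrable lborel {s<..T} (\<lambda>v. g v (X v))"
  using K by (auto intro!: set_integrable_bounded_Ioc[where K=K] m)
qed

lemma integrable_drift: "set_integrable lborel {s<..T} (\<lambda>r. g r (X r) - ldiag lam (X r))"
proof -
 have "set_integrable lborel {s<..T} (\<lambda>v. ldiag lam (X v))"
  using integrable_bounded_linear[OF bounded_linear_ldiag integrable(1)[unfolded set_integrable_def], of lam]
  by (simp add: set_integrable_def linear_cmul[OF bounded_linear.linear[OF bounded_linear_ldiag]])
 then show ?thesis using integrable(2) by (intro set_integral_diff(1))
qed

lemma increment:
 assumes "s <= r" "r <= v" "v <= T"
 shows "X v $ i = X r $ i + (LBINT u:{r<..v}. g u (X u) $ i - lam i * X u $ i) + (N v $ i - N r $ i)"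
proof -
 let ?h = "\<lambda>r. g r (X r) - ldiag lam (X r)"
 have hv: "set_integrable lborel {s<..v} ?h" using assms by (intro set_integrable_subset[OF integrable_drift]) auto
 note S = set_integral_Ioc_split[OF assms(1,2) hv]
 have "X v = X r + (LBINT u:{r<..v}. ?h u) + (N v - N r)"
  using eq[of v] eq[of r] S(1) assms by simp
 then have "X v $ i = X r $ i + (LBINT u:{r<..v}. ?h u) $ i + (N v $ i - N r $ i)" by simp
 then show ?thesis using set_integral_vec_nth(2)[OF S(3), of i] by (simp add: ldiag_def)
qed

lemma integrable_comp:
 assumes "s <= r" "v <= T"
 shows "set_integrable lborel {r<..v} (\<lambda>u. X u $ i)" "set_integrable lborel {r<..v} (\<lambda>u. g u (X u) $ i)"
 using assms by (auto intro!: set_integral_vec_nth(1) set_integrable_subset[OF integrable(1)] set_integrable_subset[OF integrable(2)])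

end

text \<open>The common noise cancels in the difference, which solves a linear equation in integrated
  form; \<open>variation_of_constants\<close> applies in each coordinate. The starting times and the
  drifts of the two solutions may differ.\<close>

lemma psol_difference:
 fixes X Y :: "real => real ^ 'n::finite"
 assumes "path_sol lam T g s x N X" "path_sol lam T g' s' x' N Y"
  and r: "s <= r" "s' <= r" "r <= q" "q <= T"
 shows "X q $ i - Y q $ i = exp (- (lam i * (q - r))) * (X r $ i - Y r $ i) +
   (LBINT v:{r<..q}. exp (- (lam i * (q - v))) * (g v (X v) $ i - g' v (Y v) $ i))"
  and "set_integrable lborel {r<..q} (\<lambda>v. exp (- (lam i * (q - v))) * (g v (X v) $ i - g' v (Y v) $ i))"
proof -
 interpret X: path_sol lam T g s x N X by fact
 interpret Y: path_sol lam T g' s' x' N Y by fact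
 define E where "E v = X v $ i - Y v $ i" for v
 have gi: "set_integrable lborel {r<..q} (\<lambda>v. g v (X v) $ i - g' v (Y v) $ i)"
  using r by (intro set_integral_diff(1) X.integrable_comp Y.integrable_comp) auto
 have Ei: "set_integrable lborel {r<..q} E"
  unfolding E_def using r by (intro set_integral_diff(1) X.integrable_comp Y.integrable_comp) auto
 have E: "E v = E r + (LBINT u:{r<..v}. (g u (X u) $ i - g' u (Y u) $ i) - lam i * E u)" if v: "v \<in> {r..q}" for v
 proof -
  have "(LBINT u:{r<..v}. (g u (X u) $ i - lam i * X u $ i) - (g' u (Y u) $ i - lam i * Y u $ i)) =
   (LBINT u:{r<..v}. g u (X u) $ i - lam i * X u $ i) - (LBINT u:{r<..v}. g' u (Y u) $ i - lam i * Y u $ i)"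
   using r v by (intro set_integral_diff(2) set_integral_diff(1) set_integrable_mult_right X.integrable_comp Y.integrable_comp) auto
  moreover have "(g u (X u) $ i - lam i * X u $ i) - (g' u (Y u) $ i - lam i * Y u $ i) = (g u (X u) $ i - g' u (Y u) $ i) - lam i * E u" for u
   by (simp add: E_def algebra_simps)
  ultimately show ?thesis
   using X.increment[of r v i] Y.increment[of r v i] r v by (simp add: E_def)
 qed
 note V = variation_of_constants[OF r(3) E gi Ei]
 show "X q $ i - Y q $ i = exp (- (lam i * (q - r))) * (X r $ i - Y r $ i) +
   (LBINT v:{r<..q}. exp (- (lam i * (q - v))) * (g v (X v) $ i - g' v (Y v) $ i))"
  using V(1) by (simp add: E_def)
 show "set_integrable lborel {r<..q} (\<lambda>v. exp (- (lam i * (q - v))) * (g v (X v) $ i - g' v (Y v) $ i))"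
  by (rule V(2))
qed

text \<open>J - N has no noise and obeys the variation of constants formula, where the noise appears
  only under a time integral. By Abel summation this integral is the limit of weighted increment
  sums: a pathwise meaning for the stochastic convolution.\<close>

lemma psol_convolution_limit:
 fixes J :: "real => real ^ 'n::finite"
 assumes "path_sol lam T (\<lambda>t _. f t) s x N J"
  and r: "s <= r" "r < q" "q <= T"
  and Nrc: "\<And>v. v \<in> {0..T} ==> continuous (at v within {v..T}) N" and Nb: "\<And>v. v \<in> {0..T} ==> norm (N v) <= K"
 shows "(\<lambda>k. (\<Sum>j<Suc k. exp (- (lam i * (q - gp r q (Suc k) j))) * (N (gp r q (Suc k) (Suc j)) $ i - N (gp r q (Suc k) j) $ i)))
   \<leadsto> J q $ i - exp (- (lam i * (q - r))) * J r $ i - (LBINT v:{r<..q}. exp (- (lam i * (q - v))) * f v $ i)"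
proof -
 interpret J: path_sol lam T "\<lambda>t _. f t" s x N J by fact
 define n where "n v = N v $ i" for v
 have sub: "{r..q} \<subseteq> {0..T}" using J.s r by auto
 have nrc: "continuous (at v within {v..q}) n" if "v \<in> {r..q}" for v
 proof -
  have "continuous (at v within {v..q}) N"
   using Nrc[of v] sub that r by (auto intro: continuous_within_subset)
  then show ?thesis unfolding n_def by (rule continuous_component)
 qed
 have nb: "\<bar>n v\<bar> <= K" if "v \<in> {r..q}" for v
  using Nb[of v] component_le_norm_cart[of "N v" i] sub that unfolding n_def by (meson order_trans subsetD)
 have ni: "set_integrable lborel {r<..q} n"
 proof (rule set_integrable_bounded_Ioc[where K=K])
  show "set_borel_measurable lborel {r<..q} n"
   using nrc r by (intro right_cont_set_measurable) auto
 qed (use nb in auto)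
 \<comment> \<open>Subtracting the noise leaves a path that satisfies an integral equation with
   source f - lam N.\<close>
 define E where "E v = J v $ i - n v" for v
 have gi: "set_integrable lborel {r<..q} (\<lambda>v. f v $ i - lam i * n v)"
  using J.integrable_comp(2)[of r q i] r ni by (intro set_integral_diff(1) set_integrable_mult_right) auto
 have Ei: "set_integrable lborel {r<..q} E"
  unfolding E_def using J.integrable_comp(1)[of r q i] r ni by (intro set_integral_diff(1)) auto
 have E: "E v = E r + (LBINT u:{r<..v}. (f u $ i - lam i * n u) - lam i * E u)" if v: "v \<in> {r..q}" for v
 proof -
  have "(f u $ i - lam i * n u) - lam i * E u = f u $ i - lam i * J u $ i" for u
   by (simp add: E_def algebra_simps)
  then have "(LBINT u:{r<..v}. (f u $ i - lam i * n u) - lam i * E u) = (LBINT u:{r<..v}. f u $ i - lam i * J u $ i)"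
   by (simp only:)
  then show ?thesis using J.increment[of r v i] r v by (simp only: E_def n_def) simp
 qed
 note V = variation_of_constants[OF less_imp_le[OF r(2)] E gi Ei]
 let ?e = "\<lambda>v. exp (- (lam i * (q - v)))"
 have "(LBINT v:{r<..q}. ?e v * (f v $ i - lam i * n v)) = (LBINT v:{r<..q}. ?e v * f v $ i) - (LBINT v:{r<..q}. lam i * ?e v * n v)"
 proof -
  have e: "?e v = exp (- lam i * q) * exp (lam i * v)" for v by (simp add: exp_add[symmetric] algebra_simps)
  have 1: "set_integrable lborel {r<..q} (\<lambda>v. ?e v * h v)" if "set_integrable lborel {r<..q} h" for h
   unfolding e mult.assoc using r that by (intro set_integrable_mult_right exp_integral_by_parts(2)) auto
  have "(LBINT v:{r<..q}. ?e v * (f v $ i - lam i * n v)) = (LBINT v:{r<..q}. ?e v * f v $ i - lam i * (?e v * n v))"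
   by (simp add: algebra_simps)
  also have "\<dots> = (LBINT v:{r<..q}. ?e v * f v $ i) - (LBINT v:{r<..q}. lam i * (?e v * n v))"
   using J.integrable_comp(2)[of r q i] r ni by (intro set_integral_diff(2) set_integrable_mult_right 1) auto
  finally show ?thesis by (simp add: mult.assoc)
 qed
 with V(1) have "J q $ i - exp (- (lam i * (q - r))) * J r $ i - (LBINT v:{r<..q}. ?e v * f v $ i) =
   n q - ?e r * n r - (LBINT v:{r<..q}. lam i * ?e v * n v)"
  by (simp add: E_def algebra_simps)
 then show ?thesis
  using abel_sum_tendsto[OF r(2) nrc nb, of "lam i"] by (simp add: n_def)
qed

text \<open>\<open>euler_tendsto\<close> is applied to the continuous part E = X - (N - N s), after
  times outside the interval have been frozen. At every finite step the approximation depends on the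
  path only through increments of N at grid points.\<close>

lemma psol_euler:
 fixes X :: "real => real ^ 'n::finite"
 assumes "path_sol lam T g s x N X"
  and r: "s < r" "r <= T"
  and lip: "\<And>t x y. t \<in> {0..T} ==> norm (g t x - g t y) <= K * norm (x - y)"
  and Nrc: "\<And>v. v \<in> {0..T} ==> continuous (at v within {v..T}) N" and Nb: "\<And>v. v \<in> {0..T} ==> norm (N v) <= KN"
 shows "(\<lambda>k. euler (\<lambda>t y. g (clip 0 T t) y - ldiag lam y) s r (Suc k) x (\<lambda>j. N (gp s r (Suc k) j) - N s) (Suc k) + (N r - N s))
  \<leadsto> X r"
proof -
 interpret X: path_sol lam T g s x N X by fact
 obtain KX where KX: "\<forall>v\<in>{s..T}. norm (X v) <= KX \<and> norm (g v (X v)) <= KX" using X.bounds by blast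
 obtain Kl where Kl: "\<And>z. norm (ldiag lam z) <= norm z * Kl" using bounded_linear.bounded[OF bounded_linear_ldiag] by blast
 define b where "b t y = g (clip 0 T t) y - ldiag lam y" for t y
 have T: "0 <= T" using X.s by simp
 have lb: "linear (ldiag lam)" by (rule bounded_linear.linear[OF bounded_linear_ldiag])
 have "norm (g 0 (axis undefined 1) - g 0 0) <= K"
  using lip[of 0 "axis undefined 1" 0] T by (simp add: norm_axis_1)
 then have K: "0 <= K" by (rule order_trans[OF norm_ge_zero])
 define n where "n v = N (clip s r v) - N s" for v
 define E where "E v = x + (LBINT u:{s<..clip s r v}. g u (X u) - ldiag lam (X u))" for v
 have Xn: "X v = E v + n v" if "v \<in> {s..r}" for v
  using X.eq[of v] that r by (simp add: E_def n_def clip_in)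
 have "(\<lambda>k. euler b s r (Suc k) x (\<lambda>j. n (gp s r (Suc k) j)) (Suc k)) \<leadsto> E r"
 proof (rule euler_tendsto[OF r(1)])
  show "continuous_on UNIV (\<lambda>(t, y). b t y)"
  proof -
   have "continuous_on UNIV (\<lambda>z::real \<times> (real ^ 'n). ldiag lam (snd z))"
    by (intro continuous_on_compose2[OF linear_continuous_on[OF bounded_linear_ldiag]] continuous_intros) auto
   then show ?thesis
    using continuous_clip_first[OF T X.gc] unfolding b_def split_beta' by (intro continuous_intros) auto
  qed
  show "norm (b t y - b t z) <= (K + \<bar>Kl\<bar>) * norm (y - z)" for t y z
  proof -
   have "b t y - b t z = (g (clip 0 T t) y - g (clip 0 T t) z) - ldiag lam (y - z)"
    by (simp add: b_def linear_diff[OF lb])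
   then have "norm (b t y - b t z) <= norm (g (clip 0 T t) y - g (clip 0 T t) z) + norm (ldiag lam (y - z))"
    by (simp only: norm_triangle_ineq4)
   also have "norm (g (clip 0 T t) y - g (clip 0 T t) z) <= K * norm (y - z)"
    by (rule lip) (use clip_in(1)[OF T] in simp)
   also have "norm (ldiag lam (y - z)) <= \<bar>Kl\<bar> * norm (y - z)"
    by (rule order_trans[OF Kl]) (simp add: mult.commute mult_right_mono)
   finally show ?thesis by (simp add: distrib_right)
  qed
  show "0 <= K + \<bar>Kl\<bar>" using K by simp
  have drift: "set_integrable lborel {s<..r} (\<lambda>u. g u (X u) - ldiag lam (X u))"
   using r by (intro set_integrable_subset[OF X.integrable_drift]) auto
  have "continuous_on {s..r} (\<lambda>v. LBINT u:{s<..v}. g u (X u) - ldiag lam (X u))"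
  proof (rule indefinite_integral_continuous[OF drift, where K="KX + KX * \<bar>Kl\<bar>"])
   fix v assume "v \<in> {s<..r}"
   then have v: "v \<in> {s..T}" using r by auto
   have "norm (ldiag lam (X v)) <= norm (X v) * Kl" by (rule Kl)
   also have "\<dots> <= norm (X v) * \<bar>Kl\<bar>" by (intro mult_left_mono) auto
   also have "\<dots> <= KX * \<bar>Kl\<bar>" using KX v by (intro mult_right_mono) auto
   finally have "norm (ldiag lam (X v)) <= KX * \<bar>Kl\<bar>" .
   then show "norm (g v (X v) - ldiag lam (X v)) <= KX + KX * \<bar>Kl\<bar>"
    using KX v by (intro order_trans[OF norm_triangle_ineq4] add_mono) auto
  qed
  then have "continuous_on UNIV (\<lambda>v. LBINT u:{s<..clip s r v}. g u (X u) - ldiag lam (X u))"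
   by (rule continuous_on_compose2[OF _ continuous_clip]) (use r in "auto simp: clip_def")
  then show "continuous_on UNIV E" unfolding E_def by (intro continuous_intros)
  show "continuous (at v within {v..}) n" for v
  proof -
   have "continuous (at v within {v..r}) N" if "v \<in> {s..r}" for v
    using Nrc[of v] that r X.s by (auto intro: continuous_within_subset)
   then have "continuous (at v within {v..}) (\<lambda>v. N (clip s r v))"
    using r by (intro clip_right_cont) auto
   then show ?thesis unfolding n_def by (intro continuous_intros)
  qed
  show "norm (n v) <= KN + KN" for v
  proof -
   have "clip s r v \<in> {0..T}" "s \<in> {0..T}" using clip_in(1)[of s r v] r X.s by auto
   then show ?thesis unfolding n_def by (intro order_trans[OF norm_triangle_ineq4] add_mono Nb)
  qed
  fix v assume v: "v \<in> {s..r}"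
  show "E v = x + (LBINT u:{s<..v}. b u (E u + n u))"
  proof -
   have "(LBINT u:{s<..v}. b u (E u + n u)) = (LBINT u:{s<..v}. g u (X u) - ldiag lam (X u))"
    by (rule set_lebesgue_integral_cong) (use v r Xn X.clip_eq(2) in "auto simp: b_def")
   then show ?thesis using v by (simp add: E_def clip_in)
  qed
 qed
 moreover have "n (gp s r (Suc k) j) = N (gp s r (Suc k) j) - N s" if "j <= Suc k" for k j
  using gp_in[OF r(1) zero_less_Suc that] by (simp add: n_def clip_in)
 then have "euler b s r (Suc k) x (\<lambda>j. n (gp s r (Suc k) j)) j = euler b s r (Suc k) x (\<lambda>j. N (gp s r (Suc k) j) - N s) j"
  if "j <= Suc k" for k j
  using that by (induction j) auto
 ultimately have "(\<lambda>k. euler b s r (Suc k) x (\<lambda>j. N (gp s r (Suc k) j) - N s) (Suc k)) \<leadsto> E r"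
  by (simp only: order_refl)
 moreover have "X r = E r + (N r - N s)" using Xn[of r] r by (simp add: n_def clip_in)
 ultimately show ?thesis unfolding b_def by (auto intro!: tendsto_intros simp del: euler.simps)
qed

section \<open>Paths of the noise and the Gaussian mixture structure of the stochastic
  convolution\<close>

context stable_noise begin

definition noise :: "('n => real) => real => 'w => real ^ 'n" where
 "noise c t om = (\<chi> i. c i * NW i t om)"

lemma L_rc_AE: "AE om in M. \<forall>v\<in>{0..T}. continuous (at v within {v..T}) (\<lambda>t. L t om)"
 using L_cadlag_AE
proof eventually_elim
 case (elim om)
 show ?case
 proof
  fix v assume v: "v \<in> {0..T}"
  have "((\<lambda>t. L t om) \<longlongrightarrow> L v om) (at v within {0..} \<inter> {v<..})" using elim v by (auto simp: cadlag_on_def)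
  then have "((\<lambda>t. L t om) \<longlongrightarrow> L v om) (at v within {v<..T})"
   by (rule tendsto_within_subset) (use v in auto)
  moreover have "at v within {v<..T} = at v within {v..T}"
   unfolding at_within_def by (intro arg_cong2[where f=inf] refl arg_cong[where f=principal]) auto
  ultimately show "continuous (at v within {v..T}) (\<lambda>t. L t om)" by (simp add: continuous_within)
 qed
qed

text \<open>A continuous path of W is composed with the right-continuous path of L. It is bounded
  because L maps [0,T] into the compact interval from 0 to L T.\<close>

lemma noise_rc_AE:
 "AE om in M. (\<forall>v\<in>{0..T}. continuous (at v within {v..T}) (\<lambda>t. noise c t om)) \<and> (\<exists>K. \<forall>v\<in>{0..T}. norm (noise c v om) <= K)"
 using W_continuous_AE NW_eq_AE L_rc_AE[of T] L_nonneg_AE L_mono_AE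
proof eventually_elim
 case (elim om)
 note Wc = elim(1) and NWe = elim(2) and Lc = elim(3) and L0 = elim(4) and Lm = elim(5)
 have rc: "continuous (at v within {v..T}) (\<lambda>t. noise c t om)" if v: "v \<in> {0..T}" for v
  unfolding continuous_within_sequentially comp_def
 proof (intro allI impI, elim conjE)
  fix X :: "nat => real" assume X: "\<forall>n. X n \<in> {v..T}" "X \<leadsto> v"
  have Llim: "(\<lambda>n. L (X n) om) \<leadsto> L v om"
   using Lc v X unfolding continuous_within_sequentially comp_def by (auto dest!: bspec[of _ _ v] spec[of _ X])
  have X0: "0 <= X n" for n using X(1)[rule_format, of n] v by auto
  have "(\<lambda>n. W (L (X n) om) om $ i) \<leadsto> W (L v om) om $ i" for i
   by (rule continuous_on_tendsto_compose[OF Wc[rule_format, of i] Llim]) (use L0 v X0 in auto)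
  then have "(\<lambda>n. NW i (X n) om) \<leadsto> NW i v om" for i
   using NWe X0 v by simp
  then show "(\<lambda>n. noise c (X n) om) \<leadsto> noise c v om"
   by (intro vec_tendstoI) (simp add: noise_def tendsto_mult_left)
 qed
 have "\<exists>K. \<forall>v\<in>{0..T}. \<bar>NW i v om\<bar> <= K" for i
 proof -
  have "compact ((\<lambda>t. W t om $ i) ` {0..L T om})"
   by (intro compact_continuous_image continuous_on_subset[OF Wc[rule_format, of i]]) auto
  then obtain K where K: "\<forall>y\<in>(\<lambda>t. W t om $ i) ` {0..L T om}. norm y <= K"
   using compact_imp_bounded bounded_iff by metis
  have "\<bar>NW i v om\<bar> <= K" if v: "v \<in> {0..T}" for v
  proof -
   have "L v om \<in> {0..L T om}" using L0 mono_onD[OF Lm, of v T] v by auto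
   then have "norm (W (L v om) om $ i) <= K" using K by blast
   then show ?thesis using NWe v by simp
  qed
  then show ?thesis by blast
 qed
 then obtain K where K: "\<And>i. \<forall>v\<in>{0..T}. \<bar>NW i v om\<bar> <= K i" by metis
 have "norm (noise c v om) <= (\<Sum>i\<in>UNIV. \<bar>c i\<bar> * K i)" if v: "v \<in> {0..T}" for v
 proof -
  have "norm (noise c v om) <= (\<Sum>i\<in>UNIV. \<bar>noise c v om $ i\<bar>)" by (rule norm_le_l1_cart)
  also have "\<dots> <= (\<Sum>i\<in>UNIV. \<bar>c i\<bar> * K i)"
   using K v by (intro sum_mono) (auto simp: noise_def abs_mult intro!: mult_left_mono)
  finally show ?thesis .
 qed
 with rc show ?case by blast
qed

end

text \<open>J is one reference solution of the linear equation, started from 0 at time 0. All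
  stochastic convolutions are read off from it, so a single process serves every starting time and
  starting point.\<close>

locale ou_sde = stable_noise M L \<alpha> gbar W
 for M :: "'w measure" and L \<alpha> gbar and W :: "real => 'w => real ^ 'n::finite" +
 fixes T :: real and lam c :: "'n => real" and f :: "real => real ^ 'n" and J :: "real => 'w => real ^ 'n"
 assumes T: "0 < T" and lam: "\<And>i. 0 < lam i" and c: "\<And>i. 0 < c i"
  and fc: "continuous_on {0..T} f"
  and J_measurable: "\<And>t. t \<in> {0..T} ==> J t \<in> borel_measurable M"
  and J_sol: "AE om in M. psol lam T (\<lambda>t _. f t) 0 0 (\<lambda>t. noise c t om) (\<lambda>t. J t om)"
begin

abbreviation "Ns \<equiv> noise c"

lemma f_joint_continuous: "continuous_on ({0..T} \<times> UNIV) (\<lambda>(t, x::real ^ 'n). f t)"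
 using continuous_on_compose2[OF fc continuous_on_fst[OF continuous_on_id], of "{0..T} \<times> UNIV"]
 by (auto simp: split_beta')

text \<open>\<open>xi r q\<close> contains the forcing \<open>f\<close>: it is the value at time \<open>q\<close> of the solution started from 0 at time \<open>r\<close>.\<close>

definition xi :: "real => real => 'w => real ^ 'n" where
 "xi r q om = (\<chi> i. J q om $ i - exp (- (lam i * (q - r))) * J r om $ i)"

definition mean :: "real => real => real ^ 'n" where
 "mean r q = (\<chi> i. LBINT v:{r<..q}. exp (- (lam i * (q - v))) * f v $ i)"

definition wgt :: "real => real => nat => 'n => nat => real" where
 "wgt r q k i j = c i * exp (- (lam i * (q - gp r q (Suc k) j)))"

text \<open>The conditional variance, given L, of component i of the convolution discretised on the
  grid with k + 1 cells.\<close>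

definition vsq :: "real => real => nat => 'w => 'n => real" where
 "vsq r q k om i = (\<Sum>j<Suc k. (wgt r q k i j)\<^sup>2 * (L (gp r q (Suc k) (Suc j)) om - L (gp r q (Suc k) j) om))"

text \<open>The conditional standard deviation of the \<open>i\<close>-th component of \<open>xi r q\<close> given \<open>L\<close>.\<close>

definition vsd :: "real => real => 'w => 'n => real" where
 "vsd r q om i = lim (\<lambda>k. sqrt (vsq r q k om i))"

lemma gp_range:
 assumes "0 <= r" "r < q" "q <= T" "j <= Suc k"
 shows "gp r q (Suc k) j \<in> {r..q}" "0 <= gp r q (Suc k) j" "gp r q (Suc k) j <= T"
 using gp_in[OF assms(2) zero_less_Suc assms(4)] assms by auto

lemma xi_measurable: "0 <= r ==> r <= q ==> q <= T ==> xi r q \<in> borel_measurable M"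
 unfolding xi_def[abs_def]
 by (intro measurable_vec_lambda_borel borel_measurable_diff borel_measurable_times borel_measurable_const
   measurable_compose[OF J_measurable measurable_vec_nth_borel]) auto

lemma vsq_measurable: "0 <= r ==> r < q ==> q <= T ==> (\<lambda>om. vsq r q k om i) \<in> borel_measurable M"
 unfolding vsq_def
 by (intro borel_measurable_sum borel_measurable_times borel_measurable_const borel_measurable_diff L_measurable gp_range) auto

lemma vsd_measurable: "0 <= r ==> r < q ==> q <= T ==> (\<lambda>om. vsd r q om i) \<in> borel_measurable M"
 unfolding vsd_def
 by (intro borel_measurable_lim_metric measurable_compose[OF vsq_measurable borel_measurable_sqrt]) auto

lemma xi_limit_AE:
 assumes r: "0 <= r" "r < q" "q <= T"
 shows "AE om in M. (\<lambda>k. \<chi> i. mean r q $ i + (\<Sum>j<Suc k. wgt r q k i j * (NW i (gp r q (Suc k) (Suc j)) om - NW i (gp r q (Suc k) j) om))) \<leadsto> xi r q om"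
 using J_sol noise_rc_AE[of T c]
proof eventually_elim
 case (elim om)
 obtain K where K: "\<forall>v\<in>{0..T}. norm (noise c v om) <= K" using elim by blast
 have ps: "path_sol lam T (\<lambda>t _. f t) 0 0 (\<lambda>t. noise c t om) (\<lambda>t. J t om)"
  using elim(1) T f_joint_continuous by unfold_locales auto
 show ?case
 proof (rule vec_tendstoI)
  fix i
  have "(\<lambda>k. (\<Sum>j<Suc k. exp (- (lam i * (q - gp r q (Suc k) j))) * (noise c (gp r q (Suc k) (Suc j)) om $ i - noise c (gp r q (Suc k) j) om $ i)))
   \<leadsto> J q om $ i - exp (- (lam i * (q - r))) * J r om $ i - (LBINT v:{r<..q}. exp (- (lam i * (q - v))) * f v $ i)"
   by (rule psol_convolution_limit[OF ps r, where K=K]) (use elim K in auto)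
  from tendsto_add[OF tendsto_const[of "mean r q $ i"] this]
  show "(\<lambda>k. (\<chi> i. mean r q $ i + (\<Sum>j<Suc k. wgt r q k i j * (NW i (gp r q (Suc k) (Suc j)) om - NW i (gp r q (Suc k) j) om))) $ i) \<leadsto> xi r q om $ i"
   by (simp add: mean_def xi_def noise_def wgt_def algebra_simps sum_distrib_left del: sum.lessThan_Suc)
 qed
qed

text \<open>The squared deviation is the integral of c_i^2 exp(-2 lam_i (q - v)) against dL. All
  weights \<open>wgt\<close> lie between c_i exp(- lam_i T) and c_i, so the deviation is comparable
  to the square root of the increment of L, which is almost surely positive.\<close>

lemma vsd_AE:
 assumes r: "0 <= r" "r < q" "q <= T"
 shows "AE om in M. \<forall>i. (\<lambda>k. sqrt (vsq r q k om i)) \<leadsto> vsd r q om i \<and>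
   c i * exp (- (lam i * T)) * sqrt (L q om - L r om) <= vsd r q om i \<and>
   vsd r q om i <= c i * sqrt (L q om - L r om) \<and> 0 < vsd r q om i"
 using L_rc_AE[of T] L_mono_AE L_nonneg_AE L_increment_pos_AE[OF r(1,2)]
proof eventually_elim
 case (elim om)
 note Lrc = elim(1) and Lm = elim(2) and L0 = elim(3) and Lp = elim(4)
 show ?case
 proof
  fix i
  let ?t = "\<lambda>k j. gp r q (Suc k) j"
  have w2: "(wgt r q k i j)\<^sup>2 = (c i)\<^sup>2 * exp (- (2 * lam i * (q - ?t k j)))" for k j
   by (simp add: wgt_def power_mult_distrib exp_double[symmetric] algebra_simps)
  have rc: "continuous (at v within {v..q}) (\<lambda>t. L t om)" if "v \<in> {r..q}" for v
   using Lrc[rule_format, of v] that r by (auto intro: continuous_within_subset)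
  have bd: "\<bar>L v om\<bar> <= L T om" if "v \<in> {r..q}" for v
   using L0 mono_onD[OF Lm, of v T] that r by auto
  \<comment> \<open>Squaring the weights doubles the rate, so Abel summation is used with \<mu> = 2
    * lam i.\<close>
  have "(\<lambda>k. vsq r q k om i) \<leadsto> (c i)\<^sup>2 * (L q om - exp (- (2 * lam i * (q - r))) * L r om -
    (LBINT v:{r<..q}. 2 * lam i * exp (- (2 * lam i * (q - v))) * L v om))"
   unfolding vsq_def w2 mult.assoc[of "(c i)\<^sup>2"] sum_distrib_left[symmetric]
   by (intro tendsto_mult_left abel_sum_tendsto[OF r(2) rc bd])
  then have "(\<lambda>k. sqrt (vsq r q k om i)) \<leadsto> sqrt ((c i)\<^sup>2 * (L q om - exp (- (2 * lam i * (q - r))) * L r om -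
    (LBINT v:{r<..q}. 2 * lam i * exp (- (2 * lam i * (q - v))) * L v om)))"
   by (rule tendsto_real_sqrt)
  then have lim: "(\<lambda>k. sqrt (vsq r q k om i)) \<leadsto> vsd r q om i"
   unfolding vsd_def by (simp add: limI)
  have inc: "0 <= L (?t k (Suc j)) om - L (?t k j) om" if "j < Suc k" for k j
  proof -
   have "?t k j <= ?t k (Suc j)" using gp_le_iff[OF r(2)] by simp
   then show ?thesis using mono_onD[OF Lm, of "?t k j" "?t k (Suc j)"] gp_range[OF r, of j k] gp_range[OF r, of "Suc j" k] that by simp
  qed
  have tele: "(\<Sum>j<Suc k. L (?t k (Suc j)) om - L (?t k j) om) = L q om - L r om" for k
   using sum_lessThan_telescope[of "\<lambda>j. L (?t k j) om" "Suc k"] by simp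
  have e: "0 < c i * exp (- (lam i * T))" using c by simp
  have wb: "c i * exp (- (lam i * T)) <= wgt r q k i j" "wgt r q k i j <= c i" if "j < Suc k" for k j
  proof -
   have "lam i * (q - ?t k j) <= lam i * T" "0 <= lam i * (q - ?t k j)"
    using gp_range[OF r, of j k] that lam[of i] r by (auto intro!: mult_left_mono mult_nonneg_nonneg simp: less_imp_le)
   then show "c i * exp (- (lam i * T)) <= wgt r q k i j" "wgt r q k i j <= c i"
    using c[of i] by (auto simp: wgt_def intro!: mult_left_mono mult_left_le)
  qed
  have lo: "(c i * exp (- (lam i * T)))\<^sup>2 * (L q om - L r om) <= vsq r q k om i" for k
   unfolding vsq_def tele[of k, symmetric] sum_distrib_left
   using inc wb(1) e by (intro sum_mono mult_right_mono power_mono) auto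
  have hi: "vsq r q k om i <= (c i)\<^sup>2 * (L q om - L r om)" for k
   unfolding vsq_def tele[of k, symmetric] sum_distrib_left
  proof (intro sum_mono mult_right_mono power_mono)
   fix j assume j: "j \<in> {..<Suc k}"
   show "0 <= wgt r q k i j" using wb(1)[of j k] e j by simp
  qed (use inc wb(2) in auto)
  have lo': "c i * exp (- (lam i * T)) * sqrt (L q om - L r om) <= sqrt (vsq r q k om i)" for k
   using real_sqrt_le_mono[OF lo[of k]] e by (simp add: real_sqrt_mult del: power_mult_distrib)
  have hi': "sqrt (vsq r q k om i) <= c i * sqrt (L q om - L r om)" for k
   using real_sqrt_le_mono[OF hi[of k]] c[of i] by (simp add: real_sqrt_mult)
  have lo'': "c i * exp (- (lam i * T)) * sqrt (L q om - L r om) <= vsd r q om i"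
   by (rule LIMSEQ_le_const[OF lim]) (use lo' in blast)
  moreover have "vsd r q om i <= c i * sqrt (L q om - L r om)"
   by (rule LIMSEQ_le_const2[OF lim]) (use hi' in blast)
  moreover have "0 < c i * exp (- (lam i * T)) * sqrt (L q om - L r om)" using e Lp by simp
  ultimately show "(\<lambda>k. sqrt (vsq r q k om i)) \<leadsto> vsd r q om i \<and>
    c i * exp (- (lam i * T)) * sqrt (L q om - L r om) <= vsd r q om i \<and>
    vsd r q om i <= c i * sqrt (L q om - L r om) \<and> 0 < vsd r q om i"
   using lim by linarith
 qed
qed

lemma gsm_measurable_vsd:
 assumes "0 <= r" "r < q" "q <= T" "\<psi> \<in> bounded_borel"
 shows "(\<lambda>om. gsm \<psi> z (vsd r q om)) \<in> borel_measurable M" "(\<lambda>om. gsd i \<psi> z (vsd r q om)) \<in> borel_measurable M"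
 using assms by (auto intro!: gs_measurable vsd_measurable bounded_borel_measurable)

text \<open>The stochastic convolution is a mixture of Gaussians; the mixing variable is \<open>vsd\<close>.\<close>

lemma xi_expectation:
 assumes r: "0 <= r" "r < q" "q <= T" and \<psi>: "\<psi> \<in> bounded_borel"
 shows "(LINT om|M. \<psi> (z + xi r q om)) = (LINT om|M. gsm \<psi> (z + mean r q) (vsd r q om))"
 using \<psi>
proof (induction \<psi> rule: bounded_borel_induct)
 \<comment> \<open>For a bump, continuity lets both sides pass from the discretised convolution to
   its limit: the noise sums inside the expectation on the left, the deviations inside
   \<open>gsm\<close> on the right.\<close>
 case (bump n a)
 let ?\<psi> = "bump n a"
 define S where "S k om = (\<chi> i. mean r q $ i + (\<Sum>j<Suc k. wgt r q k i j * (NW i (gp r q (Suc k) (Suc j)) om - NW i (gp r q (Suc k) j) om)))" for k om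
 have bm [measurable]: "?\<psi> \<in> borel_fun" by (rule bounded_borel_measurable[OF bump_bounded_borel])
 have Sm [measurable]: "S k \<in> borel_measurable M" for k
  unfolding S_def[abs_def]
  by (intro measurable_vec_lambda_borel borel_measurable_add borel_measurable_sum borel_measurable_times borel_measurable_const
    borel_measurable_diff NW_measurable gp_range[OF r]) auto
 have [measurable]: "xi r q \<in> borel_measurable M" using r by (intro xi_measurable) auto
 have eq: "(LINT om|M. ?\<psi> (z + S k om)) = (LINT om|M. gsm ?\<psi> (z + mean r q) (\<lambda>i. sqrt (vsq r q k om i)))" for k
 proof -
  have "z + S k om = (\<chi> i. (z + mean r q) $ i + (\<Sum>j<Suc k. wgt r q k i j * (NW i (gp r q (Suc k) (Suc j)) om - NW i (gp r q (Suc k) j) om)))" for om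
   by (simp add: S_def vec_eq_iff add.assoc del: sum.lessThan_Suc)
  moreover have "(LINT om|M. ?\<psi> (\<chi> i. (z + mean r q) $ i + (\<Sum>j<Suc k. wgt r q k i j * (NW i (gp r q (Suc k) (Suc j)) om - NW i (gp r q (Suc k) j) om)))) =
   (LINT om|M. gsm ?\<psi> (z + mean r q) (\<lambda>i. sqrt (\<Sum>j<Suc k. (wgt r q k i j)\<^sup>2 * (L (gp r q (Suc k) (Suc j)) om - L (gp r q (Suc k) j) om))))"
   by (rule noise_sum_expectation[OF zero_less_Suc])
    (use r c gp_less_iff[OF r(2)] bump_bounded_borel in "auto simp: wgt_def")
  ultimately show ?thesis by (simp only: vsq_def)
 qed
 have c: "isCont ?\<psi> y" for y using continuous_bump[of n a] by (simp add: continuous_on_eq_continuous_at)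
 have "(\<lambda>k. \<integral>om. ?\<psi> (z + S k om) \<partial>M) \<leadsto> (LINT om|M. ?\<psi> (z + xi r q om))"
 proof (rule integral_dominated_convergence[where w="\<lambda>_. 1"])
  show "AE om in M. (\<lambda>k. ?\<psi> (z + S k om)) \<leadsto> ?\<psi> (z + xi r q om)"
   using xi_limit_AE[OF r] by eventually_elim (intro isCont_tendsto_compose[OF c] tendsto_intros, simp only: S_def)
 qed (auto simp: bump_bounds)
 moreover have "(\<lambda>k. \<integral>om. gsm ?\<psi> (z + mean r q) (\<lambda>i. sqrt (vsq r q k om i)) \<partial>M) \<leadsto> (LINT om|M. gsm ?\<psi> (z + mean r q) (vsd r q om))"
 proof (rule integral_dominated_convergence[where w="\<lambda>_. 1"])
  show "AE om in M. (\<lambda>k. gsm ?\<psi> (z + mean r q) (\<lambda>i. sqrt (vsq r q k om i))) \<leadsto> gsm ?\<psi> (z + mean r q) (vsd r q om)"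
   using vsd_AE[OF r]
  proof eventually_elim
   case (elim om)
   interpret g: prob_space "gauss :: (real ^ 'n) measure" by (rule prob_space_gauss)
   show ?case
    unfolding gsm_def
   proof (rule integral_dominated_convergence[where w="\<lambda>_. 1"])
    show "AE g in gauss. (\<lambda>k. ?\<psi> (gmap (z + mean r q) (\<lambda>i. sqrt (vsq r q k om i)) g)) \<leadsto> ?\<psi> (gmap (z + mean r q) (vsd r q om) g)"
     using elim unfolding gmap_def
     by (intro AE_I2 isCont_tendsto_compose[OF c] vec_tendstoI) (auto intro!: tendsto_intros)
   qed (auto simp: bump_bounds)
  qed
  show "(\<lambda>om. gsm ?\<psi> (z + mean r q) (\<lambda>i. sqrt (vsq r q k om i))) \<in> borel_measurable M" for k
   using r by (intro gs_measurable(1) bm measurable_compose[OF vsq_measurable borel_measurable_sqrt])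
  show "(\<lambda>om. gsm ?\<psi> (z + mean r q) (vsd r q om)) \<in> borel_measurable M"
   by (rule gsm_measurable_vsd(1)[OF r bump_bounded_borel])
  show "AE om in M. norm (gsm ?\<psi> (z + mean r q) (\<lambda>i. sqrt (vsq r q k om i))) <= 1" for k
   unfolding real_norm_def by (intro AE_I2 gsm_bound bump_bounded_borel bump_bounds)
 qed auto
 ultimately show ?case unfolding eq by (rule LIMSEQ_unique)
next
 case (lin \<phi> \<psi> a b)
 have xm [measurable]: "xi r q \<in> borel_measurable M" using r by (intro xi_measurable) auto
 have [measurable]: "\<phi> \<in> borel_fun" "\<psi> \<in> borel_fun" using lin by (auto intro: bounded_borel_measurable)
 have i: "integrable M (\<lambda>om. h (z + xi r q om))" "integrable M (\<lambda>om. gsm h (z + mean r q) (vsd r q om))"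
  "integrable gauss (\<lambda>g. h (gmap y v g))"
  if h: "h \<in> bounded_borel" for h and y :: "real ^ 'n" and v
 proof -
  interpret g: prob_space "gauss :: (real ^ 'n) measure" by (rule prob_space_gauss)
  obtain K where K: "\<And>x. \<bar>h x\<bar> <= K" using bounded_borelD[OF h] by blast
  have [measurable]: "h \<in> borel_fun" by (rule bounded_borel_measurable[OF h])
  show "integrable M (\<lambda>om. h (z + xi r q om))" by (rule integrable_const_bound[where B=K]) (use K in auto)
  show "integrable M (\<lambda>om. gsm h (z + mean r q) (vsd r q om))"
   by (rule integrable_const_bound[where B=K]) (use gsm_bound[OF h K] gsm_measurable_vsd(1)[OF r h] in auto)
  show "integrable gauss (\<lambda>g. h (gmap y v g))" by (rule g.integrable_const_bound[where B=K]) (use K in auto)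
 qed
 have "gsm (\<lambda>x. a * \<phi> x + b * \<psi> x) y v = a * gsm \<phi> y v + b * gsm \<psi> y v" for y and v :: "'n => real"
  unfolding gsm_def using i(3)[OF lin(1)] i(3)[OF lin(2)] by simp
 then show ?case using lin i(1,2)[OF lin(1)] i(1,2)[OF lin(2)] by simp
next
 case (lim F \<phi> K)
 have xm [measurable]: "xi r q \<in> borel_measurable M" using r by (intro xi_measurable) auto
 have [measurable]: "\<phi> \<in> borel_fun" "F n \<in> borel_fun" for n using lim by (auto intro: bounded_borel_measurable)
 have "(\<lambda>n. \<integral>om. F n (z + xi r q om) \<partial>M) \<leadsto> (LINT om|M. \<phi> (z + xi r q om))"
  by (rule integral_dominated_convergence[where w="\<lambda>_. K"]) (use lim(3,5) in auto)
 moreover have "(\<lambda>n. \<integral>om. gsm (F n) (z + mean r q) (vsd r q om) \<partial>M) \<leadsto> (LINT om|M. gsm \<phi> (z + mean r q) (vsd r q om))"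
 proof (rule integral_dominated_convergence[where w="\<lambda>_. K"])
  show "AE om in M. (\<lambda>n. gsm (F n) (z + mean r q) (vsd r q om)) \<leadsto> gsm \<phi> (z + mean r q) (vsd r q om)"
   using gs_tendsto(1)[OF lim(1,2,3,5)] by (intro AE_I2) auto
  show "AE om in M. norm (gsm (F n) (z + mean r q) (vsd r q om)) <= K" for n
   using gsm_bound[OF lim(1,3)] by (intro AE_I2) auto
 qed (use gsm_measurable_vsd(1)[OF r] lim in auto)
 ultimately show ?case unfolding lim(6) by (rule LIMSEQ_unique)
qed

end

section \<open>Independence of the past and the stochastic convolution\<close>

lemma (in prob_space) indep_expectation:
 fixes U :: "'a => 'b::{second_countable_topology, metric_space}" and V :: "'a => 'c::{second_countable_topology, metric_space}"
 assumes U [measurable]: "U \<in> borel_measurable M" and V [measurable]: "V \<in> borel_measurable M"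
  and eq: "distr M borel U \<Otimes>\<^sub>M distr M borel V = distr M (borel \<Otimes>\<^sub>M borel) (\<lambda>om. (U om, V om))"
  and H: "(\<lambda>(u, v). H u v) \<in> borel_fun2" and Hb: "\<And>u v. \<bar>H u v\<bar> <= (K::real)"
 shows "(LINT om|M. H (U om) (V om)) = (LINT om|M. (LINT om'|M. H (U om) (V om')))"
proof -
 let ?U = "distr M borel U" and ?V = "distr M borel V"
 interpret PU: prob_space ?U by (rule prob_space_distr) simp
 interpret PV: prob_space ?V by (rule prob_space_distr) simp
 interpret P: pair_prob_space ?U ?V ..
 have Hm: "(\<lambda>(u, v). H u v) \<in> borel_measurable (?U \<Otimes>\<^sub>M ?V)"
  using H by (simp cong: measurable_cong_sets sets_pair_measure_cong)
 have int: "integrable (?U \<Otimes>\<^sub>M ?V) (\<lambda>(u, v). H u v)"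
  by (rule P.integrable_const_bound[where B=K]) (use Hb Hm in auto)
 have Hs: "H u \<in> borel_fun" for u
 proof -
  have "(\<lambda>v. (\<lambda>(u, v). H u v) (u, v)) \<in> borel_fun"
   by (rule measurable_compose[OF _ H]) simp
  then show ?thesis by simp
 qed
 have "(LINT om|M. H (U om) (V om)) = (LINT z|(?U \<Otimes>\<^sub>M ?V). (\<lambda>(u, v). H u v) z)"
  unfolding eq by (subst integral_distr) (use H in auto)
 also have "\<dots> = (LINT u|?U. (LINT v|?V. H u v))"
  using P.integral_fst'[OF int] by simp
 also have "\<dots> = (LINT om|M. (LINT v|?V. H (U om) v))"
 proof (rule integral_distr)
  have "(\<lambda>u. \<integral>v. H u v \<partial>?V) \<in> borel_measurable ?U"
   by (rule PV.borel_measurable_lebesgue_integral[OF Hm])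
  then show "(\<lambda>u. \<integral>v. H u v \<partial>?V) \<in> borel_fun" by simp
 qed simp
 also have "\<dots> = (LINT om|M. (LINT om'|M. H (U om) (V om')))"
  by (intro Bochner_Integration.integral_cong refl integral_distr V Hs)
 finally show ?thesis .
qed

text \<open>Factorisation of expectations survives almost sure limits when H is bounded and
  continuous: dominated convergence is applied once to the joint expectation and twice, nested, to
  the iterated one.\<close>

lemma (in prob_space) indep_limit_expectation:
 fixes U :: "nat => 'a => 'b::{second_countable_topology, metric_space}"
  and H :: "'b => 'b => real"
 assumes ind: "\<And>k. indep_var borel (U k) borel (V k)"
  and Ul [measurable]: "Ul \<in> borel_measurable M" and Vl [measurable]: "Vl \<in> borel_measurable M"
  and U: "AE om in M. (\<lambda>k. U k om) \<leadsto> Ul om" and V: "AE om in M. (\<lambda>k. V k om) \<leadsto> Vl om"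
  and H: "continuous_on UNIV (\<lambda>(u, v). H u v)" and Hb: "\<And>u v. \<bar>H u v\<bar> <= K"
 shows "(LINT om|M. H (Ul om) (Vl om)) = (LINT om|M. (LINT om'|M. H (Ul om) (Vl om')))"
proof -
 have Um [measurable]: "U k \<in> borel_measurable M" and Vm [measurable]: "V k \<in> borel_measurable M" for k
  using indep_var_rv1[OF ind] indep_var_rv2[OF ind] by auto
 have Hm: "(\<lambda>(u, v). H u v) \<in> borel_fun2"
  using borel_measurable_continuous_onI[OF H] by (simp add: borel_prod)
 have H2 [measurable]: "(\<lambda>x. H (p x) (q x)) \<in> borel_measurable X"
  if [measurable]: "p \<in> borel_measurable X" "q \<in> borel_measurable X" for p q and X :: "'z measure"
  using measurable_compose[OF _ Hm, of "\<lambda>x. (p x, q x)" X] by simp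
 have H3 [measurable]: "(\<lambda>x. H (p x) (q x)) \<in> borel_measurable X"
  if [measurable]: "p \<in> borel_measurable X" "q \<in> borel_measurable X" for p q and X :: "('a \<times> 'a) measure"
  using measurable_compose[OF _ Hm, of "\<lambda>x. (p x, q x)" X] by simp
 have H4 [measurable]: "(\<lambda>x. H (p x) (q x)) \<in> borel_measurable X"
  if [measurable]: "p \<in> borel_measurable X" "q \<in> borel_measurable X" for p q and X :: "'a measure"
  using measurable_compose[OF _ Hm, of "\<lambda>x. (p x, q x)" X] by simp
 have Hl: "(\<lambda>k. H (p k) (q k)) \<leadsto> H u v" if "p \<leadsto> u" "q \<leadsto> v" for p q u v
  using isCont_tendsto_compose[of "(u, v)" "\<lambda>(u, v). H u v", OF _ tendsto_Pair[OF that]] H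
  by (simp add: continuous_on_eq_continuous_at)
 have inb: "\<bar>LINT om'|M. H u (W' om')\<bar> <= K" if [measurable]: "W' \<in> borel_measurable M" for u W'
 proof -
  have "\<bar>LINT om'|M. H u (W' om')\<bar> <= (LINT om'|M. \<bar>H u (W' om')\<bar>)" by (rule integral_abs_bound)
  also have "\<dots> <= (LINT om'|M. K)"
   by (rule integral_mono_AE) (auto intro!: integrable_const_bound[where B=K] simp: Hb)
  finally show ?thesis by (simp add: prob_space)
 qed
 have "(LINT om|M. H (U k om) (V k om)) = (LINT om|M. (LINT om'|M. H (U k om) (V k om')))" for k
  using ind[of k] indep_var_distribution_eq[of borel "U k" borel "V k"] Hm Hb by (intro indep_expectation) auto
 moreover have "(\<lambda>k. \<integral>om. H (U k om) (V k om) \<partial>M) \<leadsto> (LINT om|M. H (Ul om) (Vl om))"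
 proof (rule integral_dominated_convergence[where w="\<lambda>_. K"])
  show "AE om in M. (\<lambda>k. H (U k om) (V k om)) \<leadsto> H (Ul om) (Vl om)"
   using U V by eventually_elim (rule Hl)
 qed (auto simp: Hb)
 moreover have "(\<lambda>k. \<integral>om. (LINT om'|M. H (U k om) (V k om')) \<partial>M) \<leadsto> (LINT om|M. (LINT om'|M. H (Ul om) (Vl om')))"
 proof (rule integral_dominated_convergence[where w="\<lambda>_. K"])
  show "AE om in M. (\<lambda>k. \<integral>om'. H (U k om) (V k om') \<partial>M) \<leadsto> (LINT om'|M. H (Ul om) (Vl om'))"
   using U
  proof eventually_elim
   case (elim om)
   show ?case
   proof (rule integral_dominated_convergence[where w="\<lambda>_. K"])
    show "AE om' in M. (\<lambda>k. H (U k om) (V k om')) \<leadsto> H (Ul om) (Vl om')"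
     using V by eventually_elim (rule Hl[OF elim])
   qed (auto simp: Hb)
  qed
  show "AE om in M. norm (LINT om'|M. H (U k om) (V k om')) <= K" for k
   using inb[OF Vm] by auto
  have "(\<lambda>om. \<integral>om'. H (p om) (q om') \<partial>M) \<in> borel_measurable M"
   if [measurable]: "p \<in> borel_measurable M" "q \<in> borel_measurable M" for p q
   by (rule borel_measurable_lebesgue_integral) (simp add: split_beta')
  then show "(\<lambda>om. \<integral>om'. H (Ul om) (Vl om') \<partial>M) \<in> borel_measurable M"
   "\<And>k. (\<lambda>om. \<integral>om'. H (U k om) (V k om') \<partial>M) \<in> borel_measurable M" by auto
 qed auto
 ultimately show ?thesis using LIMSEQ_unique by auto
qed

context ou_sde begin

definition cs :: "real ^ 'n => real ^ 'n" where "cs d = (\<chi> i. c i * d $ i)"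

lemma cs_measurable [measurable]: "cs \<in> borel_fun"
 unfolding cs_def[abs_def] by measurable

text \<open>The Euler scheme for the equation with drift \<open>g\<close>, as a function of the noise increments.\<close>

definition theta :: "(real => real ^ 'n => real ^ 'n) => real => real => real ^ 'n => nat => (nat => real ^ 'n) => real ^ 'n" where
 "theta g s r x k d = euler (\<lambda>t y. g (clip 0 T t) y - ldiag lam y) s r (Suc k) x (\<lambda>j. \<Sum>i<j. cs (d i)) (Suc k) +
   (\<Sum>i<Suc k. cs (d i))"

lemma partial_sum_measurable:
 fixes j m :: nat
 assumes "j <= m"
 shows "(\<lambda>d. \<Sum>i<j. cs (d i)) \<in> borel_measurable (Pi\<^sub>M {..<m} (\<lambda>_. borel))"
proof (rule borel_measurable_sum)
 fix i assume "i \<in> {..<j}"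
 then have "(\<lambda>d. d i) \<in> borel_measurable (Pi\<^sub>M {..<m} (\<lambda>_. borel :: (real ^ 'n) measure))"
  using assms by (intro measurable_component_singleton) (simp add: less_le_trans)
 then show "(\<lambda>d. cs (d i)) \<in> borel_measurable (Pi\<^sub>M {..<m} (\<lambda>_. borel))"
  by (rule measurable_compose[OF _ cs_measurable])
qed

lemma theta_measurable:
 assumes "\<And>t. continuous_on UNIV (g (clip 0 T t))"
 shows "theta g s r x k \<in> borel_measurable (Pi\<^sub>M {..<Suc k} (\<lambda>_. borel))"
proof -
 have b [measurable]: "(\<lambda>y. g (clip 0 T t) y - ldiag lam y) \<in> borel_fun" for t
  by (intro borel_measurable_continuous_onI continuous_intros assms linear_continuous_on bounded_linear_ldiag)
 have "(\<lambda>d. euler (\<lambda>t y. g (clip 0 T t) y - ldiag lam y) s r (Suc k) x (\<lambda>j. \<Sum>i<j. cs (d i)) j)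
   \<in> borel_measurable (Pi\<^sub>M {..<Suc k} (\<lambda>_. borel))" if "j <= Suc k" for j
  using that
 proof (induction j)
  case (Suc j)
  have [measurable]: "(\<lambda>d. euler (\<lambda>t y. g (clip 0 T t) y - ldiag lam y) s r (Suc k) x (\<lambda>j. \<Sum>i<j. cs (d i)) j)
   \<in> borel_measurable (Pi\<^sub>M {..<Suc k} (\<lambda>_. borel))" using Suc by simp
  note partial_sum_measurable[OF Suc.prems, measurable]
  show ?case
   unfolding euler.simps
   by (intro borel_measurable_add borel_measurable_scaleR measurable_compose[OF _ b] borel_measurable_const) measurable
 qed simp
 then show ?thesis
  unfolding theta_def[abs_def] by (intro borel_measurable_add partial_sum_measurable) auto
qed

lemma euler_cong: "(\<And>i. i <= j ==> n i = n' i) ==> euler b a c' k x n j = euler b a c' k x n' j"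
 by (induction j) auto

lemma theta_cong: "(\<And>i. i <= k ==> d i = d' i) ==> theta g s r x k d = theta g s r x k d'"
 unfolding theta_def
 by (intro arg_cong2[where f="(+)"] euler_cong sum.cong refl) auto

text \<open>The solution up to time \<open>r\<close> is independent of the stochastic convolution on \<open>[r,q]\<close>.\<close>

lemma solution_convolution_expectation:
 assumes s: "0 <= s" "s <= r" "r <= q" "q <= T"
  and gc: "continuous_on ({0..T} \<times> UNIV) (\<lambda>(t, x). g t x)"
  and lip: "\<And>t x y. t \<in> {0..T} ==> norm (g t x - g t y) <= K * norm (x - y)"
  and Xm [measurable]: "X r \<in> borel_measurable M"
  and X: "AE om in M. psol lam T g s x (\<lambda>t. noise c t om) (\<lambda>t. X t om)"
  and H: "continuous_on UNIV (\<lambda>(y, w). H y w)" and Hb: "\<And>y w. \<bar>H y w\<bar> <= (KH :: real)"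
 shows "(LINT om|M. H (X r om) (xi r q om)) = (LINT om|M. (LINT om'|M. H (X r om) (xi r q om')))"
proof -
 have xim [measurable]: "xi r q \<in> borel_measurable M" using s by (intro xi_measurable) auto
 have Hm: "(\<lambda>(u, v). H u v) \<in> borel_fun2"
  using borel_measurable_continuous_onI[OF H] by (simp add: borel_prod)
 have Hc: "H u \<in> borel_fun" "(\<lambda>u. H u v) \<in> borel_fun" for u v
  using measurable_compose[OF _ Hm, of "\<lambda>v. (u, v)" borel] measurable_compose[OF _ Hm, of "\<lambda>u. (u, v)" borel] by auto
 \<comment> \<open>Grids need intervals of positive length. If s = r, then X r is almost surely the
   constant x; if r = q, the convolution vanishes.\<close>
 consider "s = r" | "r = q" | "s < r" "r < q" using s by linarith
 then show ?thesis
 proof cases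
  case 1
  have Xs: "AE om in M. X r om = x"
   using X by eventually_elim (use 1 s in "auto simp: psol_def set_lebesgue_integral_def")
  have h: "(\<lambda>u. \<integral>om'. H u (xi r q om') \<partial>M) \<in> borel_fun"
  proof (rule borel_measurable_lebesgue_integral[where f="\<lambda>u om'. H u (xi r q om')"])
   show "(\<lambda>(u, om'). H u (xi r q om')) \<in> borel_measurable (borel \<Otimes>\<^sub>M M)"
    using measurable_compose[OF _ Hm, of "\<lambda>z. (fst z, xi r q (snd z))" "borel \<Otimes>\<^sub>M M"] by (simp add: split_beta')
  qed
  have "(LINT om|M. H (X r om) (xi r q om)) = (LINT om|M. H x (xi r q om))"
  proof (rule integral_cong_AE)
   show "(\<lambda>om. H (X r om) (xi r q om)) \<in> borel_measurable M"
    using measurable_compose[OF _ Hm, of "\<lambda>om. (X r om, xi r q om)" M] by simp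
  qed (use Xs Hc in auto)
  moreover have "(LINT om|M. (LINT om'|M. H (X r om) (xi r q om'))) = (LINT om|M. (LINT om'|M. H x (xi r q om')))"
   by (rule integral_cong_AE) (use Xs h in "auto intro: measurable_compose[OF Xm h]")
  ultimately show ?thesis by (simp add: prob_space)
 next
  case 2
  then have "xi r q om = 0" for om by (simp add: xi_def vec_eq_iff)
  then show ?thesis by (simp add: prob_space)
 next
  case 3
  have r0: "0 <= r" "r <= T" using s 3 by auto
  note rq = r0(1) 3(2) s(4)
  \<comment> \<open>Two grids glued at r, with k + 1 cells on [s,r] followed by k + 1 cells on
    [r,q]. Increments with index at most k drive the Euler scheme, the later ones the
    convolution.\<close>
  define \<tau> where "\<tau> k j = (if j <= Suc k then gp s r (Suc k) j else gp r q (Suc k) (j - Suc k))" for k j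
  have \<tau>1: "\<tau> k j = gp s r (Suc k) j" if "j <= Suc k" for k j using that by (simp add: \<tau>_def)
  have \<tau>2: "\<tau> k (Suc k + j) = gp r q (Suc k) j" for k j by (cases "j = 0") (auto simp: \<tau>_def)
  have \<tau>0: "0 <= \<tau> k 0" for k using s by (simp add: \<tau>_def)
  have \<tau>s: "\<tau> k j < \<tau> k (Suc j)" if "j < 2 * Suc k" for k j
  proof (cases "j < Suc k")
   case True then show ?thesis using gp_less_iff[OF 3(1), of "Suc k" j "Suc j"] by (simp add: \<tau>1)
  next
   case False
   then obtain i where "j = Suc k + i" by (auto simp: not_less le_iff_add)
   then show ?thesis using gp_less_iff[OF 3(2), of "Suc k" i "Suc i"] \<tau>2[of k i] \<tau>2[of k "Suc i"] by simp
  qed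
  define D where "D k j om = (\<chi> i. NW i (\<tau> k (Suc j)) om - NW i (\<tau> k j) om)" for k j om
  have iv: "indep_vars (\<lambda>_. borel) (D k) {..<2 * Suc k}" for k
   unfolding D_def[abs_def] by (rule noise_indep) (use \<tau>0 \<tau>s in auto)
  let ?A = "\<lambda>k. {..<Suc k}" and ?B = "\<lambda>k. {Suc k..<2 * Suc k}"
  define eta where "eta k d = (\<chi> i. mean r q $ i + (\<Sum>j<Suc k. wgt r q k i j * d (Suc k + j) $ i))" for k and d :: "nat => real ^ 'n"
  \<comment> \<open>Disjoint index blocks of an independent family are independent, hence so are
    functions of each block.\<close>
  have bl: "indep_var (Pi\<^sub>M (?A k) (\<lambda>_. borel)) (\<lambda>om. restrict (\<lambda>i. D k i om) (?A k)) (Pi\<^sub>M (?B k) (\<lambda>_. borel)) (\<lambda>om. restrict (\<lambda>i. D k i om) (?B k))" for k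
   by (rule indep_var_restrict[OF iv]) auto
  have thetam: "theta g s r x k \<in> borel_measurable (Pi\<^sub>M (?A k) (\<lambda>_. borel))" for k
  proof (rule theta_measurable)
   fix t
   have "clip 0 T t \<in> {0..T}" using T by (intro clip_in) auto
   have c: "continuous_on UNIV (\<lambda>x::real ^ 'n. (clip 0 T t, x))" by (intro continuous_intros)
   have "continuous_on UNIV (\<lambda>x. (\<lambda>(t, x). g t x) (clip 0 T t, x))"
    by (rule continuous_on_compose2[OF gc c]) (use \<open>clip 0 T t \<in> {0..T}\<close> in auto)
   then show "continuous_on UNIV (g (clip 0 T t))" by simp
  qed
  have comp: "(\<lambda>d. d (Suc k + j) $ i) \<in> borel_measurable (Pi\<^sub>M (?B k) (\<lambda>_. borel :: (real ^ 'n) measure))" if "j < Suc k" for k j i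
  proof -
   have "(\<lambda>d. d (Suc k + j)) \<in> borel_measurable (Pi\<^sub>M (?B k) (\<lambda>_. borel :: (real ^ 'n) measure))"
    using that by (intro measurable_component_singleton) auto
   then show ?thesis by (rule measurable_compose[OF _ measurable_vec_nth_borel])
  qed
  have etm: "eta k \<in> borel_measurable (Pi\<^sub>M (?B k) (\<lambda>_. borel))" for k
   unfolding eta_def[abs_def]
   by (intro measurable_vec_lambda_borel borel_measurable_add borel_measurable_const borel_measurable_sum borel_measurable_times comp) auto
  have ind: "indep_var borel (\<lambda>om. theta g s r x k (\<lambda>j. D k j om)) borel (\<lambda>om. eta k (\<lambda>j. D k j om))" for k
  proof -
   have "theta g s r x k (restrict (\<lambda>i. D k i om) (?A k)) = theta g s r x k (\<lambda>j. D k j om)" for om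
    by (rule theta_cong) auto
   moreover have "eta k (restrict (\<lambda>i. D k i om) (?B k)) = eta k (\<lambda>j. D k j om)" for om
    by (auto simp: eta_def vec_eq_iff simp del: sum.lessThan_Suc intro!: sum.cong)
   ultimately show ?thesis
    using indep_var_compose[OF bl thetam etm, of k] by (simp add: comp_def)
  qed
  show ?thesis
  proof (rule indep_limit_expectation[OF ind Xm xim _ _ H Hb])
   show "AE om in M. (\<lambda>k. theta g s r x k (\<lambda>j. D k j om)) \<leadsto> X r om"
    using X noise_rc_AE[of T c]
   proof eventually_elim
    case (elim om)
    obtain KN where KN: "\<forall>v\<in>{0..T}. norm (noise c v om) <= KN" using elim by blast
    have ps: "path_sol lam T g s x (\<lambda>t. noise c t om) (\<lambda>t. X t om)"
     using elim(1) s gc by unfold_locales auto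
    have csD: "(\<Sum>i<j. cs (D k i om)) = noise c (gp s r (Suc k) j) om - noise c s om" if "j <= Suc k" for j k
     using that
    proof (induction j)
     case (Suc j)
     have "cs (D k j om) = noise c (gp s r (Suc k) (Suc j)) om - noise c (gp s r (Suc k) j) om"
      using Suc.prems by (simp add: cs_def D_def noise_def vec_eq_iff \<tau>1 algebra_simps)
     then show ?case using Suc by simp
    qed simp
    have "theta g s r x k (\<lambda>j. D k j om) = euler (\<lambda>t y. g (clip 0 T t) y - ldiag lam y) s r (Suc k) x (\<lambda>j. noise c (gp s r (Suc k) j) om - noise c s om) (Suc k) + (noise c r om - noise c s om)" for k
    proof -
     have "(\<Sum>i<Suc k. cs (D k i om)) = noise c r om - noise c s om"
      using csD[OF order_refl, of k] by simp
     then show ?thesis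
      unfolding theta_def using csD by (intro arg_cong2[where f="(+)"] euler_cong) auto
    qed
    moreover have "(\<lambda>k. euler (\<lambda>t y. g (clip 0 T t) y - ldiag lam y) s r (Suc k) x (\<lambda>j. noise c (gp s r (Suc k) j) om - noise c s om) (Suc k) + (noise c r om - noise c s om)) \<leadsto> X r om"
     by (rule psol_euler[OF ps 3(1) r0(2) lip, where KN=KN]) (use elim(2) KN in auto)
    ultimately show ?case by (simp only:)
   qed
   show "AE om in M. (\<lambda>k. eta k (\<lambda>j. D k j om)) \<leadsto> xi r q om"
    using xi_limit_AE[OF rq]
   proof eventually_elim
    case (elim om)
    have "\<tau> k (Suc (Suc k + j)) = gp r q (Suc k) (Suc j)" for k j using \<tau>2[of k "Suc j"] by simp
    then have "eta k (\<lambda>j. D k j om) = (\<chi> i. mean r q $ i + (\<Sum>j<Suc k. wgt r q k i j * (NW i (gp r q (Suc k) (Suc j)) om - NW i (gp r q (Suc k) j) om)))" for k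
     unfolding eta_def D_def vec_lambda_beta by (simp only: \<tau>2)
    then show ?case using elim by (simp only:)
   qed
  qed
 qed
qed

end

section \<open>Volterra equations with a singular kernel\<close>

lemma powr_singular_integrable:
 fixes \<gamma> T :: real
 assumes "0 < \<gamma>" "\<gamma> < 1" "0 <= T"
 shows "set_integrable lborel {0<..<T} (\<lambda>p. p powr (- \<gamma>))"
proof -
 have "(\<lambda>p. p powr (- \<gamma>)) integrable_on {0..T}" using assms by (intro integrable_on_powr_from_0) auto
 then have "(\<lambda>p. p powr (- \<gamma>)) absolutely_integrable_on {0..T}"
  by (intro nonnegative_absolutely_integrable_1) auto
 then have "integrable lebesgue (\<lambda>p. indicator {0..T} p *\<^sub>R p powr (- \<gamma>))" by (simp add: set_integrable_def)
 then have "integrable lborel (\<lambda>p. indicator {0..T} p *\<^sub>R p powr (- \<gamma>))"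
  by (subst (asm) integrable_completion) auto
 then have "set_integrable lborel {0..T} (\<lambda>p. p powr (- \<gamma>))" by (simp add: set_integrable_def)
 then show ?thesis by (rule set_integrable_subset) auto
qed

text \<open>The truncated Laplace transform of the singular kernel. It tends to 0 as \<mu> grows,
  which is where the contraction comes from.\<close>

definition sing :: "real => real => real => real" where
 "sing \<gamma> T \<mu> = (LBINT p:{0<..<T}. p powr (- \<gamma>) * exp (- (\<mu> * p)))"

lemma powr_exp_integrable:
 fixes \<gamma> T :: real
 assumes "0 < \<gamma>" "\<gamma> < 1" "0 <= T" "0 <= \<mu>"
 shows "set_integrable lborel {0<..<T} (\<lambda>p. p powr (- \<gamma>) * exp (- (\<mu> * p)))"
 by (rule set_integrable_bound[OF powr_singular_integrable[OF assms(1-3)]])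
  (use assms in "auto simp: set_borel_measurable_def abs_mult intro!: mult_left_le AE_I2")

lemma sing_tendsto_0:
 fixes \<gamma> T :: real
 assumes "0 < \<gamma>" "\<gamma> < 1" "0 <= T"
 shows "(\<lambda>n. sing \<gamma> T (real n)) \<leadsto> 0"
proof -
 have "(\<lambda>n. sing \<gamma> T (real n)) \<leadsto> (LINT p|(lborel :: real measure). 0)"
  unfolding sing_def set_lebesgue_integral_def
 proof (rule integral_dominated_convergence[where w="\<lambda>p. indicator {0<..<T} p *\<^sub>R p powr (- \<gamma>)"])
  show "integrable lborel (\<lambda>p. indicator {0<..<T} p *\<^sub>R p powr (- \<gamma>))"
   using powr_singular_integrable[OF assms] by (simp add: set_integrable_def)
  show "AE p in lborel. (\<lambda>n. indicator {0<..<T} p *\<^sub>R (p powr (- \<gamma>) * exp (- (real n * p)))) \<leadsto> 0"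
  proof (rule AE_I2)
   fix p :: real
   show "(\<lambda>n. indicator {0<..<T} p *\<^sub>R (p powr (- \<gamma>) * exp (- (real n * p)))) \<leadsto> 0"
   proof (cases "0 < p")
    case True
    then have "(\<lambda>n. exp (- (real n * p))) \<leadsto> 0" by real_asymp
    then have "(\<lambda>n. indicator {0<..<T} p *\<^sub>R (p powr (- \<gamma>) * exp (- (real n * p)))) \<leadsto> indicator {0<..<T} p *\<^sub>R (p powr (- \<gamma>) * 0)"
     by (intro tendsto_intros)
    then show ?thesis by simp
   qed simp
  qed
 qed (auto intro!: AE_I2 mult_left_le simp: abs_mult split: split_indicator)
 then show ?thesis by simp
qed

lemma sing_nonneg: "0 <= sing \<gamma> T \<mu>"
 unfolding sing_def set_lebesgue_integral_def by (rule integral_nonneg_AE) auto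

lemma sing_mono:
 fixes \<gamma> T :: real
 assumes "0 < \<gamma>" "\<gamma> < 1" "0 <= t" "t <= T" "0 <= \<mu>"
 shows "sing \<gamma> t \<mu> <= sing \<gamma> T \<mu>"
 unfolding sing_def set_lebesgue_integral_def
 by (rule integral_mono_AE)
  (use powr_exp_integrable[of \<gamma> t \<mu>] powr_exp_integrable[of \<gamma> T \<mu>] assms in
   \<open>auto simp: set_integrable_def intro!: AE_I2 split: split_indicator\<close>)

lemma set_integral_translate:
 fixes h :: "real => real"
 shows "set_integrable lborel {r<..<t} (\<lambda>q. h (q - r)) \<longleftrightarrow> set_integrable lborel {0<..<t - r} h"
  "(LBINT q:{r<..<t}. h (q - r)) = (LBINT p:{0<..<t - r}. h p)"
  "set_integrable lborel {r<..<t} (\<lambda>q. h (t - q)) \<longleftrightarrow> set_integrable lborel {0<..<t - r} h"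
  "(LBINT q:{r<..<t}. h (t - q)) = (LBINT p:{0<..<t - r}. h p)"
proof -
 let ?H = "\<lambda>p. indicator {0<..<t - r} p *\<^sub>R h p"
 have e1: "indicator {r<..<t} q *\<^sub>R h (q - r) = ?H (- r + 1 * q)" for q by (auto split: split_indicator)
 have e2: "indicator {r<..<t} q *\<^sub>R h (t - q) = ?H (t + (-1) * q)" for q by (auto split: split_indicator)
 show "set_integrable lborel {r<..<t} (\<lambda>q. h (q - r)) \<longleftrightarrow> set_integrable lborel {0<..<t - r} h"
  unfolding set_integrable_def e1 using lborel_integrable_real_affine_iff[of 1 ?H "- r"] by simp
 show "set_integrable lborel {r<..<t} (\<lambda>q. h (t - q)) \<longleftrightarrow> set_integrable lborel {0<..<t - r} h"
  unfolding set_integrable_def e2 using lborel_integrable_real_affine_iff[of "-1" ?H t] by simp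
 show "(LBINT q:{r<..<t}. h (q - r)) = (LBINT p:{0<..<t - r}. h p)"
  unfolding set_lebesgue_integral_def e1 using lborel_integral_real_affine[of 1 ?H "- r"] by simp
 show "(LBINT q:{r<..<t}. h (t - q)) = (LBINT p:{0<..<t - r}. h p)"
  unfolding set_lebesgue_integral_def e2 using lborel_integral_real_affine[of "-1" ?H t] by simp
qed

text \<open>The integrand of a Beta integral, singular at both ends of (r,t), damped by an
  exponential weight.\<close>

definition beta_kernel :: "real => real => real => real => real => real" where
 "beta_kernel \<gamma> \<mu> t r q = (q - r) powr (- \<gamma>) * ((t - q) powr (- \<gamma>) * exp (- (\<mu> * (q - r))))"

text \<open>In each half of the interval one singular factor is at most ((t - r)/2)^(-\<gamma>) <= 2
  (t - r)^(-\<gamma>). The other is integrated with the exponential, which in the half near t is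
  first replaced by the larger exp(- \<mu> (t - q)). Two halves times the factor 2 give the constant
  4.\<close>

lemma beta_kernel_bound:
 assumes g: "0 < \<gamma>" "\<gamma> < 1" and rt: "r < t" "t - r <= T" and \<mu>: "0 <= \<mu>"
 shows "set_integrable lborel {r<..<t} (beta_kernel \<gamma> \<mu> t r)"
  and "(LBINT q:{r<..<t}. beta_kernel \<gamma> \<mu> t r q) <= 4 * sing \<gamma> T \<mu> * (t - r) powr (- \<gamma>)"
proof -
 define h where "h p = p powr (- \<gamma>) * exp (- (\<mu> * p))" for p
 define A where "A = ((t - r) / 2) powr (- \<gamma>)"
 have A0: "0 <= A" by (simp add: A_def)
 have hi: "set_integrable lborel {0<..<t - r} h"
  unfolding h_def using g rt \<mu> by (intro powr_exp_integrable) auto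
 have i1: "set_integrable lborel {r<..<t} (\<lambda>q. h (q - r))" and i2: "set_integrable lborel {r<..<t} (\<lambda>q. h (t - q))"
  using hi by (simp_all add: set_integral_translate)
 have ii: "set_integrable lborel {r<..<t} (\<lambda>q. A * (h (q - r) + h (t - q)))"
  by (intro set_integrable_mult_right set_integral_add(1) i1 i2)
 have pt: "beta_kernel \<gamma> \<mu> t r q <= A * (h (q - r) + h (t - q))" if q: "q \<in> {r<..<t}" for q
 proof (cases "q - r <= t - q")
  case True
  then have "(t - q) powr (- \<gamma>) <= A"
   unfolding A_def using q g by (intro powr_mono2') auto
  then have "beta_kernel \<gamma> \<mu> t r q <= (q - r) powr (- \<gamma>) * (A * exp (- (\<mu> * (q - r))))"
   unfolding beta_kernel_def by (intro mult_left_mono mult_right_mono) auto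
  also have "\<dots> <= A * (h (q - r) + h (t - q))"
   by (simp add: h_def A_def algebra_simps)
  finally show ?thesis .
 next
  case False
  then have 1: "(q - r) powr (- \<gamma>) <= A"
   unfolding A_def using q g by (intro powr_mono2') auto
  have 2: "exp (- (\<mu> * (q - r))) <= exp (- (\<mu> * (t - q)))"
   using False \<mu> by (simp add: mult_left_mono)
  have "beta_kernel \<gamma> \<mu> t r q <= A * ((t - q) powr (- \<gamma>) * exp (- (\<mu> * (t - q))))"
   unfolding beta_kernel_def using 1 2 A0 by (intro mult_mono mult_left_mono) auto
  also have "\<dots> <= A * (h (q - r) + h (t - q))"
   by (simp add: h_def A_def algebra_simps)
  finally show ?thesis .
 qed
 have nn: "0 <= beta_kernel \<gamma> \<mu> t r q" for q by (simp add: beta_kernel_def)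
 show bi: "set_integrable lborel {r<..<t} (beta_kernel \<gamma> \<mu> t r)"
 proof (rule set_integrable_bound[OF ii])
  show "AE q in lborel. q \<in> {r<..<t} \<longrightarrow> norm (beta_kernel \<gamma> \<mu> t r q) <= norm (A * (h (q - r) + h (t - q)))"
   using pt nn by (intro AE_I2) (auto intro: order_trans[OF _ abs_ge_self])
 qed (auto simp: set_borel_measurable_def beta_kernel_def)
 have hs: "(LBINT q:{r<..<t}. h (q - r)) = sing \<gamma> (t - r) \<mu>" "(LBINT q:{r<..<t}. h (t - q)) = sing \<gamma> (t - r) \<mu>"
  unfolding set_integral_translate(2)[of r t h] set_integral_translate(4)[of r t h] sing_def
  by (simp_all add: h_def[abs_def])
 have "(LBINT q:{r<..<t}. beta_kernel \<gamma> \<mu> t r q) <= (LBINT q:{r<..<t}. A * (h (q - r) + h (t - q)))"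
  using pt by (intro set_integral_mono bi ii) auto
 also have "\<dots> = A * ((LBINT q:{r<..<t}. h (q - r)) + (LBINT q:{r<..<t}. h (t - q)))"
  by (simp add: set_integral_mult_right set_integral_add(2)[OF i1 i2])
 also have "\<dots> = A * (2 * sing \<gamma> (t - r) \<mu>)"
  by (simp add: hs)
 also have "\<dots> <= (2 * (t - r) powr (- \<gamma>)) * (2 * sing \<gamma> T \<mu>)"
 proof (rule mult_mono)
  have "A = (1 / 2) powr (- \<gamma>) * (t - r) powr (- \<gamma>)"
   unfolding A_def using rt by (simp add: powr_mult[symmetric])
  also have "(1 / 2 :: real) powr (- \<gamma>) = 2 powr \<gamma>" by (simp add: powr_minus powr_divide)
  also have "(2::real) powr \<gamma> <= 2 powr 1" using g by (intro powr_mono) auto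
  finally show "A <= 2 * (t - r) powr (- \<gamma>)" by (simp add: mult_right_mono)
  show "2 * sing \<gamma> (t - r) \<mu> <= 2 * sing \<gamma> T \<mu>" using sing_mono[of \<gamma> "t - r" T \<mu>] g rt \<mu> by simp
 qed (auto simp: sing_nonneg)
 finally show "(LBINT q:{r<..<t}. beta_kernel \<gamma> \<mu> t r q) <= 4 * sing \<gamma> T \<mu> * (t - r) powr (- \<gamma>)"
  by (simp add: mult_ac)
qed

text \<open>This isolates what the Volterra argument uses of the family R: boundedness, a gradient
  bound of order (q - s)^(-\<gamma>), stability of the gradient under bounded pointwise limits, and
  joint measurability. \<open>Xp\<close> stands for jointly measurable versions of the
  solutions.\<close>

locale mild_setting = prob_space M for M :: "'w measure" +
 fixes T \<gamma> CR KB :: real and R :: "real => real => (real ^ 'n::finite => real) => real ^ 'n => real"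
  and Bf :: "real => real ^ 'n => real ^ 'n" and Xp :: "real => real ^ 'n => real => 'w => real ^ 'n"
 assumes T: "0 < T" and gam: "0 < \<gamma>" "\<gamma> < 1" and CR: "0 <= CR" and KB: "0 <= KB"
  and R_bound: "\<And>s q \<psi> K x. 0 <= s ==> s <= q ==> q <= T ==> \<psi> \<in> bounded_borel ==> (\<And>y. \<bar>\<psi> y\<bar> <= K) ==> \<bar>R s q \<psi> x\<bar> <= K"
  and R_refl: "\<And>s \<psi> x. 0 <= s ==> s <= T ==> \<psi> \<in> bounded_borel ==> R s s \<psi> x = \<psi> x"
  and R_deriv: "\<And>s q \<psi> x i h. 0 <= s ==> s < q ==> q <= T ==> \<psi> \<in> bounded_borel ==>
   ((\<lambda>h. R s q \<psi> (nudge x h i)) has_real_derivative partial_deriv i (R s q \<psi>) (nudge x h i)) (at h)"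
  and R_cont: "\<And>s q \<psi>. 0 <= s ==> s < q ==> q <= T ==> \<psi> \<in> bounded_borel ==> continuous_on UNIV (R s q \<psi>)"
  and R_deriv_cont: "\<And>s q \<psi> i. 0 <= s ==> s < q ==> q <= T ==> \<psi> \<in> bounded_borel ==> continuous_on UNIV (partial_deriv i (R s q \<psi>))"
  and R_deriv_bound: "\<And>s q \<psi> K x i. 0 <= s ==> s < q ==> q <= T ==> \<psi> \<in> bounded_borel ==> (\<And>y. \<bar>\<psi> y\<bar> <= K) ==>
   \<bar>partial_deriv i (R s q \<psi>) x\<bar> <= CR * K * (q - s) powr (- \<gamma>)"
  and R_deriv_lim: "\<And>s q \<Psi> \<psi> K x i. 0 <= s ==> s < q ==> q <= T ==> (\<And>n::nat. \<Psi> n \<in> bounded_borel) ==> \<psi> \<in> bounded_borel ==>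
   (\<And>n y. \<bar>\<Psi> n y\<bar> <= K) ==> (\<And>y. (\<lambda>n. \<Psi> n y) \<leadsto> \<psi> y) ==>
   (\<lambda>n. partial_deriv i (R s q (\<Psi> n)) x) \<leadsto> partial_deriv i (R s q \<psi>) x"
  and R_lincomb: "\<And>s q \<phi> \<psi> a b x. 0 <= s ==> s <= q ==> q <= T ==> \<phi> \<in> bounded_borel ==> \<psi> \<in> bounded_borel ==>
   R s q (\<lambda>y. a * \<phi> y + b * \<psi> y) x = a * R s q \<phi> x + b * R s q \<psi> x"
  and R_meas: "\<And>w. (\<lambda>(q, y). w q y) \<in> borel_fun2 ==>
   (\<lambda>(s, q, x). if 0 <= s \<and> s < q \<and> q <= T then R s q (w q) x else 0) \<in> borel_measurable (borel \<Otimes>\<^sub>M (borel \<Otimes>\<^sub>M borel))"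
  and R_time_cont: "\<And>q \<psi> x. 0 < q ==> q <= T ==> \<psi> \<in> bounded_borel ==> continuous_on {0..<q} (\<lambda>s. R s q \<psi> x)"
  and B_meas: "(\<lambda>(t, x). Bf t x) \<in> borel_fun2"
  and B_bound: "\<And>t x i. \<bar>Bf t x $ i\<bar> <= KB"
  and X_meas: "\<And>s x. 0 <= s ==> s <= T ==> (\<lambda>(t, om). Xp s x t om) \<in> borel_measurable (borel \<Otimes>\<^sub>M M)"
  and P_refl: "\<And>s \<psi> x. 0 <= s ==> s <= T ==> \<psi> \<in> bounded_borel ==> (LINT om|M. \<psi> (Xp s x s om)) = \<psi> x"
begin

abbreviation (input) "ew \<mu> h \<equiv> h powr (- \<gamma>) * exp (\<mu> * h)"

text \<open>With \<psi> = w q this is the integrand of the Volterra equation for w; with \<psi> =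
  \<phi> and q = t it is the inhomogeneity.\<close>

definition ker :: "real => real => (real ^ 'n => real) => real ^ 'n => real" where
 "ker s q \<psi> x = (\<Sum>i\<in>UNIV. Bf s x $ i * partial_deriv i (R s q \<psi>) x)"

definition adm :: "(real => real ^ 'n => real) => bool" where
 "adm w \<longleftrightarrow> (\<lambda>(q, y). w q y) \<in> borel_fun2 \<and> (\<forall>q. w q \<in> bounded_borel)"

lemma admD: "adm w ==> (\<lambda>(q, y). w q y) \<in> borel_fun2" "adm w ==> w q \<in> bounded_borel"
 by (auto simp: adm_def)

text \<open>The time triangle on which R has a gradient. Joint measurability is stated for functions
  cut off by 0 outside it.\<close>

definition dom :: "real => real => bool" where "dom s q \<longleftrightarrow> 0 <= s \<and> s < q \<and> q <= T"

lemma dom_measurable [measurable (raw)]: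
 assumes [measurable]: "a \<in> borel_measurable X" "b \<in> borel_measurable X"
 shows "Measurable.pred X (\<lambda>z. dom (a z) (b z))"
 unfolding dom_def by measurable

lemma R_measurable:
 assumes w: "adm w" and [measurable]: "a \<in> borel_measurable X" "b \<in> borel_measurable X" "p \<in> borel_measurable X"
 shows "(\<lambda>z. if dom (a z) (b z) then R (a z) (b z) (w (b z)) (p z) else 0) \<in> borel_measurable X"
 using measurable_compose[OF _ R_meas[OF admD(1)[OF w]], of "\<lambda>z. (a z, b z, p z)" X] by (simp add: dom_def)

text \<open>The derivative is the pointwise limit of difference quotients with step 1/(n+1), and
  these are jointly measurable because R is.\<close>

lemma Dp_measurable:
 assumes w: "adm w" and [measurable]: "a \<in> borel_measurable X" "b \<in> borel_measurable X" "p \<in> borel_measurable X"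
 shows "(\<lambda>z. if dom (a z) (b z) then partial_deriv i (R (a z) (b z) (w (b z))) (p z) else 0) \<in> borel_measurable X"
proof (rule borel_measurable_LIMSEQ_real)
 define Q where "Q n z = (if dom (a z) (b z) then R (a z) (b z) (w (b z)) (p z + (1 / real (Suc n)) *\<^sub>R axis i 1) else 0)" for n :: nat and z
 define Q0 where "Q0 z = (if dom (a z) (b z) then R (a z) (b z) (w (b z)) (p z) else 0)" for z
 have "Q n \<in> borel_measurable X" for n
  unfolding Q_def by (rule R_measurable[OF w]) measurable
 moreover have "Q0 \<in> borel_measurable X" unfolding Q0_def by (rule R_measurable[OF w]) measurable
 ultimately show "(\<lambda>z. (Q n z - Q0 z) / (1 / real (Suc n))) \<in> borel_measurable X" for n by measurable
 fix z
 show "(\<lambda>n. (Q n z - Q0 z) / (1 / real (Suc n))) \<leadsto> (if dom (a z) (b z) then partial_deriv i (R (a z) (b z) (w (b z))) (p z) else 0)"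
 proof (cases "dom (a z) (b z)")
  case True
  have "((\<lambda>h. R (a z) (b z) (w (b z)) (p z + h *\<^sub>R axis i 1)) has_real_derivative partial_deriv i (R (a z) (b z) (w (b z))) (p z)) (at 0)"
   using R_deriv[of "a z" "b z" "w (b z)" "p z" i 0] True admD(2)[OF w] by (simp add: dom_def)
  then have "((\<lambda>h. (R (a z) (b z) (w (b z)) (p z + h *\<^sub>R axis i 1) - R (a z) (b z) (w (b z)) (p z)) / h) \<longlongrightarrow> partial_deriv i (R (a z) (b z) (w (b z))) (p z)) (at 0)"
   by (simp add: DERIV_def)
  then have "(\<lambda>n. (R (a z) (b z) (w (b z)) (p z + (1 / real (Suc n)) *\<^sub>R axis i 1) - R (a z) (b z) (w (b z)) (p z)) / (1 / real (Suc n))) \<leadsto> partial_deriv i (R (a z) (b z) (w (b z))) (p z)"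
   unfolding tendsto_at_iff_sequentially comp_def
   by (elim allE[of _ "\<lambda>n. 1 / real (Suc n)"] impE) (auto intro: LIMSEQ_Suc[OF lim_1_over_n, unfolded of_nat_Suc] simp del: of_nat_Suc, real_asymp)
  then show ?thesis using True by (simp add: Q_def Q0_def del: of_nat_Suc)
 qed (simp add: Q_def Q0_def)
qed

lemma B_measurable [measurable (raw)]:
 assumes [measurable]: "a \<in> borel_measurable X" "p \<in> borel_measurable X"
 shows "(\<lambda>z. Bf (a z) (p z) $ i) \<in> borel_measurable X"
 using measurable_compose[OF measurable_compose[OF _ B_meas, of "\<lambda>z. (a z, p z)" X] measurable_vec_nth_borel]
 by simp

lemma ker_measurable:
 assumes w: "adm w" and [measurable]: "a \<in> borel_measurable X" "b \<in> borel_measurable X" "p \<in> borel_measurable X"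
 shows "(\<lambda>z. if dom (a z) (b z) then ker (a z) (b z) (w (b z)) (p z) else 0) \<in> borel_measurable X"
proof -
 note Dp_measurable[OF w assms(2-4), measurable]
 have "(\<lambda>z. \<Sum>i\<in>UNIV. Bf (a z) (p z) $ i * (if dom (a z) (b z) then partial_deriv i (R (a z) (b z) (w (b z))) (p z) else 0)) \<in> borel_measurable X"
  by measurable
 moreover have "(\<lambda>z. \<Sum>i\<in>UNIV. Bf (a z) (p z) $ i * (if dom (a z) (b z) then partial_deriv i (R (a z) (b z) (w (b z))) (p z) else 0)) =
   (\<lambda>z. if dom (a z) (b z) then ker (a z) (b z) (w (b z)) (p z) else 0)"
  by (auto simp: ker_def)
 ultimately show ?thesis by simp
qed

definition Ck :: real where "Ck = real CARD('n) * KB * CR"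

lemma Ck_nonneg: "0 <= Ck" using CR KB by (simp add: Ck_def)

lemma ker_bound:
 assumes "dom s q" "\<psi> \<in> bounded_borel" "\<And>y. \<bar>\<psi> y\<bar> <= K"
 shows "\<bar>ker s q \<psi> x\<bar> <= Ck * K * (q - s) powr (- \<gamma>)"
proof -
 have "\<bar>ker s q \<psi> x\<bar> <= (\<Sum>i\<in>UNIV. \<bar>Bf s x $ i * partial_deriv i (R s q \<psi>) x\<bar>)" unfolding ker_def by (rule sum_abs)
 also have "\<dots> <= (\<Sum>i\<in>(UNIV::'n set). KB * (CR * K * (q - s) powr (- \<gamma>)))"
  unfolding abs_mult using assms B_bound KB R_deriv_bound[of s q \<psi> K]
  by (intro sum_mono mult_mono) (auto simp: dom_def)
 finally show ?thesis by (simp add: Ck_def mult_ac)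
qed

lemma ker_lim:
 assumes "dom s q" "\<And>n::nat. \<Psi> n \<in> bounded_borel" "\<psi> \<in> bounded_borel" "\<And>n y. \<bar>\<Psi> n y\<bar> <= K" "\<And>y. (\<lambda>n. \<Psi> n y) \<leadsto> \<psi> y"
 shows "(\<lambda>n. ker s q (\<Psi> n) x) \<leadsto> ker s q \<psi> x"
 unfolding ker_def using assms by (intro tendsto_intros R_deriv_lim[where K=K]) (auto simp: dom_def)

lemma R_deriv_lincomb:
 assumes "dom s q" "\<phi> \<in> bounded_borel" "\<psi> \<in> bounded_borel"
 shows "partial_deriv i (R s q (\<lambda>y. a * \<phi> y + b * \<psi> y)) x = a * partial_deriv i (R s q \<phi>) x + b * partial_deriv i (R s q \<psi>) x"
proof -
 have d: "((\<lambda>h. R s q \<psi> (nudge x h i)) has_real_derivative partial_deriv i (R s q \<psi>) x) (at 0)"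
  if "\<psi> \<in> bounded_borel" for \<psi>
  using R_deriv[of s q \<psi> x i 0] assms(1) that by (simp add: dom_def)
 have "((\<lambda>h. a * R s q \<phi> (nudge x h i) + b * R s q \<psi> (nudge x h i)) has_real_derivative
   (a * partial_deriv i (R s q \<phi>) x + b * partial_deriv i (R s q \<psi>) x)) (at 0)"
  by (intro DERIV_add DERIV_cmult d assms)
 moreover have "a * R s q \<phi> (nudge x h i) + b * R s q \<psi> (nudge x h i) = R s q (\<lambda>y. a * \<phi> y + b * \<psi> y) (nudge x h i)" for h
  using assms by (intro R_lincomb[symmetric]) (auto simp: dom_def)
 ultimately show ?thesis
  using d[OF bounded_borel_lincomb[OF assms(2,3), of a b]] by (simp add: DERIV_unique)
qed

lemma ker_lincomb:
 assumes "dom s q" "\<phi> \<in> bounded_borel" "\<psi> \<in> bounded_borel"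
 shows "ker s q (\<lambda>y. a * \<phi> y + b * \<psi> y) x = a * ker s q \<phi> x + b * ker s q \<psi> x"
 unfolding ker_def R_deriv_lincomb[OF assms] by (simp add: sum.distrib sum_distrib_left algebra_simps)

text \<open>The weight \<open>exp (\<mu> * (t - q))\<close> makes \<open>Kop t\<close> a contraction for large \<open>\<mu>\<close>.\<close>

definition wtd :: "real => real => real => (real => real ^ 'n => real) => bool" where
 "wtd \<mu> t A w \<longleftrightarrow> (\<forall>q y. (0 <= q \<and> q < t \<longrightarrow> \<bar>w q y\<bar> <= A * ew \<mu> (t - q)) \<and> (\<not> (0 <= q \<and> q < t) \<longrightarrow> w q y = 0))"

definition Kop :: "real => (real => real ^ 'n => real) => real => real ^ 'n => real" where
 "Kop t w s x = (LBINT q:{s<..<t}. ker s q (w q) x)"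

lemma wtd_bound: "wtd \<mu> t A w ==> 0 <= q ==> q < t ==> \<bar>w q y\<bar> <= A * ew \<mu> (t - q)"
 and wtd_zero: "wtd \<mu> t A w ==> \<not> (0 <= q \<and> q < t) ==> w q y = 0"
 unfolding wtd_def by blast+

lemma adm_wtdI:
 assumes "(\<lambda>(q, y). w q y) \<in> borel_fun2" "wtd \<mu> t A w"
 shows "adm w"
 unfolding adm_def
proof (intro conjI allI assms(1))
 fix q
 have "w q \<in> borel_fun"
  using measurable_compose[OF _ assms(1), of "\<lambda>y. (q, y)" borel] by simp
 then show "w q \<in> bounded_borel"
 proof (cases "0 <= q \<and> q < t")
  case True
  then show ?thesis using wtd_bound[OF assms(2), of q] \<open>w q \<in> _\<close> by (intro bounded_borelI) auto
 next
  case False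
  then show ?thesis using wtd_zero[OF assms(2), of q] \<open>w q \<in> _\<close> by (intro bounded_borelI[where K=0]) auto
 qed
qed

text \<open>Writing exp(\<mu> (t - q)) as exp(\<mu> (t - s)) exp(- \<mu> (q - s)) extracts the
  weight at time s and leaves the damped Beta integrand. The weight thus reproduces itself up to the
  factor 4 * sing, which is small for large \<mu>.\<close>

lemma singular_integrand:
 fixes h :: "real => real"
 assumes st: "0 <= s" "s < t" "t <= T" and \<mu>: "0 <= \<mu>" and C: "0 <= C"
  and hm: "set_borel_measurable lborel {s<..<t} h"
  and hb: "\<And>q. q \<in> {s<..<t} ==> \<bar>h q\<bar> <= C * (q - s) powr (- \<gamma>) * ew \<mu> (t - q)"
 shows "set_integrable lborel {s<..<t} h"
  "\<bar>LBINT q:{s<..<t}. h q\<bar> <= C * (4 * sing \<gamma> T \<mu>) * ew \<mu> (t - s)"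
proof -
 let ?b = "\<lambda>q. (C * exp (\<mu> * (t - s))) * beta_kernel \<gamma> \<mu> t s q"
 have bk: "set_integrable lborel {s<..<t} (beta_kernel \<gamma> \<mu> t s)"
   "(LBINT q:{s<..<t}. beta_kernel \<gamma> \<mu> t s q) <= 4 * sing \<gamma> T \<mu> * (t - s) powr (- \<gamma>)"
 proof -
  have "t - s <= T" using st by simp
  note B = beta_kernel_bound[OF gam st(2) this \<mu>]
  show "set_integrable lborel {s<..<t} (beta_kernel \<gamma> \<mu> t s)" by (rule B(1))
  show "(LBINT q:{s<..<t}. beta_kernel \<gamma> \<mu> t s q) <= 4 * sing \<gamma> T \<mu> * (t - s) powr (- \<gamma>)" by (rule B(2))
 qed
 have bi: "set_integrable lborel {s<..<t} ?b" by (intro set_integrable_mult_right impI bk)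
 have le: "\<bar>h q\<bar> <= ?b q" if "q \<in> {s<..<t}" for q
 proof -
  have "exp (\<mu> * (t - q)) = exp (\<mu> * (t - s)) * exp (- (\<mu> * (q - s)))" by (simp add: exp_add[symmetric] algebra_simps)
  then show ?thesis using hb[OF that] by (simp add: beta_kernel_def mult_ac)
 qed
 show hi: "set_integrable lborel {s<..<t} h"
  by (rule set_integrable_bound[OF bi hm]) (use le in "auto intro!: AE_I2 intro: order_trans[OF _ abs_ge_self]")
 have "\<bar>LBINT q:{s<..<t}. h q\<bar> <= (LBINT q:{s<..<t}. \<bar>h q\<bar>)" using set_integral_norm_bound[OF hi] by simp
 also have "\<dots> <= (LBINT q:{s<..<t}. ?b q)" by (intro set_integral_mono set_integrable_abs hi bi le)
 also have "\<dots> = (C * exp (\<mu> * (t - s))) * (LBINT q:{s<..<t}. beta_kernel \<gamma> \<mu> t s q)" by (rule set_integral_mult_right)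
 also have "\<dots> <= (C * exp (\<mu> * (t - s))) * (4 * sing \<gamma> T \<mu> * (t - s) powr (- \<gamma>))"
  using bk(2) C by (intro mult_left_mono) auto
 finally show "\<bar>LBINT q:{s<..<t}. h q\<bar> <= C * (4 * sing \<gamma> T \<mu>) * ew \<mu> (t - s)"
  by (simp add: mult_ac)
qed

lemma section_measurable:
 assumes "\<And>X a b p. a \<in> borel_measurable X ==> b \<in> borel_measurable X ==> p \<in> borel_measurable X ==>
   (\<lambda>z. if dom (a z) (b z) then F (a z) (b z) (p z) else (0::real)) \<in> borel_measurable (X :: real measure)"
  and "0 <= s" "t <= T"
 shows "set_borel_measurable lborel {s<..<t} (\<lambda>q. F s q (x :: real ^ 'n))"
proof -
 have [measurable]: "(\<lambda>q. if dom s q then F s q x else 0) \<in> borel_measurable lborel"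
  by (rule assms(1)) auto
 have m: "(\<lambda>q. indicator {s<..<t} q *\<^sub>R (if dom s q then F s q x else 0)) \<in> borel_measurable lborel" by measurable
 have eq: "(\<lambda>q. indicator {s<..<t} q *\<^sub>R (if dom s q then F s q x else 0)) = (\<lambda>q. indicator {s<..<t} q *\<^sub>R F s q x)"
  using assms(2,3) by (auto simp: dom_def split: split_indicator)
 show ?thesis unfolding set_borel_measurable_def using m unfolding eq .
qed

text \<open>Here Ck * 4 * sing appears as the Lipschitz constant of the linear map w ->
  \<open>Kop t w\<close> in the weighted norm.\<close>

lemma wtd_ker:
 assumes w: "adm w" "wtd \<mu> t A w" and st: "0 <= s" "s < t" "t <= T" and \<mu>: "0 <= \<mu>" and A: "0 <= A"
 shows "set_integrable lborel {s<..<t} (\<lambda>q. ker s q (w q) x)"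
  "\<bar>Kop t w s x\<bar> <= Ck * (4 * sing \<gamma> T \<mu>) * (A * ew \<mu> (t - s))"
proof -
 have m: "set_borel_measurable lborel {s<..<t} (\<lambda>q. ker s q (w q) x)"
  by (rule section_measurable[where F="\<lambda>s q x. ker s q (w q) x"]) (use st in "auto intro: ker_measurable[OF w(1)]")
 have b: "\<bar>ker s q (w q) x\<bar> <= Ck * A * (q - s) powr (- \<gamma>) * ew \<mu> (t - q)" if q: "q \<in> {s<..<t}" for q
 proof -
  have "\<bar>ker s q (w q) x\<bar> <= Ck * (A * ew \<mu> (t - q)) * (q - s) powr (- \<gamma>)"
   using q st wtd_bound[OF w(2), of q] by (intro ker_bound admD(2)[OF w(1)]) (auto simp: dom_def)
  then show ?thesis by (simp add: mult_ac)
 qed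
 note S = singular_integrand[OF st \<mu> _ m b]
 show "set_integrable lborel {s<..<t} (\<lambda>q. ker s q (w q) x)" using S(1) A Ck_nonneg by simp
 show "\<bar>Kop t w s x\<bar> <= Ck * (4 * sing \<gamma> T \<mu>) * (A * ew \<mu> (t - s))"
  unfolding Kop_def using S(2) A Ck_nonneg by (simp add: mult_ac)
qed

text \<open>What membership in the class of the theorem gives after time reversal and what the
  uniqueness argument uses: measurability, partial derivatives, and a gradient that explodes at most
  like (t - s)^(-\<gamma>).\<close>

definition reg :: "real => (real => real ^ 'n => real) => bool" where
 "reg t u \<longleftrightarrow> (\<lambda>(s, x). if 0 <= s \<and> s < t then u s x else 0) \<in> borel_fun2 \<and>
   (\<forall>s i x. 0 <= s \<longrightarrow> s < t \<longrightarrow> ((\<lambda>h. u s (nudge x h i)) has_real_derivative partial_deriv i (u s) x) (at 0)) \<and>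
   (\<exists>K. \<forall>s i x. 0 <= s \<longrightarrow> s < t \<longrightarrow> \<bar>partial_deriv i (u s) x\<bar> <= K * (t - s) powr (- \<gamma>))"

text \<open>The time integral is over the open interval, so that the uncontrolled gradient of u t
  does not enter. The endpoints are null sets, hence the equation is the same.\<close>

definition mildp :: "(real ^ 'n => real) => real => (real => real ^ 'n => real) => bool" where
 "mildp \<phi> t u \<longleftrightarrow> (\<forall>s\<in>{0..t}. \<forall>x.
   set_integrable lborel {s<..<t} (\<lambda>r. R s r (\<lambda>y. Bf r y \<bullet> gradient (u r) y) x) \<and>
   u s x = R s t \<phi> x + (LBINT r:{s<..<t}. R s r (\<lambda>y. Bf r y \<bullet> gradient (u r) y) x))"

definition wof :: "real => (real => real ^ 'n => real) => real => real ^ 'n => real" where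
 "wof t u q y = (if 0 <= q \<and> q < t then Bf q y \<bullet> gradient (u q) y else 0)"

text \<open>The gradient bound of \<open>reg\<close> is a weighted bound with \<mu> = 0, and
  difference quotients give joint measurability of the gradient.\<close>

lemma wof_props:
 assumes "reg t u"
 obtains A where "0 <= A" "adm (wof t u)" "wtd 0 t A (wof t u)"
proof -
 obtain K where K: "\<And>s i x. 0 <= s ==> s < t ==> \<bar>partial_deriv i (u s) x\<bar> <= K * (t - s) powr (- \<gamma>)"
  using assms unfolding reg_def by blast
 have m: "(\<lambda>(s, x). if 0 <= s \<and> s < t then u s x else 0) \<in> borel_fun2"
  using assms unfolding reg_def by blast
 have d: "((\<lambda>h. u s (nudge x h i)) has_real_derivative partial_deriv i (u s) x) (at 0)" if "0 <= s" "s < t" for s i x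
  using assms that unfolding reg_def by blast
 define A where "A = real CARD('n) * (KB * \<bar>K\<bar>)"
 have A: "0 <= A" using KB by (simp add: A_def)
 have w: "wof t u q y = (\<Sum>i\<in>UNIV. Bf q y $ i * partial_deriv i (u q) y)" if "0 <= q" "q < t" for q y
  using that by (simp add: wof_def inner_vec_def gradient_def)
 have wt: "wtd 0 t A (wof t u)"
  unfolding wtd_def
 proof (intro allI conjI impI)
  fix q y assume q: "0 <= q \<and> q < t"
  have "\<bar>wof t u q y\<bar> <= (\<Sum>i\<in>UNIV. \<bar>Bf q y $ i * partial_deriv i (u q) y\<bar>)"
   using q by (simp add: w sum_abs)
  also have "\<dots> <= (\<Sum>i\<in>(UNIV::'n set). KB * (\<bar>K\<bar> * (t - q) powr (- \<gamma>)))"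
   unfolding abs_mult
  proof (intro sum_mono mult_mono B_bound KB)
   fix i
   show "\<bar>partial_deriv i (u q) y\<bar> <= \<bar>K\<bar> * (t - q) powr (- \<gamma>)"
    using K[of q i y] q by (auto intro: order_trans mult_right_mono)
  qed auto
  finally show "\<bar>wof t u q y\<bar> <= A * ((t - q) powr (- \<gamma>) * exp (0 * (t - q)))" by (simp add: A_def mult_ac)
 qed (auto simp: wof_def)
 have dm: "(\<lambda>(q, y). if 0 <= q \<and> q < t then partial_deriv i (u q) y else 0) \<in> borel_fun2" for i
 proof (rule borel_measurable_LIMSEQ_real)
  define U where "U = (\<lambda>z. case z of (s, x) => if 0 <= s \<and> s < t then u s x else 0)"
  have [measurable]: "U \<in> borel_fun2" unfolding U_def by (rule m)
  show "(\<lambda>z. (U (fst z, snd z + (1 / real (Suc n)) *\<^sub>R axis i 1) - U z) / (1 / real (Suc n))) \<in> borel_fun2" for n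
   by measurable
  fix z :: "real \<times> (real ^ 'n)"
  obtain q y where z: "z = (q, y)" by (cases z)
  show "(\<lambda>n. (U (fst z, snd z + (1 / real (Suc n)) *\<^sub>R axis i 1) - U z) / (1 / real (Suc n))) \<leadsto>
   (case z of (q, y) => if 0 <= q \<and> q < t then partial_deriv i (u q) y else 0)"
  proof (cases "0 <= q \<and> q < t")
   case True
   then have "((\<lambda>h. (u q (nudge y h i) - u q y) / h) \<longlongrightarrow> partial_deriv i (u q) y) (at 0)"
    using d[of q y i] by (simp add: DERIV_def)
   then have "(\<lambda>n. (u q (y + (1 / real (Suc n)) *\<^sub>R axis i 1) - u q y) / (1 / real (Suc n))) \<leadsto> partial_deriv i (u q) y"
    unfolding tendsto_at_iff_sequentially comp_def
    by (elim allE[of _ "\<lambda>n. 1 / real (Suc n)"] impE) (auto simp del: of_nat_Suc, real_asymp)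
   then show ?thesis using True by (simp add: z U_def del: of_nat_Suc)
  qed (auto simp: z U_def)
 qed
 have "(\<lambda>z. \<Sum>i\<in>UNIV. Bf (fst z) (snd z) $ i * (case z of (q, y) => if 0 <= q \<and> q < t then partial_deriv i (u q) y else 0)) \<in> borel_fun2"
  by (intro borel_measurable_sum borel_measurable_times dm B_measurable) auto
 also have "(\<lambda>z. \<Sum>i\<in>UNIV. Bf (fst z) (snd z) $ i * (case z of (q, y) => if 0 <= q \<and> q < t then partial_deriv i (u q) y else 0)) = (\<lambda>(q, y). wof t u q y)"
  by (auto simp: fun_eq_iff wof_def inner_vec_def gradient_def)
 finally have "adm (wof t u)" by (rule adm_wtdI[OF _ wt])
 with A wt that show ?thesis by blast
qed

lemma adm_const: "\<phi> \<in> bounded_borel ==> adm (\<lambda>_. \<phi>)"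
 unfolding adm_def split_beta' using measurable_compose[OF measurable_snd bounded_borel_measurable[of \<phi>]] by auto

lemma R_section_measurable:
 assumes "adm w" "0 <= s" "t <= T"
 shows "set_borel_measurable lborel {s<..<t} (\<lambda>q. R s q (w q) x)"
  "set_borel_measurable lborel {s<..<t} (\<lambda>q. partial_deriv i (R s q (w q)) x)"
 by (rule section_measurable[where F="\<lambda>s q x. R s q (w q) x"]; use assms in "auto intro: R_measurable")
  (rule section_measurable[where F="\<lambda>s q x. partial_deriv i (R s q (w q)) x"]; use assms in "auto intro: Dp_measurable")

definition majorant :: "real => real => real => real => real => real" where
 "majorant \<mu> s t C q = C * (q - s) powr (- \<gamma>) * ew \<mu> (t - q)"

lemma majorant_integrable:
 assumes "0 <= s" "s < t" "t <= T" "0 <= \<mu>" "0 <= C"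
 shows "set_integrable lborel {s<..<t} (majorant \<mu> s t C)"
 by (rule singular_integrand(1)[OF assms])
  (use assms in "auto simp: majorant_def[abs_def] set_borel_measurable_def abs_mult")

lemma majorized_integral_continuous:
 fixes F :: "real => real ^ 'n => real"
 assumes st: "0 <= s" "s < t" "t <= T" and \<mu>: "0 <= \<mu>" and C: "0 <= C"
  and m: "\<And>x. set_borel_measurable lborel {s<..<t} (\<lambda>q. F q x)" and c: "\<And>q. q \<in> {s<..<t} ==> continuous_on UNIV (F q)"
  and b: "\<And>q x. q \<in> {s<..<t} ==> \<bar>F q x\<bar> <= majorant \<mu> s t C q"
 shows "continuous_on UNIV (\<lambda>x. LBINT q:{s<..<t}. F q x)"
  unfolding continuous_on_sequentially comp_def
 proof (intro ballI allI impI, elim conjE)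
  fix X :: "nat => real ^ 'n" and x assume X: "X \<leadsto> x"
  show "(\<lambda>n. LBINT q:{s<..<t}. F q (X n)) \<leadsto> (LBINT q:{s<..<t}. F q x)"
   unfolding set_lebesgue_integral_def
  proof (rule integral_dominated_convergence[where w="\<lambda>q. indicator {s<..<t} q *\<^sub>R majorant \<mu> s t C q"])
   show "AE q in lborel. (\<lambda>n. indicator {s<..<t} q *\<^sub>R F q (X n)) \<leadsto> indicator {s<..<t} q *\<^sub>R F q x"
   proof (rule AE_I2)
    fix q
    show "(\<lambda>n. indicator {s<..<t} q *\<^sub>R F q (X n)) \<leadsto> indicator {s<..<t} q *\<^sub>R F q x"
    proof (cases "q \<in> {s<..<t}")
     case True
     have "(\<lambda>n. F q (X n)) \<leadsto> F q x"
      using c[OF True] by (intro isCont_tendsto_compose[OF _ X]) (simp add: continuous_on_eq_continuous_at)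
     then show ?thesis by (intro tendsto_intros)
    qed simp
   qed
   show "AE q in lborel. norm (indicator {s<..<t} q *\<^sub>R F q (X n)) <= indicator {s<..<t} q *\<^sub>R majorant \<mu> s t C q" for n
    using b by (intro AE_I2) (auto split: split_indicator)
  qed (use m majorant_integrable[OF st \<mu> C] in "auto simp: set_borel_measurable_def set_integrable_def")
 qed

lemma powr_ge_1:
 assumes "0 < h" "h <= T"
 shows "1 <= T powr \<gamma> * h powr (- \<gamma>)"
proof -
 have "h powr \<gamma> <= T powr \<gamma>" using assms gam by (intro powr_mono2) auto
 then show ?thesis using assms by (simp add: powr_minus divide_inverse[symmetric] le_divide_eq)
qed

text \<open>R itself has no singularity at q = s, but 1 <= T^\<gamma> (q - s)^(-\<gamma>) allows it
  to be dominated by the same type of majorant as its gradient. This is the origin of the factor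
  T^\<gamma>.\<close>

lemma weight_le_majorant:
 assumes "0 <= A" "0 <= s" "s < q" "q < t" "t <= T"
 shows "A * ew \<mu> (t - q) <= majorant \<mu> s t (A * T powr \<gamma>) q"
proof -
 have "A * ew \<mu> (t - q) * 1 <= A * ew \<mu> (t - q) * (T powr \<gamma> * (q - s) powr (- \<gamma>))"
  using assms powr_ge_1[of "q - s"] by (intro mult_left_mono) auto
 then show ?thesis by (simp add: majorant_def mult_ac)
qed

lemma R_wtd_bound:
 assumes w: "adm w" "wtd \<mu> t A w" and A: "0 <= A" and q: "0 <= s" "s < q" "q < t" "t <= T"
 shows "\<bar>R s q (w q) x\<bar> <= A * ew \<mu> (t - q)"
  "\<bar>R s q (w q) x\<bar> <= majorant \<mu> s t (A * T powr \<gamma>) q"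
  "\<bar>partial_deriv i (R s q (w q)) x\<bar> <= majorant \<mu> s t (CR * A) q"
proof -
 have b: "\<bar>w q y\<bar> <= A * ew \<mu> (t - q)" for y
  using q by (intro wtd_bound[OF w(2)]) auto
 show 1: "\<bar>R s q (w q) x\<bar> <= A * ew \<mu> (t - q)"
  using q b by (intro R_bound admD(2)[OF w(1)]) auto
 with weight_le_majorant[OF A q] show "\<bar>R s q (w q) x\<bar> <= majorant \<mu> s t (A * T powr \<gamma>) q" by (rule order_trans[rotated])
 have "\<bar>partial_deriv i (R s q (w q)) x\<bar> <= CR * (A * ew \<mu> (t - q)) * (q - s) powr (- \<gamma>)"
  using q b by (intro R_deriv_bound admD(2)[OF w(1)]) auto
 then show "\<bar>partial_deriv i (R s q (w q)) x\<bar> <= majorant \<mu> s t (CR * A) q"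
  by (simp add: majorant_def mult_ac)
qed

definition Rop :: "real => (real => real ^ 'n => real) => real => real ^ 'n => real" where
 "Rop t w s x = (LBINT q:{s<..<t}. R s q (w q) x)"

definition Dop :: "'n => real => (real => real ^ 'n => real) => real => real ^ 'n => real" where
 "Dop i t w s x = (LBINT q:{s<..<t}. partial_deriv i (R s q (w q)) x)"

context
 fixes w \<mu> t A s
 assumes w: "adm w" "wtd \<mu> t A w" and A: "0 <= A" and \<mu>: "0 <= \<mu>" and st: "0 <= s" "s < t" "t <= T"
begin

lemma Rop_integrable: "set_integrable lborel {s<..<t} (\<lambda>q. R s q (w q) x)"
 by (rule singular_integrand(1)[OF st \<mu> _ R_section_measurable(1)[OF w(1) st(1,3)], where C="A * T powr \<gamma>"])
  (use A R_wtd_bound(2)[OF w A st(1)] st in "auto simp: majorant_def")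

lemma Dop_integrable: "set_integrable lborel {s<..<t} (\<lambda>q. partial_deriv i (R s q (w q)) x)"
 by (rule singular_integrand(1)[OF st \<mu> _ R_section_measurable(2)[OF w(1) st(1,3)], where C="CR * A"])
  (use A CR R_wtd_bound(3)[OF w A st(1)] st in "auto simp: majorant_def")

lemma Rop_deriv: "((\<lambda>h. Rop t w s (nudge x h i)) has_real_derivative Dop i t w s x) (at 0)"
proof -
 let ?i = "\<lambda>q. indicator {s<..<t} q :: real"
 have "((\<lambda>h. \<integral>q. ?i q *\<^sub>R R s q (w q) (nudge x h i) \<partial>lborel) has_real_derivative
   (LINT q|lborel. ?i q *\<^sub>R partial_deriv i (R s q (w q)) (nudge x 0 i))) (at 0)"
 proof (rule has_real_derivative_integral[where F'="\<lambda>h q. ?i q *\<^sub>R partial_deriv i (R s q (w q)) (nudge x h i)"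
    and g="\<lambda>q. ?i q *\<^sub>R majorant \<mu> s t (CR * A) q"])
  show "integrable lborel (\<lambda>q. ?i q *\<^sub>R R s q (w q) (nudge x h i))" for h
   using Rop_integrable by (simp add: set_integrable_def)
  show "AE q in lborel. \<forall>h. \<bar>h\<bar> <= 1 \<longrightarrow>
    ((\<lambda>h. ?i q *\<^sub>R R s q (w q) (nudge x h i)) has_real_derivative ?i q *\<^sub>R partial_deriv i (R s q (w q)) (nudge x h i)) (at h)"
  proof (intro AE_I2 allI impI)
   fix q h
   show "((\<lambda>h. ?i q *\<^sub>R R s q (w q) (nudge x h i)) has_real_derivative ?i q *\<^sub>R partial_deriv i (R s q (w q)) (nudge x h i)) (at h)"
    using R_deriv[of s q "w q" x i h] st admD(2)[OF w(1), of q]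
    by (cases "q \<in> {s<..<t}") auto
  qed
  show "AE q in lborel. \<forall>h. \<bar>h\<bar> <= 1 \<longrightarrow> \<bar>?i q *\<^sub>R partial_deriv i (R s q (w q)) (nudge x h i)\<bar> <= ?i q *\<^sub>R majorant \<mu> s t (CR * A) q"
   using R_wtd_bound(3)[OF w A st(1)] st by (intro AE_I2 allI impI) (auto split: split_indicator)
  show "integrable lborel (\<lambda>q. ?i q *\<^sub>R majorant \<mu> s t (CR * A) q)"
   using majorant_integrable[OF st \<mu>, of "CR * A"] A CR by (simp add: set_integrable_def)
  show "(\<lambda>q. ?i q *\<^sub>R partial_deriv i (R s q (w q)) (nudge x 0 i)) \<in> borel_measurable lborel"
   using R_section_measurable(2)[OF w(1) st(1,3), of i x] by (simp add: set_borel_measurable_def)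
 qed
 then show ?thesis by (simp add: Rop_def Dop_def set_lebesgue_integral_def)
qed

lemma Rop_continuous: "continuous_on UNIV (Rop t w s)"
 and Dop_continuous: "continuous_on UNIV (Dop i t w s)"
proof -
 show "continuous_on UNIV (Rop t w s)"
  unfolding Rop_def
 proof (rule majorized_integral_continuous[OF st \<mu>, where C="A * T powr \<gamma>"])
  show "set_borel_measurable lborel {s<..<t} (\<lambda>q. R s q (w q) x)" for x
   by (rule R_section_measurable(1)[OF w(1) st(1,3)])
  show "continuous_on UNIV (R s q (w q))" if "q \<in> {s<..<t}" for q
   using that st by (intro R_cont admD(2)[OF w(1)]) auto
  show "\<bar>R s q (w q) x\<bar> <= majorant \<mu> s t (A * T powr \<gamma>) q" if "q \<in> {s<..<t}" for q x
   using that st by (intro R_wtd_bound(2)[OF w A]) auto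
 qed (use A in auto)
 show "continuous_on UNIV (Dop i t w s)"
  unfolding Dop_def
 proof (rule majorized_integral_continuous[OF st \<mu>, where C="CR * A"])
  show "set_borel_measurable lborel {s<..<t} (\<lambda>q. partial_deriv i (R s q (w q)) x)" for x
   by (rule R_section_measurable(2)[OF w(1) st(1,3)])
  show "continuous_on UNIV (partial_deriv i (R s q (w q)))" if "q \<in> {s<..<t}" for q
   using that st by (intro R_deriv_cont admD(2)[OF w(1)]) auto
  show "\<bar>partial_deriv i (R s q (w q)) x\<bar> <= majorant \<mu> s t (CR * A) q" if "q \<in> {s<..<t}" for q x
   using that st by (intro R_wtd_bound(3)[OF w A]) auto
 qed (use A CR in auto)
qed

lemma Kop_eq: "Kop t w s x = (\<Sum>i\<in>UNIV. Bf s x $ i * Dop i t w s x)"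
proof -
 have "Kop t w s x = (\<Sum>i\<in>UNIV. LBINT q:{s<..<t}. Bf s x $ i * partial_deriv i (R s q (w q)) x)"
  unfolding Kop_def ker_def using Dop_integrable[of _ x]
  by (simp add: set_lebesgue_integral_def set_integrable_def sum_distrib_left mult.left_commute)
 then show ?thesis by (simp add: Dop_def set_integral_mult_right)
qed

end

text \<open>Differentiating the mild formula under the time integral and pairing with B converts it
  into the Volterra equation; the third conclusion is this passage.\<close>

lemma deriv_sum:
 assumes \<phi>: "\<phi> \<in> bounded_borel" and w: "adm w" "wtd \<mu> t A w" and A: "0 <= A" and \<mu>: "0 <= \<mu>" and st: "0 <= s" "s < t" "t <= T"
  and u: "\<And>x. u x = R s t \<phi> x + Rop t w s x"
 shows "((\<lambda>h. u (nudge x h i)) has_real_derivative partial_deriv i u x) (at 0)"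
  "partial_deriv i u x = partial_deriv i (R s t \<phi>) x + Dop i t w s x"
  "Bf s x \<bullet> gradient u x = ker s t \<phi> x + Kop t w s x"
proof -
 have d: "((\<lambda>h. u (nudge x h i)) has_real_derivative (partial_deriv i (R s t \<phi>) x + Dop i t w s x)) (at 0)" for i
  unfolding u using R_deriv[OF st \<phi>, of x i 0] by (intro DERIV_add Rop_deriv[OF w A \<mu> st]) simp
 have e: "partial_deriv i u x = partial_deriv i (R s t \<phi>) x + Dop i t w s x" for i
  unfolding partial_deriv_def[of i u]
  by (rule vector_derivative_at) (use d in "simp add: has_real_derivative_iff_has_vector_derivative")
 show "partial_deriv i u x = partial_deriv i (R s t \<phi>) x + Dop i t w s x" by (rule e)
 show "((\<lambda>h. u (nudge x h i)) has_real_derivative partial_deriv i u x) (at 0)" unfolding e by (rule d)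
 show "Bf s x \<bullet> gradient u x = ker s t \<phi> x + Kop t w s x"
  by (simp add: inner_vec_def gradient_def e ker_def Kop_eq[OF w A \<mu> st] distrib_left sum.distrib)
qed

lemma X_comp_measurable [measurable (raw)]:
 assumes "0 <= s" "s <= T" and [measurable]: "r \<in> borel_measurable N" "o' \<in> measurable N M"
 shows "(\<lambda>z. Xp s x (r z) (o' z)) \<in> borel_measurable N"
 using measurable_compose[OF _ X_meas[OF assms(1,2)], of "\<lambda>z. (r z, o' z)" N x] by simp

section \<open>Uniqueness through the forward identity\<close>

theorem mild_unique:
 assumes forward: "\<And>s t \<psi> x. 0 <= s ==> s < t ==> t <= T ==> \<psi> \<in> bounded_borel ==>
   (LINT om|M. \<psi> (Xp s x t om)) = R s t \<psi> x + (LBINT r:{s<..<t}. \<integral>om. ker r t \<psi> (Xp s x r om) \<partial>M)"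
  and t: "0 < t" "t <= T" and \<phi>: "\<phi> \<in> bounded_borel" and m: "mildp \<phi> t u" and u: "reg t u" and s: "0 <= s" "s <= t"
 shows "u s x = (LINT om|M. \<phi> (Xp s x t om))"
proof (cases "s = t")
 case True
 have "u t x = R t t \<phi> x" using m t unfolding mildp_def by (auto simp: set_lebesgue_integral_def)
 then show ?thesis using True R_refl[of t \<phi> x] P_refl[of t \<phi> x] t \<phi> by simp
next
 case False
 then have st: "0 <= s" "s < t" "t <= T" using s t by auto
 have sT: "s <= T" using st by simp
 obtain A where A: "0 <= A" and w: "adm (wof t u)" "wtd 0 t A (wof t u)" using wof_props[OF u] .
 define w where "w = wof t u"
 note w = w[folded w_def]
 have Rw: "R s' r (\<lambda>y. Bf r y \<bullet> gradient (u r) y) = R s' r (w r)" if "0 <= r" "r < t" for s' r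
  using that by (simp add: w_def wof_def[abs_def])
 have us: "u s' y = R s' t \<phi> y + Rop t w s' y" if "0 <= s'" "s' < t" for s' y
 proof -
  have "(LBINT r:{s'<..<t}. R s' r (\<lambda>y. Bf r y \<bullet> gradient (u r) y) y) = Rop t w s' y"
   unfolding Rop_def by (rule set_lebesgue_integral_cong) (use that in "auto simp: Rw")
  then show ?thesis using m that unfolding mildp_def by auto
 qed
 have wK: "w r y = ker r t \<phi> y + Kop t w r y" if "0 <= r" "r < t" for r y
  using deriv_sum(3)[OF \<phi> w A order_refl that st(3) us[OF that], of y] that by (simp add: w_def wof_def)
 define X where "X r om = Xp s x r om" for r om
 have X_m [measurable (raw)]: "(\<lambda>z. X (r z) (o' z)) \<in> borel_measurable N"
  if "r \<in> borel_measurable N" "o' \<in> measurable N M" for N :: "(real \<times> real \<times> 'w) measure" and r o'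
  unfolding X_def by (rule X_comp_measurable[OF st(1) sT that])
 have X_m1 [measurable (raw)]: "(\<lambda>z. X (r z) (o' z)) \<in> borel_measurable N"
  if "r \<in> borel_measurable N" "o' \<in> measurable N M" for N :: "(real \<times> 'w) measure" and r o'
  unfolding X_def by (rule X_comp_measurable[OF st(1) sT that])
 have X_m2 [measurable (raw)]: "(\<lambda>z. X (r z) (o' z)) \<in> borel_measurable N"
  if "r \<in> borel_measurable N" "o' \<in> measurable N M" for N :: "((real \<times> real) \<times> 'w) measure" and r o'
  unfolding X_def by (rule X_comp_measurable[OF st(1) sT that])
 have X_m3 [measurable]: "X r \<in> borel_measurable M" for r
  unfolding X_def by (rule X_comp_measurable[OF st(1) sT]) auto
 interpret LM: pair_sigma_finite lborel M ..
 \<comment> \<open>The integrand of the double time integral, supported on the triangle s < r < q <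
   t and evaluated along the solution.\<close>
 define g where "g r q om = (if s < r \<and> r < q \<and> q < t then ker r q (w q) (X r om) else 0)" for r q om
 have gd: "g r q om = (if s < r \<and> r < q \<and> q < t then (if dom r q then ker r q (w q) (X r om) else 0) else 0)" for r q om
  using st by (auto simp: g_def dom_def)
 have gm1: "(\<lambda>z. g (fst (fst z)) (snd (fst z)) (snd z)) \<in> borel_measurable ((borel \<Otimes>\<^sub>M borel) \<Otimes>\<^sub>M M)"
  unfolding gd by (intro measurable_If ker_measurable[OF w(1)] X_m2) measurable
 have gm2: "(\<lambda>z. g r (fst z) (snd z)) \<in> borel_measurable (borel \<Otimes>\<^sub>M M)" for r
  unfolding gd by (intro measurable_If ker_measurable[OF w(1)] X_m1) measurable
 have gm3: "g r q \<in> borel_measurable M" for r q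
  using measurable_compose[OF _ gm2[of r], of "\<lambda>om. (q, om)" M] by simp
 have gb: "\<bar>g r q om\<bar> <= indicator {r<..<t} q *\<^sub>R majorant 0 r t (Ck * A) q" for r q om
 proof (cases "s < r \<and> r < q \<and> q < t")
  case True
  then have "\<bar>ker r q (w q) (X r om)\<bar> <= Ck * (A * ((t - q) powr (- \<gamma>) * exp (0 * (t - q)))) * (q - r) powr (- \<gamma>)"
   using st wtd_bound[OF w(2), of q] by (intro ker_bound admD(2)[OF w(1)]) (auto simp: dom_def)
  then show ?thesis using True by (simp add: g_def majorant_def mult_ac)
 qed (auto simp: g_def majorant_def Ck_nonneg A split: split_indicator)
 have CA: "0 <= Ck * A" using Ck_nonneg A by simp
 define G where "G r q = (LINT om|M. g r q om)" for r q
 have gi: "integrable M (g r q)" for r q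
  by (rule integrable_const_bound[where B="indicator {r<..<t} q *\<^sub>R majorant 0 r t (Ck * A) q"]) (use gb gm3 in auto)
 have Gb: "\<bar>G r q\<bar> <= indicator {r<..<t} q *\<^sub>R majorant 0 r t (Ck * A) q" for r q
 proof -
  have "\<bar>G r q\<bar> <= (LINT om|M. \<bar>g r q om\<bar>)" unfolding G_def by (rule integral_abs_bound)
  also have "\<dots> <= (LINT om|M. indicator {r<..<t} q *\<^sub>R majorant 0 r t (Ck * A) q)"
   by (rule integral_mono_AE) (use gb gi in auto)
  finally show ?thesis by (simp add: prob_space)
 qed
 have Gz: "G r q = 0" if "\<not> (s < r \<and> r < t)" for r q
 proof -
  have "g r q om = 0" for om using that by (auto simp: g_def)
  then show ?thesis by (simp add: G_def)
 qed
 have Gm: "(\<lambda>(r, q). G r q) \<in> borel_fun2"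
  unfolding G_def split_beta'
  by (rule borel_measurable_lebesgue_integral[where f="\<lambda>z. g (fst z) (snd z)"]) (use gm1 in "simp add: split_beta'")
 have majI: "integrable lborel (\<lambda>q. indicator {r<..<t} q *\<^sub>R majorant 0 r t (Ck * A) q)" if "s < r" "r < t" for r
  using majorant_integrable[of r t 0 "Ck * A"] st that CA by (simp add: set_integrable_def)
 \<comment> \<open>For fixed r the Beta estimate with \<mu> = 0 bounds the q-integral by a multiple
   of (t - r)^(-\<gamma>), which is again integrable over (s,t).\<close>
 have GI: "integrable (lborel \<Otimes>\<^sub>M lborel) (\<lambda>(r, q). G r q)"
 proof (rule lborel_pair.Fubini_integrable)
  show Gm': "(\<lambda>(r, q). G r q) \<in> borel_measurable (lborel \<Otimes>\<^sub>M lborel)" using Gm by simp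
  have rm: "(\<lambda>r. \<integral>q. norm (case (r, q) of (r, q) => G r q) \<partial>lborel) \<in> borel_measurable lborel"
   using Gm by (intro lborel.borel_measurable_lebesgue_integral) simp
  show "integrable lborel (\<lambda>r. \<integral>q. norm (case (r, q) of (r, q) => G r q) \<partial>lborel)"
  proof (rule Bochner_Integration.integrable_bound[OF _ rm])
   show "integrable lborel (\<lambda>r. Ck * A * (4 * sing \<gamma> T 0) * (indicator {s<..<t} r *\<^sub>R (t - r) powr (- \<gamma>)))"
   proof (intro integrable_mult_right impI)
    have "set_integrable lborel {0<..<t - s} (\<lambda>p. p powr (- \<gamma>))" using gam st by (intro powr_singular_integrable) auto
    then show "integrable lborel (\<lambda>r. indicator {s<..<t} r *\<^sub>R (t - r) powr (- \<gamma>))"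
     using set_integral_translate(3)[of s t "\<lambda>p. p powr (- \<gamma>)"] by (simp add: set_integrable_def)
   qed
   show "AE r in lborel. norm (LINT q|lborel. norm (case (r, q) of (r, q) => G r q)) <= norm (Ck * A * (4 * sing \<gamma> T 0) * (indicator {s<..<t} r *\<^sub>R (t - r) powr (- \<gamma>)))"
   proof (rule AE_I2)
    fix r
    show "norm (LINT q|lborel. norm (case (r, q) of (r, q) => G r q)) <= norm (Ck * A * (4 * sing \<gamma> T 0) * (indicator {s<..<t} r *\<^sub>R (t - r) powr (- \<gamma>)))"
    proof (cases "s < r \<and> r < t")
     case True
     then have sr: "s < r" "r < t" by auto
     have "(LINT q|lborel. \<bar>G r q\<bar>) <= (LINT q|lborel. indicator {r<..<t} q *\<^sub>R majorant 0 r t (Ck * A) q)"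
     proof (rule integral_mono_AE)
      have "(\<lambda>q. \<bar>G r q\<bar>) \<in> borel_measurable lborel"
       using measurable_compose[OF _ Gm, of "\<lambda>q. (r, q)" borel] by simp
      then show "integrable lborel (\<lambda>q. \<bar>G r q\<bar>)"
       by (rule Bochner_Integration.integrable_bound[OF majI[OF sr]]) (use Gb in "auto intro: order_trans[OF _ abs_ge_self]")
     qed (use majI[OF sr] Gb in auto)
     also have "\<dots> <= \<bar>LBINT q:{r<..<t}. majorant 0 r t (Ck * A) q\<bar>" by (simp add: set_lebesgue_integral_def)
     also have "\<dots> <= Ck * A * (4 * sing \<gamma> T 0) * ((t - r) powr (- \<gamma>) * exp (0 * (t - r)))"
      by (rule singular_integrand(2)) (use True st CA in "auto simp: majorant_def[abs_def] set_borel_measurable_def abs_mult")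
     finally have "(LINT q|lborel. \<bar>G r q\<bar>) <= Ck * A * (4 * sing \<gamma> T 0) * (t - r) powr (- \<gamma>)" by simp
     then show ?thesis using True by (auto intro: order_trans[OF _ abs_ge_self])
    qed (simp add: Gz)
   qed
  qed
  show "AE r in lborel. integrable lborel (\<lambda>q. case (r, q) of (r, q) => G r q)"
  proof (rule AE_I2)
   fix r
   show "integrable lborel (\<lambda>q. case (r, q) of (r, q) => G r q)"
   proof (cases "s < r \<and> r < t")
    case True
    then have sr: "s < r" "r < t" by auto
    have "G r \<in> borel_measurable lborel" using measurable_compose[OF _ Gm, of "\<lambda>q. (r, q)" borel] by simp
    then have "integrable lborel (G r)"
     by (rule Bochner_Integration.integrable_bound[OF majI[OF sr]]) (use Gb in "auto intro: order_trans[OF _ abs_ge_self]")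
    then show ?thesis by simp
   qed (simp add: Gz)
  qed
 qed
 have swap: "(LINT q|lborel. (LINT r|lborel. G r q)) = (LINT r|lborel. (LINT q|lborel. G r q))"
  using lborel_pair.Fubini_integral[OF GI] by simp
 define Pw where "Pw q = (LINT om|M. w q (X q om))" for q
 define Pk where "Pk r = (LINT om|M. ker r t \<phi> (X r om))" for r
 \<comment> \<open>The forward identity with terminal time q and terminal function w q.\<close>
 have fw: "Pw q = R s q (w q) x + (LINT r|lborel. G r q)" if q: "s < q" "q < t" for q
 proof -
  have "Pw q = R s q (w q) x + (LBINT r:{s<..<q}. \<integral>om. ker r q (w q) (X r om) \<partial>M)"
   unfolding Pw_def X_def using forward[of s q "w q" x] q st admD(2)[OF w(1)] by simp
  also have "(LBINT r:{s<..<q}. \<integral>om. ker r q (w q) (X r om) \<partial>M) = (LINT r|lborel. G r q)"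
   unfolding set_lebesgue_integral_def G_def g_def
   by (intro Bochner_Integration.integral_cong refl) (use q in "auto split: split_indicator")
  finally show ?thesis .
 qed
 \<comment> \<open>Fubini between time and probability turns the q-integral into
   \<open>Kop t w r\<close> along the solution, and the Volterra equation \<open>wK\<close> replaces
   it by w r minus the inhomogeneity.\<close>
 have inner: "(LINT q|lborel. G r q) = Pw r - Pk r" if r: "s < r" "r < t" for r
 proof -
  have gI: "integrable (lborel \<Otimes>\<^sub>M M) (\<lambda>(q, om). g r q om)"
  proof (rule LM.Fubini_integrable)
   show gm: "(\<lambda>(q, om). g r q om) \<in> borel_measurable (lborel \<Otimes>\<^sub>M M)" using gm2[of r] by (simp add: split_beta')
   show "AE q in lborel. integrable M (\<lambda>om. case (q, om) of (q, om) => g r q om)" using gi by auto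
   have "(\<lambda>q. \<integral>om. norm (case (q, om) of (q, om) => g r q om) \<partial>M) \<in> borel_measurable lborel"
    using gm by (intro borel_measurable_lebesgue_integral) simp
   then show "integrable lborel (\<lambda>q. \<integral>om. norm (case (q, om) of (q, om) => g r q om) \<partial>M)"
   proof (rule Bochner_Integration.integrable_bound[OF majI[OF r]], intro AE_I2)
    fix q
    have "(LINT om|M. \<bar>g r q om\<bar>) <= (LINT om|M. indicator {r<..<t} q *\<^sub>R majorant 0 r t (Ck * A) q)"
     by (rule integral_mono_AE) (use gb gi in auto)
    moreover have "0 <= (LINT om|M. \<bar>g r q om\<bar>)" by simp
    ultimately show "norm (LINT om|M. norm (case (q, om) of (q, om) => g r q om)) <= norm (indicator {r<..<t} q *\<^sub>R majorant 0 r t (Ck * A) q)"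
     by (auto simp: prob_space intro: order_trans[OF _ abs_ge_self])
   qed
  qed
  have "(LINT q|lborel. G r q) = (LINT om|M. (LINT q|lborel. g r q om))"
   unfolding G_def using LM.Fubini_integral[OF gI] by simp
  also have "\<dots> = (LINT om|M. w r (X r om) - ker r t \<phi> (X r om))"
  proof (rule Bochner_Integration.integral_cong[OF refl])
   fix om
   have "(LINT q|lborel. g r q om) = Kop t w r (X r om)"
    unfolding Kop_def set_lebesgue_integral_def g_def
    by (intro Bochner_Integration.integral_cong refl) (use r in "auto split: split_indicator")
   then show "(LINT q|lborel. g r q om) = w r (X r om) - ker r t \<phi> (X r om)" using wK[of r] r st by simp
  qed
  also have "\<dots> = Pw r - Pk r"
   unfolding Pw_def Pk_def
  proof (rule Bochner_Integration.integral_diff)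
   obtain K where K: "\<And>y. \<bar>w r y\<bar> <= K" using bounded_borelD[OF admD(2)[OF w(1), of r]] by blast
   show "integrable M (\<lambda>om. w r (X r om))"
    by (rule integrable_const_bound[where B=K])
     (use K bounded_borel_measurable[OF admD(2)[OF w(1), of r]] in "auto intro: measurable_compose[OF X_m3]")
   obtain K' where K': "\<And>y. \<bar>\<phi> y\<bar> <= K'" using bounded_borelD[OF \<phi>] by blast
   have "dom r t" using r st by (simp add: dom_def)
   then have "(\<lambda>om. ker r t \<phi> (X r om)) \<in> borel_measurable M"
    using ker_measurable[OF adm_const[OF \<phi>], of "\<lambda>_. r" M "\<lambda>_. t" "X r"] by simp
   then show "integrable M (\<lambda>om. ker r t \<phi> (X r om))"
    using ker_bound[OF \<open>dom r t\<close> \<phi> K'] by (intro integrable_const_bound[where B="Ck * K' * (t - r) powr (- \<gamma>)"]) auto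
  qed
  finally show ?thesis .
 qed
 let ?I = "{s<..<t}"
 have Gq: "(LINT r|lborel. G r q) = indicator ?I q *\<^sub>R (LINT r|lborel. G r q)" for q
  by (auto simp: G_def g_def split: split_indicator intro!: integral_eq_zero_AE)
 have Gr: "(LINT q|lborel. G r q) = indicator ?I r *\<^sub>R (LINT q|lborel. G r q)" for r
  by (auto simp: G_def g_def split: split_indicator intro!: integral_eq_zero_AE)
 have I1: "set_integrable lborel ?I (\<lambda>q. \<integral>r. G r q \<partial>lborel)" and I2: "set_integrable lborel ?I (\<lambda>r. \<integral>q. G r q \<partial>lborel)"
  unfolding set_integrable_def Gq[symmetric] Gr[symmetric]
  using lborel_pair.integrable_fst'[OF GI] lborel_pair.integrable_snd[OF GI] by simp_all
 have IR: "set_integrable lborel ?I (\<lambda>q. R s q (w q) x)" by (rule Rop_integrable[OF w A order_refl st])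
 have IP: "set_integrable lborel ?I Pw"
  using set_integral_add(1)[OF IR I1] by (rule set_integrable_cong[THEN iffD1, rotated -1]) (auto simp: fw)
 have "(LBINT q:?I. Pw q) = (LBINT q:?I. R s q (w q) x + (LINT r|lborel. G r q))"
  by (rule set_lebesgue_integral_cong) (auto simp: fw)
 also have "\<dots> = Rop t w s x + (LBINT q:?I. \<integral>r. G r q \<partial>lborel)"
  unfolding Rop_def by (rule set_integral_add(2)[OF IR I1])
 also have "(LBINT q:?I. \<integral>r. G r q \<partial>lborel) = (LBINT r:?I. \<integral>q. G r q \<partial>lborel)"
  unfolding set_lebesgue_integral_def Gq[symmetric] Gr[symmetric] by (rule swap)
 also have "(LBINT r:?I. \<integral>q. G r q \<partial>lborel) = (LBINT r:?I. Pw r) - (LBINT r:?I. Pk r)"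
 proof -
  have IPk: "set_integrable lborel ?I Pk"
   using set_integral_diff(1)[OF IP I2] by (rule set_integrable_cong[THEN iffD1, rotated -1]) (auto simp: inner)
  have "(LBINT r:?I. \<integral>q. G r q \<partial>lborel) = (LBINT r:?I. Pw r - Pk r)"
   by (rule set_lebesgue_integral_cong) (auto simp: inner)
  then show ?thesis using set_integral_diff(2)[OF IP IPk] by simp
 qed
 \<comment> \<open>The finite integral of \<open>Pw\<close> occurs on both sides and
   cancels.\<close>
 finally have "(LBINT r:?I. Pk r) = Rop t w s x" by simp
 moreover have "(LINT om|M. \<phi> (Xp s x t om)) = R s t \<phi> x + (LBINT r:?I. Pk r)"
  using forward[OF st \<phi>, of x] by (simp add: Pk_def X_def)
 ultimately show ?thesis using us[OF st(1,2)] by simp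
qed

section \<open>Existence by Picard iteration\<close>

lemma time_integral_measurable:
 assumes F: "(\<lambda>z. if dom (fst z) (fst (snd z)) then F (fst z) (fst (snd z)) (snd (snd z)) else (0::real)) \<in>
   borel_measurable (borel \<Otimes>\<^sub>M (borel \<Otimes>\<^sub>M (borel :: (real ^ 'n) measure)))" and t: "t <= T"
 shows "(\<lambda>(s, x). if 0 <= s \<and> s < t then (LBINT q:{s<..<t}. F s q x) else 0) \<in> borel_fun2"
proof -
 define H where "H z q = (if 0 <= fst z \<and> fst z < q \<and> q < t then (if dom (fst z) q then F (fst z) q (snd z) else 0) else 0)"
  for z :: "real \<times> (real ^ 'n)" and q
 have "(\<lambda>y. if dom (fst (fst y)) (snd y) then F (fst (fst y)) (snd y) (snd (fst y)) else 0) \<in> borel_measurable ((borel \<Otimes>\<^sub>M borel) \<Otimes>\<^sub>M lborel)"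
 proof -
  have "(\<lambda>y. (fst (fst y), snd y, snd (fst y))) \<in> measurable ((borel \<Otimes>\<^sub>M (borel :: (real ^ 'n) measure)) \<Otimes>\<^sub>M lborel) (borel \<Otimes>\<^sub>M (borel \<Otimes>\<^sub>M borel))"
   by measurable
  from measurable_compose[OF this F] show ?thesis unfolding fst_conv snd_conv .
 qed
 then have "(\<lambda>(z, q). H z q) \<in> borel_measurable ((borel \<Otimes>\<^sub>M borel) \<Otimes>\<^sub>M lborel)"
  unfolding H_def split_beta' by measurable
 then have "(\<lambda>z. \<integral>q. H z q \<partial>lborel) \<in> borel_fun2"
  by (rule lborel.borel_measurable_lebesgue_integral)
 moreover have eqn: "(LINT q|lborel. H (s, x) q) = (if 0 <= s \<and> s < t then (LBINT q:{s<..<t}. F s q x) else 0)" for s x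
 proof (cases "0 <= s \<and> s < t")
  case True
  then have "H (s, x) q = indicator {s<..<t} q *\<^sub>R F s q x" for q
   using t by (auto simp: H_def dom_def split: split_indicator)
  then show ?thesis using True by (simp add: set_lebesgue_integral_def)
 next
  case False
  then have "H (s, x) q = 0" for q by (auto simp: H_def)
  then show ?thesis using False by auto
 qed
 moreover have "(\<lambda>(s, x). if 0 <= s \<and> s < t then (LBINT q:{s<..<t}. F s q x) else 0) = (\<lambda>z. \<integral>q. H z q \<partial>lborel)"
 proof
  fix z
  show "(case z of (s, x) => if 0 <= s \<and> s < t then (LBINT q:{s<..<t}. F s q x) else 0) = (LINT q|lborel. H z q)"
   by (cases z) (simp only: eqn prod.case)
 qed
 ultimately show ?thesis by (simp only:)
qed

lemma Kop_measurable:
 assumes "adm w" "t <= T"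
 shows "(\<lambda>(s, x). if 0 <= s \<and> s < t then Kop t w s x else 0) \<in> borel_fun2"
 unfolding Kop_def by (rule time_integral_measurable[OF _ assms(2)], rule ker_measurable[OF assms(1)]) measurable

lemma Rop_measurable:
 assumes "adm w" "t <= T"
 shows "(\<lambda>(s, x). if 0 <= s \<and> s < t then Rop t w s x else 0) \<in> borel_fun2"
 unfolding Rop_def by (rule time_integral_measurable[OF _ assms(2)], rule R_measurable[OF assms(1)]) measurable

lemma if_dom_const_measurable:
 assumes "(\<lambda>z. if dom (fst z) t then F (fst z) (snd z) else (0::real)) \<in> borel_measurable (borel \<Otimes>\<^sub>M (borel :: (real ^ 'n) measure))" "t <= T"
 shows "(\<lambda>(s, x). if 0 <= s \<and> s < t then F s x else 0) \<in> borel_fun2"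
 using assms by (simp add: dom_def split_beta')

lemma ker_phi_measurable:
 assumes "\<phi> \<in> bounded_borel" "t <= T"
 shows "(\<lambda>(s, x). if 0 <= s \<and> s < t then ker s t \<phi> x else 0) \<in> borel_fun2"
 by (rule if_dom_const_measurable[OF _ assms(2)], rule ker_measurable[OF adm_const[OF assms(1)]]) measurable

lemma R_phi_measurable:
 assumes "\<phi> \<in> bounded_borel" "t <= T"
 shows "(\<lambda>(s, x). if 0 <= s \<and> s < t then R s t \<phi> x else 0) \<in> borel_fun2"
 by (rule if_dom_const_measurable[OF _ assms(2)], rule R_measurable[OF adm_const[OF assms(1)]]) measurable

primrec picard :: "(real ^ 'n => real) => real => nat => real => real ^ 'n => real" where
 "picard \<phi> t 0 = (\<lambda>s x. 0)"
| "picard \<phi> t (Suc n) = (\<lambda>s x. if 0 <= s \<and> s < t then ker s t \<phi> x + Kop t (picard \<phi> t n) s x else 0)"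

lemma Kop_diff:
 assumes w: "adm w" "wtd \<mu> t A w" and v: "adm v" "wtd \<mu> t A' v" and A: "0 <= A" "0 <= A'" and \<mu>: "0 <= \<mu>" and st: "0 <= s" "s < t" "t <= T"
 shows "Kop t w s x - Kop t v s x = Kop t (\<lambda>q y. w q y - v q y) s x"
proof -
 have "Kop t (\<lambda>q y. w q y - v q y) s x = (LBINT q:{s<..<t}. ker s q (w q) x - ker s q (v q) x)"
  unfolding Kop_def
 proof (rule set_lebesgue_integral_cong)
  show "\<forall>q. q \<in> {s<..<t} \<longrightarrow> ker s q (\<lambda>y. w q y - v q y) x = ker s q (w q) x - ker s q (v q) x"
  proof (intro allI impI)
   fix q assume "q \<in> {s<..<t}"
   then have "dom s q" using st by (simp add: dom_def)
   from ker_lincomb[OF this admD(2)[OF w(1), of q] admD(2)[OF v(1), of q], where a=1 and b="-1" and x=x]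
   show "ker s q (\<lambda>y. w q y - v q y) x = ker s q (w q) x - ker s q (v q) x" by simp
  qed
 qed simp
 also have "\<dots> = Kop t w s x - Kop t v s x"
  unfolding Kop_def by (rule set_integral_diff(2)[OF wtd_ker(1)[OF w st \<mu> A(1)] wtd_ker(1)[OF v st \<mu> A(2)]])
 finally show ?thesis by simp
qed

lemma adm_diff: "adm w ==> adm v ==> adm (\<lambda>q y. w q y - v q y)"
 unfolding adm_def using bounded_borel_lincomb[of _ _ 1 "-1"] by (auto simp: split_beta')

text \<open>The parameter \<mu> is chosen so large that \<open>Kop\<close> has norm below 1/2. The
  inhomogeneity has norm at most C0 = Ck * K, so the iterates stay in the ball of radius 2 * C0, as
  C0 + 2 * C0 / 2 = 2 * C0, and successive differences decay like C0 / 2^n.\<close>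

lemma fixed_point_exists:
 assumes t: "0 < t" "t <= T" and \<phi>: "\<phi> \<in> bounded_borel"
 obtains w \<mu> A where "0 <= \<mu>" "0 <= A" "adm w" "wtd \<mu> t A w"
  "\<And>s x. 0 <= s ==> s < t ==> w s x = ker s t \<phi> x + Kop t w s x"
proof -
 obtain K where K: "0 <= K" "\<And>y. \<bar>\<phi> y\<bar> <= K" using bounded_borelD[OF \<phi>] by blast
 have "(\<lambda>n. Ck * (4 * sing \<gamma> T (real n))) \<leadsto> Ck * (4 * 0)"
  using T by (intro tendsto_intros sing_tendsto_0 gam) simp
 then have "\<forall>\<^sub>F n in sequentially. Ck * (4 * sing \<gamma> T (real n)) < 1 / 2"
  by (rule order_tendstoD) simp
 then obtain n where n: "Ck * (4 * sing \<gamma> T (real n)) < 1 / 2" by (auto simp: eventually_sequentially)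
 define \<mu> where "\<mu> = real n"
 have \<mu>: "0 <= \<mu>" by (simp add: \<mu>_def)
 define C0 where "C0 = Ck * K"
 have C0: "0 <= C0" using Ck_nonneg K by (simp add: C0_def)
 define E where "E q = ew \<mu> (t - q)" for q
 have E0: "0 <= E q" for q by (simp add: E_def)
 have wtdI: "wtd \<mu> t A w" if "\<And>q y. 0 <= q ==> q < t ==> \<bar>w q y\<bar> <= A * E q" "\<And>q y. \<not> (0 <= q \<and> q < t) ==> w q y = 0" for A w
  using that unfolding wtd_def E_def by blast
 have half: "\<bar>Kop t w s x\<bar> <= (A / 2) * E s" if "adm w" "wtd \<mu> t A w" "0 <= A" "0 <= s" "s < t" for w A s x
 proof -
  have "\<bar>Kop t w s x\<bar> <= Ck * (4 * sing \<gamma> T \<mu>) * (A * E s)"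
   unfolding E_def by (rule wtd_ker(2)[OF that(1,2,4,5) t(2) \<mu> that(3)])
  also have "\<dots> <= (1 / 2) * (A * E s)"
   using n E0 that(3) by (intro mult_right_mono) (auto simp: \<mu>_def)
  finally show ?thesis by simp
 qed
 have k0: "\<bar>ker s t \<phi> x\<bar> <= C0 * E s" if "0 <= s" "s < t" for s x
 proof -
  have "\<bar>ker s t \<phi> x\<bar> <= Ck * K * (t - s) powr (- \<gamma>)"
   using that t K by (intro ker_bound \<phi>) (auto simp: dom_def)
  also have "\<dots> <= Ck * K * E s"
  proof (intro mult_left_mono)
   have "1 <= exp (\<mu> * (t - s))" using \<mu> that by simp
   then have "(t - s) powr (- \<gamma>) * 1 <= E s" unfolding E_def by (intro mult_left_mono) auto
   then show "(t - s) powr (- \<gamma>) <= E s" by simp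
  qed (use Ck_nonneg K in auto)
  finally show ?thesis by (simp add: C0_def)
 qed
 let ?w = "picard \<phi> t"
 have inv: "adm (?w n) \<and> wtd \<mu> t (2 * C0) (?w n)" for n
 proof (induction n)
  case 0
  show ?case
   using C0 E0 by (auto simp: adm_def intro!: wtdI bounded_borelI[where K=0])
 next
  case (Suc n)
  have wt: "wtd \<mu> t (2 * C0) (?w (Suc n))"
  proof (rule wtdI)
   fix q y assume q: "0 <= q" "q < t"
   have "\<bar>Kop t (?w n) q y\<bar> <= (2 * C0 / 2) * E q" using Suc C0 q by (intro half) auto
   then show "\<bar>?w (Suc n) q y\<bar> <= 2 * C0 * E q" using k0[OF q, of y] q by simp
  qed auto
  have "(\<lambda>z. (case z of (s, x) => if 0 <= s \<and> s < t then ker s t \<phi> x else 0) + (case z of (s, x) => if 0 <= s \<and> s < t then Kop t (?w n) s x else 0))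
    \<in> borel_fun2"
   using Suc t by (intro borel_measurable_add ker_phi_measurable Kop_measurable \<phi>) auto
  also have "(\<lambda>z. (case z of (s, x) => if 0 <= s \<and> s < t then ker s t \<phi> x else 0) + (case z of (s, x) => if 0 <= s \<and> s < t then Kop t (?w n) s x else 0)) = (\<lambda>(s, x). ?w (Suc n) s x)"
   by (auto simp: fun_eq_iff)
  finally have "adm (?w (Suc n))" by (rule adm_wtdI[OF _ wt])
  with wt show ?case by blast
 qed
 have C2: "0 <= 2 * C0" using C0 by simp
 have diff: "wtd \<mu> t (C0 * (1 / 2) ^ n) (\<lambda>q y. ?w (Suc n) q y - ?w n q y)" for n
 proof (induction n)
  case 0
  show ?case
  proof (rule wtdI)
   fix q y assume q: "0 <= q" "q < t"
   \<comment> \<open>The kernel is linear; a combination with both coefficients 0 shows that it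
     vanishes at the zero function.\<close>
   have "ker q r (\<lambda>y. 0) y = 0" if "q < r" "r < t" for r
    using ker_lincomb[of q r "\<lambda>_. 0" "\<lambda>_. 0" 0 0 y] q t that
    by (simp add: dom_def bounded_borelI[where K=0])
   then have "Kop t (?w 0) q y = (LBINT r:{q<..<t}. 0)"
    unfolding Kop_def by (intro set_lebesgue_integral_cong) auto
   then have "Kop t (?w 0) q y = 0" by (simp add: set_lebesgue_integral_def)
   then show "\<bar>?w (Suc 0) q y - ?w 0 q y\<bar> <= C0 * (1 / 2) ^ 0 * E q" using k0[OF q, of y] q by simp
  qed auto
 next
  case (Suc n)
  show ?case
  proof (rule wtdI)
   fix q y assume q: "0 <= q" "q < t"
   have "?w (Suc (Suc n)) q y - ?w (Suc n) q y = Kop t (?w (Suc n)) q y - Kop t (?w n) q y" using q by simp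
   also have "\<dots> = Kop t (\<lambda>q y. ?w (Suc n) q y - ?w n q y) q y"
    using inv[of "Suc n"] inv[of n] by (intro Kop_diff[OF _ _ _ _ C2 C2 \<mu> q t(2)]) blast+
   also have "\<bar>\<dots>\<bar> <= (C0 * (1 / 2) ^ n / 2) * E q"
    using inv[of "Suc n"] inv[of n] C0 q by (intro half Suc adm_diff) auto
   finally show "\<bar>?w (Suc (Suc n)) q y - ?w (Suc n) q y\<bar> <= C0 * (1 / 2) ^ Suc n * E q" by simp
  qed auto
 qed
 define w where "w s x = lim (\<lambda>n. ?w n s x)" for s x
 have lim: "(\<lambda>n. ?w n s x) \<leadsto> w s x" for s x
 proof (cases "0 <= s \<and> s < t")
  case True
  have "summable (\<lambda>k. ?w (Suc k) s x - ?w k s x)"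
  proof (rule summable_comparison_test')
   show "summable (\<lambda>k. C0 * E s * (1 / 2) ^ k)" by (intro summable_mult summable_geometric) simp
   show "norm (?w (Suc k) s x - ?w k s x) <= C0 * E s * (1 / 2) ^ k" if "k \<ge> 0" for k
    using wtd_bound[OF diff[of k], of s x] True by (simp add: E_def mult_ac)
  qed
  then have "(\<lambda>n. \<Sum>k<n. ?w (Suc k) s x - ?w k s x) \<leadsto> (\<Sum>k. ?w (Suc k) s x - ?w k s x)" by (rule summable_LIMSEQ)
  moreover have "(\<Sum>k<n. ?w (Suc k) s x - ?w k s x) = ?w n s x" for n
   using sum_lessThan_telescope[of "\<lambda>k. ?w k s x" n] by (simp del: picard.simps(2))
  ultimately have "convergent (\<lambda>n. ?w n s x)"
   unfolding convergent_def by (simp only:) blast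
  then show ?thesis unfolding w_def by (simp add: convergent_LIMSEQ_iff)
 next
  case False
  then have "?w n s x = 0" for n using wtd_zero[of \<mu> t "2 * C0" "?w n" s x] inv[of n] by blast
  then show ?thesis by (simp add: w_def)
 qed
 have wt: "wtd \<mu> t (2 * C0) w"
 proof (rule wtdI)
  fix q y assume q: "0 <= q" "q < t"
  show "\<bar>w q y\<bar> <= 2 * C0 * E q"
   by (rule LIMSEQ_le_const2[OF tendsto_rabs[OF lim]])
    (use wtd_bound[OF conjunct2[OF inv] q] in "auto simp: E_def")
 next
  fix q y assume "\<not> (0 <= q \<and> q < t)"
  then have "?w n q y = 0" for n using wtd_zero[of \<mu> t "2 * C0" "?w n" q y] inv[of n] by blast
  then show "w q y = 0" by (simp add: w_def)
 qed
 have aw: "adm w"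
 proof (rule adm_wtdI[OF _ wt])
  show "(\<lambda>(q, y). w q y) \<in> borel_fun2"
   by (rule borel_measurable_LIMSEQ_real[where u="\<lambda>n (q, y). ?w n q y"])
    (use lim inv admD(1) in "auto simp: split_beta'")
 qed
 have "w s x = ker s t \<phi> x + Kop t w s x" if s: "0 <= s" "s < t" for s x
 proof -
  \<comment> \<open>The iterates converge pointwise within a common weighted bound, so stability of
    the gradient of R under bounded limits gives convergence of the kernel for each q, and the
    majorant that of the integral.\<close>
  have "(\<lambda>n. Kop t (?w n) s x) \<leadsto> Kop t w s x"
   unfolding Kop_def set_lebesgue_integral_def
  proof (rule integral_dominated_convergence[where w="\<lambda>q. indicator {s<..<t} q *\<^sub>R majorant \<mu> s t (Ck * (2 * C0)) q"])
   show "AE q in lborel. (\<lambda>n. indicator {s<..<t} q *\<^sub>R ker s q (?w n q) x) \<leadsto> indicator {s<..<t} q *\<^sub>R ker s q (w q) x"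
   proof (rule AE_I2)
    fix q
    show "(\<lambda>n. indicator {s<..<t} q *\<^sub>R ker s q (?w n q) x) \<leadsto> indicator {s<..<t} q *\<^sub>R ker s q (w q) x"
    proof (cases "q \<in> {s<..<t}")
     case True
     then have q: "0 <= q" "q < t" "dom s q" using s t by (auto simp: dom_def)
     have "(\<lambda>n. ker s q (?w n q) x) \<leadsto> ker s q (w q) x"
     proof (rule ker_lim[OF q(3), where K="2 * C0 * E q"])
      show "?w n q \<in> bounded_borel" for n using inv[of n] admD(2) by blast
      show "w q \<in> bounded_borel" by (rule admD(2)[OF aw])
      show "\<bar>?w n q y\<bar> <= 2 * C0 * E q" for n y using wtd_bound[OF conjunct2[OF inv] q(1,2)] by (simp add: E_def)
     qed (rule lim)
     then show ?thesis by (intro tendsto_intros)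
    qed simp
   qed
   show "AE q in lborel. norm (indicator {s<..<t} q *\<^sub>R ker s q (?w n q) x) <= indicator {s<..<t} q *\<^sub>R majorant \<mu> s t (Ck * (2 * C0)) q" for n
   proof (rule AE_I2)
    fix q
    show "norm (indicator {s<..<t} q *\<^sub>R ker s q (?w n q) x) <= indicator {s<..<t} q *\<^sub>R majorant \<mu> s t (Ck * (2 * C0)) q"
    proof (cases "q \<in> {s<..<t}")
     case True
     then have q: "0 <= q" "q < t" "dom s q" using s t by (auto simp: dom_def)
     have "\<bar>ker s q (?w n q) x\<bar> <= Ck * (2 * C0 * E q) * (q - s) powr (- \<gamma>)"
      using wtd_bound[OF conjunct2[OF inv] q(1,2)] inv[of n] admD(2) by (intro ker_bound[OF q(3)]) (auto simp: E_def)
     then show ?thesis using True by (simp add: majorant_def E_def mult_ac)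
    qed simp
   qed
   show "integrable lborel (\<lambda>q. indicator {s<..<t} q *\<^sub>R majorant \<mu> s t (Ck * (2 * C0)) q)"
    using majorant_integrable[OF s t(2) \<mu>, of "Ck * (2 * C0)"] Ck_nonneg C0 by (simp add: set_integrable_def)
   show "(\<lambda>q. indicator {s<..<t} q *\<^sub>R ker s q (w q) x) \<in> borel_measurable lborel"
    using wtd_ker(1)[OF aw wt s t(2) \<mu> C2, of x] by (auto simp: set_integrable_def)
   show "(\<lambda>q. indicator {s<..<t} q *\<^sub>R ker s q (?w n q) x) \<in> borel_measurable lborel" for n
    using wtd_ker(1)[OF conjunct1[OF inv] conjunct2[OF inv] s t(2) \<mu> C2, of n x] by (auto simp: set_integrable_def)
  qed
  then have "(\<lambda>n. ?w (Suc n) s x) \<leadsto> ker s t \<phi> x + Kop t w s x"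
   using s by (simp add: tendsto_add)
  moreover have "(\<lambda>n. ?w (Suc n) s x) \<leadsto> w s x" using lim by (rule LIMSEQ_Suc)
  ultimately show ?thesis using LIMSEQ_unique by blast
 qed
 with that[OF \<mu> C2 aw wt] show ?thesis by blast
qed

text \<open>The requirements of the class of the theorem that \<open>reg\<close> omits: continuity
  in space and time, and a bound for u itself.\<close>

definition good :: "real => (real => real ^ 'n => real) => bool" where
 "good t u \<longleftrightarrow> (\<forall>s i. 0 <= s \<longrightarrow> s < t \<longrightarrow> continuous_on UNIV (u s) \<and> continuous_on UNIV (partial_deriv i (u s))) \<and>
   (\<exists>K. \<forall>s x. 0 <= s \<longrightarrow> s < t \<longrightarrow> \<bar>u s x\<bar> <= K * (t - s) powr (- \<gamma>)) \<and>
   (\<forall>x. continuous_on {0..<t} (\<lambda>s. u s x))"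

text \<open>Given the fixed point w, the mild formula with w in place of <B, grad u> is taken as the
  definition of u. Its gradient paired with B is then w by the Volterra equation, so u solves the
  mild equation.\<close>

theorem mild_exists:
 assumes t: "0 < t" "t <= T" and \<phi>: "\<phi> \<in> bounded_borel"
 obtains u where "mildp \<phi> t u" "reg t u" "good t u"
proof -
 obtain w \<mu> A where \<mu>: "0 <= \<mu>" and A: "0 <= A" and w: "adm w" "wtd \<mu> t A w"
  and fixw: "\<And>s x. 0 <= s ==> s < t ==> w s x = ker s t \<phi> x + Kop t w s x"
  using fixed_point_exists[OF t \<phi>] by metis
 obtain K where K: "0 <= K" "\<And>y. \<bar>\<phi> y\<bar> <= K" using bounded_borelD[OF \<phi>] by blast
 define u where "u s x = R s t \<phi> x + Rop t w s x" for s x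
 have ud: "((\<lambda>h. u s (nudge x h i)) has_real_derivative partial_deriv i (u s) x) (at 0)"
  "partial_deriv i (u s) x = partial_deriv i (R s t \<phi>) x + Dop i t w s x"
  "Bf s x \<bullet> gradient (u s) x = w s x" if s: "0 <= s" "s < t" for s i x
 proof -
  have us: "u s x = R s t \<phi> x + Rop t w s x" for x by (simp add: u_def)
  note D = deriv_sum[OF \<phi> w A \<mu> s t(2) us]
  show "((\<lambda>h. u s (nudge x h i)) has_real_derivative partial_deriv i (u s) x) (at 0)" by (rule D(1))
  show "partial_deriv i (u s) x = partial_deriv i (R s t \<phi>) x + Dop i t w s x" by (rule D(2))
  show "Bf s x \<bullet> gradient (u s) x = w s x" using D(3)[of x] fixw[OF s, of x] by simp
 qed
 have mild: "mildp \<phi> t u"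
  unfolding mildp_def
 proof (intro ballI allI)
  fix s x assume s: "s \<in> {0..t}"
  have eq: "R s r (\<lambda>y. Bf r y \<bullet> gradient (u r) y) x = R s r (w r) x" if "r \<in> {s<..<t}" for r
   using ud(3)[of r] that s by simp
  have I: "set_integrable lborel {s<..<t} (\<lambda>r. R s r (w r) x)"
  proof (cases "s = t")
   case True then show ?thesis by (simp add: set_integrable_def)
  next
   case False then show ?thesis using s by (intro Rop_integrable[OF w A \<mu> _ _ t(2)]) auto
  qed
  have "set_integrable lborel {s<..<t} (\<lambda>r. R s r (\<lambda>y. Bf r y \<bullet> gradient (u r) y) x)"
   using I by (rule set_integrable_cong[THEN iffD1, rotated -1]) (auto simp: eq)
  moreover have "(LBINT r:{s<..<t}. R s r (\<lambda>y. Bf r y \<bullet> gradient (u r) y) x) = Rop t w s x"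
   unfolding Rop_def by (rule set_lebesgue_integral_cong) (auto simp: eq)
  ultimately show "set_integrable lborel {s<..<t} (\<lambda>r. R s r (\<lambda>y. Bf r y \<bullet> gradient (u r) y) x) \<and>
    u s x = R s t \<phi> x + (LBINT r:{s<..<t}. R s r (\<lambda>y. Bf r y \<bullet> gradient (u r) y) x)"
   by (simp add: u_def)
 qed
 have ebd: "exp (\<mu> * (t - s)) <= exp (\<mu> * T)" if "0 <= s" for s
  using that t \<mu> by (simp add: mult_left_mono)
 have sbd: "\<bar>LBINT q:{s<..<t}. F q\<bar> <= C * (4 * sing \<gamma> T \<mu>) * exp (\<mu> * T) * (t - s) powr (- \<gamma>)"
  if s: "0 <= s" "s < t" and C: "0 <= C" and m: "set_borel_measurable lborel {s<..<t} F" and b: "\<And>q. q \<in> {s<..<t} ==> \<bar>F q\<bar> <= majorant \<mu> s t C q" for s C F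
 proof -
  have "\<bar>LBINT q:{s<..<t}. F q\<bar> <= C * (4 * sing \<gamma> T \<mu>) * ew \<mu> (t - s)"
   by (rule singular_integrand(2)[OF s t(2) \<mu> C m]) (use b in "simp add: majorant_def")
  also have "\<dots> <= C * (4 * sing \<gamma> T \<mu>) * ((t - s) powr (- \<gamma>) * exp (\<mu> * T))"
   using ebd[OF s(1)] C sing_nonneg[of \<gamma> T \<mu>] by (intro mult_left_mono) auto
  finally show ?thesis by (simp add: mult_ac)
 qed
 have "reg t u"
  unfolding reg_def
 proof (intro conjI allI impI)
  have "(\<lambda>z. (case z of (s, x) => if 0 <= s \<and> s < t then R s t \<phi> x else 0) + (case z of (s, x) => if 0 <= s \<and> s < t then Rop t w s x else 0))
    \<in> borel_fun2"
   by (intro borel_measurable_add R_phi_measurable Rop_measurable \<phi> w t)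
  also have "(\<lambda>z. (case z of (s, x) => if 0 <= s \<and> s < t then R s t \<phi> x else 0) + (case z of (s, x) => if 0 <= s \<and> s < t then Rop t w s x else 0)) =
    (\<lambda>(s, x). if 0 <= s \<and> s < t then u s x else 0)" by (auto simp: fun_eq_iff u_def)
  finally show "(\<lambda>(s, x). if 0 <= s \<and> s < t then u s x else 0) \<in> borel_fun2" .
  show "\<exists>K. \<forall>s i x. 0 <= s \<longrightarrow> s < t \<longrightarrow> \<bar>partial_deriv i (u s) x\<bar> <= K * (t - s) powr (- \<gamma>)"
  proof (intro exI[of _ "CR * K + CR * A * (4 * sing \<gamma> T \<mu>) * exp (\<mu> * T)"] allI impI)
   fix s i x assume s: "0 <= s" "s < t"
   have "\<bar>Dop i t w s x\<bar> <= CR * A * (4 * sing \<gamma> T \<mu>) * exp (\<mu> * T) * (t - s) powr (- \<gamma>)"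
    unfolding Dop_def
    by (rule sbd[OF s _ R_section_measurable(2)[OF w(1) s(1) t(2)]]) (use CR A R_wtd_bound(3)[OF w A s(1)] t in auto)
   moreover have "\<bar>partial_deriv i (R s t \<phi>) x\<bar> <= CR * K * (t - s) powr (- \<gamma>)"
    using s t K by (intro R_deriv_bound \<phi>) auto
   ultimately show "\<bar>partial_deriv i (u s) x\<bar> <= (CR * K + CR * A * (4 * sing \<gamma> T \<mu>) * exp (\<mu> * T)) * (t - s) powr (- \<gamma>)"
    unfolding ud(2)[OF s] distrib_right by linarith
  qed
 qed (rule ud(1))
 moreover have "good t u"
  unfolding good_def
 proof (intro conjI allI impI)
  fix s i assume s: "0 <= s" "s < t"
  show "continuous_on UNIV (u s)"
   unfolding u_def using s t by (intro continuous_on_add R_cont Rop_continuous[OF w A \<mu>] \<phi>) auto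
  have "continuous_on UNIV (\<lambda>x. partial_deriv i (R s t \<phi>) x + Dop i t w s x)"
   using s t by (intro continuous_on_add R_deriv_cont Dop_continuous[OF w A \<mu>] \<phi>) auto
  then show "continuous_on UNIV (partial_deriv i (u s))" using ud(2)[OF s] by (simp add: ext)
 next
  show "\<exists>K. \<forall>s x. 0 <= s \<longrightarrow> s < t \<longrightarrow> \<bar>u s x\<bar> <= K * (t - s) powr (- \<gamma>)"
  proof (intro exI[of _ "K * T powr \<gamma> + A * T powr \<gamma> * (4 * sing \<gamma> T \<mu>) * exp (\<mu> * T)"] allI impI)
   fix s x assume s: "0 <= s" "s < t"
   have "\<bar>Rop t w s x\<bar> <= A * T powr \<gamma> * (4 * sing \<gamma> T \<mu>) * exp (\<mu> * T) * (t - s) powr (- \<gamma>)"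
    unfolding Rop_def
    by (rule sbd[OF s _ R_section_measurable(1)[OF w(1) s(1) t(2)]]) (use A R_wtd_bound(2)[OF w A s(1)] t in auto)
   moreover have "\<bar>R s t \<phi> x\<bar> <= K" using s t K by (intro R_bound \<phi>) auto
   moreover have "K * 1 <= K * (T powr \<gamma> * (t - s) powr (- \<gamma>))"
    using s t K powr_ge_1[of "t - s"] by (intro mult_left_mono) auto
   ultimately show "\<bar>u s x\<bar> <= (K * T powr \<gamma> + A * T powr \<gamma> * (4 * sing \<gamma> T \<mu>) * exp (\<mu> * T)) * (t - s) powr (- \<gamma>)"
    unfolding u_def distrib_right by (simp only: mult_1_right mult.assoc[of K])
  qed
 next
  fix x
  have "continuous_on {0..<t} (\<lambda>s. Rop t w s x)"
   unfolding continuous_on_sequentially comp_def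
  proof (intro ballI allI impI, elim conjE)
   fix S :: "nat => real" and s assume s: "s \<in> {0..<t}" and S: "\<forall>n. S n \<in> {0..<t}" "S \<leadsto> s"
   show "(\<lambda>n. Rop t w (S n) x) \<leadsto> Rop t w s x"
    unfolding Rop_def set_lebesgue_integral_def
   \<comment> \<open>The lower limit S n moves, so the majorant starts at 0 for all n. This is
     possible because the bound for R, unlike that for its gradient, is not singular at the lower
     limit.\<close>
   proof (rule integral_dominated_convergence[where w="\<lambda>q. indicator {0<..<t} q *\<^sub>R majorant \<mu> 0 t (A * T powr \<gamma>) q"])
    show "integrable lborel (\<lambda>q. indicator {0<..<t} q *\<^sub>R majorant \<mu> 0 t (A * T powr \<gamma>) q)"
     using majorant_integrable[OF order_refl t \<mu>, of "A * T powr \<gamma>"] A by (simp add: set_integrable_def)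
    show "(\<lambda>q. indicator {s<..<t} q *\<^sub>R R s q (w q) x) \<in> borel_measurable lborel"
     using R_section_measurable(1)[OF w(1) _ t(2), of s x] s by (simp add: set_borel_measurable_def)
    show "(\<lambda>q. indicator {S n<..<t} q *\<^sub>R R (S n) q (w q) x) \<in> borel_measurable lborel" for n
     using R_section_measurable(1)[OF w(1) _ t(2), of "S n" x] S(1)[rule_format, of n] by (simp add: set_borel_measurable_def)
    show "AE q in lborel. norm (indicator {S n<..<t} q *\<^sub>R R (S n) q (w q) x) <= indicator {0<..<t} q *\<^sub>R majorant \<mu> 0 t (A * T powr \<gamma>) q" for n
    proof (rule AE_I2)
     fix q
     have Sn: "0 <= S n" using S(1)[rule_format, of n] by simp
     show "norm (indicator {S n<..<t} q *\<^sub>R R (S n) q (w q) x) <= indicator {0<..<t} q *\<^sub>R majorant \<mu> 0 t (A * T powr \<gamma>) q"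
     proof (cases "q \<in> {S n<..<t}")
      case True
      then have "\<bar>R (S n) q (w q) x\<bar> <= A * ew \<mu> (t - q)"
       using Sn t by (intro R_wtd_bound(1)[OF w A]) auto
      also have "\<dots> <= majorant \<mu> 0 t (A * T powr \<gamma>) q"
       using True Sn t A by (intro weight_le_majorant) auto
      finally show ?thesis using True Sn by simp
     qed (use A in "auto simp: majorant_def split: split_indicator")
    qed
    \<comment> \<open>At q = s the indicators may oscillate as S n approaches s from both sides;
      this single point is discarded.\<close>
    have "AE q in lborel. q \<noteq> s" by (rule AE_lborel_singleton)
    then show "AE q in lborel. (\<lambda>n. indicator {S n<..<t} q *\<^sub>R R (S n) q (w q) x) \<leadsto> indicator {s<..<t} q *\<^sub>R R s q (w q) x"
    proof eventually_elim
     case (elim q)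
     consider "q < s" | "s < q" "q < t" | "t <= q" using elim by linarith
     then show ?case
     proof cases
      case 1
      then have "\<forall>\<^sub>F n in sequentially. q < S n" using S(2) by (intro order_tendstoD)
      then have "\<forall>\<^sub>F n in sequentially. indicator {S n<..<t} q *\<^sub>R R (S n) q (w q) x = indicator {s<..<t} q *\<^sub>R R s q (w q) x"
       by eventually_elim (use 1 in simp)
      then show ?thesis by (rule tendsto_eventually)
     next
      case 2
      have ev: "\<forall>\<^sub>F n in sequentially. S n < q" using S(2) 2 by (intro order_tendstoD)
      then have ev2: "\<forall>\<^sub>F n in sequentially. S n \<in> {0..<q}"
       by eventually_elim (use S(1) in auto)
      have "continuous_on {0..<q} (\<lambda>s. R s q (w q) x)"
       using 2 s t by (intro R_time_cont admD(2)[OF w(1)]) auto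
      from continuous_on_tendsto_compose[OF this S(2) _ ev2]
      have "(\<lambda>n. R (S n) q (w q) x) \<leadsto> R s q (w q) x" using 2 s by simp
      moreover have "\<forall>\<^sub>F n in sequentially. R (S n) q (w q) x = indicator {S n<..<t} q *\<^sub>R R (S n) q (w q) x"
       using ev by eventually_elim (use 2 in simp)
      ultimately have "(\<lambda>n. indicator {S n<..<t} q *\<^sub>R R (S n) q (w q) x) \<leadsto> R s q (w q) x"
       by (rule Lim_transform_eventually)
      then show ?thesis using 2 by simp
     next
      case 3 then show ?thesis by simp
     qed
    qed
   qed
  qed
  then show "continuous_on {0..<t} (\<lambda>s. u s x)"
   unfolding u_def by (intro continuous_on_add R_time_cont t \<phi>)
 qed
 ultimately show thesis using that mild by blast
qed

end

section \<open>The Kolmogorov equation\<close>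

text \<open>On a measurable null set containing all bad paths the process is replaced by 0;
  elsewhere clipping makes it right-continuous on the whole line, and
  \<open>right_cont_measurable_pair\<close> applies.\<close>

lemma (in prob_space) cadlag_joint_version:
 fixes Y :: "real => 'a => real ^ 'n::finite"
 assumes sT: "s <= T" and Y: "\<And>t. t \<in> {s..T} ==> Y t \<in> borel_measurable M"
  and cad: "AE om in M. cadlag_on {s..T} (\<lambda>t. Y t om)"
 obtains Y' where "(\<lambda>(t, om). Y' t om) \<in> borel_measurable (borel \<Otimes>\<^sub>M M)"
  "AE om in M. \<forall>t\<in>{s..T}. Y' t om = Y t om"
proof -
 obtain A where A: "{om \<in> space M. \<not> cadlag_on {s..T} (\<lambda>t. Y t om)} \<subseteq> A" "emeasure M A = 0" "A \<in> sets M"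
  by (rule AE_E[OF cad])
 define Y' where "Y' t om = (if om \<in> A then 0 else Y (clip s T t) om)" for t om
 have "(\<lambda>(t, om). Y' t om) \<in> borel_measurable (borel \<Otimes>\<^sub>M M)"
 proof (rule right_cont_measurable_pair)
  show "Y' v \<in> borel_measurable M" for v
  proof -
   note Y[OF clip_in(1)[OF sT], measurable]
   note A(3)[measurable]
   show ?thesis unfolding Y'_def[abs_def] by measurable
  qed
  fix v om assume w: "om \<in> space M"
  show "continuous (at v within {v..}) (\<lambda>v. Y' v om)"
  proof (cases "om \<in> A")
   case False
   then have "cadlag_on {s..T} (\<lambda>t. Y t om)" using A w by blast
   then have "continuous (at v within {v..}) (\<lambda>v. Y (clip s T v) om)"
    by (intro clip_right_cont[OF sT] cadlag_on_right_cont)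
   then show ?thesis using False by (simp add: Y'_def)
  qed (simp add: Y'_def)
 qed
 moreover have "AE om in M. \<forall>t\<in>{s..T}. Y' t om = Y t om"
  using AE_not_in[OF null_setsI[OF A(2,3)]] by eventually_elim (simp add: Y'_def clip_in(2))
 ultimately show thesis by (rule that)
qed

lemma continuous_integral_param:
 fixes G :: "'b::{first_countable_topology, t2_space} => 'a => real"
 assumes m: "\<And>x. G x \<in> borel_measurable M"
  and c: "AE a in M. continuous_on UNIV (\<lambda>x. G x a)"
  and b: "AE a in M. \<forall>x. \<bar>G x a\<bar> <= w a" and w: "integrable M w"
 shows "continuous_on UNIV (\<lambda>x. \<integral>a. G x a \<partial>M)"
proof -
 have "(\<lambda>n. \<integral>a. G (X n) a \<partial>M) \<leadsto> (LINT a|M. G l a)" if X: "X \<leadsto> l" for X l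
 proof (rule integral_dominated_convergence[OF m m w])
  show "AE a in M. (\<lambda>n. G (X n) a) \<leadsto> G l a"
   using c by eventually_elim (rule continuous_on_tendsto_compose[OF _ X], auto)
  show "AE a in M. norm (G (X n) a) <= w a" for n using b by eventually_elim auto
 qed
 then show ?thesis
  unfolding continuous_on_sequentially comp_def by auto
qed

locale kolmogorov = ou_sde M L \<alpha> gbar W T lam c f J
 for M :: "'w measure" and L \<alpha> gbar and W :: "real => 'w => real ^ 'n::finite" and T lam c f J +
 fixes B0 :: "real => real ^ 'n => real ^ 'n" and Z X :: "real => real ^ 'n => real => 'w => real ^ 'n"
  and KL K0 :: real
 assumes B0c: "continuous_on ({0..T} \<times> UNIV) (\<lambda>(t, x). B0 t x)"
  and B0_lip: "\<And>t x y. t \<in> {0..T} ==> norm (B0 t x - B0 t y) <= KL * norm (x - y)"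
  and B0_bound: "\<And>t x i. t \<in> {0..T} ==> \<bar>B0 t x $ i\<bar> <= K0"
  and Z_measurable: "\<And>s x t. 0 <= s ==> s <= t ==> t <= T ==> Z s x t \<in> borel_measurable M"
  and X_measurable: "\<And>s x t. 0 <= s ==> s <= t ==> t <= T ==> X s x t \<in> borel_measurable M"
  and Z_sol: "\<And>s x. 0 <= s ==> s <= T ==> AE om in M. psol lam T (\<lambda>t _. f t) s x (\<lambda>t. noise c t om) (\<lambda>t. Z s x t om)"
  and X_sol: "\<And>s x. 0 <= s ==> s <= T ==> AE om in M. psol lam T B0 s x (\<lambda>t. noise c t om) (\<lambda>t. X s x t om)"
begin

text \<open>The solutions are only known to be measurable for each fixed time; Fubini in time requires jointly measurable
 versions.\<close>

definition Jv :: "real => 'w => real ^ 'n" where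
 "Jv = (SOME Y'. (\<lambda>(t, om). Y' t om) \<in> borel_measurable (borel \<Otimes>\<^sub>M M) \<and> (AE om in M. \<forall>t\<in>{0..T}. Y' t om = J t om))"

lemma Jv: "(\<lambda>(t, om). Jv t om) \<in> borel_measurable (borel \<Otimes>\<^sub>M M)" "AE om in M. \<forall>t\<in>{0..T}. Jv t om = J t om"
proof -
 have "AE om in M. cadlag_on {0..T} (\<lambda>t. J t om)" using J_sol by eventually_elim (simp add: psol_def)
 then have "\<exists>Y'. (\<lambda>(t, om). Y' t om) \<in> borel_measurable (borel \<Otimes>\<^sub>M M) \<and> (AE om in M. \<forall>t\<in>{0..T}. Y' t om = J t om)"
  by - (rule cadlag_joint_version[OF less_imp_le[OF T] J_measurable], assumption+, blast)
 from someI_ex[OF this]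
 show "(\<lambda>(t, om). Jv t om) \<in> borel_measurable (borel \<Otimes>\<^sub>M M)" "AE om in M. \<forall>t\<in>{0..T}. Jv t om = J t om"
  unfolding Jv_def by auto
qed

definition Xv :: "real => real ^ 'n => real => 'w => real ^ 'n" where
 "Xv s x = (SOME Y'. (\<lambda>(t, om). Y' t om) \<in> borel_measurable (borel \<Otimes>\<^sub>M M) \<and> (AE om in M. \<forall>t\<in>{s..T}. Y' t om = X s x t om))"

lemma Xv:
 assumes "0 <= s" "s <= T"
 shows "(\<lambda>(t, om). Xv s x t om) \<in> borel_measurable (borel \<Otimes>\<^sub>M M)" "AE om in M. \<forall>t\<in>{s..T}. Xv s x t om = X s x t om"
proof -
 have "AE om in M. cadlag_on {s..T} (\<lambda>t. X s x t om)" using X_sol[OF assms, of x] by eventually_elim (simp add: psol_def)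
 then have "\<exists>Y'. (\<lambda>(t, om). Y' t om) \<in> borel_measurable (borel \<Otimes>\<^sub>M M) \<and> (AE om in M. \<forall>t\<in>{s..T}. Y' t om = X s x t om)"
  using X_measurable[OF assms(1), of _ x] by - (rule cadlag_joint_version[OF assms(2), of "X s x"], auto)
 from someI_ex[OF this]
 show "(\<lambda>(t, om). Xv s x t om) \<in> borel_measurable (borel \<Otimes>\<^sub>M M)" "AE om in M. \<forall>t\<in>{s..T}. Xv s x t om = X s x t om"
  unfolding Xv_def by auto
qed

definition Em :: "real => real => real ^ 'n => real ^ 'n" where
 "Em s q x = (\<chi> i. exp (- (lam i * (q - s))) * x $ i)"

definition xiv :: "real => real => 'w => real ^ 'n" where
 "xiv s q om = (\<chi> i. Jv q om $ i - exp (- (lam i * (q - s))) * Jv s om $ i)"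

text \<open>R expressed through the single process J. The solutions Z s x are given separately for
  each s and x and yield no joint measurability in (s, q, x); this form does.\<close>

definition Rf :: "real => real => (real ^ 'n => real) => real ^ 'n => real" where
 "Rf s q \<psi> x = (LINT om|M. \<psi> (Em s q x + xiv s q om))"

lemma Em_refl [simp]: "Em s s x = x" by (simp add: Em_def vec_eq_iff)
lemma xiv_refl [simp]: "xiv s s om = 0" by (simp add: xiv_def vec_eq_iff)

lemma Em_add: "Em s q (x + y) = Em s q x + Em s q y"
 by (simp add: Em_def vec_eq_iff algebra_simps)

lemma Em_axis: "Em s q (nudge x h i) = Em s q x + (h * exp (- (lam i * (q - s)))) *\<^sub>R axis i 1"
 by (simp add: Em_def vec_eq_iff axis_def algebra_simps)

lemma continuous_Em: "continuous_on UNIV (Em s q)"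
 unfolding Em_def[abs_def] by (intro continuous_intros)

lemma Jv_measurable [measurable (raw)]:
 assumes [measurable]: "a \<in> borel_measurable N" "b \<in> measurable N M"
 shows "(\<lambda>z. Jv (a z) (b z)) \<in> borel_measurable N"
 using measurable_compose[OF _ Jv(1), of "\<lambda>z. (a z, b z)" N] by simp

lemma xiv_measurable [measurable (raw)]:
 assumes [measurable]: "a \<in> borel_measurable N" "q \<in> borel_measurable N" "b \<in> measurable N M"
 shows "(\<lambda>z. xiv (a z) (q z) (b z)) \<in> borel_measurable N"
 unfolding xiv_def
 by (intro measurable_vec_lambda_borel borel_measurable_diff borel_measurable_times
   measurable_compose[OF _ measurable_vec_nth_borel]) measurable

lemma Em_measurable [measurable (raw)]:
 assumes [measurable]: "a \<in> borel_measurable N" "q \<in> borel_measurable N" "b \<in> borel_measurable N"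
 shows "(\<lambda>z. Em (a z) (q z) (b z)) \<in> borel_measurable N"
 unfolding Em_def
 by (intro measurable_vec_lambda_borel borel_measurable_times
   measurable_compose[OF _ measurable_vec_nth_borel]) measurable

lemma xiv_AE: "AE om in M. \<forall>s\<in>{0..T}. \<forall>q\<in>{0..T}. xiv s q om = xi s q om"
 using Jv(2) by eventually_elim (simp add: xiv_def xi_def)

lemma Rf_eq_xi:
 assumes "0 <= s" "s <= q" "q <= T" "\<psi> \<in> borel_fun"
 shows "Rf s q \<psi> x = (LINT om|M. \<psi> (Em s q x + xi s q om))"
 unfolding Rf_def
proof (rule integral_cong_AE)
 show "AE om in M. \<psi> (Em s q x + xiv s q om) = \<psi> (Em s q x + xi s q om)"
  using xiv_AE by eventually_elim (use assms in auto)
qed (use assms xi_measurable[of s q] in measurable)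

lemma Rf_integrable: "\<psi> \<in> bounded_borel ==> integrable M (\<lambda>om. \<psi> (Em s q x + xiv s q om))"
proof -
 assume p: "\<psi> \<in> bounded_borel"
 then obtain K where "\<And>y. \<bar>\<psi> y\<bar> <= K" by (rule bounded_borelD) auto
 then show ?thesis using bounded_borel_measurable[OF p] by (intro integrable_const_bound[where B=K]) auto
qed

lemma Rf_bound:
 assumes p: "\<psi> \<in> bounded_borel" and K: "\<And>y. \<bar>\<psi> y\<bar> <= K"
 shows "\<bar>Rf s q \<psi> x\<bar> <= K"
proof -
 have "\<bar>Rf s q \<psi> x\<bar> <= (LINT om|M. \<bar>\<psi> (Em s q x + xiv s q om)\<bar>)" unfolding Rf_def by (rule integral_abs_bound)
 also have "\<dots> <= (LINT om|M. K)" using Rf_integrable[OF p] K by (intro integral_mono) auto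
 finally show ?thesis by (simp add: prob_space)
qed

lemma Rf_lincomb: "\<phi> \<in> bounded_borel ==> \<psi> \<in> bounded_borel ==>
   Rf s q (\<lambda>y. a * \<phi> y + b * \<psi> y) x = a * Rf s q \<phi> x + b * Rf s q \<psi> x"
 unfolding Rf_def using Rf_integrable[of \<phi> s q x] Rf_integrable[of \<psi> s q x] by simp

lemma Rf_measurable_pair:
 assumes w: "(\<lambda>(q, y). w q y) \<in> borel_fun2"
 shows "(\<lambda>(s, q, x). if 0 <= s \<and> s < q \<and> q <= T then Rf s q (w q) x else 0) \<in> borel_measurable (borel \<Otimes>\<^sub>M (borel \<Otimes>\<^sub>M borel))"
proof -
 have "(\<lambda>((s, q, x), om). w q (Em s q x + xiv s q om)) \<in> borel_measurable ((borel \<Otimes>\<^sub>M (borel \<Otimes>\<^sub>M borel)) \<Otimes>\<^sub>M M)"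
  using measurable_compose[OF _ w, of "\<lambda>((s, q, x), om). (q, Em s q x + xiv s q om)" "(borel \<Otimes>\<^sub>M (borel \<Otimes>\<^sub>M borel)) \<Otimes>\<^sub>M M"]
  by (simp add: split_beta')
 then have [measurable]: "(\<lambda>(s, q, x). Rf s q (w q) x) \<in> borel_measurable (borel \<Otimes>\<^sub>M (borel \<Otimes>\<^sub>M borel))"
  unfolding Rf_def split_beta' by (rule borel_measurable_lebesgue_integral[where f="\<lambda>z om. w (fst (snd z)) (Em (fst z) (fst (snd z)) (snd (snd z)) + xiv (fst z) (fst (snd z)) om)", unfolded split_beta'])
 then have [measurable]: "(\<lambda>z. Rf (fst z) (fst (snd z)) (w (fst (snd z))) (snd (snd z))) \<in> borel_measurable (borel \<Otimes>\<^sub>M (borel \<Otimes>\<^sub>M borel))"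
  by (simp add: split_beta')
 show ?thesis unfolding split_beta' by measurable
qed

text \<open>Given L, the conditional value of \<open>Rf s q \<psi> x\<close>; \<open>gd\<close> is
  its i-th partial derivative, with the exponential contributed by the linear flow
  \<open>Em\<close>.\<close>

definition gm :: "real => real => (real ^ 'n => real) => real ^ 'n => 'w => real" where
 "gm s q \<psi> x om = gsm \<psi> (Em s q x + mean s q) (vsd s q om)"

definition gd :: "'n => real => real => (real ^ 'n => real) => real ^ 'n => 'w => real" where
 "gd i s q \<psi> x om = exp (- (lam i * (q - s))) * gsd i \<psi> (Em s q x + mean s q) (vsd s q om)"

text \<open>Combines the constant of \<open>gsd_bound\<close> with the lower bound c_i exp(- lam_i
  T) for the deviation relative to the square root of the increment of L.\<close>

definition Kd :: "'n => real" where "Kd i = gC TYPE('n) * exp (lam i * T) / c i"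

lemma Kd_nonneg: "0 <= Kd i"
proof -
 have "0 <= gC TYPE('n)" unfolding gC_def by (rule integral_nonneg_AE) (simp add: gwt_def)
 then show ?thesis using c[of i] by (simp add: Kd_def)
qed

text \<open>Summing over the coordinates gives one constant valid for every partial
  derivative.\<close>

definition CRd :: real where "CRd = (\<Sum>i\<in>UNIV. Kd i) * Cneg"

context
 fixes s q :: real
 assumes sq: "0 <= s" "s < q" "q <= T"
begin

lemma Rf_eq: "\<psi> \<in> bounded_borel ==> Rf s q \<psi> x = (LINT om|M. gm s q \<psi> x om)"
 using Rf_eq_xi[of s q \<psi> x] xi_expectation[OF sq, of \<psi> "Em s q x"] sq by (simp add: gm_def bounded_borel_measurable)

lemma gm_measurable: "\<psi> \<in> bounded_borel ==> gm s q \<psi> x \<in> borel_measurable M"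
 and gd_measurable: "\<psi> \<in> bounded_borel ==> gd i s q \<psi> x \<in> borel_measurable M"
 unfolding gm_def[abs_def] gd_def[abs_def] using gsm_measurable_vsd[OF sq, of \<psi>] by auto

lemma gm_bound: "\<psi> \<in> bounded_borel ==> (\<And>y. \<bar>\<psi> y\<bar> <= K) ==> \<bar>gm s q \<psi> x om\<bar> <= K"
 unfolding gm_def by (rule gsm_bound)

lemma gd_bound:
 assumes p: "\<psi> \<in> bounded_borel" and K: "\<And>y. \<bar>\<psi> y\<bar> <= K"
 shows "AE om in M. \<forall>x i. \<bar>gd i s q \<psi> x om\<bar> <= K * Kd i * (1 / sqrt (L q om - L s om))"
 using vsd_AE[OF sq] L_increment_pos_AE[OF sq(1,2)]
proof eventually_elim
 case (elim om)
 have K0: "0 <= K" using K[of 0] by linarith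
 have C0: "0 <= gC TYPE('n)" unfolding gC_def by (rule integral_nonneg_AE) (simp add: gwt_def)
 show ?case
 proof (intro allI)
  fix x i
  let ?v = "vsd s q om" and ?l = "sqrt (L q om - L s om)"
  have l: "0 < ?l" using elim by simp
  have v: "0 < c i * exp (- (lam i * T)) * ?l" "c i * exp (- (lam i * T)) * ?l <= ?v i" "0 < ?v i"
   using elim(1) l c[of i] by auto
  have "\<bar>gd i s q \<psi> x om\<bar> <= 1 * \<bar>gsd i \<psi> (Em s q x + mean s q) ?v\<bar>"
   unfolding gd_def abs_mult using lam[of i] sq by (intro mult_right_mono) (auto simp: less_imp_le)
  also have "\<dots> <= K * gC TYPE('n) / ?v i" using gsd_bound[of \<psi> K ?v i "Em s q x + mean s q"] p K v(3) by simp
  also have "\<dots> <= K * gC TYPE('n) / (c i * exp (- (lam i * T)) * ?l)"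
   using v K0 C0 c[of i] elim(2) by (intro divide_left_mono mult_pos_pos) auto
  also have "\<dots> = K * Kd i * (1 / ?l)"
   using c[of i] l by (simp add: Kd_def exp_minus field_simps)
  finally show "\<bar>gd i s q \<psi> x om\<bar> <= K * Kd i * (1 / ?l)" .
 qed
qed

lemma gd_dominating: "integrable M (\<lambda>om. K * Kd i * (1 / sqrt (L q om - L s om)))"
 using inverse_sqrt_increment(1)[OF sq(1,2)] by (rule integrable_mult_right)

text \<open>Conditionally on L the function is differentiable by Gaussian smoothing. The derivatives
  are dominated by a multiple of (L_q - L_s)^(-1/2), whose expectation is finite, so differentiation
  passes through the average over L.\<close>

lemma Rf_deriv_0:
 assumes p: "\<psi> \<in> bounded_borel"
 shows "((\<lambda>h. Rf s q \<psi> (nudge x h i)) has_real_derivative (LINT om|M. gd i s q \<psi> x om)) (at 0)"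
proof -
 obtain K where K: "\<And>y. \<bar>\<psi> y\<bar> <= K" using bounded_borelD[OF p] by blast
 have "((\<lambda>h. \<integral>om. gm s q \<psi> (nudge x h i) om \<partial>M) has_real_derivative (LINT om|M. gd i s q \<psi> (nudge x 0 i) om)) (at 0)"
 proof (rule has_real_derivative_integral)
  show "integrable M (gm s q \<psi> (nudge x h i))" for h
   using gm_bound[OF p K] gm_measurable[OF p] by (intro integrable_const_bound[where B=K]) auto
  show "AE om in M. \<forall>h. \<bar>h\<bar> <= 1 \<longrightarrow> ((\<lambda>h. gm s q \<psi> (nudge x h i) om) has_real_derivative gd i s q \<psi> (nudge x h i) om) (at h)"
   using vsd_AE[OF sq]
  proof eventually_elim
   case (elim om)
   let ?e = "exp (- (lam i * (q - s)))" and ?z = "Em s q x + mean s q"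
   have "((\<lambda>h. gsm \<psi> (?z + (h * ?e) *\<^sub>R axis i 1) (vsd s q om)) has_real_derivative
     gsd i \<psi> (?z + (h * ?e) *\<^sub>R axis i 1) (vsd s q om) * ?e) (at h)" for h
    by (rule DERIV_chain2[where f="\<lambda>k. gsm \<psi> (?z + k *\<^sub>R axis i 1) (vsd s q om)" and g="\<lambda>h. h * ?e"])
     (use elim gsm_deriv[OF p] in "auto intro!: derivative_eq_intros")
   then show ?case by (simp add: gm_def gd_def Em_axis mult_ac add_ac)
  qed
  show "AE om in M. \<forall>h. \<bar>h\<bar> <= 1 \<longrightarrow> \<bar>gd i s q \<psi> (nudge x h i) om\<bar> <= K * Kd i * (1 / sqrt (L q om - L s om))"
   using gd_bound[OF p K] by eventually_elim blast
 qed (use gd_dominating gd_measurable[OF p] in auto)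
 then show ?thesis by (simp add: Rf_eq[OF p])
qed

lemma Rf_partial_deriv: "\<psi> \<in> bounded_borel ==> partial_deriv i (Rf s q \<psi>) x = (LINT om|M. gd i s q \<psi> x om)"
 unfolding partial_deriv_def
 by (rule vector_derivative_at) (use Rf_deriv_0 has_real_derivative_iff_has_vector_derivative in blast)

lemma Rf_deriv:
 assumes p: "\<psi> \<in> bounded_borel"
 shows "((\<lambda>h. Rf s q \<psi> (nudge x h i)) has_real_derivative partial_deriv i (Rf s q \<psi>) (nudge x h i)) (at h)"
 using Rf_deriv_0[OF p, of "nudge x h i" i] DERIV_shift[of "\<lambda>h. Rf s q \<psi> (nudge x h i)" _ 0 h]
 by (simp add: Rf_partial_deriv[OF p] scaleR_add_left add_ac)

lemma Rf_continuous:
 assumes p: "\<psi> \<in> bounded_borel"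
 shows "continuous_on UNIV (Rf s q \<psi>)"
proof -
 obtain K where K: "\<And>y. \<bar>\<psi> y\<bar> <= K" using bounded_borelD[OF p] by blast
 have "continuous_on UNIV (\<lambda>x. \<integral>om. gm s q \<psi> x om \<partial>M)"
 proof (rule continuous_integral_param[where w="\<lambda>_. K"])
  show "AE om in M. continuous_on UNIV (\<lambda>x. gm s q \<psi> x om)"
   using vsd_AE[OF sq]
  proof eventually_elim
   case (elim om)
   show ?case unfolding gm_def
    by (rule continuous_on_compose2[OF gsm_continuous[OF p]]) (use elim in "auto intro!: continuous_intros continuous_Em")
  qed
 qed (use gm_bound[OF p K] gm_measurable[OF p] in auto)
 then show ?thesis by (simp add: Rf_eq[OF p, abs_def])
qed

lemma Rf_deriv_continuous:
 assumes p: "\<psi> \<in> bounded_borel"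
 shows "continuous_on UNIV (partial_deriv i (Rf s q \<psi>))"
proof -
 obtain K where K: "\<And>y. \<bar>\<psi> y\<bar> <= K" using bounded_borelD[OF p] by blast
 have "continuous_on UNIV (\<lambda>x. \<integral>om. gd i s q \<psi> x om \<partial>M)"
 proof (rule continuous_integral_param[OF gd_measurable[OF p] _ _ gd_dominating])
  show "AE om in M. continuous_on UNIV (\<lambda>x. gd i s q \<psi> x om)"
   using vsd_AE[OF sq]
  proof eventually_elim
   case (elim om)
   show ?case unfolding gd_def
    by (intro continuous_on_mult continuous_on_const continuous_on_compose2[OF gsd_continuous[OF p]]) (use elim in "auto intro!: continuous_intros continuous_Em")
  qed
  show "AE om in M. \<forall>x. \<bar>gd i s q \<psi> x om\<bar> <= K * Kd i * (1 / sqrt (L q om - L s om))"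
   using gd_bound[OF p K] by eventually_elim blast
 qed
 then show ?thesis by (simp add: Rf_partial_deriv[OF p, abs_def])
qed

lemma Rf_deriv_bound:
 assumes p: "\<psi> \<in> bounded_borel" and K: "\<And>y. \<bar>\<psi> y\<bar> <= K"
 shows "\<bar>partial_deriv i (Rf s q \<psi>) x\<bar> <= CRd * K * (q - s) powr (- (1 / (2 * \<alpha>)))"
proof -
 have K0: "0 <= K" using K[of 0] by linarith
 have b: "AE om in M. \<bar>gd i s q \<psi> x om\<bar> <= K * Kd i * (1 / sqrt (L q om - L s om))"
  using gd_bound[OF p K] by eventually_elim blast
 have "\<bar>partial_deriv i (Rf s q \<psi>) x\<bar> <= (LINT om|M. \<bar>gd i s q \<psi> x om\<bar>)"
  unfolding Rf_partial_deriv[OF p] by (rule integral_abs_bound)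
 also have "\<dots> <= (LINT om|M. K * Kd i * (1 / sqrt (L q om - L s om)))"
 proof (rule integral_mono_AE[OF _ gd_dominating b])
  show "integrable M (\<lambda>om. \<bar>gd i s q \<psi> x om\<bar>)"
   by (rule integrable_abs[OF Bochner_Integration.integrable_bound[OF gd_dominating[of K i] gd_measurable[OF p]]])
    (use b in eventually_elim, unfold real_norm_def abs_abs, rule order_trans[OF _ abs_ge_self])
 qed
 also have "\<dots> = K * Kd i * ((q - s) powr (- (1 / (2 * \<alpha>))) * Cneg)"
  unfolding inverse_sqrt_increment(2)[OF sq(1,2), symmetric] by (rule integral_mult_right_zero)
 also have "\<dots> <= K * (\<Sum>i\<in>UNIV. Kd i) * ((q - s) powr (- (1 / (2 * \<alpha>))) * Cneg)"
  using K0 Kd_nonneg Cneg_nonneg by (intro mult_right_mono mult_left_mono member_le_sum mult_nonneg_nonneg) auto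
 finally show ?thesis by (simp add: CRd_def mult_ac)
qed

lemma Rf_deriv_lim:
 assumes P: "\<And>n::nat. \<Psi> n \<in> bounded_borel" and p: "\<psi> \<in> bounded_borel"
  and K: "\<And>n y. \<bar>\<Psi> n y\<bar> <= K" and lim: "\<And>y. (\<lambda>n. \<Psi> n y) \<leadsto> \<psi> y"
 shows "(\<lambda>n. partial_deriv i (Rf s q (\<Psi> n)) x) \<leadsto> partial_deriv i (Rf s q \<psi>) x"
 unfolding Rf_partial_deriv[OF P] Rf_partial_deriv[OF p]
proof (rule integral_dominated_convergence[OF gd_measurable[OF p] gd_measurable[OF P] gd_dominating])
 show "AE om in M. (\<lambda>n. gd i s q (\<Psi> n) x om) \<leadsto> gd i s q \<psi> x om"
  using vsd_AE[OF sq]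
 proof eventually_elim
  case (elim om)
  have "vsd s q om i \<noteq> 0" using elim by (metis less_irrefl)
  then show ?case
   unfolding gd_def
   by (intro tendsto_mult_left gs_tendsto(2)[where \<Psi>=\<Psi> and K=K]) (use P p K lim in auto)
 qed
 show "AE om in M. norm (gd i s q (\<Psi> n) x om) <= K * Kd i * (1 / sqrt (L q om - L s om))" for n
  using gd_bound[OF P K, of n] by eventually_elim simp
qed

end

end

text \<open>Coordinates are exchanged one at a time, each step controlled by the mean value
  inequality along an axis; bounded partial derivatives suffice, whether or not the function is
  totally differentiable.\<close>

lemma lipschitz_of_partial_bounds:
 fixes g :: "real ^ 'n::finite => 'b::real_normed_vector"
 assumes d: "\<And>i x. ((\<lambda>h. g (nudge x h i)) has_vector_derivative D i x) (at 0)"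
  and b: "\<And>i x. norm (D i x) <= C"
 shows "norm (g x - g y) <= real CARD('n) * C * norm (x - y)"
proof -
 have C: "0 <= C" using b[of undefined 0] norm_ge_zero order_trans by blast
 have line: "norm (g (nudge z k i) - g z) <= C * \<bar>k\<bar>" for z i k
 proof -
  have "norm ((\<lambda>h. g (nudge z h i)) k - (\<lambda>h. g (nudge z h i)) 0) <= C * norm (k - 0)"
  proof (rule differentiable_bound[where S=UNIV and f'="\<lambda>h t. t *\<^sub>R D i (nudge z h i)"])
   fix h :: real
   have "((\<lambda>h'. g (nudge z h i + h' *\<^sub>R axis i 1)) \<circ> (\<lambda>u. u - h) has_vector_derivative 1 *\<^sub>R D i (nudge z h i)) (at h)"
    by (rule vector_diff_chain_at) (use d in "auto intro!: derivative_eq_intros")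
   then show "((\<lambda>h. g (nudge z h i)) has_derivative (\<lambda>t. t *\<^sub>R D i (nudge z h i))) (at h within UNIV)"
    by (simp add: has_vector_derivative_def comp_def algebra_simps)
   show "onorm (\<lambda>t. t *\<^sub>R D i (nudge z h i)) <= C"
   proof (rule onorm_le)
    fix t :: real
    show "norm (t *\<^sub>R D i (nudge z h i)) <= C * norm t"
     using mult_right_mono[OF b[of i "nudge z h i"] abs_ge_zero[of t]] by (simp add: mult.commute)
   qed
  qed auto
  then show ?thesis by simp
 qed
 have "norm (g (\<chi> i. if i \<in> S then x $ i else y $ i) - g y) <= (\<Sum>i\<in>S. C * \<bar>x $ i - y $ i\<bar>)" for S :: "'n set"
  using finite[of S]
 proof (induction S)
  case empty
  have "(\<chi> i. y $ i) = y" by (simp add: vec_eq_iff)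
  then show ?case by simp
 next
  case (insert i S)
  let ?z = "\<chi> j. if j \<in> S then x $ j else y $ j"
  have "(\<chi> j. if j \<in> insert i S then x $ j else y $ j) = ?z + (x $ i - y $ i) *\<^sub>R axis i 1"
   using insert(2) by (auto simp: vec_eq_iff axis_def)
  then have "norm (g (\<chi> j. if j \<in> insert i S then x $ j else y $ j) - g y) <= C * \<bar>x $ i - y $ i\<bar> + (\<Sum>i\<in>S. C * \<bar>x $ i - y $ i\<bar>)"
   using line[of ?z "x $ i - y $ i" i] insert(3) norm_triangle_ineq[of "g (?z + (x $ i - y $ i) *\<^sub>R axis i 1) - g ?z" "g ?z - g y"] by simp
  then show ?case using insert(1,2) by simp
 qed
 from this[of UNIV] have "norm (g x - g y) <= (\<Sum>i\<in>(UNIV :: 'n set). C * \<bar>x $ i - y $ i\<bar>)" by simp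
 also have "\<dots> <= (\<Sum>i\<in>(UNIV :: 'n set). C * norm (x - y))"
  using C component_le_norm_cart[of "x - y"] by (intro sum_mono mult_left_mono) auto
 finally show ?thesis by (simp add: mult_ac)
qed

section \<open>The Chapman-Kolmogorov relation and continuity in the starting time\<close>

context kolmogorov begin

lemma Z_path_sol:
 assumes "0 <= s" "s <= T"
 shows "AE om in M. path_sol lam T (\<lambda>t _. f t) s x (\<lambda>t. noise c t om) (\<lambda>t. Z s x t om)"
 using Z_sol[OF assms, of x] by eventually_elim (use assms f_joint_continuous in "unfold_locales, auto")

lemma J_path_sol: "AE om in M. path_sol lam T (\<lambda>t _. f t) 0 0 (\<lambda>t. noise c t om) (\<lambda>t. J t om)"
 using J_sol by eventually_elim (use T f_joint_continuous in "unfold_locales, auto")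

lemma X_path_sol:
 assumes "0 <= s" "s <= T"
 shows "AE om in M. path_sol lam T B0 s x (\<lambda>t. noise c t om) (\<lambda>t. X s x t om)"
 using X_sol[OF assms, of x] by eventually_elim (use assms B0c in "unfold_locales, auto")

text \<open>Z and J share noise and forcing, so their difference evolves by the homogeneous linear
  flow from its value x - J_s at time s.\<close>

lemma Z_eq:
 assumes s: "0 <= s" "s <= q" "q <= T"
 shows "AE om in M. Z s x q om = Em s q x + xi s q om"
 using Z_path_sol[OF s(1) order_trans[OF s(2,3)], of x] J_path_sol
proof eventually_elim
 case (elim om)
 have "Z s x q om $ i - J q om $ i = exp (- (lam i * (q - s))) * (x $ i - J s om $ i)" for i
  using psol_difference(1)[OF elim, of s q i] path_sol.X_s[OF elim(1)] s by (simp add: set_lebesgue_integral_def)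
 then show ?case by (simp add: vec_eq_iff Em_def xi_def algebra_simps)
qed

lemma Rf_measurable: "\<psi> \<in> bounded_borel ==> Rf s q \<psi> \<in> borel_fun"
 unfolding Rf_def[abs_def]
 by (rule borel_measurable_lebesgue_integral) (use bounded_borel_measurable[of \<psi>] in measurable)

lemma Rf_lim:
 assumes P: "\<And>n::nat. \<Psi> n \<in> bounded_borel" and p: "\<psi> \<in> bounded_borel"
  and K: "\<And>n y. \<bar>\<Psi> n y\<bar> <= K" and lim: "\<And>y. (\<lambda>n. \<Psi> n y) \<leadsto> \<psi> y"
 shows "(\<lambda>n. Rf s q (\<Psi> n) x) \<leadsto> Rf s q \<psi> x"
 unfolding Rf_def
 by (rule integral_dominated_convergence[where w="\<lambda>_. K"])
  (use K lim bounded_borel_measurable[OF p] bounded_borel_measurable[OF P] in auto)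

lemma Em_Em: "Em r q (Em s r x) = Em s q x"
 by (simp add: Em_def vec_eq_iff exp_add[symmetric] algebra_simps flip: mult.assoc)

lemma xi_split: "Em r q (xi s r om) + xi r q om = xi s q om"
proof -
 have "exp (- (lam i * (q - s))) = exp (- (lam i * (q - r))) * exp (- (lam i * (r - s)))" for i
  by (simp add: exp_add[symmetric] algebra_simps)
 then show ?thesis by (simp add: Em_def vec_eq_iff xi_def algebra_simps)
qed

text \<open>The flow and the convolution split at time r, and Z_r is independent of the convolution
  on [r,q]. The relation is used to compare two starting times.\<close>

lemma Chapman_Kolmogorov:
 assumes s: "0 <= s" "s <= r" "r <= q" "q <= T" and \<psi>: "\<psi> \<in> bounded_borel"
 shows "Rf s q \<psi> x = (LINT om|M. Rf r q \<psi> (Em s r x + xi s r om))"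
 using \<psi>
proof (induction \<psi> rule: bounded_borel_induct)
 case (bump n a)
 let ?\<psi> = "bump n a"
 have [measurable]: "Z s x r \<in> borel_measurable M" "xi r q \<in> borel_measurable M" "xi s r \<in> borel_measurable M" "xi s q \<in> borel_measurable M"
  using s by (auto intro!: Z_measurable xi_measurable)
 have bm [measurable]: "?\<psi> \<in> borel_fun" by (rule bounded_borel_measurable[OF bump_bounded_borel])
 note Rf_measurable[OF bump_bounded_borel, measurable]
 have "Rf s q ?\<psi> x = (LINT om|M. ?\<psi> (Em s q x + xi s q om))" using s by (intro Rf_eq_xi) auto
 also have "\<dots> = (LINT om|M. ?\<psi> (Em r q (Z s x r om) + xi r q om))"
 proof (rule integral_cong_AE)
  show "AE om in M. ?\<psi> (Em s q x + xi s q om) = ?\<psi> (Em r q (Z s x r om) + xi r q om)"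
   using Z_eq[OF s(1,2) order_trans[OF s(3,4)], of x]
   by eventually_elim (simp add: Em_add Em_Em add.assoc xi_split)
 qed measurable
 also have "\<dots> = (LINT om|M. (LINT om'|M. ?\<psi> (Em r q (Z s x r om) + xi r q om')))"
 proof (rule solution_convolution_expectation[OF s f_joint_continuous, where K=0 and KH=1 and x=x and X="Z s x" and H="\<lambda>y w. bump n a (Em r q y + w)"])
  have "continuous_on UNIV (\<lambda>z::(real^'n) \<times> (real^'n). ?\<psi> (Em r q (fst z) + snd z))"
   by (intro continuous_on_compose2[OF continuous_bump] continuous_on_add continuous_on_compose2[OF continuous_Em]
     continuous_on_fst continuous_on_snd continuous_on_id) auto
  then show "continuous_on UNIV (\<lambda>(y, w). ?\<psi> (Em r q y + w))" by (simp add: split_beta')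
 qed (use s Z_sol in "auto simp: bump_bounds")
 also have "\<dots> = (LINT om|M. Rf r q ?\<psi> (Z s x r om))"
  using s by (intro Bochner_Integration.integral_cong refl Rf_eq_xi[symmetric]) auto
 also have "\<dots> = (LINT om|M. Rf r q ?\<psi> (Em s r x + xi s r om))"
 proof (rule integral_cong_AE)
  show "AE om in M. Rf r q ?\<psi> (Z s x r om) = Rf r q ?\<psi> (Em s r x + xi s r om)"
   using Z_eq[OF s(1,2) order_trans[OF s(3,4)], of x] by eventually_elim simp
 qed measurable
 finally show ?case .
next
 case (lin \<phi> \<psi> a b)
 have xm [measurable]: "xi s r \<in> borel_measurable M" using s by (intro xi_measurable) auto
 have i: "integrable M (\<lambda>om. Rf r q h (Em s r x + xi s r om))" if h: "h \<in> bounded_borel" for h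
 proof -
  obtain K where K: "\<And>x. \<bar>h x\<bar> <= K" using bounded_borelD[OF h] by blast
  note Rf_measurable[OF h, measurable]
  show ?thesis by (rule integrable_const_bound[where B=K]) (use Rf_bound[OF h K] in auto)
 qed
 show ?case using i[OF lin(1)] i[OF lin(2)] lin(3,4) Rf_lincomb[OF lin(1,2)] by simp
next
 case (lim F \<phi> K)
 have xm [measurable]: "xi s r \<in> borel_measurable M" using s by (intro xi_measurable) auto
 note Rf_measurable[OF lim(1), measurable] Rf_measurable[OF lim(2), measurable]
 have "(\<lambda>n. \<integral>om. Rf r q (F n) (Em s r x + xi s r om) \<partial>M) \<leadsto> (LINT om|M. Rf r q \<phi> (Em s r x + xi s r om))"
  by (rule integral_dominated_convergence[where w="\<lambda>_. K"])
   (use Rf_bound[OF lim(1,3)] Rf_lim[OF lim(1,2,3,5)] in auto)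
 moreover have "(\<lambda>n. Rf s q (F n) x) \<leadsto> Rf s q \<phi> x" by (rule Rf_lim[OF lim(1,2,3,5)])
 ultimately show ?case unfolding lim(6) by (metis LIMSEQ_unique)
qed

text \<open>Dominates the mean of min 1 (norm Y) for a centred Gaussian vector Y whose deviations
  are at most (sum of the c_i) times the square root of l. Truncation at 1 keeps all quantities
  bounded.\<close>

definition kap :: "real => real" where
 "kap l = (LINT g|(gauss :: (real ^ 'n) measure). min 1 ((\<Sum>i\<in>UNIV. c i) * sqrt \<bar>l\<bar> * (\<Sum>i\<in>UNIV. \<bar>g $ i\<bar>)))"

text \<open>The average of \<open>kap\<close> over an increment of L of duration h, expressed
  through L 1 by scaling: a modulus of stochastic continuity for the convolution.\<close>

definition smod :: "real => real" where
 "smod h = (LINT om|M. kap (h powr (1 / \<alpha>) * L 1 om))"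

lemma kap_integrand_bound: "\<bar>min 1 ((\<Sum>i\<in>UNIV. c i) * sqrt \<bar>l\<bar> * (\<Sum>i\<in>UNIV. \<bar>g $ i\<bar>))\<bar> <= 1"
proof -
 have "0 <= (\<Sum>i\<in>UNIV. c i) * sqrt \<bar>l\<bar> * (\<Sum>i\<in>UNIV. \<bar>g $ i\<bar>)"
  using c by (intro mult_nonneg_nonneg sum_nonneg) (auto simp: less_imp_le)
 then show ?thesis by (simp add: min_def)
qed

lemma kap_measurable [measurable]: "kap \<in> borel_fun"
proof -
 interpret g: prob_space "gauss :: (real ^ 'n) measure" by (rule prob_space_gauss)
 show ?thesis unfolding kap_def[abs_def]
  by (rule g.borel_measurable_lebesgue_integral) measurable
qed

lemma kap_bound: "\<bar>kap l\<bar> <= 1"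
proof -
 interpret g: prob_space "gauss :: (real ^ 'n) measure" by (rule prob_space_gauss)
 have "\<bar>kap l\<bar> <= (LINT g|(gauss :: (real ^ 'n) measure). \<bar>min 1 ((\<Sum>i\<in>UNIV. c i) * sqrt \<bar>l\<bar> * (\<Sum>i\<in>UNIV. \<bar>g $ i\<bar>))\<bar>)"
  unfolding kap_def by (rule integral_abs_bound)
 also have "\<dots> <= (LINT g|(gauss :: (real ^ 'n) measure). 1)"
  using kap_integrand_bound by (intro integral_mono g.integrable_const_bound[where B=1]) (auto simp del: min_less_iff_conj)
 finally show ?thesis using g.prob_space by simp
qed

lemma kap_tendsto: "l \<leadsto> 0 ==> (\<lambda>n. kap (l n)) \<leadsto> 0"
proof -
 assume l: "l \<leadsto> 0"
 interpret g: prob_space "gauss :: (real ^ 'n) measure" by (rule prob_space_gauss)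
 have "(\<lambda>n. kap (l n)) \<leadsto> (LINT g|(gauss :: (real ^ 'n) measure). (0::real))"
  unfolding kap_def
 proof (rule integral_dominated_convergence[where w="\<lambda>_. 1"])
  show "AE g::real ^ 'n in gauss. (\<lambda>n. min 1 ((\<Sum>i\<in>UNIV. c i) * sqrt \<bar>l n\<bar> * (\<Sum>i\<in>UNIV. \<bar>g $ i\<bar>))) \<leadsto> 0"
  proof (rule AE_I2)
   fix g :: "real ^ 'n"
   have "(\<lambda>n. min 1 ((\<Sum>i\<in>UNIV. c i) * sqrt \<bar>l n\<bar> * (\<Sum>i\<in>UNIV. \<bar>g $ i\<bar>))) \<leadsto>
     min 1 ((\<Sum>i\<in>UNIV. c i) * sqrt \<bar>0\<bar> * (\<Sum>i\<in>UNIV. \<bar>g $ i\<bar>))"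
    by (intro tendsto_min tendsto_mult tendsto_const tendsto_real_sqrt tendsto_rabs l)
   then show "(\<lambda>n. min 1 ((\<Sum>i\<in>UNIV. c i) * sqrt \<bar>l n\<bar> * (\<Sum>i\<in>UNIV. \<bar>g $ i\<bar>))) \<leadsto> 0" by simp
  qed
 qed (use kap_integrand_bound in auto)
 then show ?thesis by simp
qed

lemma smod_tendsto:
 assumes h: "\<And>n. 0 <= h n" "h \<leadsto> 0"
 shows "(\<lambda>n. smod (h n)) \<leadsto> 0"
proof -
 have "(\<lambda>n. smod (h n)) \<leadsto> (LINT om|M. 0)"
  unfolding smod_def
 proof (rule integral_dominated_convergence[where w="\<lambda>_. 1"])
  have "(\<lambda>n. h n powr (1 / \<alpha>)) \<leadsto> 0"
   by (rule tendsto_zero_powrI[OF h(2) tendsto_const]) (use h alpha in auto)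
  from tendsto_mult_left_zero[OF this]
  show "AE om in M. (\<lambda>n. kap (h n powr (1 / \<alpha>) * L 1 om)) \<leadsto> 0"
   by (intro AE_I2 kap_tendsto)
 qed (use kap_bound in auto)
 then show ?thesis by simp
qed

lemma min_norm_bounded_borel: "(\<lambda>y::real ^ 'n. min 1 (norm (y - x))) \<in> bounded_borel"
 by (rule bounded_borelI[where K=1]) (auto simp: min_def)

lemma displacement_bound:
 assumes ab: "0 <= a" "a < b" "b <= T"
 shows "(LINT om|M. min 1 (norm (Em a b x + xi a b om - x))) <= norm (Em a b x - x + mean a b) + smod (b - a)"
proof -
 interpret g: prob_space "gauss :: (real ^ 'n) measure" by (rule prob_space_gauss)
 let ?\<psi> = "\<lambda>y::real ^ 'n. min 1 (norm (y - x))" and ?z = "Em a b x - x + mean a b"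
 note bb = min_norm_bounded_borel[of x]
 have K: "\<bar>?\<psi> y\<bar> <= 1" for y by (simp add: min_def)
 have [measurable]: "L a \<in> borel_measurable M" "L b \<in> borel_measurable M" using ab by (auto intro: L_measurable)
 have "(LINT om|M. ?\<psi> (Em a b x + xi a b om)) = (LINT om|M. gsm ?\<psi> (Em a b x + mean a b) (vsd a b om))"
  by (rule xi_expectation[OF ab bb])
 also have "\<dots> <= (LINT om|M. norm ?z + kap (L b om - L a om))"
 proof (rule integral_mono_AE)
  show "integrable M (\<lambda>om. gsm ?\<psi> (Em a b x + mean a b) (vsd a b om))"
   by (rule integrable_const_bound[where B=1]) (use gsm_bound[OF bb K] gsm_measurable_vsd(1)[OF ab bb] in auto)
  show "integrable M (\<lambda>om. norm ?z + kap (L b om - L a om))"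
   by (intro Bochner_Integration.integrable_add integrable_const integrable_const_bound[where B=1]) (use kap_bound in auto)
  show "AE om in M. gsm ?\<psi> (Em a b x + mean a b) (vsd a b om) <= norm ?z + kap (L b om - L a om)"
   using vsd_AE[OF ab] L_increment_pos_AE[OF ab(1,2)]
  proof eventually_elim
   case (elim om)
   let ?v = "vsd a b om" and ?l = "L b om - L a om"
   have "gsm ?\<psi> (Em a b x + mean a b) ?v <= (LINT g|(gauss :: (real ^ 'n) measure). norm ?z + min 1 ((\<Sum>i\<in>UNIV. c i) * sqrt \<bar>?l\<bar> * (\<Sum>i\<in>UNIV. \<bar>g $ i\<bar>)))"
    unfolding gsm_def
   proof (rule integral_mono)
    show "integrable gauss (\<lambda>g. ?\<psi> (gmap (Em a b x + mean a b) ?v g))"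
     by (rule g.integrable_const_bound[where B=1]) (use K in auto)
    show "integrable gauss (\<lambda>g::real ^ 'n. norm ?z + min 1 ((\<Sum>i\<in>UNIV. c i) * sqrt \<bar>?l\<bar> * (\<Sum>i\<in>UNIV. \<bar>g $ i\<bar>)))"
     by (intro Bochner_Integration.integrable_add g.integrable_const g.integrable_const_bound[where B=1])
      (use kap_integrand_bound[of ?l] in auto)
    fix g :: "real ^ 'n"
    let ?w = "\<chi> i. ?v i * g $ i"
    have "norm ?w <= (\<Sum>i\<in>UNIV. \<bar>?w $ i\<bar>)" by (rule norm_le_l1_cart)
    also have "\<dots> <= (\<Sum>i\<in>UNIV. ((\<Sum>i\<in>UNIV. c i) * sqrt \<bar>?l\<bar>) * \<bar>g $ i\<bar>)"
    proof (rule sum_mono)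
     fix i
     have "?v i <= c i * sqrt ?l" "0 < ?v i" using elim(1) by auto
     moreover have "c i * sqrt ?l <= (\<Sum>i\<in>UNIV. c i) * sqrt ?l"
      using c elim(2) by (intro mult_right_mono member_le_sum) (auto simp: less_imp_le)
     ultimately have "\<bar>?v i\<bar> <= (\<Sum>i\<in>UNIV. c i) * sqrt \<bar>?l\<bar>" using elim(2) by linarith
     from mult_right_mono[OF this abs_ge_zero[of "g $ i"]]
     show "\<bar>?w $ i\<bar> <= ((\<Sum>i\<in>UNIV. c i) * sqrt \<bar>?l\<bar>) * \<bar>g $ i\<bar>" by (simp add: abs_mult)
    qed
    finally have w: "norm ?w <= (\<Sum>i\<in>UNIV. c i) * sqrt \<bar>?l\<bar> * (\<Sum>i\<in>UNIV. \<bar>g $ i\<bar>)" by (simp add: sum_distrib_left)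
    have "gmap (Em a b x + mean a b) ?v g - x = ?z + ?w" by (simp add: gmap_def vec_eq_iff)
    then have "norm (gmap (Em a b x + mean a b) ?v g - x) <= norm ?z + norm ?w" by (metis norm_triangle_ineq)
    then show "?\<psi> (gmap (Em a b x + mean a b) ?v g) <= norm ?z + min 1 ((\<Sum>i\<in>UNIV. c i) * sqrt \<bar>?l\<bar> * (\<Sum>i\<in>UNIV. \<bar>g $ i\<bar>))"
     using w norm_ge_zero[of ?z] by linarith
   qed
   also have "\<dots> = norm ?z + kap ?l"
   proof -
    have "integrable (gauss :: (real ^ 'n) measure) (\<lambda>g. min 1 ((\<Sum>i\<in>UNIV. c i) * sqrt \<bar>?l\<bar> * (\<Sum>i\<in>UNIV. \<bar>g $ i\<bar>)))"
     by (rule g.integrable_const_bound[where B=1]) (use kap_integrand_bound[of ?l] in auto)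
    then show ?thesis unfolding kap_def using g.prob_space by simp
   qed
   finally show ?case .
  qed
 qed
 also have "\<dots> = norm ?z + smod (b - a)"
 proof -
  have "integrable M (\<lambda>om. kap (L b om - L a om))" by (rule integrable_const_bound[where B=1]) (use kap_bound in auto)
  then show ?thesis
   using expectation_increment(1)[OF ab(1,2) kap_measurable] by (simp add: smod_def prob_space)
 qed
 finally show ?thesis .
qed

lemma drift_displacement:
 "\<exists>C. \<forall>a b. 0 <= a \<longrightarrow> a <= b \<longrightarrow> b <= T \<longrightarrow> norm (Em a b x - x + mean a b) <= C * (b - a)"
proof -
 have "compact (f ` {0..T})" by (intro compact_continuous_image fc) auto
 then obtain Kf where Kf: "\<And>v. v \<in> {0..T} ==> norm (f v) <= Kf"
  using compact_imp_bounded bounded_iff by (metis imageI)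
 define C where "C = (\<Sum>i\<in>UNIV. lam i * \<bar>x $ i\<bar> + Kf)"
 have "norm (Em a b x - x + mean a b) <= C * (b - a)" if ab: "0 <= a" "a <= b" "b <= T" for a b
 proof -
  have "norm (Em a b x - x + mean a b) <= (\<Sum>i\<in>UNIV. \<bar>(Em a b x - x + mean a b) $ i\<bar>)" by (rule norm_le_l1_cart)
  also have "\<dots> <= (\<Sum>i\<in>UNIV. (lam i * \<bar>x $ i\<bar> + Kf) * (b - a))"
  proof (rule sum_mono)
   fix i
   let ?h = "\<lambda>v. exp (- (lam i * (b - v))) * f v $ i"
   have "continuous_on {a..b} ?h"
    using ab by (intro continuous_intros continuous_on_subset[OF fc]) auto
   then have h: "set_integrable lborel {a<..b} ?h"
    using borel_integrable_atLeastAtMost'[of a b ?h] set_integrable_Icc_iff_Ioc[OF ab(2), of ?h] by simp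
   have hb: "norm (?h v) <= Kf" if v: "v \<in> {a<..b}" for v
   proof -
    have "\<bar>exp (- (lam i * (b - v)))\<bar> * \<bar>f v $ i\<bar> <= 1 * Kf"
     using Kf[of v] component_le_norm_cart[of "f v" i] v ab lam[of i]
     by (intro mult_mono) (auto simp: less_imp_le)
    then show ?thesis by (simp add: abs_mult)
   qed
   have m: "\<bar>mean a b $ i\<bar> <= Kf * (b - a)"
    using indefinite_integral_lipschitz[OF h hb, of a b] ab by (simp add: mean_def set_lebesgue_integral_def)
   have "0 <= lam i * (b - a)" using lam[of i] ab by simp
   then have "\<bar>exp (- (lam i * (b - a))) - 1\<bar> <= lam i * (b - a)"
    using exp_ge_add_one_self[of "- (lam i * (b - a))"] by (simp add: abs_le_iff)
   then have "\<bar>(exp (- (lam i * (b - a))) - 1) * x $ i\<bar> <= lam i * (b - a) * \<bar>x $ i\<bar>"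
    unfolding abs_mult by (rule mult_right_mono) simp
   with m show "\<bar>(Em a b x - x + mean a b) $ i\<bar> <= (lam i * \<bar>x $ i\<bar> + Kf) * (b - a)"
    by (simp add: Em_def algebra_simps)
  qed
  also have "\<dots> = C * (b - a)" by (simp add: C_def sum_distrib_right)
  finally show ?thesis .
 qed
 then show ?thesis by blast
qed

text \<open>By Chapman-Kolmogorov the difference is the mean of R_{b,q} \<psi> at Z_b, started from
  x at time a, minus its value at x. Since b <= p < q, that function is bounded by K and Lipschitz
  with a constant depending only on q - p; both facts combine into a multiple of min 1 (norm (y -
  x)), whose mean \<open>displacement_bound\<close> estimates.\<close>

lemma Rf_time_modulus:
 assumes ab: "0 <= a" "a <= b" "b <= p" "p < q" "q <= T" and \<psi>: "\<psi> \<in> bounded_borel" and K: "\<And>y. \<bar>\<psi> y\<bar> <= K"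
  and Cx: "\<And>a b. 0 <= a ==> a <= b ==> b <= T ==> norm (Em a b x - x + mean a b) <= Cx * (b - a)"
 shows "\<bar>Rf a q \<psi> x - Rf b q \<psi> x\<bar> <=
  (2 * K + real CARD('n) * (CRd * K * (q - p) powr (- (1 / (2 * \<alpha>))))) * (Cx * (b - a) + smod (b - a))"
proof (cases "a = b")
 case False
 then have ab': "0 <= a" "a < b" "b <= T" and bq: "0 <= b" "b < q" "q <= T" using ab by auto
 let ?C = "real CARD('n) * (CRd * K * (q - p) powr (- (1 / (2 * \<alpha>))))"
 have K0: "0 <= K" using K[of 0] by linarith
 have CR0: "0 <= CRd" unfolding CRd_def by (intro mult_nonneg_nonneg sum_nonneg Kd_nonneg Cneg_nonneg)
 have [measurable]: "xi a b \<in> borel_measurable M" using ab' by (intro xi_measurable) auto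
 note Rm = Rf_measurable[OF \<psi>, measurable]
 have D: "((\<lambda>h. Rf b q \<psi> (nudge y h i)) has_vector_derivative partial_deriv i (Rf b q \<psi>) y) (at 0)" for i y
  using Rf_deriv[OF bq \<psi>, of y i 0] by (simp add: has_real_derivative_iff_has_vector_derivative)
 have Db: "norm (partial_deriv i (Rf b q \<psi>) y) <= CRd * K * (q - p) powr (- (1 / (2 * \<alpha>)))" for i y
 proof -
  have "(q - b) powr (- (1 / (2 * \<alpha>))) <= (q - p) powr (- (1 / (2 * \<alpha>)))"
   using ab alpha by (intro powr_mono2') auto
  then show ?thesis
   using Rf_deriv_bound[OF bq \<psi> K, of i y] CR0 K0
   by (simp only: real_norm_def) (rule order_trans, assumption, intro mult_left_mono, auto)
 qed
 have lip: "\<bar>Rf b q \<psi> y - Rf b q \<psi> x\<bar> <= (2 * K + ?C) * min 1 (norm (y - x))" for y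
 proof -
  have C0: "0 <= ?C" using CR0 K0 by simp
  have 1: "\<bar>Rf b q \<psi> y - Rf b q \<psi> x\<bar> <= 2 * K"
   using Rf_bound[OF \<psi> K, of b q x] Rf_bound[OF \<psi> K, of b q y] by linarith
  have 2: "\<bar>Rf b q \<psi> y - Rf b q \<psi> x\<bar> <= ?C * norm (y - x)"
   using lipschitz_of_partial_bounds[OF D Db, of y x] by simp
  show ?thesis
  proof (cases "norm (y - x) <= 1")
   case True
   then have eq: "min 1 (norm (y - x)) = norm (y - x)" by simp
   have "?C * norm (y - x) <= (2 * K + ?C) * norm (y - x)" using K0 by (intro mult_right_mono) auto
   from order_trans[OF 2 this] show ?thesis unfolding eq .
  next
   case False
   then have eq: "min 1 (norm (y - x)) = 1" by simp
   have "2 * K <= 2 * K + ?C" using C0 by simp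
   from order_trans[OF 1 this] show ?thesis unfolding eq mult_1_right .
  qed
 qed
 have i1: "integrable M (\<lambda>om. Rf b q \<psi> (Em a b x + xi a b om))"
  by (rule integrable_const_bound[where B=K]) (use Rf_bound[OF \<psi> K] in auto)
 have i2: "integrable M (\<lambda>om. min 1 (norm (Em a b x + xi a b om - x)))"
  by (rule integrable_const_bound[where B=1]) (auto simp: min_def)
 have eq: "Rf a q \<psi> x - Rf b q \<psi> x = (LINT om|M. Rf b q \<psi> (Em a b x + xi a b om) - Rf b q \<psi> x)"
  using Chapman_Kolmogorov[of a b q \<psi> x] ab' bq \<psi> i1 by (simp add: prob_space)
 have "\<bar>Rf a q \<psi> x - Rf b q \<psi> x\<bar> <= (LINT om|M. \<bar>Rf b q \<psi> (Em a b x + xi a b om) - Rf b q \<psi> x\<bar>)"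
  unfolding eq by (rule integral_abs_bound)
 also have "\<dots> <= (LINT om|M. (2 * K + ?C) * min 1 (norm (Em a b x + xi a b om - x)))"
  using lip i1 i2 by (intro integral_mono integrable_abs Bochner_Integration.integrable_diff integrable_mult_right) auto
 also have "\<dots> = (2 * K + ?C) * (LINT om|M. min 1 (norm (Em a b x + xi a b om - x)))" by (rule integral_mult_right_zero)
 also have "\<dots> <= (2 * K + ?C) * (Cx * (b - a) + smod (b - a))"
  using displacement_bound[OF ab', of x] Cx[of a b] ab' K0 CR0 by (intro mult_left_mono) auto
 finally show ?thesis .
next
 case True
 have "0 <= smod 0" using smod_tendsto[of "\<lambda>_. 0"] by (simp add: LIMSEQ_const_iff)
 moreover have "smod 0 = 0" using smod_tendsto[of "\<lambda>_. 0"] by (simp add: LIMSEQ_const_iff)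
 ultimately show ?thesis using True by simp
qed

lemma Rf_time_continuous:
 assumes q: "0 < q" "q <= T" and \<psi>: "\<psi> \<in> bounded_borel"
 shows "continuous_on {0..<q} (\<lambda>s. Rf s q \<psi> x)"
 unfolding continuous_on_sequentially comp_def
proof (intro allI ballI impI, elim conjE)
 fix S :: "nat => real" and s assume s: "s \<in> {0..<q}" and S: "\<forall>n. S n \<in> {0..<q}" "S \<leadsto> s"
 obtain K where K: "\<And>y. \<bar>\<psi> y\<bar> <= K" using bounded_borelD[OF \<psi>] by blast
 obtain C where "\<forall>a b. 0 <= a \<longrightarrow> a <= b \<longrightarrow> b <= T \<longrightarrow> norm (Em a b x - x + mean a b) <= C * (b - a)"
  using drift_displacement[of x] by blast
 then have C: "norm (Em a b x - x + mean a b) <= C * (b - a)" if "0 <= a" "a <= b" "b <= T" for a b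
  using that by simp
 \<comment> \<open>The midpoint separates the starting times near s from the terminal time q, which
   makes the gradient bound uniform.\<close>
 define p where "p = (s + q) / 2"
 have p: "s < p" "p < q" using s by (auto simp: p_def)
 let ?D = "2 * K + real CARD('n) * (CRd * K * (q - p) powr (- (1 / (2 * \<alpha>))))"
 have ev: "\<forall>\<^sub>F n in sequentially. S n < p" using order_tendstoD(2)[OF S(2) p(1)] .
 have "\<forall>\<^sub>F n in sequentially. norm (Rf (S n) q \<psi> x - Rf s q \<psi> x) <= ?D * (C * \<bar>S n - s\<bar> + smod \<bar>S n - s\<bar>)"
  using ev
 proof eventually_elim
  case (elim n)
  have Sn: "0 <= S n" using S(1) by auto
  show ?case
  proof (cases "S n <= s")
   case True
   then show ?thesis using Rf_time_modulus[OF Sn True _ p(2) q(2) \<psi> K C] p by simp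
  next
   case False
   then show ?thesis using Rf_time_modulus[of s "S n" p q \<psi> K x C] p(2) q(2) \<psi> K C elim s
    by (simp add: abs_minus_commute)
  qed
 qed
 moreover have "(\<lambda>n. ?D * (C * \<bar>S n - s\<bar> + smod \<bar>S n - s\<bar>)) \<leadsto> 0"
 proof -
  have d: "(\<lambda>n. \<bar>S n - s\<bar>) \<leadsto> 0" using tendsto_rabs_zero[OF LIM_zero[OF S(2)]] by simp
  show ?thesis
   by (intro tendsto_mult_right_zero tendsto_add_zero d smod_tendsto) auto
 qed
 ultimately have "(\<lambda>n. Rf (S n) q \<psi> x - Rf s q \<psi> x) \<leadsto> 0"
  by (rule Lim_null_comparison)
 then show "(\<lambda>n. Rf (S n) q \<psi> x) \<leadsto> Rf s q \<psi> x" by (simp add: LIM_zero_iff)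
qed

definition Bc :: "real => real ^ 'n => real ^ 'n" where
 "Bc t x = B0 (clip 0 T t) x - f (clip 0 T t)"

lemma Bc_continuous: "continuous_on UNIV (\<lambda>(t, x). Bc t x)"
 unfolding Bc_def split_beta'
 using continuous_clip_first[OF less_imp_le[OF T] B0c] continuous_clip_first[OF less_imp_le[OF T] f_joint_continuous]
 by (intro continuous_on_diff) (simp_all add: split_beta')

lemma Bc_bounded: "\<exists>KB\<ge>0. \<forall>t x i. \<bar>Bc t x $ i\<bar> <= KB"
proof -
 have "compact (f ` {0..T})" by (intro compact_continuous_image fc) auto
 then obtain Kf where Kf: "\<And>v. v \<in> {0..T} ==> norm (f v) <= Kf"
  using compact_imp_bounded bounded_iff by (metis imageI)
 have "\<bar>Bc t x $ i\<bar> <= K0 + Kf" for t x i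
  using B0_bound[OF clip_in(1)[OF less_imp_le[OF T]], of t x i] Kf[OF clip_in(1)[OF less_imp_le[OF T]], of t]
   component_le_norm_cart[of "f (clip 0 T t)" i]
  by (simp add: Bc_def)
 moreover from this have "0 <= K0 + Kf" using abs_ge_zero order_trans by blast
 ultimately show ?thesis by blast
qed

definition KBc :: real where "KBc = (SOME KB. KB \<ge> 0 \<and> (\<forall>t x i. \<bar>Bc t x $ i\<bar> <= KB))"

lemma KBc: "0 <= KBc" "\<bar>Bc t x $ i\<bar> <= KBc"
 using someI_ex[OF Bc_bounded] unfolding KBc_def by auto

lemma Bc_measurable: "(\<lambda>(t, x). Bc t x) \<in> borel_fun2"
 using borel_measurable_continuous_onI[OF Bc_continuous] by (simp add: borel_prod)

lemma Xv_start:
 assumes "0 <= s" "s <= T" shows "AE om in M. Xv s x s om = x"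
 using Xv(2)[OF assms, of x] X_path_sol[OF assms, of x]
 by eventually_elim (use path_sol.X_s assms in auto)

lemma Xv_measurable [measurable (raw)]:
 assumes "0 <= s" "s <= T" and [measurable]: "a \<in> borel_measurable N" "b \<in> measurable N M"
 shows "(\<lambda>z. Xv s x (a z) (b z)) \<in> borel_measurable N"
 using measurable_compose[OF _ Xv(1)[OF assms(1,2)], of "\<lambda>z. (a z, b z)" N x] by simp

sublocale mild_setting M T "1 / (2 * \<alpha>)" CRd KBc Rf Bc Xv
proof
 show "0 < T" by (rule T)
 show "0 < 1 / (2 * \<alpha>)" "1 / (2 * \<alpha>) < 1" using alpha by auto
 show "0 <= CRd" unfolding CRd_def by (intro mult_nonneg_nonneg sum_nonneg Kd_nonneg Cneg_nonneg)
 show "0 <= KBc" "\<bar>Bc t x $ i\<bar> <= KBc" for t x i by (rule KBc)+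
 show "Rf s s \<psi> x = \<psi> x" for s \<psi> x by (simp add: Rf_def prob_space)
 show "(\<lambda>(t, x). Bc t x) \<in> borel_fun2" by (rule Bc_measurable)
 show "(LINT om|M. \<psi> (Xv s x s om)) = \<psi> x" if s: "0 <= s" "s <= T" and p: "\<psi> \<in> bounded_borel" for s \<psi> x
 proof -
  note bounded_borel_measurable[OF p, measurable]
  have "(LINT om|M. \<psi> (Xv s x s om)) = (LINT om|M. \<psi> x)"
   by (rule integral_cong_AE) (use s Xv_start[OF s, of x] in "measurable, auto")
  then show ?thesis by (simp add: prob_space)
 qed
qed (rule Rf_bound Rf_deriv Rf_continuous Rf_deriv_continuous Rf_deriv_bound Rf_deriv_lim Rf_lincomb Rf_measurable_pair
  Rf_time_continuous Xv(1), assumption+)+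

end

section \<open>The forward identity\<close>

definition dbump :: "nat => real ^ 'n::finite => 'n => real ^ 'n => real" where
 "dbump n a i x = - (2 * real n * max 0 (x $ i - a $ i)) * bump n a x"

text \<open>The first-order remainder is at most (y - x)^2 in every sign constellation, including
  across the kink of the positive part.\<close>

lemma has_real_derivative_max_square: "((\<lambda>y. (max 0 y)\<^sup>2) has_real_derivative 2 * max 0 x) (at (x :: real))"
 unfolding has_field_derivative_def
proof (rule has_derivativeI_sandwich[where e=1 and H="\<lambda>y. norm (y - x)"])
 show "bounded_linear ((*) (2 * max 0 x))" by (rule bounded_linear_mult_right)
 have "((\<lambda>y. norm (y - x)) \<longlongrightarrow> norm (x - x)) (at x)" by (intro tendsto_intros)
 then show "((\<lambda>y. norm (y - x)) \<longlongrightarrow> 0) (at x)" by simp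
 fix y assume y: "y \<noteq> x"
 have le: "\<bar>(max 0 y)\<^sup>2 - (max 0 x)\<^sup>2 - 2 * max 0 x * (y - x)\<bar> <= (y - x)\<^sup>2"
 proof -
  consider "0 <= x" "0 <= y" | "x <= 0" "y <= 0" | "x <= 0" "0 <= y" | "0 <= x" "y <= 0" by linarith
  then show ?thesis
  proof cases
   case 1
   then have "(max 0 y)\<^sup>2 - (max 0 x)\<^sup>2 - 2 * max 0 x * (y - x) = (y - x)\<^sup>2"
    by (simp add: power2_eq_square algebra_simps)
   then show ?thesis by simp
  next
   case 3
   then have "y\<^sup>2 <= (y - x)\<^sup>2" by (intro power_mono) auto
   then show ?thesis using 3 by (simp add: max_def)
  next
   case 4
   then have "x * y <= 0" by (intro mult_nonneg_nonpos)
   moreover have "(y - x)\<^sup>2 = y\<^sup>2 - 2 * (x * y) + x\<^sup>2" by (simp add: power2_eq_square algebra_simps)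
   moreover have "(max 0 y)\<^sup>2 - (max 0 x)\<^sup>2 - 2 * max 0 x * (y - x) = x\<^sup>2 - 2 * (x * y)"
    using 4 by (simp add: max_def power2_eq_square algebra_simps)
   ultimately show ?thesis using zero_le_power2[of x] zero_le_power2[of y] by linarith
  qed (simp add: max_def)
 qed
 have "norm ((max 0 y)\<^sup>2 - (max 0 x)\<^sup>2 - 2 * max 0 x * (y - x)) / norm (y - x) <= (y - x)\<^sup>2 / norm (y - x)"
  using le by (intro divide_right_mono) auto
 also have "\<dots> = norm (y - x)" using y by (simp add: power2_eq_square field_simps abs_mult[symmetric])
 finally show "norm ((max 0 y)\<^sup>2 - (max 0 x)\<^sup>2 - 2 * max 0 x * (y - x)) / norm (y - x) <= norm (y - x)" .
qed simp

lemma bump_has_derivative: "(bump n a has_derivative (\<lambda>h. \<Sum>i\<in>UNIV. dbump n a i x * h $ i)) (at x)"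
proof -
 have c: "((\<lambda>x. (max 0 (x $ i - a $ i))\<^sup>2) has_derivative (\<lambda>h. h $ i * (2 * max 0 (x $ i - a $ i)))) (at x)" for i
  by (rule DERIV_compose_FDERIV[OF has_real_derivative_max_square])
   (auto intro!: derivative_eq_intros bounded_linear.has_derivative[OF bounded_linear_vec_nth])
 have "((\<lambda>x. \<Sum>i\<in>UNIV. (max 0 (x $ i - a $ i))\<^sup>2) has_derivative (\<lambda>h. \<Sum>i\<in>UNIV. h $ i * (2 * max 0 (x $ i - a $ i)))) (at x)"
  by (intro has_derivative_sum c)
 then have "((\<lambda>x. exp (- (real n * (\<Sum>i\<in>UNIV. (max 0 (x $ i - a $ i))\<^sup>2)))) has_derivative
  (\<lambda>h. (\<Sum>i\<in>UNIV. h $ i * (2 * max 0 (x $ i - a $ i))) * (exp (- (real n * (\<Sum>i\<in>UNIV. (max 0 (x $ i - a $ i))\<^sup>2))) * - real n))) (at x)"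
  by (intro DERIV_compose_FDERIV[where f="\<lambda>u. exp (- (real n * u))"]) (auto intro!: derivative_eq_intros)
 then show ?thesis
  by (simp add: bump_def[abs_def] dbump_def sum_distrib_left sum_distrib_right sum_negf mult_ac)
qed

lemma continuous_dbump: "continuous_on UNIV (dbump n a i)"
 unfolding dbump_def[abs_def] by (intro continuous_intros continuous_bump)

text \<open>With m the positive part in coordinate i, m <= 1 + m^2 <= exp(m^2), and for n >= 1 the
  exponential in the bump decays at least as fast as exp(- m^2).\<close>

lemma dbump_bound: "\<bar>dbump n a i x\<bar> <= 2 * real n"
proof (cases "n = 0")
 case False
 let ?m = "max 0 (x $ i - a $ i)"
 have "0 <= (?m - 1 / 2)\<^sup>2" by simp
 then have "?m <= 1 + ?m\<^sup>2" by (simp only: power2_diff) (simp add: power2_eq_square)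
 also have "\<dots> <= exp (?m\<^sup>2)" by (rule exp_ge_add_one_self)
 also have "\<dots> <= exp (real n * (\<Sum>i\<in>UNIV. (max 0 (x $ i - a $ i))\<^sup>2))"
 proof -
  have "1 * ?m\<^sup>2 <= real n * (\<Sum>i\<in>UNIV. (max 0 (x $ i - a $ i))\<^sup>2)"
   using False by (intro mult_mono member_le_sum) auto
  then show ?thesis by simp
 qed
 finally have "?m * bump n a x <= 1"
  unfolding bump_def exp_minus by (simp add: field_simps)
 then have "2 * real n * (?m * bump n a x) <= 2 * real n * 1" by (intro mult_left_mono) auto
 moreover have "\<bar>dbump n a i x\<bar> = 2 * real n * (?m * bump n a x)"
  using bump_bounds(1)[of n a x] by (simp add: dbump_def abs_mult)
 ultimately show ?thesis by simp
qed (simp add: dbump_def)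

context kolmogorov begin

text \<open>For a bump the derivative may also be placed on the function. This identifies the
  expression produced by the chain rule with the gradient of R, defined elsewhere by Gaussian
  smoothing.\<close>

lemma Rf_bump_partial_deriv:
 assumes r: "0 <= r" "r <= t" "t <= T"
 shows "partial_deriv i (Rf r t (bump n a)) y = (LINT om|M. dbump n a i (Em r t y + xiv r t om) * exp (- (lam i * (t - r))))"
proof -
 let ?e = "exp (- (lam i * (t - r)))"
 have e: "0 <= lam i * (t - r)" using lam[of i] r by simp
 have [measurable]: "dbump n a i \<in> borel_fun" by (rule borel_measurable_continuous_onI[OF continuous_dbump])
 note bounded_borel_measurable[OF bump_bounded_borel, measurable]
 have "((\<lambda>h. \<integral>om. bump n a (Em r t (nudge y h i) + xiv r t om) \<partial>M) has_real_derivative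
   (LINT om|M. dbump n a i (Em r t (nudge y 0 i) + xiv r t om) * ?e)) (at 0)"
 proof (rule has_real_derivative_integral[where g="\<lambda>_. 2 * real n * 1"])
  show "integrable M (\<lambda>om. bump n a (Em r t (nudge y h i) + xiv r t om))" for h
   by (rule integrable_const_bound[where B=1]) (auto simp: bump_bounds)
  show "AE om in M. \<forall>h. \<bar>h\<bar> <= 1 \<longrightarrow> ((\<lambda>h. bump n a (Em r t (nudge y h i) + xiv r t om)) has_real_derivative
    dbump n a i (Em r t (nudge y h i) + xiv r t om) * ?e) (at h)"
  proof (intro AE_I2 allI impI)
   fix om h
   have g: "((\<lambda>h. Em r t (nudge y h i) + xiv r t om) has_derivative (\<lambda>k. (k * ?e) *\<^sub>R axis i 1)) (at h)"
    unfolding Em_axis by (auto intro!: derivative_eq_intros)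
   have "(bump n a \<circ> (\<lambda>h. Em r t (nudge y h i) + xiv r t om) has_derivative
     (\<lambda>h'. \<Sum>j\<in>UNIV. dbump n a j (Em r t (nudge y h i) + xiv r t om) * h' $ j) \<circ> (\<lambda>k. (k * ?e) *\<^sub>R axis i 1)) (at h)"
    by (rule diff_chain_at[OF g bump_has_derivative])
   then show "((\<lambda>h. bump n a (Em r t (nudge y h i) + xiv r t om)) has_real_derivative
    dbump n a i (Em r t (nudge y h i) + xiv r t om) * ?e) (at h)"
    unfolding has_field_derivative_def comp_def
    by (rule has_derivative_eq_rhs) (auto simp: fun_eq_iff axis_def if_distrib[where f="\<lambda>z. _ * z"] sum.delta cong: if_cong)
  qed
  show "AE om in M. \<forall>h. \<bar>h\<bar> <= 1 \<longrightarrow> \<bar>dbump n a i (Em r t (nudge y h i) + xiv r t om) * ?e\<bar> <= 2 * real n * 1"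
   unfolding abs_mult using e by (intro AE_I2 allI impI mult_mono dbump_bound) auto
 qed auto
 then have "((\<lambda>h. Rf r t (bump n a) (nudge y h i)) has_vector_derivative
   (LINT om|M. dbump n a i (Em r t y + xiv r t om) * ?e)) (at 0)"
  by (simp add: Rf_def has_real_derivative_iff_has_vector_derivative)
 then show ?thesis unfolding partial_deriv_def by (rule vector_derivative_at)
qed

lemma Bc_eq: "v \<in> {0..T} ==> Bc v x = B0 v x - f v"
 by (simp add: Bc_def clip_in(2))

text \<open>The path \<open>r \<mapsto> e\<^sup>-\<^sup>\<lambda>\<^sup>(\<^sup>t\<^sup>-\<^sup>r\<^sup>) X\<^sub>r + \<xi>\<^sub>r\<^sub>,\<^sub>t\<close> joins the value whose law is \<open>R\<^sub>s\<^sub>,\<^sub>t\<close> to \<open>X\<^sub>t\<close>, and it is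
 absolutely continuous because the noise cancels.\<close>

lemma bump_path_formula:
 assumes st: "0 <= s" "s < t" "t <= T"
 shows "AE om in M. bump n a (X s x t om) - bump n a (Em s t x + xi s t om) =
  (LBINT v:{s<..t}. \<Sum>i\<in>UNIV. dbump n a i (Em v t (X s x v om) + xi v t om) * (exp (- (lam i * (t - v))) * Bc v (X s x v om) $ i))"
proof -
 have sT: "s <= T" using st by simp
 show ?thesis
  using X_path_sol[OF st(1) sT, of x] J_path_sol
 proof eventually_elim
  case (elim om)
  note d = psol_difference[OF elim]
  define Y where "Y v = Em v t (X s x v om) + xi v t om" for v
  define g where "g i v = exp (- (lam i * (t - v))) * Bc v (X s x v om) $ i" for i v
  have geq: "g i v = exp (- (lam i * (t - v))) * (B0 v (X s x v om) $ i - f v $ i)" if "v \<in> {s<..t}" for i v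
   using that st by (simp add: g_def Bc_eq)
  have Xs: "X s x s om = x" by (rule path_sol.X_s[OF elim(1)])
  \<comment> \<open>Componentwise Y_v = exp(- lam_i (t - v)) (X_v - J_v) + J_t, so only the
    difference X - J enters, for which \<open>psol_difference\<close> gives an absolutely continuous
    formula.\<close>
  have Y: "Y v $ i = Y s $ i + (LBINT u:{s<..v}. g i u)" if v: "v \<in> {s..t}" for v i
  proof -
   have vT: "0 <= s" "s <= s" "s <= v" "v <= T" using v st by auto
   have "(LBINT u:{s<..v}. g i u) = (LBINT u:{s<..v}. exp (- (lam i * (t - v))) * (exp (- (lam i * (v - u))) * (B0 u (X s x u om) $ i - f u $ i)))"
   proof (rule set_lebesgue_integral_cong)
    show "\<forall>u. u \<in> {s<..v} \<longrightarrow> g i u = exp (- (lam i * (t - v))) * (exp (- (lam i * (v - u))) * (B0 u (X s x u om) $ i - f u $ i))"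
    proof (intro allI impI)
     fix u assume u: "u \<in> {s<..v}"
     have "exp (- (lam i * (t - u))) = exp (- (lam i * (t - v))) * exp (- (lam i * (v - u)))"
      by (simp add: exp_add[symmetric] algebra_simps)
     then show "g i u = exp (- (lam i * (t - v))) * (exp (- (lam i * (v - u))) * (B0 u (X s x u om) $ i - f u $ i))"
      using geq[of u i] u v by simp
    qed
   qed simp
   also have "\<dots> = exp (- (lam i * (t - v))) * (X s x v om $ i - J v om $ i - exp (- (lam i * (v - s))) * (X s x s om $ i - J s om $ i))"
    using d(1)[OF vT(2,1,3,4), of i] by simp
   also have "\<dots> = exp (- (lam i * (t - v))) * (X s x v om $ i - J v om $ i) - exp (- (lam i * (t - s))) * (x $ i - J s om $ i)"
   proof -
    have "exp (- (lam i * (t - s))) = exp (- (lam i * (t - v))) * exp (- (lam i * (v - s)))"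
     by (simp add: exp_add[symmetric] algebra_simps)
    then show ?thesis by (simp add: Xs algebra_simps)
   qed
   finally show ?thesis by (simp add: Y_def Em_def xi_def Xs algebra_simps)
  qed
  have gi: "set_integrable lborel {s<..t} (g i)" for i
  proof -
   have "set_integrable lborel {s<..t} (g i) \<longleftrightarrow>
    set_integrable lborel {s<..t} (\<lambda>v. exp (- (lam i * (t - v))) * (B0 v (X s x v om) $ i - f v $ i))"
    by (rule set_integrable_cong) (use geq in auto)
   then show ?thesis using d(2)[of s t i] st by simp
  qed
  have gb: "\<bar>g i v\<bar> <= 1 * KBc" if "v \<in> {s<..t}" for i v
  proof -
   have "0 <= lam i * (t - v)" using that lam[of i] by simp
   then show ?thesis unfolding g_def abs_mult using KBc by (intro mult_mono) auto
  qed
  have "bump n a (Y t) - bump n a (Y s) = (LBINT v:{s<..t}. \<Sum>i\<in>UNIV. dbump n a i (Y v) * g i v)"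
   by (rule chain_rule_integral[OF st(2) Y _ gb bump_has_derivative continuous_dbump dbump_bound])
    (use gi set_borel_measurable_def set_integrable_def borel_measurable_integrable in blast)+
  moreover have "Y t = X s x t om" "Y s = Em s t x + xi s t om"
   by (simp_all add: Y_def Xs xi_def vec_eq_iff)
  ultimately show ?case by (simp add: Y_def g_def)
 qed
qed

text \<open>Taking expectations in the path formula and exchanging them with the time integral
  leaves, for each v, a mean of a function of X_v and the convolution on [v,t]. Independence allows
  the latter to be averaged first, which yields the gradient of R_{v,t}.\<close>

lemma bump_forward:
 assumes st: "0 <= s" "s < t" "t <= T"
 shows "(LINT om|M. bump n a (Xv s x t om)) = Rf s t (bump n a) x +
  (LBINT r:{s<..<t}. \<integral>om. ker r t (bump n a) (Xv s x r om) \<partial>M)"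
proof -
 have sT: "0 <= s" "s <= T" using st by auto
 define h where "h v y w = (\<Sum>i\<in>UNIV. dbump n a i (Em v t y + w) * (exp (- (lam i * (t - v))) * Bc v y $ i))" for v y w
 have db [measurable]: "dbump n a i \<in> borel_fun" for i by (rule borel_measurable_continuous_onI[OF continuous_dbump])
 note bounded_borel_measurable[OF bump_bounded_borel, measurable]
 note Xm = Xv_measurable[OF sT, measurable (raw)]
 define KG where "KG = real CARD('n) * (2 * real n * (1 * KBc))"
 have KG0: "0 <= KG" using KBc(1) by (simp add: KG_def)
 have hb: "\<bar>h v y w\<bar> <= KG" if v: "v <= t" for v y w
 proof -
  have "\<bar>h v y w\<bar> <= (\<Sum>i\<in>UNIV. \<bar>dbump n a i (Em v t y + w) * (exp (- (lam i * (t - v))) * Bc v y $ i)\<bar>)"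
   unfolding h_def by (rule sum_abs)
  also have "\<dots> <= (\<Sum>i\<in>(UNIV :: 'n set). 2 * real n * (1 * KBc))"
  proof (rule sum_mono)
   fix i
   have "0 <= lam i * (t - v)" using v lam[of i] by simp
   then show "\<bar>dbump n a i (Em v t y + w) * (exp (- (lam i * (t - v))) * Bc v y $ i)\<bar> <= 2 * real n * (1 * KBc)"
    unfolding abs_mult using KBc by (intro mult_mono dbump_bound) auto
  qed
  finally show ?thesis by (simp add: KG_def)
 qed
 define G where "G v om = (if s < v \<and> v < t then h v (Xv s x v om) (xiv v t om) else 0)" for v om
 interpret LM: pair_sigma_finite lborel M ..
 have Gm: "(\<lambda>(v, om). G v om) \<in> borel_measurable (lborel \<Otimes>\<^sub>M M)"
  unfolding G_def h_def split_beta' by measurable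
 have Gi: "integrable (lborel \<Otimes>\<^sub>M M) (\<lambda>(v, om). G v om)"
 proof (rule integrableI_bounded_set[where A="{s<..<t} \<times> space M" and B=KG])
  show "emeasure (lborel \<Otimes>\<^sub>M M) ({s<..<t} \<times> space M) < \<infinity>"
   using st by (simp add: emeasure_pair_measure_Times emeasure_space_1)
  show "AE z in lborel \<Otimes>\<^sub>M M. z \<in> {s<..<t} \<times> space M \<longrightarrow> norm (case z of (v, om) => G v om) <= KG"
   using hb KG0 by (intro AE_I2) (auto simp: G_def)
 qed (use Gm in "auto simp: G_def space_pair_measure intro!: AE_I2 split: if_splits")
 have ae: "AE om in M. bump n a (Xv s x t om) - bump n a (Em s t x + xiv s t om) = (LINT v|lborel. G v om)"
  using bump_path_formula[OF st, of n a x] Xv(2)[OF sT, of x] xiv_AE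
 proof eventually_elim
  case (elim om)
  have "(LBINT v:{s<..t}. h v (X s x v om) (xi v t om)) = (LINT v|lborel. G v om)"
   unfolding set_lebesgue_integral_def
   by (rule integral_discrete_difference[where X="{t}"])
    (use elim st in "auto simp: G_def split: split_indicator")
  then show ?case using elim st by (simp add: h_def)
 qed
 have i1: "integrable M (\<lambda>om. bump n a (Xv s x t om))"
  by (rule integrable_const_bound[where B=1]) (auto simp: bump_bounds)
 have i2: "integrable M (\<lambda>om. bump n a (Em s t x + xiv s t om))" by (rule Rf_integrable[OF bump_bounded_borel])
 have "(LINT om|M. bump n a (Xv s x t om)) - Rf s t (bump n a) x =
   (LINT om|M. bump n a (Xv s x t om) - bump n a (Em s t x + xiv s t om))"
  unfolding Rf_def using i1 i2 by simp
 also have "\<dots> = (LINT om|M. (LINT v|lborel. G v om))"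
  by (rule integral_cong_AE) (use i1 i2 ae LM.integrable_snd[OF Gi] in "auto dest: borel_measurable_integrable")
 also have "\<dots> = (LINT v|lborel. (LINT om|M. G v om))"
  by (rule LM.Fubini_integral[OF Gi])
 also have "\<dots> = (LBINT r:{s<..<t}. \<integral>om. ker r t (bump n a) (Xv s x r om) \<partial>M)"
  unfolding set_lebesgue_integral_def
 proof (intro Bochner_Integration.integral_cong refl)
  fix v :: real
  show "(LINT om|M. G v om) = indicator {s<..<t} v *\<^sub>R (LINT om|M. ker v t (bump n a) (Xv s x v om))"
  proof (cases "s < v \<and> v < t")
   case True
   then have v: "0 <= s" "s <= v" "v <= t" "t <= T" "0 <= v" "v <= T" using st by auto
   have [measurable]: "X s x v \<in> borel_measurable M" "xi v t \<in> borel_measurable M"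
    using v by (auto intro!: X_measurable xi_measurable)
   have Bcc: "continuous_on UNIV (Bc v)"
    using continuous_on_compose2[OF Bc_continuous continuous_on_Pair[OF continuous_on_const[of UNIV v] continuous_on_id]] by simp
   have "continuous_on UNIV (\<lambda>z::(real^'n) \<times> (real^'n). h v (fst z) (snd z))"
    unfolding h_def
    by (intro continuous_on_sum continuous_on_mult continuous_on_const continuous_on_component
      continuous_on_compose2[OF continuous_dbump] continuous_on_compose2[OF Bcc] continuous_on_add
      continuous_on_compose2[OF continuous_Em] continuous_on_fst continuous_on_snd continuous_on_id) auto
   then have hc: "continuous_on UNIV (\<lambda>(y, w). h v y w)" by (simp add: split_beta')
   have hm: "(\<lambda>(y, w). h v y w) \<in> borel_fun2"
    using borel_measurable_continuous_onI[OF hc] by (simp add: borel_prod)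
   have hm2: "(\<lambda>om. h v (p om) (q om)) \<in> borel_measurable M" if "p \<in> borel_measurable M" "q \<in> borel_measurable M" for p q
    using measurable_compose[OF _ hm, of "\<lambda>om. (p om, q om)" M] that by simp
   \<comment> \<open>Averaging over the convolution alone, with the position y fixed, gives the
     kernel \<open>ker\<close>.\<close>
   have k: "(LINT om'|M. h v y (xi v t om')) = ker v t (bump n a) y" for y
   proof -
    have "(LINT om'|M. h v y (xi v t om')) = (LINT om'|M. h v y (xiv v t om'))"
     by (rule integral_cong_AE) (use xiv_AE v in "auto intro!: hm2 elim!: eventually_mono")
    also have "\<dots> = (\<Sum>i\<in>UNIV. (LINT om'|M. dbump n a i (Em v t y + xiv v t om') * (exp (- (lam i * (t - v))) * Bc v y $ i)))"
     unfolding h_def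
    proof (rule Bochner_Integration.integral_sum)
     fix i
     have "integrable M (\<lambda>om'. dbump n a i (Em v t y + xiv v t om'))"
      by (rule integrable_const_bound[where B="2 * real n"]) (auto simp: dbump_bound)
     then show "integrable M (\<lambda>om'. dbump n a i (Em v t y + xiv v t om') * (exp (- (lam i * (t - v))) * Bc v y $ i))"
      by (rule integrable_mult_left)
    qed
    also have "\<dots> = ker v t (bump n a) y"
     unfolding ker_def Rf_bump_partial_deriv[OF v(5,3,4)] by (simp add: mult_ac)
    finally show ?thesis .
   qed
   have km: "ker v t (bump n a) \<in> borel_fun"
   proof -
    have "(\<lambda>y. \<integral>om'. h v y (xi v t om') \<partial>M) \<in> borel_fun"
    proof (rule borel_measurable_lebesgue_integral[where f="\<lambda>y om'. h v y (xi v t om')"])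
     show "(\<lambda>(y, om'). h v y (xi v t om')) \<in> borel_measurable (borel \<Otimes>\<^sub>M M)"
      using measurable_compose[OF _ hm, of "\<lambda>z. (fst z, xi v t (snd z))" "borel \<Otimes>\<^sub>M M"] by (simp add: split_beta')
    qed
    then show ?thesis by (simp add: k)
   qed
   have "(LINT om|M. G v om) = (LINT om|M. h v (X s x v om) (xi v t om))"
   proof (rule integral_cong_AE)
    show "G v \<in> borel_measurable M" unfolding G_def[abs_def] using True by (simp add: hm2)
    show "AE om in M. G v om = h v (X s x v om) (xi v t om)"
     using Xv(2)[OF sT, of x] xiv_AE by eventually_elim (use v True in "simp add: G_def")
   qed (simp add: hm2)
   also have "\<dots> = (LINT om|M. (LINT om'|M. h v (X s x v om) (xi v t om')))"
    by (rule solution_convolution_expectation[OF v(1-4) B0c B0_lip, where X="X s x" and H="h v" and x=x and KH=KG])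
     (use hc hb[OF v(3)] X_sol[OF sT] in auto)
   also have "\<dots> = (LINT om|M. ker v t (bump n a) (Xv s x v om))"
    unfolding k
   proof (rule integral_cong_AE)
    show "AE om in M. ker v t (bump n a) (X s x v om) = ker v t (bump n a) (Xv s x v om)"
     using Xv(2)[OF sT, of x] by eventually_elim (use v in simp)
   qed (use km in auto)
   finally show ?thesis using True by simp
  qed (auto simp: G_def)
 qed
 finally show ?thesis by simp
qed

definition mker :: "real => real ^ 'n => real => (real ^ 'n => real) => real => real" where
 "mker s x t \<psi> r = indicator {s<..<t} r *\<^sub>R (LINT om|M. ker r t \<psi> (Xv s x r om))"

context
 fixes s t :: real and x :: "real ^ 'n"
 assumes st: "0 <= s" "s < t" "t <= T"
begin

lemma ker_Xv_integrable:
 assumes "r \<in> {s<..<t}" "\<psi> \<in> bounded_borel"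
 shows "integrable M (\<lambda>om. ker r t \<psi> (Xv s x r om))"
proof -
 obtain K where K: "\<And>y. \<bar>\<psi> y\<bar> <= K" using bounded_borelD[OF assms(2)] by blast
 have d: "dom r t" using assms st by (simp add: dom_def)
 have [measurable]: "Xv s x r \<in> borel_measurable M" using st by (intro Xv_measurable) auto
 have "(\<lambda>om. ker r t \<psi> (Xv s x r om)) \<in> borel_measurable M"
  using ker_measurable[OF adm_const[OF assms(2)], of "\<lambda>_. r" M "\<lambda>_. t" "Xv s x r"] d by simp
 then show ?thesis
  using ker_bound[OF d assms(2) K] by (intro integrable_const_bound[where B="Ck * K * (t - r) powr (- (1 / (2 * \<alpha>)))"]) auto
qed

lemma mker_measurable: "\<psi> \<in> bounded_borel ==> mker s x t \<psi> \<in> borel_measurable lborel"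
proof -
 assume p: "\<psi> \<in> bounded_borel"
 have sT: "0 <= s" "s <= T" using st by auto
 have "(\<lambda>z. if dom (fst z) t then ker (fst z) t \<psi> (Xv s x (fst z) (snd z)) else 0) \<in> borel_measurable (borel \<Otimes>\<^sub>M M)"
  by (rule ker_measurable[OF adm_const[OF p]]) (auto intro!: Xv_measurable[OF sT])
 then have [measurable]: "(\<lambda>r. \<integral>om. (if dom r t then ker r t \<psi> (Xv s x r om) else 0) \<partial>M) \<in> borel_fun"
  by (intro borel_measurable_lebesgue_integral) (simp add: split_beta')
 have "mker s x t \<psi> = (\<lambda>r. indicator {s<..<t} r *\<^sub>R (LINT om|M. (if dom r t then ker r t \<psi> (Xv s x r om) else 0)))"
  using st by (auto simp: mker_def dom_def fun_eq_iff split: split_indicator)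
 then show ?thesis by simp
qed

lemma mker_bound:
 assumes p: "\<psi> \<in> bounded_borel" and K: "\<And>y. \<bar>\<psi> y\<bar> <= K"
 shows "\<bar>mker s x t \<psi> r\<bar> <= indicator {s<..<t} r *\<^sub>R (Ck * K * (t - r) powr (- (1 / (2 * \<alpha>))))"
proof (cases "r \<in> {s<..<t}")
 case True
 then have d: "dom r t" using st by (simp add: dom_def)
 have "\<bar>LINT om|M. ker r t \<psi> (Xv s x r om)\<bar> <= (LINT om|M. \<bar>ker r t \<psi> (Xv s x r om)\<bar>)" by (rule integral_abs_bound)
 also have "\<dots> <= (LINT om|M. Ck * K * (t - r) powr (- (1 / (2 * \<alpha>))))"
  using ker_bound[OF d p K] ker_Xv_integrable[OF True p] by (intro integral_mono) auto
 finally show ?thesis using True by (simp add: mker_def prob_space)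
qed (simp add: mker_def)

lemma mker_dominating: "integrable lborel (\<lambda>r. indicator {s<..<t} r *\<^sub>R (C * (t - r) powr (- (1 / (2 * \<alpha>)))))"
proof -
 have "set_integrable lborel {0<..<t - s} (\<lambda>p. p powr (- (1 / (2 * \<alpha>))))"
  using gam st by (intro powr_singular_integrable) auto
 then have "set_integrable lborel {s<..<t} (\<lambda>r. (t - r) powr (- (1 / (2 * \<alpha>))))"
  by (simp add: set_integral_translate(3)[of s t "\<lambda>p. p powr (- (1 / (2 * \<alpha>)))"])
 then have "set_integrable lborel {s<..<t} (\<lambda>r. C * (t - r) powr (- (1 / (2 * \<alpha>))))" by simp
 then show ?thesis by (simp only: set_integrable_def)
qed

lemma mker_integrable: "\<psi> \<in> bounded_borel ==> integrable lborel (mker s x t \<psi>)"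
proof -
 assume p: "\<psi> \<in> bounded_borel"
 obtain K where K: "\<And>y. \<bar>\<psi> y\<bar> <= K" using bounded_borelD[OF p] by blast
 show ?thesis
  by (rule Bochner_Integration.integrable_bound[OF mker_dominating[of "Ck * K"] mker_measurable[OF p]])
   (intro AE_I2, unfold real_norm_def, rule order_trans[OF mker_bound[OF p K] abs_ge_self])
qed

lemma forward_formula_aux:
 assumes "\<psi> \<in> bounded_borel"
 shows "(LINT om|M. \<psi> (Xv s x t om)) = Rf s t \<psi> x + (LINT r|lborel. mker s x t \<psi> r)"
 using assms
proof (induction \<psi> rule: bounded_borel_induct)
 case (bump n a)
 show ?case using bump_forward[OF st, of n a x] by (simp add: mker_def set_lebesgue_integral_def)
next
 case (lin \<phi> \<psi> a b)
 have sT: "0 <= s" "s <= T" using st by auto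
 note Xm = Xv_measurable[OF sT, measurable (raw)]
 have i: "integrable M (\<lambda>om. h (Xv s x t om))" if h: "h \<in> bounded_borel" for h
 proof -
  obtain K where K: "\<And>x. \<bar>h x\<bar> <= K" using bounded_borelD[OF h] by blast
  note bounded_borel_measurable[OF h, measurable]
  show ?thesis by (rule integrable_const_bound[where B=K]) (use K in auto)
 qed
 have "mker s x t (\<lambda>y. a * \<phi> y + b * \<psi> y) r = a * mker s x t \<phi> r + b * mker s x t \<psi> r" for r
 proof (cases "r \<in> {s<..<t}")
  case True
  then have d: "dom r t" using st by (simp add: dom_def)
  show ?thesis
   using True ker_Xv_integrable[OF True lin(1)] ker_Xv_integrable[OF True lin(2)]
   by (simp add: mker_def ker_lincomb[OF d lin(1,2)])
 qed (simp add: mker_def)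
 then show ?case
  using lin(3,4) i[OF lin(1)] i[OF lin(2)] mker_integrable[OF lin(1)] mker_integrable[OF lin(2)] Rf_lincomb[OF lin(1,2)]
  by (simp add: algebra_simps)
next
 case (lim F \<phi> K)
 have sT: "0 <= s" "s <= T" using st by auto
 note Xm = Xv_measurable[OF sT, measurable (raw)]
 note bounded_borel_measurable[OF lim(1), measurable] bounded_borel_measurable[OF lim(2), measurable]
 have 1: "(\<lambda>n. \<integral>om. F n (Xv s x t om) \<partial>M) \<leadsto> (LINT om|M. \<phi> (Xv s x t om))"
  by (rule integral_dominated_convergence[where w="\<lambda>_. K"]) (use lim(3,5) in auto)
 have 2: "(\<lambda>n. \<integral>r. mker s x t (F n) r \<partial>lborel) \<leadsto> (LINT r|lborel. mker s x t \<phi> r)"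
 proof (rule integral_dominated_convergence[OF mker_measurable[OF lim(2)] mker_measurable[OF lim(1)] mker_dominating[of "Ck * K"]])
  show "AE r in lborel. (\<lambda>n. mker s x t (F n) r) \<leadsto> mker s x t \<phi> r"
  proof (rule AE_I2)
   fix r
   show "(\<lambda>n. mker s x t (F n) r) \<leadsto> mker s x t \<phi> r"
   proof (cases "r \<in> {s<..<t}")
    case True
    then have d: "dom r t" using st by (simp add: dom_def)
    have "(\<lambda>n. \<integral>om. ker r t (F n) (Xv s x r om) \<partial>M) \<leadsto> (LINT om|M. ker r t \<phi> (Xv s x r om))"
     by (rule integral_dominated_convergence[where w="\<lambda>_. Ck * K * (t - r) powr (- (1 / (2 * \<alpha>)))"])
      (use ker_Xv_integrable[OF True] lim(1,2) ker_bound[OF d lim(1,3)] ker_lim[OF d lim(1,2,3,5)] in "auto dest: borel_measurable_integrable")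
    then show ?thesis using True by (simp add: mker_def)
   qed (simp add: mker_def)
  qed
  show "AE r in lborel. norm (mker s x t (F n) r) <= indicator {s<..<t} r *\<^sub>R (Ck * K * (t - r) powr (- (1 / (2 * \<alpha>))))" for n
   unfolding real_norm_def by (intro AE_I2 mker_bound lim)
 qed
 have "(\<lambda>n. Rf s t (F n) x + (LINT r|lborel. mker s x t (F n) r)) \<leadsto> Rf s t \<phi> x + (LINT r|lborel. mker s x t \<phi> r)"
  by (intro tendsto_add 2 Rf_lim[OF lim(1,2,3,5)])
 with 1 show ?case unfolding lim(6) by (rule LIMSEQ_unique)
qed

end

lemma forward_formula:
 assumes "0 <= s" "s < t" "t <= T" "\<psi> \<in> bounded_borel"
 shows "(LINT om|M. \<psi> (Xv s x t om)) = Rf s t \<psi> x + (LBINT r:{s<..<t}. \<integral>om. ker r t \<psi> (Xv s x r om) \<partial>M)"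
 using forward_formula_aux[OF assms, of x] by (simp add: mker_def set_lebesgue_integral_def)

lemma kolmogorov_unique:
 assumes "0 < t" "t <= T" "\<phi> \<in> bounded_borel" "mildp \<phi> t u" "reg t u" "0 <= s" "s <= t"
 shows "u s x = (LINT om|M. \<phi> (Xv s x t om))"
 by (rule mild_unique[OF _ assms]) (rule forward_formula)

end

section \<open>Transfer to the function class and the operators of the statement\<close>

lemma set_integral_Icc_Ioo:
 fixes g h :: "real => real"
 assumes "\<And>r. r \<in> {s<..<t} ==> g r = h r"
 shows "set_integrable lborel {s..t} g \<longleftrightarrow> set_integrable lborel {s<..<t} h"
  "(LBINT r:{s..t}. g r) = (LBINT r:{s<..<t}. h r)"
proof -
 have e: "indicator {s..t} r *\<^sub>R g r = indicator {s<..<t} r *\<^sub>R h r" if "r \<notin> {s, t}" for r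
  using assms[of r] that by (auto split: split_indicator)
 show "set_integrable lborel {s..t} g \<longleftrightarrow> set_integrable lborel {s<..<t} h"
  unfolding set_integrable_def by (rule integrable_discrete_difference[where X="{s, t}"]) (use e in auto)
 show "(LBINT r:{s..t}. g r) = (LBINT r:{s<..<t}. h r)"
  unfolding set_lebesgue_integral_def by (rule integral_discrete_difference[where X="{s, t}"]) (use e in auto)
qed

lemma sup_norm_le: "(\<And>x. \<bar>g x\<bar> <= K) ==> sup_norm g <= K"
 unfolding sup_norm_def by (rule cSUP_least) auto

lemma sup_norm_ge:
 assumes "bounded (range g)" shows "\<bar>g x\<bar> <= sup_norm g"
proof -
 obtain K where "\<And>x. \<bar>g x\<bar> <= K" using assms by (auto simp: bounded_iff)
 then show ?thesis unfolding sup_norm_def by (intro cSUP_upper bdd_aboveI2) auto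
qed

lemma partial_derivD:
 fixes g :: "real ^ 'n::finite => 'b::real_normed_vector"
 shows "partial_differentiable i g x ==> ((\<lambda>h. g (nudge x h i)) has_vector_derivative partial_deriv i g x) (at 0)"
 unfolding partial_differentiable_def partial_deriv_def by (simp add: vector_derivative_works)

context mild_setting begin

text \<open>Time reversal maps (0,t] to [0,t). All ranges involved are bounded, so the supremum
  norms really bound the partial derivatives, and the weight s^\<gamma> becomes the singularity (t -
  s)^(-\<gamma>).\<close>

lemma Lambda1_reg:
 assumes V: "(\<lambda>s. u (t - s)) \<in> Lambda1 \<gamma> t"
 shows "reg t u" "0 <= s ==> s < t ==> partial_deriv i (u s) \<in> borel_fun"
proof -
 have C: "u s \<in> C_b 1" if "0 <= s" "s < t" for s
 proof -
  have "t - s \<in> {0<..t}" using that by simp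
  with V have "u (t - (t - s)) \<in> C_b 1" unfolding Lambda1_def by blast
  moreover have "t - (t - s) = s" by simp
  ultimately show ?thesis by metis
 qed
 then have Cd: "partial_differentiable i (u s) x" "continuous_on UNIV (partial_deriv i (u s))"
  "bounded (range (partial_deriv i (u s)))" "bounded (range (u s))" if "0 <= s" "s < t" for s i x
  using C[OF that] unfolding One_nat_def C_b.simps mem_Collect_eq by blast+
 show "0 <= s ==> s < t ==> partial_deriv i (u s) \<in> borel_fun"
  using Cd(2) by (intro borel_measurable_continuous_onI)
 show "reg t u"
  unfolding reg_def
 proof (intro conjI allI impI)
  let ?O = "{0<..t} \<times> (UNIV :: (real ^ 'n) set)"
  have "(\<lambda>(s, x). u (t - s) x) \<in> borel_measurable (restrict_space borel ?O)"
   using V by (simp add: Lambda1_def)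
  then have "(\<lambda>z. if z \<in> ?O then (case z of (s, x) => u (t - s) x) else 0) \<in> borel_fun"
   by (subst (asm) measurable_restrict_space_iff[where c=0]) (auto intro!: borel_Times)
  then have m: "(\<lambda>z. if z \<in> ?O then (case z of (s, x) => u (t - s) x) else 0) \<in> borel_fun2"
   by (simp add: borel_prod)
  have "(\<lambda>z. if (t - fst z, snd z) \<in> ?O then (case (t - fst z, snd z) of (s, x) => u (t - s) x) else 0) \<in> borel_fun2"
   by (rule measurable_compose[OF _ m, of "\<lambda>z. (t - fst z, snd z)"]) measurable
  moreover have "(\<lambda>z. if (t - fst z, snd z) \<in> ?O then (case (t - fst z, snd z) of (s, x) => u (t - s) x) else 0) =
    (\<lambda>(s, x). if 0 <= s \<and> s < t then u s x else 0)"
   by (auto simp: fun_eq_iff)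
  ultimately show "(\<lambda>(s, x). if 0 <= s \<and> s < t then u s x else 0) \<in> borel_fun2" by simp
 next
  fix s i x assume s: "0 <= s" "s < t"
  show "((\<lambda>h. u s (nudge x h i)) has_real_derivative partial_deriv i (u s) x) (at 0)"
   using partial_derivD[OF Cd(1)[OF s]] by (simp add: has_real_derivative_iff_has_vector_derivative)
 next
  obtain K where K: "\<And>s. s \<in> {0<..t} ==> s powr \<gamma> * (sup_norm (u (t - s)) + (MAX i. sup_norm (partial_deriv i (u (t - s))))) <= K"
  proof -
   have "bdd_above ((\<lambda>s. s powr \<gamma> * (sup_norm (u (t - s)) + (MAX i. sup_norm (partial_deriv i (u (t - s)))))) ` {0<..t})"
    using V unfolding Lambda1_def mem_Collect_eq by (elim conjE)
   then show thesis using that unfolding bdd_above_def by blast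
  qed
  have "\<bar>partial_deriv i (u s) x\<bar> <= K * (t - s) powr (- \<gamma>)" if s: "0 <= s" "s < t" for s i x
  proof -
   have "\<bar>partial_deriv i (u s) x\<bar> <= sup_norm (partial_deriv i (u s))" by (rule sup_norm_ge[OF Cd(3)[OF s]])
   also have "\<dots> <= (MAX i. sup_norm (partial_deriv i (u s)))" by (rule Max_ge) auto
   also have "\<dots> <= sup_norm (u s) + (MAX i. sup_norm (partial_deriv i (u s)))"
    using order_trans[OF abs_ge_zero sup_norm_ge[OF Cd(4)[OF s], of 0]] by simp
   also have "\<dots> <= K * (t - s) powr (- \<gamma>)"
    using K[of "t - s"] s by (simp add: powr_minus field_simps)
   finally show ?thesis .
  qed
  then show "\<exists>K. \<forall>s i x. 0 <= s \<longrightarrow> s < t \<longrightarrow> \<bar>partial_deriv i (u s) x\<bar> <= K * (t - s) powr (- \<gamma>)" by blast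
 qed
qed

lemma good_Lambda1:
 assumes r: "reg t u" and g: "good t u" and eq: "\<And>s. s \<in> {0..<t} ==> u' s = u s"
 shows "(\<lambda>s. u' (t - s)) \<in> Lambda1 \<gamma> t"
proof -
 have e: "u' (t - s) = u (t - s)" "0 <= t - s" "t - s < t" if "s \<in> {0<..t}" for s
  using eq[of "t - s"] that by auto
 have d: "((\<lambda>h. u s (nudge x h i)) has_real_derivative partial_deriv i (u s) x) (at 0)" if "0 <= s" "s < t" for s i x
  using r that unfolding reg_def by blast
 obtain K1 where K1: "\<And>s i x. 0 <= s ==> s < t ==> \<bar>partial_deriv i (u s) x\<bar> <= K1 * (t - s) powr (- \<gamma>)"
  using r unfolding reg_def by blast
 obtain K2 where K2: "\<And>s x. 0 <= s ==> s < t ==> \<bar>u s x\<bar> <= K2 * (t - s) powr (- \<gamma>)"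
  using g unfolding good_def by blast
 have c: "continuous_on UNIV (u s)" "continuous_on UNIV (partial_deriv i (u s))" if "0 <= s" "s < t" for s i
  using g that unfolding good_def by blast+
 have tc: "continuous_on {0..<t} (\<lambda>s. u s x)" for x using g unfolding good_def by blast
 have "(\<lambda>(s, x). u' (t - s) x) \<in> borel_measurable (restrict_space borel ({0<..t} \<times> UNIV))"
 proof -
  let ?F = "\<lambda>(s, x). if 0 <= s \<and> s < t then u s x else 0"
  have m: "?F \<in> borel_fun2" using r unfolding reg_def by blast
  have "(\<lambda>z. ?F (t - fst z, snd z)) \<in> borel_fun2"
   by (rule measurable_compose[OF _ m]) measurable
  then have "(\<lambda>z. ?F (t - fst z, snd z)) \<in> borel_measurable (restrict_space borel ({0<..t} \<times> UNIV))"
   by (intro measurable_restrict_space1) (simp add: borel_prod)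
  then show ?thesis
   by (rule measurable_cong[THEN iffD1, rotated]) (use e in "auto simp: space_restrict_space")
 qed
 moreover have "continuous_on {0<..t} (\<lambda>s. u' (t - s) x)" for x
 proof -
  have "continuous_on {0<..t} (\<lambda>s. u (t - s) x)"
   by (rule continuous_on_compose2[OF tc]) (auto intro!: continuous_intros)
  then show ?thesis by (rule continuous_on_eq) (simp add: e)
 qed
 moreover have "u' (t - s) \<in> C_b 1" if s: "s \<in> {0<..t}" for s
  unfolding e(1)[OF s] One_nat_def C_b.simps mem_Collect_eq
 proof (intro conjI allI)
  note s' = e(2,3)[OF s]
  show "continuous_on UNIV (u (t - s))" "continuous_on UNIV (partial_deriv i (u (t - s)))" for i by (rule c[OF s'])+
  show "bounded (range (u (t - s)))"
   unfolding bounded_iff by (intro exI[of _ "K2 * (t - (t - s)) powr (- \<gamma>)"]) (use K2[OF s'] in auto)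
  show "bounded (range (partial_deriv i (u (t - s))))" for i
   unfolding bounded_iff by (intro exI[of _ "K1 * (t - (t - s)) powr (- \<gamma>)"]) (use K1[OF s'] in auto)
  show "partial_differentiable i (u (t - s)) x" for i x
   unfolding partial_differentiable_def
   by (rule differentiableI[OF has_field_derivative_imp_has_derivative[OF d[OF s']]])
 qed
 moreover have "bdd_above ((\<lambda>s. s powr \<gamma> * (sup_norm (u' (t - s)) + (MAX i. sup_norm (partial_deriv i (u' (t - s)))))) ` {0<..t})"
 proof (rule bdd_aboveI2)
  fix s assume s: "s \<in> {0<..t}"
  note e' = e[OF s]
  have "sup_norm (u (t - s)) <= K2 * s powr (- \<gamma>)" using K2[OF e'(2,3)] by (intro sup_norm_le) simp
  moreover have "(MAX i. sup_norm (partial_deriv i (u (t - s)))) <= K1 * s powr (- \<gamma>)"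
   using K1[OF e'(2,3)] by (intro Max.boundedI) (auto intro!: sup_norm_le)
  ultimately have "s powr \<gamma> * (sup_norm (u (t - s)) + (MAX i. sup_norm (partial_deriv i (u (t - s))))) <=
   s powr \<gamma> * (K2 * s powr (- \<gamma>) + K1 * s powr (- \<gamma>))"
   by (intro mult_left_mono add_mono) auto
  also have "\<dots> = K2 + K1" using s by (simp add: powr_minus field_simps)
  finally show "s powr \<gamma> * (sup_norm (u' (t - s)) + (MAX i. sup_norm (partial_deriv i (u' (t - s))))) <= K2 + K1"
   by (simp add: e'(1))
 qed
 ultimately show ?thesis unfolding Lambda1_def by blast
qed

end

context kolmogorov begin

lemma transition_Z:
 assumes s: "0 <= s" "s <= q" "q <= T" and [measurable]: "\<psi> \<in> borel_fun"
 shows "transition_op M Z s q \<psi> x = Rf s q \<psi> x"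
 unfolding transition_op_def Rf_eq_xi[OF assms]
proof (rule integral_cong_AE)
 show "AE om in M. \<psi> (Z s x q om) = \<psi> (Em s q x + xi s q om)" using Z_eq[OF s, of x] by eventually_elim simp
qed (use Z_measurable[OF s] xi_measurable[OF s] in measurable)

lemma transition_X:
 assumes s: "0 <= s" "s <= q" "q <= T" and [measurable]: "\<psi> \<in> borel_fun"
 shows "transition_op M X s q \<psi> x = (LINT om|M. \<psi> (Xv s x q om))"
 unfolding transition_op_def
proof (rule integral_cong_AE)
 have sT: "0 <= s" "s <= T" using s by auto
 show "AE om in M. \<psi> (X s x q om) = \<psi> (Xv s x q om)" using Xv(2)[OF sT, of x] by eventually_elim (use s in simp)
 show "(\<lambda>om. \<psi> (Xv s x q om)) \<in> borel_measurable M" by (rule measurable_compose[OF Xv_measurable[OF sT]]) auto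
qed (use X_measurable[OF s] in measurable)

text \<open>For times in the open interval both sides see the same integrand: B agrees with its
  clipped extension there, and measurability of the gradient allows Z to be replaced by
  \<open>Rf\<close>. Two functions that agree on [0,t] are permitted so that P can be compared with
  the constructed solution.\<close>

lemma mild_solution_iff:
 assumes t: "0 < t" "t <= T" and \<phi>: "\<phi> \<in> bounded_borel"
  and eq: "\<And>s. s \<in> {0..t} ==> u' s = u s"
  and m: "\<And>s i. 0 <= s ==> s < t ==> partial_deriv i (u s) \<in> borel_fun"
 shows "mild_solution (transition_op M Z) (\<lambda>t x. B0 t x - f t) \<phi> t u' \<longleftrightarrow> mildp \<phi> t u"
proof -
 have in_eq: "transition_op M Z s r (\<lambda>y. (B0 r y - f r) \<bullet> gradient (u' r) y) x = Rf s r (\<lambda>y. Bc r y \<bullet> gradient (u r) y) x"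
  if s: "0 <= s" and r: "r \<in> {s<..<t}" for s r x
 proof -
  have rr: "0 <= r" "r < t" "r \<in> {0..T}" "r \<in> {0..t}" using r s t by auto
  have "(\<lambda>y. \<Sum>i\<in>UNIV. Bc r y $ i * partial_deriv i (u r) y) \<in> borel_fun"
   by (intro borel_measurable_sum borel_measurable_times m rr B_measurable) auto
  then have "(\<lambda>y. Bc r y \<bullet> gradient (u r) y) \<in> borel_fun"
   by (simp add: inner_vec_def gradient_def)
  from transition_Z[OF s _ _ this, of r x] show ?thesis
   using r t by (simp add: eq[OF rr(4)] Bc_eq[OF rr(3)])
 qed
 have p: "transition_op M Z s t \<phi> x = Rf s t \<phi> x" if "s \<in> {0..t}" for s x
  using that t \<phi> by (intro transition_Z) (auto intro: bounded_borel_measurable)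
 show ?thesis
  unfolding mild_solution_def mildp_def
 proof (intro ball_cong refl all_cong1 conj_cong)
  fix s x assume s: "s \<in> {0..t}"
  then have s0: "0 <= s" by simp
  note I = set_integral_Icc_Ioo[of s t "\<lambda>r. transition_op M Z s r (\<lambda>y. (B0 r y - f r) \<bullet> gradient (u' r) y) x", OF in_eq[OF s0]]
  show "set_integrable lborel {s..t} (\<lambda>r. transition_op M Z s r (\<lambda>y. (B0 r y - f r) \<bullet> gradient (u' r) y) x) =
   set_integrable lborel {s<..<t} (\<lambda>r. Rf s r (\<lambda>y. Bc r y \<bullet> gradient (u r) y) x)" by (rule I(1))
  show "(u' s x = transition_op M Z s t \<phi> x + (LBINT r:{s..t}. transition_op M Z s r (\<lambda>y. (B0 r y - f r) \<bullet> gradient (u' r) y) x)) =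
   (u s x = Rf s t \<phi> x + (LBINT r:{s<..<t}. Rf s r (\<lambda>y. Bc r y \<bullet> gradient (u r) y) x))"
   by (intro arg_cong2[where f="(=)"] arg_cong2[where f="(+)"] I(2) p[OF s]) (simp add: eq[OF s])
 qed
qed

theorem kolmogorov_equation:
 assumes \<phi>: "\<phi> \<in> bounded_borel" and t: "0 < t" "t <= T"
 defines "P \<equiv> transition_op M X"
 shows "mild_solution (transition_op M Z) (\<lambda>t x. B0 t x - f t) \<phi> t (\<lambda>s. P s t \<phi>)"
  and "(\<lambda>s. P (t - s) t \<phi>) \<in> Lambda1 (1 / (2 * \<alpha>)) t"
  and "mild_solution (transition_op M Z) (\<lambda>t x. B0 t x - f t) \<phi> t u ==>
   (\<lambda>s. u (t - s)) \<in> Lambda1 (1 / (2 * \<alpha>)) t ==> s \<in> {0..t} ==> u s x = P s t \<phi> x"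
proof -
 have uniq: "u s x = P s t \<phi> x" if "mildp \<phi> t u" "reg t u" "s \<in> {0..t}" for u s x
  using kolmogorov_unique[OF t \<phi> that(1,2), of s x] transition_X[of s t \<phi> x] that(3) t(2)
   bounded_borel_measurable[OF \<phi>] by (simp add: P_def)
 obtain u0 where u0: "mildp \<phi> t u0" "reg t u0" "good t u0" by (rule mild_exists[OF t \<phi>])
 \<comment> \<open>The uniqueness result, applied to the constructed solution, identifies it with P;
   the equation and the regularity of P are then inherited from \<open>u0\<close>.\<close>
 have eq: "P s t \<phi> = u0 s" if "s \<in> {0..t}" for s using uniq[OF u0(1,2) that] by (auto simp: fun_eq_iff)
 have "partial_deriv i (u0 s) \<in> borel_fun" if "0 <= s" "s < t" for i s
  using u0(3) that unfolding good_def by (intro borel_measurable_continuous_onI) blast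
 then have "mild_solution (transition_op M Z) (\<lambda>t x. B0 t x - f t) \<phi> t (\<lambda>s. P s t \<phi>) \<longleftrightarrow> mildp \<phi> t u0"
  by (intro mild_solution_iff[OF t \<phi>] eq)
 with u0(1) show "mild_solution (transition_op M Z) (\<lambda>t x. B0 t x - f t) \<phi> t (\<lambda>s. P s t \<phi>)" by blast
 show "(\<lambda>s. P (t - s) t \<phi>) \<in> Lambda1 (1 / (2 * \<alpha>)) t"
  by (rule good_Lambda1[OF u0(2,3), of "\<lambda>s. P s t \<phi>"]) (simp add: eq)
 assume m: "mild_solution (transition_op M Z) (\<lambda>t x. B0 t x - f t) \<phi> t u"
  and l: "(\<lambda>s. u (t - s)) \<in> Lambda1 (1 / (2 * \<alpha>)) t" and s: "s \<in> {0..t}"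
 have "mildp \<phi> t u"
  using m mild_solution_iff[OF t \<phi>, of u u] Lambda1_reg(2)[OF l] by simp
 then show "u s x = P s t \<phi> x" using uniq[OF _ Lambda1_reg(1)[OF l] s] by blast
qed

end

lemma diag_matrix_mult: "diag_matrix d *v x = (\<chi> i. d i * x $ i)"
 by (simp add: diag_matrix_def matrix_vector_mult_def vec_eq_iff if_distrib[where f="\<lambda>z. z * _"] cong: if_cong)

lemma uminus_diag_matrix_mult: "(- diag_matrix d) *v x = - ldiag d x"
 by (simp add: ldiag_def diag_matrix_def matrix_vector_mult_def vec_eq_iff if_distrib[where f="\<lambda>z. z * _"] sum_negf cong: if_cong)

lemma C_b_space_mono: "g \<in> C_b_space T k ==> g \<in> C_b_space T 0"
 by (cases k) auto

lemma C_b_space_lipschitz: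
 fixes g :: "real => real ^ 'n::finite => 'b::real_normed_vector"
 assumes g: "g \<in> C_b_space T (Suc k)"
 shows "\<exists>K. \<forall>t\<in>{0..T}. \<forall>x y. norm (g t x - g t y) <= K * norm (x - y)"
proof -
 have d: "partial_differentiable i (g t) x" if "t \<in> {0..T}" for t i x using g that by simp
 have "(\<lambda>t. partial_deriv i (g t)) \<in> C_b_space T 0" for i using g C_b_space_mono by auto
 then have "\<exists>K. \<forall>t\<in>{0..T}. \<forall>x. norm (partial_deriv i (g t) x) <= K" for i by (auto simp: bounded_iff)
 then obtain K where K: "\<And>i t x. t \<in> {0..T} ==> norm (partial_deriv i (g t) x) <= K i" by metis
 have KM: "norm (partial_deriv i (g t) x) <= Max (range K)" if "t \<in> {0..T}" for i t x
  using order_trans[OF K[OF that, of i x] Max_ge[of "range K" "K i"]] by simp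
 show ?thesis
  using lipschitz_of_partial_bounds[OF partial_derivD[OF d] KM] by blast
qed

text \<open>Outside a null set the noise functional \<open>NW\<close> coincides with W at L t for
  all times, so the integral equation of the SDE becomes the deterministic path equation.\<close>

lemma (in stable_noise) sde_solution_psol:
 assumes X: "sde_solution M (\<lambda>t om. diag_matrix c *v W (L t om) om) (\<lambda>t z. (- diag_matrix lam) *v z + g t z) T s x X" and s: "0 <= s"
 shows "AE om in M. psol lam T g s x (\<lambda>t. noise c t om) (\<lambda>t. X t om)"
proof -
 have "AE om in M. cadlag_on {s..T} (\<lambda>t. X t om) \<and>
   (\<forall>t\<in>{s..T}. X t om = x + (LBINT r:{s..t}. (- diag_matrix lam) *v X r om + g r (X r om)) +
    (diag_matrix c *v W (L t om) om - diag_matrix c *v W (L s om) om))"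
  using X by (simp add: sde_solution_def)
 then show ?thesis
  using NW_eq_AE
 proof eventually_elim
  case (elim om)
  have n: "noise c t om = diag_matrix c *v W (L t om) om" if "0 <= t" for t
   using elim(2) that by (simp add: noise_def diag_matrix_mult)
  show ?case
   unfolding psol_def
  proof (intro conjI ballI)
   fix t assume t: "t \<in> {s..T}"
   have "(LBINT r:{s..t}. (- diag_matrix lam) *v X r om + g r (X r om)) = (LBINT r:{s<..t}. g r (X r om) - ldiag lam (X r om))"
    using t by (simp add: set_integral_Icc_eq_Ioc uminus_diag_matrix_mult)
   then show "X t om = x + (LBINT r:{s<..t}. g r (X r om) - ldiag lam (X r om)) + (noise c t om - noise c s om)"
    using elim(1) t s by (simp add: n)
  qed (use elim in blast)
 qed
qed

theorem theorem3:
  fixes M :: "'w measure"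
    and W :: "real \<Rightarrow> 'w \<Rightarrow> real ^ 'n::{finite, linorder}"
    and L :: "real \<Rightarrow> 'w \<Rightarrow> real"
    and lam sigma :: "'n \<Rightarrow> real"
    and A sqrtQ :: "((real, 'n) vec, 'n) vec"
    and T \<alpha> \<gamma> gbar :: real
    and f :: "real \<Rightarrow> (real, 'n) vec"
    and B0 B :: "real \<Rightarrow> (real, 'n) vec \<Rightarrow> (real, 'n) vec"
    and Z X :: "real \<Rightarrow> (real, 'n) vec \<Rightarrow> real \<Rightarrow> 'w \<Rightarrow> (real, 'n) vec"
    and R P :: "real \<Rightarrow> real \<Rightarrow> ((real, 'n) vec \<Rightarrow> real) \<Rightarrow> (real, 'n) vec \<Rightarrow> real"
  assumes prob: "prob_space M" and complete: "complete_measure M"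
    and T: "T > 0"
    and \<alpha>: "1 / 2 < \<alpha>" "\<alpha> < 1"
    and gbar: "gbar > 0"
    and W: "brownian_motion M W"
    and L: "subordinator M L" "strictly_stable M \<alpha> L"
    and char_L: "\<And>u. char (distr M borel (L 1)) u =
        exp (- complex_of_real (gbar powr \<alpha> * \<bar>u\<bar> powr \<alpha>) *
               (1 - \<i> * complex_of_real (tan (pi * \<alpha> / 2) * sgn u)))"
    and indep: "independent_processes M W L"
    and lam: "\<And>n. 0 < lam n" "mono lam"
    and sigma: "\<And>n. (sigma n)\<^sup>2 > 0"
    and A: "A = - diag_matrix lam"
    and sqrtQ: "sqrtQ = diag_matrix (\<lambda>n. sqrt ((sigma n)\<^sup>2))"
    and B0: "B0 \<in> C_b_space T 3"
    and f: "continuous_on {0..T} f"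
    and B: "B = (\<lambda>t x. B0 t x - f t)"
    and \<gamma>: "\<gamma> = 1 / (2 * \<alpha>)"
    and Z: "\<And>s x. s \<in> {0..T} \<Longrightarrow>
        sde_solution M (\<lambda>t \<omega>. sqrtQ *v W (L t \<omega>) \<omega>) (\<lambda>t z. A *v z + f t) T s x (Z s x)"
    and X: "\<And>s x. s \<in> {0..T} \<Longrightarrow>
        sde_solution M (\<lambda>t \<omega>. sqrtQ *v W (L t \<omega>) \<omega>) (\<lambda>t z. A *v z + B0 t z) T s x (X s x)"
    and R: "R = transition_op M Z"
    and P: "P = transition_op M X"
  shows "\<forall>\<phi>\<in>bounded_borel. \<forall>t. 0 < t \<and> t \<le> T \<longrightarrow>
      mild_solution R B \<phi> t (\<lambda>s. P s t \<phi>) \<and>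
      (\<lambda>s. P (t - s) t \<phi>) \<in> Lambda1 \<gamma> t \<and>
      (\<forall>u. mild_solution R B \<phi> t u \<and> (\<lambda>s. u (t - s)) \<in> Lambda1 \<gamma> t \<longrightarrow>
           (\<forall>s\<in>{0..t}. \<forall>x. u s x = P s t \<phi> x))"
proof -
 \<comment> \<open>The positive root of sigma^2, so c is positive whatever the sign of
   sigma.\<close>
 define c where "c n = sqrt ((sigma n)\<^sup>2)" for n
 have c: "0 < c n" for n unfolding c_def using sigma by (rule real_sqrt_gt_zero)
 have sQ: "sqrtQ = diag_matrix c" by (simp add: sqrtQ c_def[abs_def])
 interpret prob_space M by (rule prob)
 interpret stable_noise M L \<alpha> gbar W
  by unfold_locales (fact \<alpha> gbar L char_L W indep)+
 have Zp: "AE om in M. psol lam T (\<lambda>t _. f t) s x (\<lambda>t. noise c t om) (\<lambda>t. Z s x t om)" if "0 <= s" "s <= T" for s x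
  using Z[of s x] that by (intro sde_solution_psol) (simp_all add: A sQ)
 have Xp: "AE om in M. psol lam T B0 s x (\<lambda>t. noise c t om) (\<lambda>t. X s x t om)" if "0 <= s" "s <= T" for s x
  using X[of s x] that by (intro sde_solution_psol) (simp_all add: A sQ)
 have Zm: "Z s x t \<in> borel_measurable M" and Xm: "X s x t \<in> borel_measurable M" if "0 <= s" "s <= t" "t <= T" for s x t
  using Z[of s x] X[of s x] that by (simp_all add: sde_solution_def)
 have B3: "B0 \<in> C_b_space T (Suc 2)" using B0 by (simp only: eval_nat_numeral)
 obtain KL where KL: "\<And>t x y. t \<in> {0..T} ==> norm (B0 t x - B0 t y) <= KL * norm (x - y)"
  using C_b_space_lipschitz[OF B3] by blast
 have B00: "B0 \<in> C_b_space T 0" by (rule C_b_space_mono[OF B0])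
 then have "\<exists>K. \<forall>t\<in>{0..T}. \<forall>x. norm (B0 t x) <= K" by (auto simp: bounded_iff)
 then obtain K0 where K0: "\<And>t x. t \<in> {0..T} ==> norm (B0 t x) <= K0" by blast
 \<comment> \<open>The reference process J is the solution of the linear equation started from 0 at
   time 0.\<close>
 interpret kolmogorov M L \<alpha> gbar W T lam c f "Z 0 0" B0 Z X KL K0
 proof unfold_locales
  show "continuous_on ({0..T} \<times> UNIV) (\<lambda>(t, x). B0 t x)" using B00 by simp
  show "\<bar>B0 t x $ i\<bar> <= K0" if "t \<in> {0..T}" for t x i
   using K0[OF that, of x] component_le_norm_cart[of "B0 t x" i] by simp
 qed (use T lam c f Zm Xm Zp Xp KL in auto)
 show ?thesis
  unfolding R P B \<gamma> using kolmogorov_equation by blast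
qed

end
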